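(* Let $S:\Phi\to C$ be the differential operator of order $n$ described in the context, $a\in\mathbb C$, and let $F^\pm_\lambda$, $\Gamma_0^\pm$, $\Gamma_a^\pm$, $\Gamma_0=\Gamma_0^+\cup\Gamma_0^-$, $\Gamma_a=\Gamma_a^+\cup\Gamma_a^-$ be as in the context. The system $$\mathcal F_0=\{F^+_\lambda:\lambda\in\Gamma^+_0\}\cup\{F^-_\lambda:\lambda\in\Gamma^-_0\}$$ is a family of type I augmented eigenfunctions of $S$ up to integration over $\Gamma_0$, with eigenvalues $\lambda^n$. The system $$\mathcal F_a=\{F^+_\lambda:\lambda\in\Gamma^+_a\}\cup\{F^-_\lambda:\lambda\in\Gamma^-_a\}$$ is a family of type II augmented eigenfunctions of $S$ up to integration over $\Gamma_a$, with eigenvalues $\lambda^n$. Furthermore, if the initial-boundary value problem associated with $(S,a)$ is well-posed, then $\mathcal F=\mathcal F_0\cup\mathcal F_a$ is a complete system.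
   Context: **Operator.** Let $n\ge2$, $C=C^\infty[0,1]$, and let $B_j\phi=\sum_{k=0}^{n-1}(b_{jk}\phi^{(k)}(0)+\beta_{jk}\phi^{(k)}(1))$, $j=1,\dots,n$, be linearly independent boundary forms with $b_{jk},\beta_{jk}\in\mathbb R$. Let $\Phi=\{\phi\in C:B_j\phi=0\ \forall j\}$ and $S:\Phi\to C$, $S\phi=(-i)^n\phi^{(n)}$. Put $[\phi\psi](x)=(-i)^n\sum_{j=0}^{n-1}(-1)^j\phi^{(n-1-j)}(x)\overline{\psi}^{(j)}(x)$. Let $B_j^\star\psi=\sum_{k=0}^{n-1}(b^\star_{jk}\psi^{(k)}(0)+\beta^\star_{jk}\psi^{(k)}(1))$, $j=1,\dots,n$, with real coefficients, be a set of adjoint boundary forms (linearly independent, with $B^\star_j\psi=0\ \forall j$ if and only if $[\phi\psi](1)-[\phi\psi](0)=0$ for all $\phi\in\Phi$). **IBVP.** The problem for $(S,a)$ is: $(\partial_t+aS)q(x,t)=0$ on $(0,1)\times(0,T)$; $q(x,0)=f(x)$, $x\in[0,1]$; $q(\cdot,t)\in\Phi$, $t\in[0,T]$; where $f\in\Phi$ is arbitrary. The problem is ill-posed unless $a=\pm i$ (if $n$ is odd) or $\operatorname{Re}(a)\ge0$ (if $n$ is even). It is well-posed if there exists a unique solution for every $f\in\Phi$. **Functionals and contours.** Let $\alpha=e^{2\pi i/n}$, $M^+_{kj}(\lambda)=\sum_{r=0}^{n-1}(-i\alpha^{k-1}\lambda)^rb^\star_{jr}$, $M^-_{kj}(\lambda)=\sum_{r=0}^{n-1}(-i\alpha^{k-1}\lambda)^r\beta^\star_{jr}$,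 $M_{kj}(\lambda)=M^+_{kj}(\lambda)+M^-_{kj}(\lambda)e^{-i\alpha^{k-1}\lambda}$, $\Delta=\det M$, assumed not identically zero. Let $X^{lj}$ be the $(n-1)\times(n-1)$ submatrix of $M$ whose $(1,1)$ entry is the $(l+1,j+1)$ entry of $M$, indices read cyclically mod $n$ (rows $l+1,\dots,l+n-1$, columns $j+1,\dots,j+n-1$, in that order). For $\Delta(\lambda)\ne0$, $$F^+_\lambda(f)=\tfrac{1}{2\pi\Delta(\lambda)}\sum_{l,j=1}^n(-1)^{(n-1)(l+j)}\det X^{lj}(\lambda)M^+_{1j}(\lambda)\int_0^1e^{-i\alpha^{l-1}\lambda x}f(x)\,dx,$$ $$F^-_\lambda(f)=\tfrac{-e^{-i\lambda}}{2\pi\Delta(\lambda)}\sum_{l,j=1}^n(-1)^{(n-1)(l+j)}\det X^{lj}(\lambda)M^-_{1j}(\lambda)\int_0^1e^{-i\alpha^{l-1}\lambda x}f(x)\,dx.$$ The zeros of $\Delta$ are isolated, of finite order, with infimal separation denoted $5\epsilon>0$. With $C(\sigma,r)$, $D(\sigma,r)$ the circle and disc of radius $r$ about $\sigma$ and $\mathbb C^\pm$ the open upper/lower half-planes: $\Gamma_0^+=\bigcup_{\sigma\in\overline{\mathbb C^+},\Delta(\sigma)=0}C(\sigma,\epsilon)$, $\Gamma_0^-=\bigcup_{\sigma\in\mathbb C^-,\Delta(\sigma)=0}C(\sigma,\epsilon)$, and $\Gamma_a^\pm$ is the boundary of $\{\lambda\in\mathbb C^\pm:\operatorname{Re}(a\lambda^n)>0\}\setminus\bigcup_{\Delta(\sigma)=0}D(\sigma,2\epsilon)$.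 All contours have the enclosed region (discs, resp. stated domain) on their left. Integrals over infinite contours or infinite unions of circles are improper integrals / series; integrals over $\Gamma_0$, $\Gamma_a$ of a family are the sum of the integral of its $+$ part over the $+$ contour and its $-$ part over the $-$ contour. **Augmented eigenfunctions.** Let $I=(0,1)$, $\gamma$ an oriented contour, $E=\{E_\lambda:\lambda\in\gamma\}$ with $E_\lambda\in C'$. Suppose there are remainder functionals $R_\lambda\in\Phi'$ with $E_\lambda(S\phi)=\lambda^nE_\lambda(\phi)+R_\lambda(\phi)$ for all $\phi\in\Phi$, $\lambda\in\gamma$. $E$ is a family of type I (resp. type II) augmented eigenfunctions of $S$ up to integration along $\gamma$, with eigenvalues $\lambda^n$, if $\int_\gamma e^{i\lambda x}R_\lambda(\phi)\,d\lambda=0$ (resp. $\int_\gamma e^{i\lambda x}\lambda^{-n}R_\lambda(\phi)\,d\lambda=0$) for all $\phi\in\Phi$, $x\in I$. A system $E$ is complete if [$\phi\in\Phi$ and $E_\lambda\phi=0$ for every functional $E_\lambda$ in the system] implies $\phi=0$.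
   Formalization: Completeness is claimed when a ≠ 0 or Δ has more than one zero; for a = 0 with a single zero of Δ the infimal separation 5ε is undefined and completeness can fail (n = 2, φ(0) = φ'(0) = 0). *)

theory Defs
  imports
    "HOL-Complex_Analysis.Contour_Integration"
    "Jordan_Normal_Form.Determinant"
begin

section \<open>Smooth functions on the closed unit interval\<close>

text \<open>
  A function on \<open>[0,1]\<close> is represented by a function on the reals of which only the values on
  \<open>[0,1]\<close> matter; derivatives are taken within \<open>[0,1]\<close>, hence are one-sided at the end points.
\<close>

type_synonym functional = "(real \<Rightarrow> complex) \<Rightarrow> complex"

definition D :: "nat \<Rightarrow> (real \<Rightarrow> complex) \<Rightarrow> real \<Rightarrow> complex" where
  "D k = (\<lambda>f x. vector_derivative f (at x within {0..1})) ^^ k"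

definition Cinf :: "(real \<Rightarrow> complex) set" where
  "Cinf = {\<phi>. \<forall>k. \<forall>x\<in>{0..1}. D k \<phi> differentiable (at x within {0..1})}"

text \<open>
  The dual of a subspace \<open>V\<close> of \<open>Cinf\<close>: linear functionals that are continuous for the usual
  Frechet topology, given by the norms \<open>Ck_norm N\<close>.
\<close>

definition Ck_norm :: "nat \<Rightarrow> (real \<Rightarrow> complex) \<Rightarrow> real" where
  "Ck_norm N \<phi> = (\<Sum>k\<le>N. SUP x\<in>{0..1}. norm (D k \<phi> x))"

definition dual :: "(real \<Rightarrow> complex) set \<Rightarrow> functional set" where
  "dual V = {E. (\<forall>\<phi>\<in>V. \<forall>\<psi>\<in>V. E (\<lambda>x. \<phi> x + \<psi> x) = E \<phi> + E \<psi>) \<and>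
                (\<forall>c. \<forall>\<phi>\<in>V. E (\<lambda>x. c * \<phi> x) = c * E \<phi>) \<and>
                (\<exists>N K. \<forall>\<phi>\<in>V. norm (E \<phi>) \<le> K * Ck_norm N \<phi>)}"


section \<open>The differential operator and its boundary forms\<close>

text \<open>
  The form with index \<open>j\<close> (\<open>1 \<le> j \<le> n\<close>) has coefficients \<open>b j k\<close> at \<open>0\<close> and \<open>\<beta> j k\<close> at \<open>1\<close>,
  \<open>k < n\<close>.
\<close>

definition bform :: "nat \<Rightarrow> (nat \<Rightarrow> nat \<Rightarrow> real) \<Rightarrow> (nat \<Rightarrow> nat \<Rightarrow> real) \<Rightarrow> nat \<Rightarrow> functional" where
  "bform n b \<beta> j \<phi> = (\<Sum>k<n. of_real (b j k) * D k \<phi> 0 + of_real (\<beta> j k) * D k \<phi> 1)"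

definition indep_forms :: "nat \<Rightarrow> (nat \<Rightarrow> nat \<Rightarrow> real) \<Rightarrow> (nat \<Rightarrow> nat \<Rightarrow> real) \<Rightarrow> bool" where
  "indep_forms n b \<beta> \<longleftrightarrow>
     (\<forall>c :: nat \<Rightarrow> complex. (\<forall>\<phi>\<in>Cinf. (\<Sum>j=1..n. c j * bform n b \<beta> j \<phi>) = 0) \<longrightarrow>
        (\<forall>j\<in>{1..n}. c j = 0))"

definition Phi :: "nat \<Rightarrow> (nat \<Rightarrow> nat \<Rightarrow> real) \<Rightarrow> (nat \<Rightarrow> nat \<Rightarrow> real) \<Rightarrow> (real \<Rightarrow> complex) set" where
  "Phi n b \<beta> = {\<phi>\<in>Cinf. \<forall>j\<in>{1..n}. bform n b \<beta> j \<phi> = 0}"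

definition Sop :: "nat \<Rightarrow> (real \<Rightarrow> complex) \<Rightarrow> real \<Rightarrow> complex" where
  "Sop n \<phi> x = (- \<i>) ^ n * D n \<phi> x"

definition bracket ::
    "nat \<Rightarrow> (real \<Rightarrow> complex) \<Rightarrow> (real \<Rightarrow> complex) \<Rightarrow> real \<Rightarrow> complex" where
  "bracket n \<phi> \<psi> x =
     (- \<i>) ^ n * (\<Sum>j<n. (- 1) ^ j * D (n - 1 - j) \<phi> x * D j (\<lambda>y. cnj (\<psi> y)) x)"

definition adjoint_forms ::
    "nat \<Rightarrow> (nat \<Rightarrow> nat \<Rightarrow> real) \<Rightarrow> (nat \<Rightarrow> nat \<Rightarrow> real) \<Rightarrow>
     (nat \<Rightarrow> nat \<Rightarrow> real) \<Rightarrow> (nat \<Rightarrow> nat \<Rightarrow> real) \<Rightarrow> bool" where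
  "adjoint_forms n b \<beta> bs \<beta>s \<longleftrightarrow>
     indep_forms n bs \<beta>s \<and>
     (\<forall>\<psi>\<in>Cinf. (\<forall>j\<in>{1..n}. bform n bs \<beta>s j \<psi> = 0) \<longleftrightarrow>
        (\<forall>\<phi>\<in>Phi n b \<beta>. bracket n \<phi> \<psi> 1 - bracket n \<phi> \<psi> 0 = 0))"


section \<open>The initial-boundary value problem\<close>

text \<open>
  Solutions are classical: continuity on the closed rectangle is what ties the values for \<open>t > 0\<close>
  to the initial datum (without it no problem could have a unique solution).
\<close>

definition solves_ibvp ::
    "nat \<Rightarrow> (nat \<Rightarrow> nat \<Rightarrow> real) \<Rightarrow> (nat \<Rightarrow> nat \<Rightarrow> real) \<Rightarrow> complex \<Rightarrow> real \<Rightarrow>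
     (real \<Rightarrow> complex) \<Rightarrow> (real \<Rightarrow> real \<Rightarrow> complex) \<Rightarrow> bool" where
  "solves_ibvp n b \<beta> a T f q \<longleftrightarrow>
     continuous_on ({0..1} \<times> {0..T}) (\<lambda>(x, t). q x t) \<and>
     (\<forall>x\<in>{0<..<1}. \<forall>t\<in>{0<..<T}.
        (q x has_vector_derivative - (a * Sop n (\<lambda>y. q y t) x)) (at t)) \<and>
     (\<forall>x\<in>{0..1}. q x 0 = f x) \<and>
     (\<forall>t\<in>{0..T}. (\<lambda>x. q x t) \<in> Phi n b \<beta>)"

definition well_posed ::
    "nat \<Rightarrow> (nat \<Rightarrow> nat \<Rightarrow> real) \<Rightarrow> (nat \<Rightarrow> nat \<Rightarrow> real) \<Rightarrow> complex \<Rightarrow> real \<Rightarrow> bool" where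
  "well_posed n b \<beta> a T \<longleftrightarrow>
     (\<forall>f\<in>Phi n b \<beta>.
        (\<exists>q. solves_ibvp n b \<beta> a T f q) \<and>
        (\<forall>q q'. solves_ibvp n b \<beta> a T f q \<and> solves_ibvp n b \<beta> a T f q' \<longrightarrow>
           (\<forall>x\<in>{0..1}. \<forall>t\<in>{0..T}. q x t = q' x t)))"


section \<open>The functionals\<close>

definition alpha :: "nat \<Rightarrow> complex" where
  "alpha n = exp (2 * of_real pi * \<i> / of_nat n)"

text \<open>
  \<open>Mpart n bs\<close> and \<open>Mpart n \<beta>s\<close> are $M^+$ and $M^-$. Row and column indices run
  through \<open>{1..n}\<close>, while the matrices of the library are indexed from \<open>0\<close>.
\<close>

definition Mpart :: "nat \<Rightarrow> (nat \<Rightarrow> nat \<Rightarrow> real) \<Rightarrow> complex \<Rightarrow> nat \<Rightarrow> nat \<Rightarrow> complex" where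
  "Mpart n c z k j = (\<Sum>r<n. (- \<i> * alpha n ^ (k - 1) * z) ^ r * of_real (c j r))"

definition Mentry ::
    "nat \<Rightarrow> (nat \<Rightarrow> nat \<Rightarrow> real) \<Rightarrow> (nat \<Rightarrow> nat \<Rightarrow> real) \<Rightarrow> complex \<Rightarrow> nat \<Rightarrow> nat \<Rightarrow> complex" where
  "Mentry n bs \<beta>s z k j =
     Mpart n bs z k j + Mpart n \<beta>s z k j * exp (- \<i> * alpha n ^ (k - 1) * z)"

definition Delta ::
    "nat \<Rightarrow> (nat \<Rightarrow> nat \<Rightarrow> real) \<Rightarrow> (nat \<Rightarrow> nat \<Rightarrow> real) \<Rightarrow> complex \<Rightarrow> complex" where
  "Delta n bs \<beta>s z =
     Determinant.det (Matrix.mat n n (\<lambda>(k, j). Mentry n bs \<beta>s z (k + 1) (j + 1)))"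

definition cyc :: "nat \<Rightarrow> nat \<Rightarrow> nat" where
  "cyc n m = (m - 1) mod n + 1"

definition detX ::
    "nat \<Rightarrow> (nat \<Rightarrow> nat \<Rightarrow> real) \<Rightarrow> (nat \<Rightarrow> nat \<Rightarrow> real) \<Rightarrow> complex \<Rightarrow> nat \<Rightarrow> nat \<Rightarrow> complex" where
  "detX n bs \<beta>s z l j =
     Determinant.det (Matrix.mat (n - 1) (n - 1)
       (\<lambda>(r, s). Mentry n bs \<beta>s z (cyc n (l + 1 + r)) (cyc n (j + 1 + s))))"

definition Fplus ::
    "nat \<Rightarrow> (nat \<Rightarrow> nat \<Rightarrow> real) \<Rightarrow> (nat \<Rightarrow> nat \<Rightarrow> real) \<Rightarrow> complex \<Rightarrow> functional" where
  "Fplus n bs \<beta>s z f =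
     1 / (2 * of_real pi * Delta n bs \<beta>s z) *
     (\<Sum>l=1..n. \<Sum>j=1..n. (- 1) ^ ((n - 1) * (l + j)) * detX n bs \<beta>s z l j *
        Mpart n bs z 1 j *
        integral {0..1} (\<lambda>x. exp (- \<i> * alpha n ^ (l - 1) * z * of_real x) * f x))"

definition Fminus ::
    "nat \<Rightarrow> (nat \<Rightarrow> nat \<Rightarrow> real) \<Rightarrow> (nat \<Rightarrow> nat \<Rightarrow> real) \<Rightarrow> complex \<Rightarrow> functional" where
  "Fminus n bs \<beta>s z f =
     - exp (- \<i> * z) / (2 * of_real pi * Delta n bs \<beta>s z) *
     (\<Sum>l=1..n. \<Sum>j=1..n. (- 1) ^ ((n - 1) * (l + j)) * detX n bs \<beta>s z l j *
        Mpart n \<beta>s z 1 j *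
        integral {0..1} (\<lambda>x. exp (- \<i> * alpha n ^ (l - 1) * z * of_real x) * f x))"


section \<open>Oriented contours\<close>

text \<open>
  For a point \<open>z\<close> on a curve with tangent \<open>v\<close>, \<open>bdry_sign \<Omega> z v\<close> is \<open>1\<close> if \<open>\<Omega>\<close> lies on the left of the
  curve only, \<open>-1\<close> if it lies on the right only, and \<open>0\<close> if \<open>z\<close> is interior or exterior to
  \<open>\<Omega>\<close>.
\<close>

definition bdry_sign :: "complex set \<Rightarrow> complex \<Rightarrow> complex \<Rightarrow> complex" where
  "bdry_sign \<Omega> z v =
     of_bool (\<forall>\<^sub>F s in at_right 0. z + of_real s * \<i> * v \<in> \<Omega>) -
     of_bool (\<forall>\<^sub>F s in at_right 0. z - of_real s * \<i> * v \<in> \<Omega>)"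

text \<open>
  The integral over the part in a bounded set \<open>K\<close> of the boundary of \<open>\<Omega>\<close>, oriented so that \<open>\<Omega>\<close> is on
  the left. The boundary is covered by finitely many regular curves that overlap in finitely many
  points only. The curves may run in either direction and leave the boundary: \<open>bdry_sign\<close>
  corrects the orientation and cancels the superfluous parts.
\<close>

definition has_bdry_integral_in ::
    "complex set \<Rightarrow> complex set \<Rightarrow> (complex \<Rightarrow> complex) \<Rightarrow> complex \<Rightarrow> bool" where
  "has_bdry_integral_in \<Omega> K g J \<longleftrightarrow>
     (\<exists>(N::nat) c I.
        (\<forall>i<N. simple_path (c i) \<and> c i C1_differentiable_on {0..1} \<and>
           (\<forall>t\<in>{0..1}. vector_derivative (c i) (at t) \<noteq> 0)) \<and>
        (\<forall>i<N. \<forall>j<N. i \<noteq> j \<longrightarrow> finite (path_image (c i) \<inter> path_image (c j))) \<and>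
        frontier \<Omega> \<inter> K \<subseteq> (\<Union>i<N. path_image (c i)) \<and>
        (\<forall>i<N. ((\<lambda>t. bdry_sign \<Omega> (c i t) (vector_derivative (c i) (at t)) *
                   g (c i t) * vector_derivative (c i) (at t))
                 has_integral I i) {t\<in>{0..1}. c i t \<in> K}) \<and>
        J = (\<Sum>i<N. I i))"

text \<open>
  Improper integrals over an unbounded boundary: the parts in the right and in the left half-plane
  are truncated at radii that tend to infinity independently, so that no cancellation between the
  two ends of the real line is involved (no principal values).
\<close>

definition half_discs :: "real \<Rightarrow> real \<Rightarrow> complex set" where
  "half_discs A B = {z. (0 \<le> Re z \<and> norm z \<le> A) \<or> (Re z < 0 \<and> norm z \<le> B)}"

definition has_bdry_integral :: "complex set \<Rightarrow> (complex \<Rightarrow> complex) \<Rightarrow> complex \<Rightarrow> bool" where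
  "has_bdry_integral \<Omega> g I \<longleftrightarrow>
     (\<exists>J. (\<forall>A>0. \<forall>B>0. has_bdry_integral_in \<Omega> (half_discs A B) g (J A B)) \<and>
          ((\<lambda>(A, B). J A B) \<longlongrightarrow> I) (at_top \<times>\<^sub>F at_top))"

text \<open>
  \<open>Circles Z r\<close> is the union of the positively oriented circles of radius \<open>r\<close> about the points of
  \<open>Z\<close>; integrals over it are the sums of the series of the integrals over the individual circles.
  \<open>Boundary \<Omega>\<close> is the boundary of \<open>\<Omega>\<close>, with \<open>\<Omega>\<close> on the left.
\<close>

datatype contour = Circles "complex set" real | Boundary "complex set"

fun contour_set :: "contour \<Rightarrow> complex set" where
  "contour_set (Circles Z r) = (\<Union>\<sigma>\<in>Z. sphere \<sigma> r)"
| "contour_set (Boundary \<Omega>) = frontier \<Omega>"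

fun has_int_over :: "contour \<Rightarrow> (complex \<Rightarrow> complex) \<Rightarrow> complex \<Rightarrow> bool" where
  "has_int_over (Circles Z r) g I \<longleftrightarrow>
     (\<forall>\<sigma>\<in>Z. g contour_integrable_on circlepath \<sigma> r) \<and>
     ((\<lambda>\<sigma>. contour_integral (circlepath \<sigma> r) g) has_sum I) Z"
| "has_int_over (Boundary \<Omega>) g I \<longleftrightarrow> has_bdry_integral \<Omega> g I"


section \<open>The contours of the problem\<close>

text \<open>
  \<open>5 * \<epsilon>\<close> is the infimal separation of the zeros. If there is only one zero (\<open>0\<close> always is one), then
  the separation carries no information and \<open>\<epsilon>\<close> is an arbitrary positive number.

  A single zero together with \<open>a = 0\<close> has to be excluded from the completeness claim: for \<open>n = 2\<close>
  and the boundary conditions \<open>\<phi>(0) = \<phi>'(0) = 0\<close>, $\Delta$ is a multiple of $\lambda$, so that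
  $\Gamma_0^-$ and $\Gamma_a$ are empty and $F^+$ vanishes, although $\partial_t q = 0$ is well-posed.
\<close>

definition several_zeros :: "nat \<Rightarrow> (nat \<Rightarrow> nat \<Rightarrow> real) \<Rightarrow> (nat \<Rightarrow> nat \<Rightarrow> real) \<Rightarrow> bool" where
  "several_zeros n bs \<beta>s \<longleftrightarrow>
     (\<exists>\<sigma> \<tau>. Delta n bs \<beta>s \<sigma> = 0 \<and> Delta n bs \<beta>s \<tau> = 0 \<and> \<sigma> \<noteq> \<tau>)"

definition separation ::
    "nat \<Rightarrow> (nat \<Rightarrow> nat \<Rightarrow> real) \<Rightarrow> (nat \<Rightarrow> nat \<Rightarrow> real) \<Rightarrow> real \<Rightarrow> bool" where
  "separation n bs \<beta>s \<epsilon> \<longleftrightarrow>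
     0 < \<epsilon> \<and>
     (several_zeros n bs \<beta>s \<longrightarrow>
        5 * \<epsilon> = Inf {dist \<sigma> \<tau> | \<sigma> \<tau>. Delta n bs \<beta>s \<sigma> = 0 \<and> Delta n bs \<beta>s \<tau> = 0 \<and> \<sigma> \<noteq> \<tau>})"

definition Gamma0_plus ::
    "nat \<Rightarrow> (nat \<Rightarrow> nat \<Rightarrow> real) \<Rightarrow> (nat \<Rightarrow> nat \<Rightarrow> real) \<Rightarrow> real \<Rightarrow> contour" where
  "Gamma0_plus n bs \<beta>s \<epsilon> = Circles {\<sigma>. 0 \<le> Im \<sigma> \<and> Delta n bs \<beta>s \<sigma> = 0} \<epsilon>"

definition Gamma0_minus ::
    "nat \<Rightarrow> (nat \<Rightarrow> nat \<Rightarrow> real) \<Rightarrow> (nat \<Rightarrow> nat \<Rightarrow> real) \<Rightarrow> real \<Rightarrow> contour" where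
  "Gamma0_minus n bs \<beta>s \<epsilon> = Circles {\<sigma>. Im \<sigma> < 0 \<and> Delta n bs \<beta>s \<sigma> = 0} \<epsilon>"

definition Gammaa_plus ::
    "nat \<Rightarrow> (nat \<Rightarrow> nat \<Rightarrow> real) \<Rightarrow> (nat \<Rightarrow> nat \<Rightarrow> real) \<Rightarrow> real \<Rightarrow> complex \<Rightarrow> contour" where
  "Gammaa_plus n bs \<beta>s \<epsilon> a =
     Boundary ({z. 0 < Im z \<and> 0 < Re (a * z ^ n)} -
               (\<Union>\<sigma>\<in>{\<sigma>. Delta n bs \<beta>s \<sigma> = 0}. cball \<sigma> (2 * \<epsilon>)))"

definition Gammaa_minus ::
    "nat \<Rightarrow> (nat \<Rightarrow> nat \<Rightarrow> real) \<Rightarrow> (nat \<Rightarrow> nat \<Rightarrow> real) \<Rightarrow> real \<Rightarrow> complex \<Rightarrow> contour" where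
  "Gammaa_minus n bs \<beta>s \<epsilon> a =
     Boundary ({z. Im z < 0 \<and> 0 < Re (a * z ^ n)} -
               (\<Union>\<sigma>\<in>{\<sigma>. Delta n bs \<beta>s \<sigma> = 0}. cball \<sigma> (2 * \<epsilon>)))"


section \<open>Augmented eigenfunctions\<close>

text \<open>
  The contour and the family consist of two parts, labelled \<open>p\<close> and \<open>m\<close>, and the integral is the sum
  of the integrals over the parts. The two parts may overlap (on the real line) with
  different functionals attached, so the family cannot be a function of the parameter alone.
  The operator is \<open>L\<close> with domain \<open>V\<close>, and the eigenvalues are $\lambda^n$.
\<close>

definition remainders ::
    "nat \<Rightarrow> (real \<Rightarrow> complex) set \<Rightarrow> ((real \<Rightarrow> complex) \<Rightarrow> real \<Rightarrow> complex) \<Rightarrow> contour \<Rightarrow>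
     (complex \<Rightarrow> functional) \<Rightarrow> (complex \<Rightarrow> functional) \<Rightarrow> bool" where
  "remainders n V L \<gamma> E R \<longleftrightarrow>
     (\<forall>z\<in>contour_set \<gamma>. E z \<in> dual Cinf \<and> R z \<in> dual V \<and>
        (\<forall>\<phi>\<in>V. E z (L \<phi>) = z ^ n * E z \<phi> + R z \<phi>))"

definition augmented_type_I ::
    "nat \<Rightarrow> (real \<Rightarrow> complex) set \<Rightarrow> ((real \<Rightarrow> complex) \<Rightarrow> real \<Rightarrow> complex) \<Rightarrow>
     contour \<Rightarrow> (complex \<Rightarrow> functional) \<Rightarrow> contour \<Rightarrow> (complex \<Rightarrow> functional) \<Rightarrow> bool" where
  "augmented_type_I n V L \<gamma>p Ep \<gamma>m Em \<longleftrightarrow>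
     (\<exists>Rp Rm. remainders n V L \<gamma>p Ep Rp \<and> remainders n V L \<gamma>m Em Rm \<and>
        (\<forall>\<phi>\<in>V. \<forall>x\<in>{0<..<1}. \<exists>Jp Jm.
           has_int_over \<gamma>p (\<lambda>z. exp (\<i> * z * of_real x) * Rp z \<phi>) Jp \<and>
           has_int_over \<gamma>m (\<lambda>z. exp (\<i> * z * of_real x) * Rm z \<phi>) Jm \<and>
           Jp + Jm = 0))"

definition augmented_type_II ::
    "nat \<Rightarrow> (real \<Rightarrow> complex) set \<Rightarrow> ((real \<Rightarrow> complex) \<Rightarrow> real \<Rightarrow> complex) \<Rightarrow>
     contour \<Rightarrow> (complex \<Rightarrow> functional) \<Rightarrow> contour \<Rightarrow> (complex \<Rightarrow> functional) \<Rightarrow> bool" where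
  "augmented_type_II n V L \<gamma>p Ep \<gamma>m Em \<longleftrightarrow>
     (\<exists>Rp Rm. remainders n V L \<gamma>p Ep Rp \<and> remainders n V L \<gamma>m Em Rm \<and>
        (\<forall>\<phi>\<in>V. \<forall>x\<in>{0<..<1}. \<exists>Jp Jm.
           has_int_over \<gamma>p (\<lambda>z. exp (\<i> * z * of_real x) / z ^ n * Rp z \<phi>) Jp \<and>
           has_int_over \<gamma>m (\<lambda>z. exp (\<i> * z * of_real x) / z ^ n * Rm z \<phi>) Jm \<and>
           Jp + Jm = 0))"

definition complete_system :: "(real \<Rightarrow> complex) set \<Rightarrow> functional set \<Rightarrow> bool" where
  "complete_system V \<E> \<longleftrightarrow>
     (\<forall>\<phi>\<in>V. (\<forall>E\<in>\<E>. E \<phi> = 0) \<longrightarrow> (\<forall>x\<in>{0..1}. \<phi> x = 0))"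

end

(*
  Integrating by parts in F(S phi) and inserting the adjoint boundary forms produces sums that Cramer's
  rule turns into multiples of Delta. The denominator of F cancels, so that the remainder of F^+ is a
  polynomial in lambda of degree less than n, and that of F^- is such a polynomial times exp (-i lambda).

  Type I: the integrand is entire, and Cauchy's theorem applies on every circle.

  Type II: for 0 < x < 1 the integrand decays exponentially inside the half-plane, is O(1 / lambda) on the
  real axis, and has its only singularity at 0, which is a zero of Delta and thus removed. It has a
  primitive in the half-plane whose oscillation at infinity tends to 0. Integrating along the boundary rays of the
  sectors straight through the removed discs gives increments of this primitive that cancel around 0, up
  to values at infinity. Going around a disc instead changes nothing as long as the disc is not cut by the
  truncation, and the discs that are cut contribute little because the zeros are separated.

  Completeness: the numerators of F^+ and F^- are entire, so they vanish identically as soon as they vanish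
  on an arc. The circle around 0 is such an arc for F^+. For F^- it is a circle around a nonzero zero of Delta,
  rotated into the lower half-plane by a power of alpha, or an arc of Gamma_a. The two numerators
  combine to Delta times the Fourier transform of phi, so phi = 0.
*)

theory Submission
  imports
    Defs
    "HOL-Complex_Analysis.Complex_Analysis"
    "HOL-Real_Asymp.Real_Asymp"
begin

section \<open>Smooth functions and boundary forms\<close>

text \<open>For \<open>\<phi>\<close> in the domain, the bracket with an exponential is a
  combination of the adjoint boundary values of that exponential, which are the entries of M. This
  is what makes Cramer's rule available.

  In type II the slow decay on the real axis rules out absolute estimates, and a term 1/z rules out
  a single-valued primitive around 0. So the primitive lives on a plane cut opposite to the
  half-plane, and its increments are weighted by the jumps of the indicator of the sector across the
  rays. These jumps add up to 0, so common values drop out. Among the discs cut by a truncation at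
  radius A, only O(sqrt A) lie within about sqrt A of the real axis, each contributing O(1/A);
  higher up the exponential wins.

  The exceptional case of completeness is n = 2, a = 0: alpha is -1, real zeros stay real, and
  Gamma_a is empty, so that possibly only F^+ is at hand. Its vanishing relates the exponential
  transforms of \<open>\<phi>\<close> at w and -w. Eliminating one of them, comparing growth and
  integrating by parts leads to moments against cosh.\<close>

lemma D_0: "D 0 f = f"
  by (simp add: D_def)

lemma D_Suc: "D (Suc k) f x = vector_derivative (D k f) (at x within {0..1})"
  by (simp add: D_def)

text \<open>Derivatives within a closed interval are unique, at the end points too, so a chain of
  candidate derivatives can be identified with the iterates of \<open>D\<close> one order at a time.
  The closure properties of \<open>Cinf\<close> below come from this rule.\<close>

lemma Cinf_derivatives:
  assumes 0: "\<And>x. x \<in> {0..1} \<Longrightarrow> f x = g 0 x"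
    and g: "\<And>k x. x \<in> {0..1} \<Longrightarrow> (g k has_vector_derivative g (Suc k) x) (at x within {0..1})"
  shows "f \<in> Cinf" and "x \<in> {0..1} \<Longrightarrow> D k f x = g k x"
proof -
  have eq: "\<forall>x\<in>{0..1}. D k f x = g k x" for k
  proof (induction k)
    case 0
    then show ?case using assms(1) by (simp add: D_0)
  next
    case (Suc k)
    show ?case
    proof
      fix x :: real assume x: "x \<in> {0..1}"
      have "(D k f has_vector_derivative g (Suc k) x) (at x within {0..1})"
        using Suc x by (intro has_vector_derivative_transform[OF x _ g[OF x]]) auto
      then show "D (Suc k) f x = g (Suc k) x"
        using x by (simp add: D_Suc vector_derivative_within_closed_interval)
    qed
  qed
  then show "x \<in> {0..1} \<Longrightarrow> D k f x = g k x" by blast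
  show "f \<in> Cinf"
    unfolding Cinf_def
  proof safe
    fix k and x :: real assume x: "x \<in> {0..1}"
    have "(D k f has_vector_derivative g (Suc k) x) (at x within {0..1})"
      using eq[of k] x by (intro has_vector_derivative_transform[OF x _ g[OF x]]) auto
    then show "D k f differentiable (at x within {0..1})"
      by (rule differentiableI_vector)
  qed
qed

lemma D_has_vector_derivative:
  assumes "\<phi> \<in> Cinf" "x \<in> {0..1}"
  shows "(D k \<phi> has_vector_derivative D (Suc k) \<phi> x) (at x within {0..1})"
  using assms unfolding Cinf_def D_Suc by (auto simp: vector_derivative_works)

lemma continuous_on_D:
  assumes "\<phi> \<in> Cinf"
  shows "continuous_on {0..1} (D k \<phi>)"
  using D_has_vector_derivative[OF assms] continuous_on_vector_derivative by blast

lemma Cinf_add_mult: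
  assumes "\<phi> \<in> Cinf" "\<psi> \<in> Cinf"
  shows "(\<lambda>x. \<phi> x + c * \<psi> x) \<in> Cinf"
    and "x \<in> {0..1} \<Longrightarrow> D k (\<lambda>x. \<phi> x + c * \<psi> x) x = D k \<phi> x + c * D k \<psi> x"
proof -
  have g: "((\<lambda>x. D k \<phi> x + c * D k \<psi> x) has_vector_derivative D (Suc k) \<phi> x + c * D (Suc k) \<psi> x)
     (at x within {0..1})" if "x \<in> {0..1}" for k x
    using D_has_vector_derivative[OF assms(1) that] D_has_vector_derivative[OF assms(2) that]
    by (auto intro!: derivative_eq_intros)
  show "(\<lambda>x. \<phi> x + c * \<psi> x) \<in> Cinf"
    by (rule Cinf_derivatives(1)[of _ "\<lambda>k x. D k \<phi> x + c * D k \<psi> x"]) (auto simp: D_0 g)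
  show "D k (\<lambda>x. \<phi> x + c * \<psi> x) x = D k \<phi> x + c * D k \<psi> x" if "x \<in> {0..1}"
    by (rule Cinf_derivatives(2)[of _ "\<lambda>k x. D k \<phi> x + c * D k \<psi> x"]) (use that in \<open>auto simp: D_0 g\<close>)
qed

lemma Cinf_cnj:
  assumes "\<psi> \<in> Cinf"
  shows "(\<lambda>x. cnj (\<psi> x)) \<in> Cinf" and "x \<in> {0..1} \<Longrightarrow> D k (\<lambda>x. cnj (\<psi> x)) x = cnj (D k \<psi> x)"
proof -
  have g: "((\<lambda>x. cnj (D k \<psi> x)) has_vector_derivative cnj (D (Suc k) \<psi> x)) (at x within {0..1})"
    if "x \<in> {0..1}" for k x
    using D_has_vector_derivative[OF assms that] by (rule has_vector_derivative_cnj)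
  show "(\<lambda>x. cnj (\<psi> x)) \<in> Cinf"
    by (rule Cinf_derivatives(1)[of _ "\<lambda>k x. cnj (D k \<psi> x)"]) (auto simp: D_0 g)
  show "D k (\<lambda>x. cnj (\<psi> x)) x = cnj (D k \<psi> x)" if "x \<in> {0..1}"
    by (rule Cinf_derivatives(2)[of _ "\<lambda>k x. cnj (D k \<psi> x)"]) (use that in \<open>auto simp: D_0 g\<close>)
qed

lemma Cinf_exp:
  fixes \<mu> :: complex
  shows "(\<lambda>x. exp (\<mu> * of_real x)) \<in> Cinf"
    and "x \<in> {0..1} \<Longrightarrow> D k (\<lambda>x. exp (\<mu> * of_real x)) x = \<mu> ^ k * exp (\<mu> * of_real x)"
proof -
  have g: "((\<lambda>x. \<mu> ^ k * exp (\<mu> * of_real x)) has_vector_derivative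
      \<mu> ^ Suc k * exp (\<mu> * of_real x)) (at x within {0..1})" for k x
    by (rule has_vector_derivative_real_field) (auto intro!: derivative_eq_intros)
  show "(\<lambda>x. exp (\<mu> * of_real x)) \<in> Cinf"
    by (rule Cinf_derivatives(1)[of _ "\<lambda>k x. \<mu> ^ k * exp (\<mu> * of_real x)"])
       (use g in auto)
  show "D k (\<lambda>x. exp (\<mu> * of_real x)) x = \<mu> ^ k * exp (\<mu> * of_real x)" if "x \<in> {0..1}"
    by (rule Cinf_derivatives(2)[of _ "\<lambda>k x. \<mu> ^ k * exp (\<mu> * of_real x)"])
       (use g that in auto)
qed

lemma Cinf_zero: "(\<lambda>x. 0) \<in> Cinf" and D_zero: "x \<in> {0..1} \<Longrightarrow> D k (\<lambda>x. 0) x = 0"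
  by (rule Cinf_derivatives(1)[of _ "\<lambda>k x. 0"], auto,
      rule Cinf_derivatives(2)[of _ "\<lambda>k x. 0"], auto)

text \<open>Each \<open>D k \<phi>\<close> is continuous on a compact interval, so the suprema in
  \<open>Ck_norm\<close> are genuine upper bounds.\<close>

lemma norm_D_le_Ck_norm:
  assumes "\<phi> \<in> Cinf" "x \<in> {0..1}" "k \<le> N"
  shows "norm (D k \<phi> x) \<le> Ck_norm N \<phi>"
proof -
  have bdd: "bdd_above ((\<lambda>x. norm (D k \<phi> x)) ` {0..1})" for k
    by (intro bounded_imp_bdd_above compact_imp_bounded compact_continuous_image
        continuous_intros continuous_on_D assms) auto
  have le: "norm (D k \<phi> x) \<le> (SUP x\<in>{0..1}. norm (D k \<phi> x))" if "x \<in> {0..1}" for k x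
    using that by (intro cSUP_upper bdd)
  have "(SUP x\<in>{0..1}. norm (D k \<phi> x)) \<le> Ck_norm N \<phi>"
    unfolding Ck_norm_def
  proof (rule member_le_sum)
    show "0 \<le> (SUP x\<in>{0..1}. norm (D k \<phi> x))" for k
      using order_trans[OF norm_ge_zero le[of 0 k]] by simp
  qed (use assms in auto)
  with le[OF assms(2)] show ?thesis by (rule order_trans)
qed

lemma Ck_norm_nonneg:
  assumes "\<phi> \<in> Cinf"
  shows "0 \<le> Ck_norm N \<phi>"
  using norm_D_le_Ck_norm[OF assms, of 0 0 N] norm_ge_zero[of "D 0 \<phi> 0"] by (meson atLeastAtMost_iff order.refl order_trans zero_le zero_le_one)

section \<open>Linearity of boundary forms and brackets, and dual bases\<close>

lemma Cinf_sum:
  assumes "finite J" "\<And>j. j \<in> J \<Longrightarrow> v j \<in> Cinf"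
  shows "(\<lambda>x. \<Sum>j\<in>J. d j * v j x) \<in> Cinf"
  using assms
proof (induction J rule: finite_induct)
  case empty
  then show ?case using Cinf_zero by simp
next
  case (insert i J)
  then have "(\<lambda>x. (\<Sum>j\<in>J. d j * v j x) + d i * v i x) \<in> Cinf"
    by (intro Cinf_add_mult) auto
  then show ?case using insert by (simp add: add.commute)
qed

lemma bform_add_mult:
  assumes "\<phi> \<in> Cinf" "\<psi> \<in> Cinf"
  shows "bform n b \<beta> j (\<lambda>x. \<phi> x + c * \<psi> x) = bform n b \<beta> j \<phi> + c * bform n b \<beta> j \<psi>"
  by (simp add: bform_def Cinf_add_mult(2)[OF assms] sum.distrib sum_distrib_left algebra_simps)

lemma bform_zero: "bform n b \<beta> j (\<lambda>x. 0) = 0"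
  by (simp add: bform_def D_zero)

lemma bform_sum:
  assumes "finite J" "\<And>j. j \<in> J \<Longrightarrow> v j \<in> Cinf"
  shows "bform n b \<beta> i (\<lambda>x. \<Sum>j\<in>J. d j * v j x) = (\<Sum>j\<in>J. d j * bform n b \<beta> i (v j))"
  using assms
proof (induction J rule: finite_induct)
  case empty
  then show ?case by (simp add: bform_zero)
next
  case (insert k J)
  then have "bform n b \<beta> i (\<lambda>x. (\<Sum>j\<in>J. d j * v j x) + d k * v k x) = (\<Sum>j\<in>J. d j * bform n b \<beta> i (v j)) + d k * bform n b \<beta> i (v k)"
    by (subst bform_add_mult) (auto intro: Cinf_sum)
  then show ?case using insert by (simp add: add.commute)
qed

text \<open>The boundary term of an n-fold integration by parts. It is linear in
  \<open>\<phi>\<close> and conjugate-linear in \<open>\<psi>\<close>, which is why conjugated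
  coefficients and exponentials appear from here on.\<close>

definition bracket_diff :: "nat \<Rightarrow> (real \<Rightarrow> complex) \<Rightarrow> (real \<Rightarrow> complex) \<Rightarrow> complex" where
  "bracket_diff n \<phi> \<psi> = bracket n \<phi> \<psi> 1 - bracket n \<phi> \<psi> 0"

lemma bracket_diff_add_mult_left:
  assumes "\<phi> \<in> Cinf" "\<phi>' \<in> Cinf"
  shows "bracket_diff n (\<lambda>x. \<phi> x + c * \<phi>' x) \<psi> = bracket_diff n \<phi> \<psi> + c * bracket_diff n \<phi>' \<psi>"
  by (simp add: bracket_diff_def bracket_def Cinf_add_mult(2)[OF assms] sum.distrib
      sum_distrib_left algebra_simps)

lemma bracket_diff_add_mult_right:
  assumes "\<psi> \<in> Cinf" "\<psi>' \<in> Cinf"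
  shows "bracket_diff n \<phi> (\<lambda>x. \<psi> x + c * \<psi>' x) = bracket_diff n \<phi> \<psi> + cnj c * bracket_diff n \<phi> \<psi>'"
proof -
  have "D j (\<lambda>x. cnj (\<psi> x) + cnj c * cnj (\<psi>' x)) x =
      D j (\<lambda>x. cnj (\<psi> x)) x + cnj c * D j (\<lambda>x. cnj (\<psi>' x)) x" if "x \<in> {0..1}" for j x
    using that by (rule Cinf_add_mult(2)[OF Cinf_cnj(1)[OF assms(1)] Cinf_cnj(1)[OF assms(2)]])
  then show ?thesis
    by (simp add: bracket_diff_def bracket_def sum.distrib sum_distrib_left algebra_simps)
qed

lemma bracket_diff_sum_right:
  assumes "finite J" "\<And>j. j \<in> J \<Longrightarrow> v j \<in> Cinf"
  shows "bracket_diff n \<phi> (\<lambda>x. \<Sum>j\<in>J. d j * v j x) = (\<Sum>j\<in>J. cnj (d j) * bracket_diff n \<phi> (v j))"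
  using assms
proof (induction J rule: finite_induct)
  case empty
  then show ?case by (simp add: bracket_diff_def bracket_def D_zero)
next
  case (insert k J)
  then have "bracket_diff n \<phi> (\<lambda>x. (\<Sum>j\<in>J. d j * v j x) + d k * v k x) =
      (\<Sum>j\<in>J. cnj (d j) * bracket_diff n \<phi> (v j)) + cnj (d k) * bracket_diff n \<phi> (v k)"
    by (subst bracket_diff_add_mult_right) (auto intro: Cinf_sum)
  then show ?case using insert by (simp add: add.commute)
qed

text \<open>With \<open>\<psi>\<close> fixed, only derivatives of \<open>\<phi>\<close> of order
  below n at the two end points enter. The continuity of the remainder functionals rests on
  this.\<close>

lemma bracket_diff_bound: "\<exists>K. \<forall>\<phi>\<in>Cinf. norm (bracket_diff n \<phi> \<psi>) \<le> K * Ck_norm n \<phi>"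
proof -
  define K where "K x = (\<Sum>j<n. norm (D j (\<lambda>y. cnj (\<psi> y)) x))" for x
  have "norm (bracket n \<phi> \<psi> x) \<le> K x * Ck_norm n \<phi>" if "\<phi> \<in> Cinf" "x \<in> {0..1}" for \<phi> x
  proof -
    have "norm (bracket n \<phi> \<psi> x) \<le> (\<Sum>j<n. norm (D (n - 1 - j) \<phi> x) * norm (D j (\<lambda>y. cnj (\<psi> y)) x))"
      unfolding bracket_def norm_mult by (simp add: norm_power) (rule sum_norm_le, simp add: norm_mult norm_power)
    also have "\<dots> \<le> (\<Sum>j<n. Ck_norm n \<phi> * norm (D j (\<lambda>y. cnj (\<psi> y)) x))"
      using that by (intro sum_mono mult_right_mono norm_D_le_Ck_norm) auto
    finally show ?thesis by (simp add: K_def sum_distrib_left mult.commute)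
  qed
  then have "norm (bracket_diff n \<phi> \<psi>) \<le> (K 1 + K 0) * Ck_norm n \<phi>" if "\<phi> \<in> Cinf" for \<phi>
    unfolding bracket_diff_def distrib_right using that
    by (intro order_trans[OF norm_triangle_ineq4] add_mono) auto
  then show ?thesis by blast
qed

text \<open>Gaussian elimination on the functionals.\<close>

lemma ex_dual_basis:
  fixes f :: "nat \<Rightarrow> ('a \<Rightarrow> complex) \<Rightarrow> complex"
  assumes closed: "\<And>\<phi> \<psi> c. \<phi> \<in> V \<Longrightarrow> \<psi> \<in> V \<Longrightarrow> (\<lambda>x. \<phi> x + c * \<psi> x) \<in> V"
    and lin: "\<And>i \<phi> \<psi> c. i \<in> {1..n} \<Longrightarrow> \<phi> \<in> V \<Longrightarrow> \<psi> \<in> V \<Longrightarrow> f i (\<lambda>x. \<phi> x + c * \<psi> x) = f i \<phi> + c * f i \<psi>"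
    and indep: "\<And>c. (\<And>\<phi>. \<phi> \<in> V \<Longrightarrow> (\<Sum>j=1..n. c j * f j \<phi>) = 0) \<Longrightarrow> \<forall>j\<in>{1..n}. c j = 0"
  shows "\<exists>v. \<forall>j\<in>{1..n}. v j \<in> V \<and> (\<forall>i\<in>{1..n}. f i (v j) = of_bool (i = j))"
proof -
  have "m \<le> n \<Longrightarrow> \<exists>v. \<forall>j\<in>{1..m}. v j \<in> V \<and> (\<forall>i\<in>{1..m}. f i (v j) = of_bool (i = j))" for m
  proof (induction m)
    case 0
    then show ?case by auto
  next
    case (Suc m)
    then obtain v where v: "\<And>j. j \<in> {1..m} \<Longrightarrow> v j \<in> V"
      "\<And>i j. i \<in> {1..m} \<Longrightarrow> j \<in> {1..m} \<Longrightarrow> f i (v j) = of_bool (i = j)"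
      by (metis Suc_leD)
    \<comment> \<open>The combination
      \<open>f (Suc m) - (\<Sum>j=1..m. f (Suc m) (v j) * f j)\<close> annihilates every
      \<open>v j\<close> found so far. Its leading coefficient is 1, so independence provides a
      \<open>w\<close> on which it does not vanish.\<close>
    define c where "c j = (if j = Suc m then 1 else if j \<le> m then - f (Suc m) (v j) else 0)" for j
    have "\<not> (\<forall>j\<in>{1..n}. c j = 0)"
      using Suc.prems by (auto simp: c_def intro!: bexI[of _ "Suc m"])
    then obtain w where w: "w \<in> V" "(\<Sum>j=1..n. c j * f j w) \<noteq> 0"
      using indep[of c] by blast
    have "(\<Sum>j=1..n. c j * f j w) = (\<Sum>j=1..Suc m. c j * f j w)"
      using Suc.prems by (intro sum.mono_neutral_right) (auto simp: c_def)
    also have "\<dots> = f (Suc m) w - (\<Sum>j=1..m. f (Suc m) (v j) * f j w)"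
      by (simp add: c_def sum_negf)
    finally have ne: "f (Suc m) w - (\<Sum>j=1..m. f (Suc m) (v j) * f j w) \<noteq> 0" using w by simp
    \<comment> \<open>The components of \<open>w\<close> along \<open>v 1\<close>, ...,
      \<open>v m\<close> are removed one at a time, because the closure assumption speaks of
      two-term combinations. The outcome is killed by \<open>f 1\<close>, ..., \<open>f m\<close>,
      and \<open>f (Suc m)\<close> takes on it the nonzero value of the combination at
      \<open>w\<close>.\<close>
    have step: "k \<le> m \<Longrightarrow> \<exists>u\<in>V. \<forall>i\<in>{1..Suc m}. f i u = f i w - (\<Sum>j=1..k. f i (v j) * f j w)" for k
    proof (induction k)
      case 0
      then show ?case using w by auto
    next
      case (Suc k)
      then obtain u where u: "u \<in> V" "\<forall>i\<in>{1..Suc m}. f i u = f i w - (\<Sum>j=1..k. f i (v j) * f j w)"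
        by (meson Suc_leD)
      show ?case
      proof (intro bexI ballI)
        show "(\<lambda>x. u x + (- f (Suc k) w) * v (Suc k) x) \<in> V"
          using Suc.prems u v by (intro closed) auto
        fix i assume i: "i \<in> {1..Suc m}"
        show "f i (\<lambda>x. u x + (- f (Suc k) w) * v (Suc k) x) = f i w - (\<Sum>j=1..Suc k. f i (v j) * f j w)"
          using Suc.prems u v i \<open>Suc m \<le> n\<close> by (subst lin) auto
      qed
    qed
    obtain u where u: "u \<in> V" "\<And>i. i \<in> {1..Suc m} \<Longrightarrow> f i u = f i w - (\<Sum>j=1..m. f i (v j) * f j w)"
      using step[of m] by blast
    define e where "e = f (Suc m) u"
    have e: "e \<noteq> 0" using u(2)[of "Suc m"] ne by (simp add: e_def)
    have fu: "f i u = 0" if "i \<in> {1..m}" for i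
    proof -
      have "(\<Sum>j=1..m. f i (v j) * f j w) = (\<Sum>j=1..m. if i = j then f j w else 0)"
        using that v by (intro sum.cong) auto
      then show ?thesis using that u(2)[of i] by simp
    qed
    \<comment> \<open>This is \<open>u / e\<close>, written as a combination to which closure and
      linearity apply.\<close>
    define u' where "u' = (\<lambda>x. u x + (1 / e - 1) * u x)"
    have "f i u' = f i u + (1 / e - 1) * f i u" if "i \<in> {1..Suc m}" for i
      unfolding u'_def using that u(1) Suc.prems by (intro lin) auto
    then have u': "u' \<in> V" "\<And>i. i \<in> {1..m} \<Longrightarrow> f i u' = 0" "f (Suc m) u' = 1"
      using fu e closed[OF u(1) u(1), of "1 / e - 1"]
      by (simp_all add: u'_def[symmetric]) (simp add: e_def[symmetric] field_simps)
    \<comment> \<open>The old vectors are corrected so that the new functional kills them. The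
      earlier conditions survive because \<open>u'\<close> is killed by \<open>f 1\<close>, ...,
      \<open>f m\<close>.\<close>
    define v' where "v' j = (if j = Suc m then u' else (\<lambda>x. v j x + (- f (Suc m) (v j)) * u' x))" for j
    have "v' j \<in> V \<and> (\<forall>i\<in>{1..Suc m}. f i (v' j) = of_bool (i = j))" if j: "j \<in> {1..Suc m}" for j
    proof (cases "j = Suc m")
      case True
      then have "v' j = u'" by (simp add: v'_def)
      moreover have "f i u' = of_bool (i = j)" if "i \<in> {1..Suc m}" for i
        using True u'(2)[of i] u'(3) that by (cases "i = Suc m") auto
      ultimately show ?thesis using u' by simp
    next
      case False
      then have j': "j \<in> {1..m}" using j by auto
      have eq: "f i (v' j) = f i (v j) - f (Suc m) (v j) * f i u'" if "i \<in> {1..Suc m}" for i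
        using False that j' v u' Suc.prems unfolding v'_def
        by (simp only: if_False) (subst lin, auto)
      have "v' j \<in> V" using False j' v u' unfolding v'_def by (simp only: if_False) (intro closed, auto)
      moreover have "f i (v' j) = of_bool (i = j)" if "i \<in> {1..Suc m}" for i
        using that eq[OF that] False j' v(2)[of i j] u'(2)[of i] u'(3) by (cases "i = Suc m") auto
      ultimately show ?thesis by blast
    qed
    then show ?case by blast
  qed
  then show ?thesis by blast
qed

text \<open>Subtract from \<open>\<psi>\<close> the combination of dual basis vectors with the same
  adjoint boundary values. The rest is killed by all adjoint forms, so its bracket with
  \<open>\<phi>\<close> vanishes by the defining property of these forms. The boundary term thus
  depends on \<open>\<psi>\<close> only through n numbers.\<close>

lemma adjoint_representation:
  assumes "adjoint_forms n b \<beta> bs \<beta>s"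
  shows "\<exists>v. \<forall>\<phi>\<in>Phi n b \<beta>. \<forall>\<psi>\<in>Cinf.
      bracket_diff n \<phi> \<psi> = (\<Sum>j=1..n. cnj (bform n bs \<beta>s j \<psi>) * bracket_diff n \<phi> (v j))"
proof -
  have "\<exists>v. \<forall>j\<in>{1..n}. v j \<in> Cinf \<and> (\<forall>i\<in>{1..n}. bform n bs \<beta>s i (v j) = of_bool (i = j))"
    using assms
    by (intro ex_dual_basis Cinf_add_mult bform_add_mult) (auto simp: adjoint_forms_def indep_forms_def)
  then obtain v where v: "\<And>j. j \<in> {1..n} \<Longrightarrow> v j \<in> Cinf"
    "\<And>i j. i \<in> {1..n} \<Longrightarrow> j \<in> {1..n} \<Longrightarrow> bform n bs \<beta>s i (v j) = of_bool (i = j)"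
    by blast
  have "bracket_diff n \<phi> \<psi> = (\<Sum>j=1..n. cnj (bform n bs \<beta>s j \<psi>) * bracket_diff n \<phi> (v j))"
    if \<phi>: "\<phi> \<in> Phi n b \<beta>" and \<psi>: "\<psi> \<in> Cinf" for \<phi> \<psi>
  proof -
    define p where "p = (\<lambda>x. \<Sum>j=1..n. bform n bs \<beta>s j \<psi> * v j x)"
    define h where "h = (\<lambda>x. \<psi> x + (-1) * p x)"
    have p: "p \<in> Cinf" unfolding p_def using v by (intro Cinf_sum) auto
    have h: "h \<in> Cinf" unfolding h_def by (intro Cinf_add_mult p \<psi>)
    have "bform n bs \<beta>s i h = 0" if i: "i \<in> {1..n}" for i
    proof -
      have "bform n bs \<beta>s i p = (\<Sum>j=1..n. bform n bs \<beta>s j \<psi> * bform n bs \<beta>s i (v j))"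
        unfolding p_def using v by (intro bform_sum) auto
      also have "\<dots> = (\<Sum>j=1..n. if i = j then bform n bs \<beta>s j \<psi> else 0)"
        using v i by (intro sum.cong) auto
      finally have "bform n bs \<beta>s i p = bform n bs \<beta>s i \<psi>" using i by simp
      then show ?thesis unfolding h_def by (subst bform_add_mult[OF \<psi> p]) simp
    qed
    then have "bracket_diff n \<phi> h = 0"
      using assms h \<phi> unfolding adjoint_forms_def bracket_diff_def by blast
    then have "bracket_diff n \<phi> \<psi> = bracket_diff n \<phi> p"
      unfolding h_def by (subst (asm) bracket_diff_add_mult_right[OF \<psi> p]) simp
    also have "\<dots> = (\<Sum>j=1..n. cnj (bform n bs \<beta>s j \<psi>) * bracket_diff n \<phi> (v j))"
      unfolding p_def using v by (intro bracket_diff_sum_right) auto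
    finally show ?thesis .
  qed
  then show ?thesis by blast
qed

section \<open>Remainders\<close>

text \<open>All n integrations by parts at once: the derivative of the boundary sum telescopes, and
  its two end terms form the integrand.\<close>

lemma has_integral_exp_D:
  assumes "\<phi> \<in> Cinf"
  shows "((\<lambda>x. D n \<phi> x * exp (\<mu> * of_real x) - (-1) ^ n * \<mu> ^ n * \<phi> x * exp (\<mu> * of_real x)) has_integral
     (\<Sum>j<n. (-1) ^ j * D (n - 1 - j) \<phi> 1 * (\<mu> ^ j * exp \<mu>)) -
     (\<Sum>j<n. (-1) ^ j * D (n - 1 - j) \<phi> 0 * \<mu> ^ j)) {0..1}"
proof -
  define F where "F x = (\<Sum>j<n. (-1) ^ j * D (n - 1 - j) \<phi> x * (\<mu> ^ j * exp (\<mu> * of_real x)))" for x :: real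
  define t where "t x j = (-1) ^ j * D (n - j) \<phi> x * (\<mu> ^ j * exp (\<mu> * of_real x))" for x :: real and j
  have e: "((\<lambda>x. \<mu> ^ j * exp (\<mu> * of_real x)) has_vector_derivative
      \<mu> ^ Suc j * exp (\<mu> * of_real x)) (at x within {0..1})" for j x
    by (rule has_vector_derivative_real_field) (auto intro!: derivative_eq_intros)
  have "(F has_vector_derivative (\<Sum>j<n. t x j - t x (Suc j))) (at x within {0..1})" if x: "x \<in> {0..1}" for x
    unfolding F_def
  proof (rule has_vector_derivative_sum)
    fix j assume j: "j \<in> {..<n}"
    then have s: "Suc (n - Suc j) = n - j" by auto
    have "(D (n - 1 - j) \<phi> has_vector_derivative D (n - j) \<phi> x) (at x within {0..1})"
      using D_has_vector_derivative[OF assms x, of "n - 1 - j"] s by simp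
    then have "((\<lambda>x. (-1) ^ j * D (n - 1 - j) \<phi> x) has_vector_derivative (-1) ^ j * D (n - j) \<phi> x) (at x within {0..1})"
      by (rule has_vector_derivative_mult_right)
    from has_vector_derivative_mult[OF this e[of j x]]
    show "((\<lambda>x. (- 1) ^ j * D (n - 1 - j) \<phi> x * (\<mu> ^ j * exp (\<mu> * complex_of_real x))) has_vector_derivative
         t x j - t x (Suc j)) (at x within {0..1})"
      by (simp add: t_def s algebra_simps)
  qed
  moreover have "(\<Sum>j<n. t x j - t x (Suc j)) =
      D n \<phi> x * exp (\<mu> * of_real x) - (-1) ^ n * \<mu> ^ n * \<phi> x * exp (\<mu> * of_real x)" for x
    by (subst sum_lessThan_telescope') (simp add: t_def D_0)
  ultimately have "((\<lambda>x. D n \<phi> x * exp (\<mu> * of_real x) - (-1) ^ n * \<mu> ^ n * \<phi> x * exp (\<mu> * of_real x))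
      has_integral F 1 - F 0) {0..1}"
    by (intro fundamental_theorem_of_calculus) auto
  then show ?thesis by (simp add: F_def)
qed

text \<open>The bracket conjugates its second argument, so the conjugate exponential is inserted
  there. Only \<open>\<mu> ^ n\<close> matters: by
  \<open>((- \<i>) * (-1) * (- \<i>)) ^ n = 1\<close> every admissible \<open>\<mu>\<close> yields
  the same factor \<open>z ^ n\<close>.\<close>

lemma integral_exp_Sop:
  assumes "\<phi> \<in> Cinf" and \<mu>: "\<mu> ^ n = (- \<i>) ^ n * z ^ n"
  shows "integral {0..1} (\<lambda>x. exp (\<mu> * of_real x) * Sop n \<phi> x) =
     z ^ n * integral {0..1} (\<lambda>x. exp (\<mu> * of_real x) * \<phi> x) +
     bracket_diff n \<phi> (\<lambda>x. cnj (exp (\<mu> * of_real x)))"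
proof -
  let ?B = "(\<Sum>j<n. (-1) ^ j * D (n - 1 - j) \<phi> 1 * (\<mu> ^ j * exp \<mu>)) -
     (\<Sum>j<n. (-1) ^ j * D (n - 1 - j) \<phi> 0 * \<mu> ^ j)"
  have B: "bracket_diff n \<phi> (\<lambda>x. cnj (exp (\<mu> * of_real x))) = (- \<i>) ^ n * ?B"
    unfolding bracket_diff_def bracket_def
    by (simp add: Cinf_exp(2) right_diff_distrib del: exp_cnj)
  have c: "continuous_on {0..1} (\<lambda>x. exp (\<mu> * of_real x) * \<phi> x)"
    using continuous_on_D[OF assms(1), of 0] by (intro continuous_intros) (simp add: D_0)
  have one: "(- \<i>) ^ n * (-1) ^ n * \<mu> ^ n = z ^ n"
  proof -
    have "(- \<i>) ^ n * (-1) ^ n * \<mu> ^ n = ((- \<i>) * (-1) * (- \<i>)) ^ n * z ^ n"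
      by (simp only: \<mu> power_mult_distrib mult_ac)
    then show ?thesis by simp
  qed
  have "((\<lambda>x. (- \<i>) ^ n * (D n \<phi> x * exp (\<mu> * of_real x) - (-1) ^ n * \<mu> ^ n * \<phi> x * exp (\<mu> * of_real x)) +
      z ^ n * (exp (\<mu> * of_real x) * \<phi> x)) has_integral
      (- \<i>) ^ n * ?B + z ^ n * integral {0..1} (\<lambda>x. exp (\<mu> * of_real x) * \<phi> x)) {0..1}"
    by (intro has_integral_add has_integral_mult_right has_integral_exp_D assms
        integrable_integral integrable_continuous_real c)
  also have "(\<lambda>x. (- \<i>) ^ n * (D n \<phi> x * exp (\<mu> * of_real x) - (-1) ^ n * \<mu> ^ n * \<phi> x * exp (\<mu> * of_real x)) +
      z ^ n * (exp (\<mu> * of_real x) * \<phi> x)) = (\<lambda>x. exp (\<mu> * of_real x) * Sop n \<phi> x)"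
    by (simp add: one[symmetric] Sop_def algebra_simps)
  finally show ?thesis
    using B by (simp add: integral_unique add.commute)
qed

lemma alpha_power_n: "0 < n \<Longrightarrow> alpha n ^ n = 1"
  unfolding alpha_def by (subst exp_of_nat_mult[symmetric]) (simp add: field_simps)

text \<open>Row l of M consists of the adjoint boundary values of the l-th exponential. The two
  conjugations cancel because the coefficients of the forms are real.\<close>

lemma Mentry_eq_bform:
  "Mentry n bs \<beta>s z l j =
     cnj (bform n bs \<beta>s j (\<lambda>x. cnj (exp (- \<i> * alpha n ^ (l - 1) * z * of_real x))))"
proof -
  define \<mu> where "\<mu> = - \<i> * alpha n ^ (l - 1) * z"
  have "D k (\<lambda>x. cnj (exp (\<mu> * of_real x))) x = cnj (\<mu> ^ k * exp (\<mu> * of_real x))" if "x \<in> {0..1}" for k x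
    using Cinf_cnj(2)[OF Cinf_exp(1) that, of k \<mu>] Cinf_exp(2)[OF that, of k \<mu>] by (simp only:)
  then show ?thesis
    unfolding bform_def Mentry_def Mpart_def \<mu>_def[symmetric]
    by (simp add: sum.distrib sum_distrib_left sum_distrib_right algebra_simps del: exp_cnj)
qed

section \<open>Cofactors and Cramer's rule\<close>

definition Mmat where
  "Mmat n bs \<beta>s z = Matrix.mat n n (\<lambda>(k, j). Mentry n bs \<beta>s z (k + 1) (j + 1))"

lemma det_Mmat: "Determinant.det (Mmat n bs \<beta>s z) = Delta n bs \<beta>s z"
  by (simp add: Mmat_def Delta_def)

text \<open>The cyclic submatrix arises from the ordinary minor by moving its last
  \<open>n - 1 - l\<close> rows in front of the first \<open>l\<close>, and likewise for the
  columns. The signs of these two block swaps join the sign of the cofactor.\<close>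

lemma detX_eq_cofactor:
  assumes "l < n" "j < n"
  shows "(- 1) ^ ((n - 1) * (Suc l + Suc j)) * detX n bs \<beta>s z (Suc l) (Suc j) = cofactor (Mmat n bs \<beta>s z) l j"
proof -
  let ?A = "mat_delete (Mmat n bs \<beta>s z) l j"
  let ?m = "n - 1" and ?p = "n - 1 - l" and ?q = "n - 1 - j"
  have A: "?A \<in> carrier_mat ?m ?m" by (rule mat_delete_carrier) (simp add: Mmat_def)
  let ?A' = "Matrix.mat ?m ?m (\<lambda>(i, k). ?A $$ (if i < ?p then i + l else if i < l + ?p then i - ?p else i, k))"
  have A': "?A' \<in> carrier_mat ?m ?m" by simp
  let ?A'' = "Matrix.mat ?m ?m (\<lambda>(i, k). ?A' $$ (i, if k < ?q then k + j else if k < j + ?q then k - ?q else k))"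
  have X: "?A'' = Matrix.mat ?m ?m (\<lambda>(r, s). Mentry n bs \<beta>s z (cyc n (Suc l + 1 + r)) (cyc n (Suc j + 1 + s)))"
  proof (rule eq_matI, goal_cases)
    case (1 r s)
    then have r: "r < ?m" and s: "s < ?m" by auto
    have cyc: "cyc n (Suc l + 1 + r) = Suc (if r < n - 1 - l then Suc (r + l) else r - (n - 1 - l))"
      if "l < n" "r < n - 1" for l r
    proof (cases "r < n - 1 - l")
      case True
      then have "Suc (r + l) < n" by simp
      then have "cyc n (Suc l + 1 + r) = Suc (Suc (r + l))" by (simp add: cyc_def add_ac)
      then show ?thesis by (simp only: if_P[OF True])
    next
      case False
      then have e: "Suc l + 1 + r - 1 = n + (r - (n - 1 - l))" using that by simp
      have "r - (n - 1 - l) < n" using that by simp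
      then have "cyc n (Suc l + 1 + r) = Suc (r - (n - 1 - l))"
        unfolding cyc_def e mod_add_self1 by (simp only: mod_less Suc_eq_plus1)
      then show ?thesis by (simp only: if_not_P[OF False])
    qed
    have e1: "?A' $$ (r, if s < ?q then s + j else if s < j + ?q then s - ?q else s) =
        ?A $$ (if r < ?p then r + l else r - ?p, if s < ?q then s + j else s - ?q)"
      using r s assms by auto
    have a: "(if r < ?p then r + l else r - ?p) < n - 1" "(if s < ?q then s + j else s - ?q) < n - 1"
      using r s assms by auto
    have b: "(if (if i < n - 1 - k then i + k else i - (n - 1 - k)) < k
        then (if i < n - 1 - k then i + k else i - (n - 1 - k))
        else Suc (if i < n - 1 - k then i + k else i - (n - 1 - k))) =
        (if i < n - 1 - k then Suc (i + k) else i - (n - 1 - k))"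
      if "i < n - 1" "k < n" for i k
      using that by auto
    have d: "?A $$ (if r < ?p then r + l else r - ?p, if s < ?q then s + j else s - ?q) =
        Mmat n bs \<beta>s z $$ (if r < ?p then Suc (r + l) else r - ?p, if s < ?q then Suc (s + j) else s - ?q)"
      unfolding mat_delete_def
      by (subst index_mat(1))
        (use a in \<open>simp_all only: Mmat_def dim_row_mat dim_col_mat old.prod.case b[OF r assms(1)] b[OF s assms(2)]\<close>)
    have e: "(if r < ?p then Suc (r + l) else r - ?p) < n" "(if s < ?q then Suc (s + j) else s - ?q) < n"
      using r s assms by auto
    have "?A'' $$ (r, s) = ?A' $$ (r, if s < ?q then s + j else if s < j + ?q then s - ?q else s)"
      by (simp only: index_mat(1)[OF r s] old.prod.case)
    also note e1
    also note d
    also have "Mmat n bs \<beta>s z $$ (if r < ?p then Suc (r + l) else r - ?p, if s < ?q then Suc (s + j) else s - ?q) =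
        Mentry n bs \<beta>s z (cyc n (Suc l + 1 + r)) (cyc n (Suc j + 1 + s))"
      unfolding Mmat_def index_mat(1)[OF e] old.prod.case cyc[OF assms(1) r] cyc[OF assms(2) s]
      by (simp only: Suc_eq_plus1)
    finally show ?case by (simp only: index_mat(1)[OF r s] old.prod.case)
  qed auto
  have "Determinant.det ?A = (-1) ^ (l * ?p) * Determinant.det ?A'"
    using assms by (intro det_swap_initial_rows[OF A]) auto
  also have "Determinant.det ?A' = (-1) ^ (j * ?q) * Determinant.det ?A''"
    using assms by (intro det_swap_initial_cols[OF A']) auto
  also have "Determinant.det ?A'' = detX n bs \<beta>s z (Suc l) (Suc j)"
    by (simp only: X detX_def)
  finally have "cofactor (Mmat n bs \<beta>s z) l j =
      (-1) ^ ((l + j) + l * ?p + j * ?q) * detX n bs \<beta>s z (Suc l) (Suc j)"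
    by (simp add: cofactor_def power_add)
  \<comment> \<open>Modulo 2, \<open>l\<close> equals \<open>l * l\<close>, so
    \<open>l + l * (n - 1 - l)\<close> has the parity of \<open>(n - 1) * l\<close>. Passing from
    \<open>l\<close>, \<open>j\<close> to \<open>Suc l\<close>, \<open>Suc j\<close> adds the even
    number \<open>2 * (n - 1)\<close>.\<close>
  moreover have "(-1 :: complex) ^ ((l + j) + l * ?p + j * ?q) = (- 1) ^ ((n - 1) * (Suc l + Suc j))"
  proof -
    have n: "n - 1 = l + ?p" "n - 1 = j + ?q" using assms by auto
    have "even ((l + j) + l * p + j * q) \<longleftrightarrow> even ((l + p) * l + (j + q) * j)" for p q
      by auto
    then have "even ((l + j) + l * ?p + j * ?q) \<longleftrightarrow> even ((l + ?p) * l + (j + ?q) * j)" .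
    also have "(l + ?p) * l + (j + ?q) * j = (n - 1) * (l + j)"
      by (simp only: n[symmetric] distrib_left)
    finally have "even ((l + j) + l * ?p + j * ?q) \<longleftrightarrow> even ((n - 1) * (l + j))" .
    moreover have "even ((n - 1) * (l + j)) \<longleftrightarrow> even ((n - 1) * (Suc l + Suc j))"
      unfolding even_mult_iff even_add even_Suc by blast
    ultimately show ?thesis by (simp only: minus_one_power_iff)
  qed
  ultimately show ?thesis by simp
qed

lemma sum_shift_1: "(\<Sum>l=1..n. g l) = (\<Sum>l<n. g (Suc l))" for g :: "nat \<Rightarrow> complex"
  using sum.atLeast1_atMost_eq by simp

text \<open>This is \<open>A * adj A = det A * 1\<close>, which serves the relation between the two
  numerators. Its companion below is \<open>adj A * A = det A * 1\<close>, which cancels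
  \<open>Delta\<close> in the remainders.\<close>

lemma detX_expansion_row:
  assumes "l \<in> {1..n}" "l' \<in> {1..n}"
  shows "(\<Sum>j=1..n. (- 1) ^ ((n - 1) * (l + j)) * detX n bs \<beta>s z l j * Mentry n bs \<beta>s z l' j) =
     (if l = l' then Delta n bs \<beta>s z else 0)"
proof -
  let ?A = "Mmat n bs \<beta>s z"
  have A: "?A \<in> carrier_mat n n" by (simp add: Mmat_def)
  obtain i i' where i: "l = Suc i" "i < n" "l' = Suc i'" "i' < n"
    using assms by (metis atLeastAtMost_iff Suc_le_D Suc_le_lessD One_nat_def)
  have "(\<Sum>j=1..n. (- 1) ^ ((n - 1) * (l + j)) * detX n bs \<beta>s z l j * Mentry n bs \<beta>s z l' j) =
      (\<Sum>j<n. ?A $$ (i', j) * cofactor ?A i j)"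
    unfolding sum_shift_1 i(1) using i by (intro sum.cong refl) (subst detX_eq_cofactor, auto simp: Mmat_def)
  also have "\<dots> = (?A * adj_mat ?A) $$ (i', i)"
    using i by (simp add: adj_mat_def scalar_prod_def Mmat_def atLeast0LessThan)
  also have "\<dots> = (if i = i' then Delta n bs \<beta>s z else 0)"
    using i by (simp add: adj_mat(2)[OF A] det_Mmat)
  finally show ?thesis using i by simp
qed

lemma detX_expansion:
  assumes "j \<in> {1..n}" "j' \<in> {1..n}"
  shows "(\<Sum>l=1..n. (- 1) ^ ((n - 1) * (l + j)) * detX n bs \<beta>s z l j * Mentry n bs \<beta>s z l j') =
     (if j = j' then Delta n bs \<beta>s z else 0)"
proof -
  let ?A = "Mmat n bs \<beta>s z"
  have A: "?A \<in> carrier_mat n n" by (simp add: Mmat_def)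
  obtain i i' where i: "j = Suc i" "i < n" "j' = Suc i'" "i' < n"
    using assms by (metis atLeastAtMost_iff Suc_le_D Suc_le_lessD One_nat_def)
  have "(\<Sum>l=1..n. (- 1) ^ ((n - 1) * (l + j)) * detX n bs \<beta>s z l j * Mentry n bs \<beta>s z l j') =
      (\<Sum>l<n. cofactor ?A l i * ?A $$ (l, i'))"
    unfolding sum_shift_1 i(1) using i by (intro sum.cong refl) (subst detX_eq_cofactor, auto simp: Mmat_def)
  also have "\<dots> = (adj_mat ?A * ?A) $$ (i, i')"
    using i by (simp add: adj_mat_def scalar_prod_def Mmat_def atLeast0LessThan)
  also have "\<dots> = (if i = i' then Delta n bs \<beta>s z else 0)"
    using i by (simp add: adj_mat(3)[OF A] det_Mmat)
  finally show ?thesis using i by simp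
qed

text \<open>Clearing the denominator in $F^\pm$ leaves an entire function of the spectral parameter. The coefficients
  \<open>c\<close> are those of the boundary forms at \<open>0\<close> for $F^+$ and at \<open>1\<close> for $F^-$.\<close>

definition numer ::
    "nat \<Rightarrow> (nat \<Rightarrow> nat \<Rightarrow> real) \<Rightarrow> (nat \<Rightarrow> nat \<Rightarrow> real) \<Rightarrow> (nat \<Rightarrow> nat \<Rightarrow> real) \<Rightarrow> complex \<Rightarrow> functional" where
  "numer n bs \<beta>s c z f =
     (\<Sum>l=1..n. \<Sum>j=1..n. (- 1) ^ ((n - 1) * (l + j)) * detX n bs \<beta>s z l j *
        Mpart n c z 1 j *
        integral {0..1} (\<lambda>x. exp (- \<i> * alpha n ^ (l - 1) * z * of_real x) * f x))"

lemma Fplus_numer: "Fplus n bs \<beta>s z f = 1 / (2 * of_real pi * Delta n bs \<beta>s z) * numer n bs \<beta>s bs z f"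
  and Fminus_numer: "Fminus n bs \<beta>s z f = - exp (- \<i> * z) / (2 * of_real pi * Delta n bs \<beta>s z) * numer n bs \<beta>s \<beta>s z f"
  by (simp_all add: Fplus_def Fminus_def numer_def)

text \<open>The boundary term of the l-th exponential is the l-th row of M applied to the fixed
  vector \<open>c\<close>. The weights in \<open>numer\<close> are cofactors, so after summation
  over l only j = j' survives, with the factor \<open>Delta\<close>. The coefficients
  \<open>d\<close> are arbitrary, so one proof serves F^+ and F^-.\<close>

lemma numer_Sop:
  assumes "0 < n" "\<phi> \<in> Cinf"
    and c: "\<And>\<psi>. \<psi> \<in> Cinf \<Longrightarrow> bracket_diff n \<phi> \<psi> = (\<Sum>j=1..n. cnj (bform n bs \<beta>s j \<psi>) * c j)"
  shows "numer n bs \<beta>s d z (Sop n \<phi>) = z ^ n * numer n bs \<beta>s d z \<phi> +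
     Delta n bs \<beta>s z * (\<Sum>j=1..n. Mpart n d z 1 j * c j)"
proof -
  let ?s = "\<lambda>l j. (- 1) ^ ((n - 1) * (l + j)) * detX n bs \<beta>s z l j"
  let ?\<mu> = "\<lambda>l. - \<i> * alpha n ^ (l - 1) * z"
  \<comment> \<open>All n exponentials share one eigenvalue because alpha is an n-th root of
    unity.\<close>
  have pow: "?\<mu> l ^ n = (- \<i>) ^ n * z ^ n" for l
  proof -
    have "(alpha n ^ (l - 1)) ^ n = 1"
      using alpha_power_n[OF assms(1)] by (metis power_mult mult.commute power_one)
    then show ?thesis by (simp only: power_mult_distrib mult_1_right)
  qed
  have int: "integral {0..1} (\<lambda>x. exp (?\<mu> l * of_real x) * Sop n \<phi> x) =
      z ^ n * integral {0..1} (\<lambda>x. exp (?\<mu> l * of_real x) * \<phi> x) +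
      (\<Sum>j'=1..n. Mentry n bs \<beta>s z l j' * c j')" for l
    unfolding integral_exp_Sop[OF assms(2) pow] Mentry_eq_bform
    by (subst c) (intro Cinf_cnj Cinf_exp, rule refl)
  have "numer n bs \<beta>s d z (Sop n \<phi>) = z ^ n * numer n bs \<beta>s d z \<phi> +
      (\<Sum>l=1..n. \<Sum>j=1..n. \<Sum>j'=1..n. ?s l j * Mpart n d z 1 j * (Mentry n bs \<beta>s z l j' * c j'))"
    unfolding numer_def int
    by (simp add: distrib_left sum.distrib sum_distrib_left mult_ac)
  also have "(\<Sum>l=1..n. \<Sum>j=1..n. \<Sum>j'=1..n. ?s l j * Mpart n d z 1 j * (Mentry n bs \<beta>s z l j' * c j')) =
      (\<Sum>j=1..n. \<Sum>j'=1..n. \<Sum>l=1..n. ?s l j * Mpart n d z 1 j * (Mentry n bs \<beta>s z l j' * c j'))"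
    by (subst sum.swap, intro sum.cong refl sum.swap)
  also have "\<dots> = (\<Sum>j=1..n. \<Sum>j'=1..n. Mpart n d z 1 j * c j' * (\<Sum>l=1..n. ?s l j * Mentry n bs \<beta>s z l j'))"
    by (simp add: sum_distrib_left mult_ac)
  also have "\<dots> = (\<Sum>j=1..n. \<Sum>j'=1..n. Mpart n d z 1 j * c j' * (if j = j' then Delta n bs \<beta>s z else 0))"
    by (intro sum.cong refl arg_cong2[where f="(*)"] detX_expansion)
  also have "\<dots> = (\<Sum>j=1..n. \<Sum>j'=1..n. if j = j' then Delta n bs \<beta>s z * (Mpart n d z 1 j * c j') else 0)"
    by (intro sum.cong refl) auto
  also have "\<dots> = Delta n bs \<beta>s z * (\<Sum>j=1..n. Mpart n d z 1 j * c j)"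
    by (simp add: sum_distrib_left)
  finally show ?thesis .
qed

section \<open>Membership in the dual spaces\<close>

lemma integral_exp_add_mult:
  assumes "\<phi> \<in> Cinf" "\<psi> \<in> Cinf"
  shows "integral {0..1} (\<lambda>x. exp (\<mu> * of_real x) * (\<phi> x + c * \<psi> x)) =
     integral {0..1} (\<lambda>x. exp (\<mu> * of_real x) * \<phi> x) + c * integral {0..1} (\<lambda>x. exp (\<mu> * of_real x) * \<psi> x)"
proof -
  have i: "(\<lambda>x. exp (\<mu> * of_real x) * f x) integrable_on {0..1}" if "f \<in> Cinf" for f
    using continuous_on_D[OF that, of 0]
    by (intro integrable_continuous_real continuous_intros) (simp add: D_0)
  have "((\<lambda>x. exp (\<mu> * of_real x) * \<phi> x + c * (exp (\<mu> * of_real x) * \<psi> x)) has_integral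
      integral {0..1} (\<lambda>x. exp (\<mu> * of_real x) * \<phi> x) + c * integral {0..1} (\<lambda>x. exp (\<mu> * of_real x) * \<psi> x)) {0..1}"
    by (intro has_integral_add has_integral_mult_right integrable_integral i assms)
  then show ?thesis by (simp add: algebra_simps integral_unique)
qed

text \<open>Additivity and homogeneity both follow from the rule for
  \<open>\<phi> + c * \<psi>\<close>, the shape in which linearity has been proved above;
  homogeneity takes the zero function for \<open>\<phi>\<close>.\<close>

lemma dualI:
  assumes add: "\<And>\<phi> \<psi> c. \<phi> \<in> V \<Longrightarrow> \<psi> \<in> V \<Longrightarrow> E (\<lambda>x. \<phi> x + c * \<psi> x) = E \<phi> + c * E \<psi>"
    and 0: "V \<noteq> {} \<Longrightarrow> (\<lambda>x. 0) \<in> V"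
    and "\<And>\<phi>. \<phi> \<in> V \<Longrightarrow> norm (E \<phi>) \<le> K * Ck_norm N \<phi>"
  shows "E \<in> dual V"
proof -
  have "E (\<lambda>x. \<phi> x + \<psi> x) = E \<phi> + E \<psi>" if "\<phi> \<in> V" "\<psi> \<in> V" for \<phi> \<psi>
    using add[OF that, of 1] by simp
  moreover have "E (\<lambda>x. c * \<phi> x) = c * E \<phi>" if "\<phi> \<in> V" for c \<phi>
  proof -
    have z: "(\<lambda>x. 0) \<in> V" using 0 that by blast
    have "E (\<lambda>x. 0) = 0" using add[OF z z, of 1] by simp
    then show ?thesis using add[OF z that, of c] by simp
  qed
  ultimately show ?thesis using assms(3) unfolding dual_def by blast
qed

text \<open>For fixed z each kernel is bounded on [0,1] by \<open>exp (norm \<mu>)\<close>, so the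
  seminorm of order 0 suffices.\<close>

lemma numer_dual: "(\<lambda>f. k * numer n bs \<beta>s c z f) \<in> dual Cinf"
proof -
  have "\<exists>K. \<forall>\<phi>\<in>Cinf. norm (integral {0..1} (\<lambda>x. exp (\<mu> * of_real x) * \<phi> x)) \<le> K * Ck_norm 0 \<phi>" for \<mu> :: complex
  proof (intro exI ballI)
    fix \<phi> assume \<phi>: "\<phi> \<in> Cinf"
    have "norm (integral {0..1} (\<lambda>x. exp (\<mu> * of_real x) * \<phi> x)) \<le> (exp (norm \<mu>) * Ck_norm 0 \<phi>) * (1 - 0)"
    proof (rule integral_bound)
      show "continuous_on {0..1} (\<lambda>x. exp (\<mu> * of_real x) * \<phi> x)"
        using continuous_on_D[OF \<phi>, of 0] by (intro continuous_intros) (simp add: D_0)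
      fix x :: real assume x: "x \<in> {0..1}"
      have "norm (exp (\<mu> * of_real x)) \<le> exp (norm (\<mu> * of_real x))" by (rule norm_exp)
      also have "\<dots> \<le> exp (norm \<mu>)" using x by (simp add: norm_mult mult_left_le)
      finally show "norm (exp (\<mu> * of_real x) * \<phi> x) \<le> exp (norm \<mu>) * Ck_norm 0 \<phi>"
        unfolding norm_mult using norm_D_le_Ck_norm[OF \<phi> x, of 0 0] Ck_norm_nonneg[OF \<phi>]
        by (intro mult_mono) (auto simp: D_0)
    qed simp
    then show "norm (integral {0..1} (\<lambda>x. exp (\<mu> * of_real x) * \<phi> x)) \<le> exp (norm \<mu>) * Ck_norm 0 \<phi>" by simp
  qed
  then obtain K where K: "\<And>\<mu> \<phi>. \<phi> \<in> Cinf \<Longrightarrow>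
      norm (integral {0..1} (\<lambda>x. exp (\<mu> * of_real x) * \<phi> x)) \<le> K (\<mu> :: complex) * Ck_norm 0 \<phi>"
    by metis
  let ?s = "\<lambda>l j. (- 1) ^ ((n - 1) * (l + j)) * detX n bs \<beta>s z l j * Mpart n c z 1 j"
  let ?\<mu> = "\<lambda>l. - \<i> * alpha n ^ (l - 1) * z"
  show ?thesis
  proof (rule dualI)
    show "k * numer n bs \<beta>s c z (\<lambda>x. \<phi> x + d * \<psi> x) = k * numer n bs \<beta>s c z \<phi> + d * (k * numer n bs \<beta>s c z \<psi>)"
      if "\<phi> \<in> Cinf" "\<psi> \<in> Cinf" for \<phi> \<psi> d
      unfolding numer_def integral_exp_add_mult[OF that]
      by (simp add: distrib_left sum.distrib sum_distrib_left mult_ac)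
    fix \<phi> assume \<phi>: "\<phi> \<in> Cinf"
    have "norm (numer n bs \<beta>s c z \<phi>) \<le> (\<Sum>l=1..n. \<Sum>j=1..n. norm (?s l j) * (K (?\<mu> l) * Ck_norm 0 \<phi>))"
      unfolding numer_def
      by (intro order_trans[OF norm_sum] sum_mono) (subst norm_mult, intro mult_left_mono K \<phi> norm_ge_zero)
    also have "\<dots> = (\<Sum>l=1..n. \<Sum>j=1..n. norm (?s l j) * K (?\<mu> l)) * Ck_norm 0 \<phi>"
      unfolding sum_distrib_right mult.assoc by (rule refl)
    finally have "norm (numer n bs \<beta>s c z \<phi>) \<le> (\<Sum>l=1..n. \<Sum>j=1..n. norm (?s l j) * K (?\<mu> l)) * Ck_norm 0 \<phi>" .
    then show "norm (k * numer n bs \<beta>s c z \<phi>) \<le> (norm k * (\<Sum>l=1..n. \<Sum>j=1..n. norm (?s l j) * K (?\<mu> l))) * Ck_norm 0 \<phi>"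
      unfolding norm_mult mult.assoc by (intro mult_left_mono) auto
  qed (rule Cinf_zero)
qed

lemma bracket_diff_dual: "(\<lambda>\<phi>. \<Sum>j=1..n. k j * bracket_diff n \<phi> (v j)) \<in> dual (Phi n b \<beta>)"
proof -
  have "\<forall>j. \<exists>K. \<forall>\<phi>\<in>Cinf. norm (bracket_diff n \<phi> (v j)) \<le> K * Ck_norm n \<phi>"
    using bracket_diff_bound by blast
  then obtain K where K: "\<And>j \<phi>. \<phi> \<in> Cinf \<Longrightarrow> norm (bracket_diff n \<phi> (v j)) \<le> K j * Ck_norm n \<phi>"
    by metis
  show ?thesis
  proof (rule dualI)
    show "(\<Sum>j=1..n. k j * bracket_diff n (\<lambda>x. \<phi> x + c * \<psi> x) (v j)) =
        (\<Sum>j=1..n. k j * bracket_diff n \<phi> (v j)) + c * (\<Sum>j=1..n. k j * bracket_diff n \<psi> (v j))"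
      if "\<phi> \<in> Phi n b \<beta>" "\<psi> \<in> Phi n b \<beta>" for \<phi> \<psi> c
      using that by (simp add: Phi_def bracket_diff_add_mult_left distrib_left sum.distrib sum_distrib_left mult_ac)
    show "(\<lambda>x. 0) \<in> Phi n b \<beta>" by (simp add: Phi_def Cinf_zero bform_zero)
    fix \<phi> assume \<phi>: "\<phi> \<in> Phi n b \<beta>"
    have "norm (\<Sum>j=1..n. k j * bracket_diff n \<phi> (v j)) \<le> (\<Sum>j=1..n. norm (k j) * (K j * Ck_norm n \<phi>))"
      using \<phi> by (intro order_trans[OF norm_sum] sum_mono) (subst norm_mult, intro mult_left_mono K norm_ge_zero, simp add: Phi_def)
    then show "norm (\<Sum>j=1..n. k j * bracket_diff n \<phi> (v j)) \<le> (\<Sum>j=1..n. norm (k j) * K j) * Ck_norm n \<phi>"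
      unfolding sum_distrib_right mult.assoc .
  qed
qed

section \<open>Completeness\<close>

text \<open>By Leibniz's formula the determinant is a finite sum of products of entries. This covers
  \<open>Delta\<close> and the cyclic minors alike.\<close>

lemma holomorphic_on_det:
  assumes "\<And>i j. i < m \<Longrightarrow> j < m \<Longrightarrow> (\<lambda>z. f z (i, j)) holomorphic_on S"
  shows "(\<lambda>z. Determinant.det (Matrix.mat m m (f z))) holomorphic_on S"
proof -
  have eq: "Determinant.det (Matrix.mat m m (f z)) =
      (\<Sum>p | p permutes {0..<m}. signof p * (\<Prod>i = 0..<m. f z (i, p i)))" for z
    unfolding det_def'[OF mat_carrier]
  proof (intro sum.cong refl arg_cong2[where f = "(*)"] prod.cong, goal_cases)
    case (1 p i)
    then have "p i < m" using permutes_in_image[of p "{0..<m}" i] by auto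
    then show ?case using 1 by simp
  qed
  show ?thesis
    unfolding eq
  proof (intro holomorphic_intros assms, goal_cases)
    case (2 p i)
    then show ?case using permutes_in_image[of p "{0..<m}" i] by auto
  qed auto
qed

lemma holomorphic_integral_exp:
  fixes \<phi> :: "real \<Rightarrow> complex"
  assumes "continuous_on {0..1} \<phi>"
  shows "(\<lambda>z. integral {0..1} (\<lambda>x. exp (\<mu> * z * of_real x) * \<phi> x)) holomorphic_on UNIV"
proof -
  have "(\<lambda>z. integral (cbox 0 1) (\<lambda>x. exp (\<mu> * z * of_real x) * \<phi> x)) holomorphic_on UNIV"
  proof (rule leibniz_rule_holomorphic)
    show "((\<lambda>z. exp (\<mu> * z * of_real t) * \<phi> t) has_field_derivative
        \<mu> * of_real t * exp (\<mu> * z * of_real t) * \<phi> t) (at z within UNIV)" for z t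
      by (auto intro!: derivative_eq_intros)
    show "(\<lambda>x. exp (\<mu> * z * of_real x) * \<phi> x) integrable_on cbox 0 1" for z
      using assms by (intro integrable_continuous continuous_intros) auto
    have "continuous_on ((UNIV :: complex set) \<times> {0..1}) (\<lambda>p. \<phi> (snd p))"
      by (intro continuous_on_compose2[OF assms] continuous_intros) auto
    then show "continuous_on (UNIV \<times> cbox 0 1) (\<lambda>(z, t). \<mu> * of_real t * exp (\<mu> * z * of_real t) * \<phi> t)"
      unfolding split_beta' by (intro continuous_intros) auto
  qed auto
  then show ?thesis by simp
qed

lemma holomorphic_Mentry: "(\<lambda>z. Mentry n bs \<beta>s z k j) holomorphic_on S"
  unfolding Mentry_def Mpart_def by (intro holomorphic_intros)

lemma holomorphic_Delta: "(\<lambda>z. Delta n bs \<beta>s z) holomorphic_on S"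
  unfolding Delta_def by (intro holomorphic_on_det) (simp add: holomorphic_Mentry)

lemma holomorphic_numer:
  assumes "\<phi> \<in> Cinf"
  shows "(\<lambda>z. numer n bs \<beta>s c z \<phi>) holomorphic_on UNIV"
proof -
  have "continuous_on {0..1} \<phi>" using continuous_on_D[OF assms, of 0] by (simp add: D_0)
  from holomorphic_integral_exp[OF this]
  have i: "(\<lambda>z. integral {0..1} (\<lambda>x. exp (\<mu> * z * of_real x) * \<phi> x)) holomorphic_on UNIV" for \<mu> .
  have d: "(\<lambda>z. detX n bs \<beta>s z l j) holomorphic_on UNIV" for l j
    unfolding detX_def by (intro holomorphic_on_det) (simp add: holomorphic_Mentry)
  have m: "(\<lambda>z. Mpart n c z 1 j) holomorphic_on UNIV" for j
    unfolding Mpart_def by (intro holomorphic_intros)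
  show ?thesis
    unfolding numer_def by (intro holomorphic_intros d m i)
qed

text \<open>The weights \<open>Mpart n bs z 1 j\<close> and
  \<open>exp (- \<i> * z) * Mpart n \<beta>s z 1 j\<close> add up to the first row of M. Expansion
  along that row keeps only l = 1, whose integral is the Fourier transform.\<close>

lemma numer_relation:
  assumes "1 \<le> n"
  shows "numer n bs \<beta>s bs z \<phi> + exp (- \<i> * z) * numer n bs \<beta>s \<beta>s z \<phi> =
     Delta n bs \<beta>s z * integral {0..1} (\<lambda>x. exp (- \<i> * z * of_real x) * \<phi> x)"
proof -
  let ?s = "\<lambda>l j. (- 1) ^ ((n - 1) * (l + j)) * detX n bs \<beta>s z l j"
  let ?I = "\<lambda>l. integral {0..1} (\<lambda>x. exp (- \<i> * alpha n ^ (l - 1) * z * of_real x) * \<phi> x)"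
  have M: "Mentry n bs \<beta>s z 1 j = Mpart n bs z 1 j + exp (- \<i> * z) * Mpart n \<beta>s z 1 j" for j
    by (simp add: Mentry_def)
  have "numer n bs \<beta>s bs z \<phi> + exp (- \<i> * z) * numer n bs \<beta>s \<beta>s z \<phi> =
      (\<Sum>l=1..n. ?I l * (\<Sum>j=1..n. ?s l j * Mentry n bs \<beta>s z 1 j))"
    unfolding M numer_def by (simp add: sum_distrib_left sum_distrib_right sum.distrib distrib_left mult_ac)
  also have "\<dots> = (\<Sum>l=1..n. ?I l * (if l = 1 then Delta n bs \<beta>s z else 0))"
    using assms by (intro sum.cong refl arg_cong2[where f = "(*)"] detX_expansion_row) auto
  also have "\<dots> = (\<Sum>l=1..n. if l = 1 then Delta n bs \<beta>s z * ?I l else 0)"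
    by (intro sum.cong refl) auto
  also have "\<dots> = Delta n bs \<beta>s z * ?I 1"
    using assms by simp
  finally show ?thesis by simp
qed

section \<open>Identity theorem and moment problems\<close>

lemma entire_eq_zero:
  assumes "f holomorphic_on UNIV" "z0 islimpt U" "\<And>z. z \<in> U \<Longrightarrow> f z = 0"
  shows "f w = (0 :: complex)"
  using analytic_continuation[OF assms(1) open_UNIV connected_UNIV _ _ assms(2,3), of w] by simp

text \<open>A connected set with more than one point has no isolated points; the antipode of z is
  the second point.\<close>

lemma sphere_islimpt:
  fixes \<sigma> :: complex
  assumes "0 < r" "open U" "z \<in> sphere \<sigma> r" "z \<in> U"
  shows "z islimpt (sphere \<sigma> r \<inter> U)"
proof -
  have "\<sigma> - (z - \<sigma>) \<in> sphere \<sigma> r"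
    using assms(3) by (simp add: dist_norm norm_minus_commute)
  moreover have "\<sigma> - (z - \<sigma>) \<noteq> z"
  proof
    assume "\<sigma> - (z - \<sigma>) = z"
    then have "2 * (z - \<sigma>) = 0" by (simp add: algebra_simps)
    then show False using assms(1,3) by simp
  qed
  ultimately have "sphere \<sigma> r \<noteq> {x}" for x
    using assms(3) by (metis singletonD)
  then have "z islimpt sphere \<sigma> r"
    using assms(3) by (intro connected_imp_perfect connected_sphere) (simp_all only: DIM_complex order.refl not_False_eq_True)
  then show ?thesis
    using assms(2,4) unfolding islimpt_def by (metis IntI Int_iff open_Int)
qed

text \<open>The polynomials in \<open>g\<close> separate points because \<open>g\<close> is
  injective, so by Stone-Weierstrass they approximate \<open>w\<close> uniformly. Replacing one
  factor of \<open>w * w\<close> by an approximation changes the integral by at most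
  \<open>e\<close> times the integral of \<open>\<bar>w x\<bar>\<close>, and the replaced integral
  is 0.\<close>

lemma zero_if_orthogonal_to_powers_real:
  fixes w g :: "real \<Rightarrow> real"
  assumes w: "continuous_on {0..1} w" and g: "continuous_on {0..1} g" "inj_on g {0..1}"
    and int: "\<And>k. integral {0..1} (\<lambda>x. g x ^ k * w x) = 0"
    and x: "x \<in> {0..1}"
  shows "w x = 0"
proof -
  define P where "P f \<longleftrightarrow> (\<exists>p. f = (\<lambda>x. poly p (g x)))" for f :: "real \<Rightarrow> real"
  have cont: "continuous_on {0..1} (\<lambda>x. poly p (g x))" for p
    by (intro continuous_intros g)
  have Pint: "integral {0..1} (\<lambda>x. poly p (g x) * w x) = 0" for p
  proof -
    have "((\<lambda>x. \<Sum>i\<le>degree p. coeff p i * (g x ^ i * w x)) has_integral (\<Sum>i\<le>degree p. coeff p i * 0)) {0..1}"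
    proof (intro has_integral_sum has_integral_mult_right)
      fix i
      have "(\<lambda>x. g x ^ i * w x) integrable_on {0..1}"
        by (intro integrable_continuous_real continuous_intros g w)
      then show "((\<lambda>x. g x ^ i * w x) has_integral 0) {0..1}"
        using int[of i] by (metis has_integral_integral)
    qed auto
    then show ?thesis
      by (simp add: poly_altdef sum_distrib_right mult.assoc integral_unique)
  qed
  have small: "integral {0..1} (\<lambda>x. w x * w x) \<le> e * integral {0..1} (\<lambda>x. \<bar>w x\<bar>)" if "0 < e" for e
  proof -
    have "\<exists>f. P f \<and> (\<forall>x\<in>{0..1}. \<bar>w x - f x\<bar> < e)"
    proof (rule Stone_Weierstrass_HOL)
      show "compact {0..1::real}" by simp
      show "P (\<lambda>x. c)" for c
        unfolding P_def by (intro exI[of _ "[:c:]"]) simp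
      show "continuous_on {0..1} f" if "P f" for f
        using that cont unfolding P_def by auto
      show "P (\<lambda>x. f x + h x)" if "P f \<and> P h" for f h
      proof -
        obtain p q where "f = (\<lambda>x. poly p (g x))" "h = (\<lambda>x. poly q (g x))"
          using \<open>P f \<and> P h\<close> unfolding P_def by blast
        then show ?thesis unfolding P_def by (intro exI[of _ "p + q"]) auto
      qed
      show "P (\<lambda>x. f x * h x)" if "P f \<and> P h" for f h
      proof -
        obtain p q where "f = (\<lambda>x. poly p (g x))" "h = (\<lambda>x. poly q (g x))"
          using \<open>P f \<and> P h\<close> unfolding P_def by blast
        then show ?thesis unfolding P_def by (intro exI[of _ "p * q"]) auto
      qed
      show "\<exists>f. P f \<and> f x \<noteq> f y" if "x \<in> {0..1} \<and> y \<in> {0..1} \<and> x \<noteq> y" for x y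
        unfolding P_def using that g(2)
        by (intro exI[of _ g] conjI exI[of _ "[:0, 1:]"]) (auto dest: inj_onD)
    qed (use w that in auto)
    then obtain p where p: "\<And>x. x \<in> {0..1} \<Longrightarrow> \<bar>w x - poly p (g x)\<bar> < e"
      unfolding P_def by blast
    have "integral {0..1} (\<lambda>x. w x * w x) = integral {0..1} (\<lambda>x. w x * w x - poly p (g x) * w x)"
      by (subst Henstock_Kurzweil_Integration.integral_diff)
        (auto simp: Pint intro!: integrable_continuous_real continuous_intros w cont)
    also have "\<dots> \<le> integral {0..1} (\<lambda>x. e * \<bar>w x\<bar>)"
    proof (rule integral_le)
      fix x :: real assume "x \<in> {0..1}"
      have "w x * w x - poly p (g x) * w x \<le> \<bar>w x - poly p (g x)\<bar> * \<bar>w x\<bar>"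
        by (simp add: abs_mult[symmetric] left_diff_distrib[symmetric])
      also have "\<dots> \<le> e * \<bar>w x\<bar>"
        using p[OF \<open>x \<in> {0..1}\<close>] by (intro mult_right_mono) auto
      finally show "w x * w x - poly p (g x) * w x \<le> e * \<bar>w x\<bar>" .
    qed (auto intro!: integrable_continuous_real continuous_intros w cont)
    finally show ?thesis by simp
  qed
  have "integral {0..1} (\<lambda>x. w x * w x) \<le> 0"
  proof (rule ccontr)
    define A where "A = integral {0..1} (\<lambda>x. w x * w x)"
    define B where "B = integral {0..1} (\<lambda>x. \<bar>w x\<bar>)"
    assume "\<not> integral {0..1} (\<lambda>x. w x * w x) \<le> 0"
    then have "0 < A" by (simp add: A_def)
    have "0 \<le> B"
      unfolding B_def by (intro integral_nonneg integrable_continuous_real continuous_intros w) auto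
    \<comment> \<open>The tolerance is chosen so that A \<le> A / 2 follows; the summand 1 covers B
      = 0.\<close>
    have "A \<le> A / (2 * (B + 1)) * B"
      using small[of "A / (2 * (B + 1))"] \<open>0 < A\<close> \<open>0 \<le> B\<close> unfolding A_def[symmetric] B_def[symmetric] by simp
    also have "\<dots> \<le> A / 2" using \<open>0 < A\<close> \<open>0 \<le> B\<close> by (simp add: divide_simps)
    finally show False using \<open>0 < A\<close> by simp
  qed
  moreover have "0 \<le> integral {0..1} (\<lambda>x. w x * w x)"
    by (intro integral_nonneg integrable_continuous_real continuous_intros w) auto
  ultimately have "integral {0..1} (\<lambda>x. w x * w x) = 0" by simp
  then have "\<forall>x\<in>{0..1}. w x * w x = 0"
    by (subst (asm) integral_eq_0_iff) (auto intro!: continuous_intros w)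
  then show ?thesis using x by auto
qed

text \<open>Since \<open>g\<close> is real, the hypothesis splits into real and imaginary
  parts.\<close>

lemma zero_if_orthogonal_to_powers:
  fixes w :: "real \<Rightarrow> complex" and g :: "real \<Rightarrow> real"
  assumes w: "continuous_on {0..1} w" and g: "continuous_on {0..1} g" "inj_on g {0..1}"
    and int: "\<And>k. integral {0..1} (\<lambda>x. of_real (g x) ^ k * w x) = 0"
    and x: "x \<in> {0..1}"
  shows "w x = 0"
proof -
  have i: "((\<lambda>x. of_real (g x) ^ k * w x) has_integral 0) {0..1}" for k
  proof -
    have "(\<lambda>x. of_real (g x) ^ k * w x) integrable_on {0..1}"
      by (intro integrable_continuous_real continuous_intros g w)
    then show ?thesis using int[of k] by (metis has_integral_integral)
  qed
  have "Re (w x) = 0"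
  proof (rule zero_if_orthogonal_to_powers_real[of "\<lambda>x. Re (w x)", OF _ g])
    show "integral {0..1} (\<lambda>x. g x ^ k * Re (w x)) = 0" for k
      using has_integral_Re[OF i[of k]] by (simp add: of_real_power[symmetric] del: of_real_power) (rule integral_unique)
  qed (use x w in \<open>auto intro!: continuous_intros\<close>)
  moreover have "Im (w x) = 0"
  proof (rule zero_if_orthogonal_to_powers_real[of "\<lambda>x. Im (w x)", OF _ g])
    show "integral {0..1} (\<lambda>x. g x ^ k * Im (w x)) = 0" for k
      using has_integral_Im[OF i[of k]] by (simp add: of_real_power[symmetric] del: of_real_power) (rule integral_unique)
  qed (use x w in \<open>auto intro!: continuous_intros\<close>)
  ultimately show ?thesis by (simp add: complex_eq_iff)
qed

text \<open>At \<open>z = \<i> * k\<close> the kernel is the k-th power of the real injective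
  function \<open>exp\<close>, so these values of the transform are already the moments
  needed.\<close>

lemma exp_transform_eq_zero:
  fixes \<phi> :: "real \<Rightarrow> complex"
  assumes "continuous_on {0..1} \<phi>"
    and "\<And>z. integral {0..1} (\<lambda>x. exp (- \<i> * z * of_real x) * \<phi> x) = 0" and "x \<in> {0..1}"
  shows "\<phi> x = 0"
proof (rule zero_if_orthogonal_to_powers[OF assms(1), of exp])
  fix k :: nat
  have "- \<i> * (\<i> * of_nat k) * of_real y = of_nat k * complex_of_real y" for y
    by (simp add: algebra_simps)
  then show "integral {0..1} (\<lambda>x. of_real (exp x) ^ k * \<phi> x) = 0"
    using assms(2)[of "\<i> * of_nat k"] by (simp add: exp_of_nat_mult exp_of_real)
qed (use assms in \<open>auto intro!: continuous_intros inj_onI\<close>)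

text \<open>\<open>Delta\<close> times the transform vanishes everywhere. \<open>Delta\<close> is
  nonzero on a nonempty open set, so the transform vanishes there, and by the identity theorem in
  the whole plane.\<close>

lemma zero_if_both_numer_zero:
  assumes "1 \<le> n" "\<phi> \<in> Cinf" "\<exists>z. Delta n bs \<beta>s z \<noteq> 0"
    and "\<And>z. numer n bs \<beta>s bs z \<phi> = 0" "\<And>z. numer n bs \<beta>s \<beta>s z \<phi> = 0"
    and "x \<in> {0..1}"
  shows "\<phi> x = 0"
proof -
  have c: "continuous_on {0..1} \<phi>" using continuous_on_D[OF assms(2), of 0] by (simp add: D_0)
  let ?F = "\<lambda>z. integral {0..1} (\<lambda>x. exp (- \<i> * z * of_real x) * \<phi> x)"
  have prod: "Delta n bs \<beta>s z * ?F z = 0" for z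
    using numer_relation[OF assms(1), of bs \<beta>s z \<phi>] assms(4,5) by simp
  obtain z0 where z0: "Delta n bs \<beta>s z0 \<noteq> 0" using assms(3) by blast
  have "open ((\<lambda>z. Delta n bs \<beta>s z) -` (- {0}))"
    by (intro open_vimage holomorphic_on_imp_continuous_on holomorphic_Delta) auto
  then have "z0 islimpt ((\<lambda>z. Delta n bs \<beta>s z) -` (- {0}))"
    using z0 by (intro interior_limit_point) (auto simp: interior_open)
  moreover have "?F z = 0" if "z \<in> (\<lambda>z. Delta n bs \<beta>s z) -` (- {0})" for z
    using prod[of z] that by auto
  ultimately have "?F w = 0" for w
    using entire_eq_zero[OF holomorphic_integral_exp[OF c, of "- \<i>"]] by blast
  then show ?thesis by (rule exp_transform_eq_zero[OF c _ assms(6)])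
qed

section \<open>Rotations by roots of unity and the zeros of \<open>Delta\<close>\<close>

lemma sum_alpha_powers:
  assumes "2 \<le> n"
  shows "(\<Sum>k<n. alpha n ^ k) = 0"
proof -
  have "alpha n \<noteq> 1"
  proof
    assume "alpha n = 1"
    then have "exp (2 * of_real pi * \<i> * of_nat 1 / of_nat n) = (1 :: complex)" by (simp add: alpha_def)
    then show False using complex_root_unity_eq_1[of n 1] assms by simp
  qed
  then show ?thesis using assms by (simp add: geometric_sum alpha_power_n)
qed

text \<open>The n rotations of z add up to 0, so their imaginary parts cannot all be
  positive.\<close>

lemma ex_rotation_Im_le:
  assumes "2 \<le> n"
  shows "\<exists>k. Im (alpha n ^ k * z) \<le> 0"
proof (rule ccontr)
  assume "\<nexists>k. Im (alpha n ^ k * z) \<le> 0"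
  then have "0 < (\<Sum>k<n. Im (alpha n ^ k * z))"
    using assms by (intro sum_pos) (auto simp: not_le lessThan_empty_iff)
  also have "\<dots> = Im ((\<Sum>k<n. alpha n ^ k) * z)" by (simp add: sum_distrib_right del: times_complex.sel)
  finally show False by (simp add: sum_alpha_powers[OF assms])
qed

text \<open>If no rotation goes below the real axis, all imaginary parts are 0, in particular those
  of z and \<open>alpha n * z\<close>. Then alpha would be real, which fails from n = 3 on. For n =
  2 a real z is a genuine exception.\<close>

lemma ex_rotation_Im_less:
  assumes "3 \<le> n" "z \<noteq> 0"
  shows "\<exists>k. Im (alpha n ^ k * z) < 0"
proof (rule ccontr)
  assume "\<nexists>k. Im (alpha n ^ k * z) < 0"
  then have nn: "0 \<le> Im (alpha n ^ k * z)" for k by (simp add: not_less)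
  have "(\<Sum>k<n. Im (alpha n ^ k * z)) = Im ((\<Sum>k<n. alpha n ^ k) * z)"
    by (simp add: sum_distrib_right del: times_complex.sel)
  also have "\<dots> = 0" using assms by (simp add: sum_alpha_powers)
  finally have "Im (alpha n ^ k * z) = 0" if "k < n" for k
    using nn that by (simp add: sum_nonneg_eq_0_iff)
  from this[of 0] this[of 1] assms have 0: "Im z = 0" "Im (alpha n * z) = 0" by auto
  then have "Im (alpha n) = 0" using assms(2) by (auto simp: complex_eq_iff)
  moreover have "alpha n = cis (2 * pi / n)" by (simp add: alpha_def cis_conv_exp mult_ac)
  moreover have "0 < sin (2 * pi / n)" using assms by (intro sin_gt_zero) (auto simp: field_simps)
  ultimately show False by simp
qed

lemma Mentry_rotate:
  assumes "2 \<le> n" "k \<in> {1..n}"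
  shows "Mentry n bs \<beta>s (alpha n * z) k j = Mentry n bs \<beta>s z (if k = n then 1 else k + 1) j"
proof -
  have "alpha n ^ (k - 1) * (alpha n * z) = alpha n ^ ((if k = n then 1 else k + 1) - 1) * z"
  proof (cases "k = n")
    case True
    then have "alpha n ^ (k - 1) * alpha n = 1"
      using assms alpha_power_n[of n] power_minus_mult[of n "alpha n"] by simp
    then show ?thesis using True by (simp add: mult.assoc[symmetric])
  next
    case False
    have "alpha n ^ (k - 1) * alpha n = alpha n ^ k" using assms by (cases k) auto
    then show ?thesis using False by (simp add: mult.assoc[symmetric])
  qed
  then have "- \<i> * alpha n ^ (k - 1) * (alpha n * z) = - \<i> * alpha n ^ ((if k = n then 1 else k + 1) - 1) * z"
    by (simp only: mult.assoc)
  then show ?thesis unfolding Mentry_def Mpart_def by (simp only:)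
qed

text \<open>Singularity is expressed by a kernel vector, a condition on the rows that does not see
  their order. Rotation of the argument only permutes the rows, so no sign of a permutation has to
  be followed.\<close>

lemma Delta_eq_0_iff:
  "Delta n bs \<beta>s z = 0 \<longleftrightarrow> (\<exists>v\<in>carrier_vec n. v \<noteq> 0\<^sub>v n \<and> (\<forall>k\<in>{1..n}. (\<Sum>j<n. Mentry n bs \<beta>s z k (j + 1) * vec_index v j) = 0))"
proof -
  have A: "Mmat n bs \<beta>s z \<in> carrier_mat n n" by (simp add: Mmat_def)
  have "Mmat n bs \<beta>s z *\<^sub>v v = 0\<^sub>v n \<longleftrightarrow> (\<forall>k\<in>{1..n}. (\<Sum>j<n. Mentry n bs \<beta>s z k (j + 1) * vec_index v j) = 0)"
    if "v \<in> carrier_vec n" for v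
  proof -
    have "Mmat n bs \<beta>s z *\<^sub>v v = 0\<^sub>v n \<longleftrightarrow> (\<forall>k<n. (\<Sum>j<n. Mentry n bs \<beta>s z (Suc k) (j + 1) * vec_index v j) = 0)"
      using that by (auto simp: vec_eq_iff Mmat_def scalar_prod_def atLeast0LessThan)
    also have "\<dots> \<longleftrightarrow> (\<forall>k\<in>{1..n}. (\<Sum>j<n. Mentry n bs \<beta>s z k (j + 1) * vec_index v j) = 0)"
      unfolding image_Suc_lessThan[symmetric] by auto
    finally show ?thesis .
  qed
  then show ?thesis
    unfolding det_Mmat[symmetric] det_0_iff_vec_prod_zero_field[OF A] by blast
qed

lemma Delta_rotate:
  assumes "2 \<le> n" "Delta n bs \<beta>s z = 0"
  shows "Delta n bs \<beta>s (alpha n ^ k * z) = 0"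
proof (induction k)
  case 0
  then show ?case using assms by simp
next
  case (Suc k)
  then obtain v where v: "v \<in> carrier_vec n" "v \<noteq> 0\<^sub>v n"
    "\<And>i. i \<in> {1..n} \<Longrightarrow> (\<Sum>j<n. Mentry n bs \<beta>s (alpha n ^ k * z) i (j + 1) * vec_index v j) = 0"
    unfolding Delta_eq_0_iff by blast
  have "(\<Sum>j<n. Mentry n bs \<beta>s (alpha n * (alpha n ^ k * z)) i (j + 1) * vec_index v j) = 0" if "i \<in> {1..n}" for i
    unfolding Mentry_rotate[OF assms(1) that] using that assms(1) by (intro v(3)) auto
  then show ?case unfolding power_Suc mult.assoc Delta_eq_0_iff using v by blast
qed

text \<open>At 0 all n exponentials are constant 1, so the rows of M coincide.\<close>

lemma Delta_0:
  assumes "2 \<le> n"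
  shows "Delta n bs \<beta>s 0 = 0"
proof -
  have A: "Mmat n bs \<beta>s 0 \<in> carrier_mat n n" by (simp add: Mmat_def)
  have "Determinant.det (Mmat n bs \<beta>s 0) = 0"
    using assms by (intro det_identical_rows[OF A, of 0 1]) (auto simp: Mmat_def Mentry_def Mpart_def)
  then show ?thesis by (simp add: det_Mmat)
qed

lemma separation_dist:
  assumes "separation n bs \<beta>s \<epsilon>" "Delta n bs \<beta>s \<sigma> = 0" "Delta n bs \<beta>s \<tau> = 0" "\<sigma> \<noteq> \<tau>"
  shows "5 * \<epsilon> \<le> dist \<sigma> \<tau>"
proof -
  have "several_zeros n bs \<beta>s" using assms unfolding several_zeros_def by blast
  then have "5 * \<epsilon> = Inf {dist \<sigma> \<tau> | \<sigma> \<tau>. Delta n bs \<beta>s \<sigma> = 0 \<and> Delta n bs \<beta>s \<tau> = 0 \<and> \<sigma> \<noteq> \<tau>}"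
    using assms(1) unfolding separation_def by blast
  also have "\<dots> \<le> dist \<sigma> \<tau>"
    using assms by (intro cInf_lower bdd_belowI[of _ 0]) auto
  finally show ?thesis .
qed

lemma Delta_sphere_ne_0:
  assumes "separation n bs \<beta>s \<epsilon>" "Delta n bs \<beta>s \<sigma> = 0" "z \<in> sphere \<sigma> r" "0 < r" "r < 5 * \<epsilon>"
  shows "Delta n bs \<beta>s z \<noteq> 0"
  using separation_dist[OF assms(1,2), of z] assms by (auto simp: dist_commute)

lemma numer_zero_if_Fplus_zero:
  assumes "\<phi> \<in> Cinf" "z0 islimpt U"
    and "\<And>z. z \<in> U \<Longrightarrow> Delta n bs \<beta>s z \<noteq> 0 \<and> Fplus n bs \<beta>s z \<phi> = 0"
  shows "numer n bs \<beta>s bs w \<phi> = 0"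
proof (rule entire_eq_zero[OF holomorphic_numer[OF assms(1)] assms(2)])
  fix z assume "z \<in> U"
  from assms(3)[OF this] show "numer n bs \<beta>s bs z \<phi> = 0" by (auto simp: Fplus_numer)
qed

lemma numer_zero_if_Fminus_zero:
  assumes "\<phi> \<in> Cinf" "z0 islimpt U"
    and "\<And>z. z \<in> U \<Longrightarrow> Delta n bs \<beta>s z \<noteq> 0 \<and> Fminus n bs \<beta>s z \<phi> = 0"
  shows "numer n bs \<beta>s \<beta>s w \<phi> = 0"
proof (rule entire_eq_zero[OF holomorphic_numer[OF assms(1)] assms(2)])
  fix z assume "z \<in> U"
  from assms(3)[OF this] show "numer n bs \<beta>s \<beta>s z \<phi> = 0" by (auto simp: Fminus_numer)
qed

lemma Re_of_real_times: "Re (of_real r * z) = r * Re z"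
  by simp

section \<open>Order two with \<open>a = 0\<close>\<close>

lemma alpha_2: "alpha 2 = -1"
  unfolding alpha_def by (simp add: exp_pi_i)

lemma numer_2:
  assumes "\<And>z. I z = integral {0..1} (\<lambda>x. exp (- \<i> * z * of_real x) * \<phi> x)"
  shows "numer 2 bs \<beta>s c z \<phi> =
     I z * (Mentry 2 bs \<beta>s z 2 2 * Mpart 2 c z 1 1 - Mentry 2 bs \<beta>s z 2 1 * Mpart 2 c z 1 2) +
     I (- z) * (Mentry 2 bs \<beta>s z 1 1 * Mpart 2 c z 1 2 - Mentry 2 bs \<beta>s z 1 2 * Mpart 2 c z 1 1)"
proof -
  have X: "detX 2 bs \<beta>s z l j = Mentry 2 bs \<beta>s z (cyc 2 (l + 1)) (cyc 2 (j + 1))" for l j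
    unfolding detX_def by (subst det_single) simp_all
  have c: "cyc 2 2 = 2" "cyc 2 (Suc (Suc 0)) = 2" "cyc 2 3 = 1" by (simp_all add: cyc_def)
  have s: "{1..2::nat} = {1, 2}" by auto
  have i: "integral {0..1} (\<lambda>x. exp (- \<i> * alpha 2 ^ (l - 1) * z * of_real x) * \<phi> x) = I ((-1) ^ (l - 1) * z)" for l
    unfolding assms alpha_2 by (simp only: mult.assoc)
  show ?thesis
    unfolding numer_def i X s by (simp add: c algebra_simps)
qed

lemma Delta_2:
  "Delta 2 bs \<beta>s z = Mentry 2 bs \<beta>s z 1 1 * Mentry 2 bs \<beta>s z 2 2 - Mentry 2 bs \<beta>s z 1 2 * Mentry 2 bs \<beta>s z 2 1"
proof -
  let ?A = "Matrix.mat 2 2 (\<lambda>(k, j). Mentry 2 bs \<beta>s z (k + 1) (j + 1))"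
  have d: "Determinant.det (mat_delete ?A 0 0) = ?A $$ (1, 1)" "Determinant.det (mat_delete ?A 1 0) = ?A $$ (0, 1)"
    by (subst det_single, auto simp: mat_delete_def)+
  have sum2: "(\<Sum>i<2. h i) = h 0 + h 1" for h :: "nat \<Rightarrow> complex"
    by (simp add: numeral_2_eq_2)
  have "Delta 2 bs \<beta>s z = (\<Sum>i<2. ?A $$ (i, 0) * cofactor ?A i 0)"
    unfolding Delta_def by (rule laplace_expansion_column) auto
  then show ?thesis
    unfolding sum2 cofactor_def d by (simp add: numeral_2_eq_2 mult.commute)
qed

text \<open>Here \<open>w\<close> stands for \<open>-\<i>z\<close>, which makes all coefficients real.\<close>

lemma Mpart_2: "Mpart 2 c (\<i> * w) (Suc 0) j = of_real (c j 0) + w * of_real (c j 1)"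
  and Mpart_2': "Mpart 2 c (\<i> * w) 2 j = of_real (c j 0) - w * of_real (c j 1)"
  unfolding Mpart_def by (simp_all add: numeral_2_eq_2 alpha_2[unfolded numeral_2_eq_2])

text \<open>The bound forces the polynomial itself to tend to 0 at infinity. Dividing by the square
  of w, then by w, reads off the coefficients from the top.\<close>

lemma quadratic_times_exp_bounded:
  fixes c0 c1 c2 C :: real
  assumes "\<And>w. 1 \<le> w \<Longrightarrow> \<bar>c0 + c1 * w + c2 * w ^ 2\<bar> * exp w \<le> C * w ^ 4"
  shows "c0 = 0 \<and> c1 = 0 \<and> c2 = 0"
proof -
  define f where "f w = c0 + c1 * w + c2 * w ^ 2" for w
  have "((\<lambda>w. C * w ^ 4 * exp (- w)) \<longlongrightarrow> 0) at_top" by real_asymp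
  then have f0: "(f \<longlongrightarrow> 0) at_top"
  proof (rule Lim_null_comparison[rotated])
    show "\<forall>\<^sub>F w in at_top. norm (f w) \<le> C * w ^ 4 * exp (- w)"
      using eventually_ge_at_top[of 1]
    proof eventually_elim
      case (elim w)
      from assms[OF elim] have "norm (f w) * exp w * exp (- w) \<le> C * w ^ 4 * exp (- w)"
        unfolding f_def by (intro mult_right_mono) auto
      then show ?case by (simp add: mult.assoc exp_minus)
    qed
  qed
  have inv: "((\<lambda>w::real. 1 / w) \<longlongrightarrow> 0) at_top" "((\<lambda>w::real. 1 / w ^ 2) \<longlongrightarrow> 0) at_top" by real_asymp+
  have "((\<lambda>w. f w * (1 / w ^ 2) - c0 * (1 / w ^ 2) - c1 * (1 / w)) \<longlongrightarrow> 0 * 0 - c0 * 0 - c1 * 0) at_top"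
    by (intro tendsto_intros f0 inv)
  moreover have "\<forall>\<^sub>F w in at_top. f w * (1 / w ^ 2) - c0 * (1 / w ^ 2) - c1 * (1 / w) = c2"
    using eventually_gt_at_top[of 0]
    by eventually_elim (simp add: f_def field_simps power2_eq_square)
  ultimately have "((\<lambda>_::real. c2) \<longlongrightarrow> 0 * 0 - c0 * 0 - c1 * 0) at_top" by (rule Lim_transform_eventually)
  then have c2: "c2 = 0" by (simp add: tendsto_const_iff)
  have "((\<lambda>w. f w * (1 / w) - c0 * (1 / w)) \<longlongrightarrow> 0 * 0 - c0 * 0) at_top"
    by (intro tendsto_intros f0 inv)
  moreover have "\<forall>\<^sub>F w in at_top. f w * (1 / w) - c0 * (1 / w) = c1"
    using eventually_gt_at_top[of 0]
    by eventually_elim (simp add: f_def c2 field_simps)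
  ultimately have "((\<lambda>_::real. c1) \<longlongrightarrow> 0 * 0 - c0 * 0) at_top" by (rule Lim_transform_eventually)
  then have c1: "c1 = 0" by (simp add: tendsto_const_iff)
  have "c0 = 0" using f0 unfolding f_def c1 c2 by (simp add: tendsto_const_iff)
  with c1 c2 show ?thesis by simp
qed

text \<open>By \<open>cosh y * cosh (k * y) = (cosh ((k + 1) * y) + cosh ((k - 1) * y)) / 2\<close>
  the powers of \<open>cosh (1 - x)\<close> are combinations of the given kernels. The induction
  carries an extra factor with arbitrary k to which this formula applies. Injectivity of
  \<open>cosh (1 - x)\<close> on [0,1] then reduces the claim to powers.\<close>

lemma zero_if_cosh_orthogonal:
  fixes W :: "real \<Rightarrow> complex"
  assumes W: "continuous_on {0..1} W"
    and int: "\<And>k::nat. integral {0..1} (\<lambda>x. of_real (cosh (real k * (1 - x))) * W x) = 0"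
    and "x \<in> {0..1}"
  shows "W x = 0"
proof (rule zero_if_orthogonal_to_powers[OF W, of "\<lambda>x. cosh (1 - x)"])
  have "((\<lambda>x. of_real (cosh (1 - x) ^ m * cosh (real k * (1 - x))) * W x) has_integral 0) {0..1}" for m k
  proof (induction m arbitrary: k)
    case 0
    have "(\<lambda>x. of_real (cosh (real k * (1 - x))) * W x) integrable_on {0..1}"
      by (intro integrable_continuous_real continuous_intros W)
    then show ?case using int[of k] by (metis (no_types, lifting) has_integral_cong has_integral_integral mult_1 power_0)
  next
    case (Suc m)
    show ?case
    proof (cases k)
      \<comment> \<open>The product formula would need the index -1; instead the new factor is
        itself read as the kernel with k = 1.\<close>
      case 0
      then show ?thesis using Suc[of 1] by (simp add: mult_ac)
    next
      case (Suc k')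
      have p: "cosh y * cosh (real k * y) = (cosh (real (Suc k) * y) + cosh (real k' * y)) / 2" for y :: real
      proof -
        have "real (Suc k) * y = real k * y + y" "real k' * y = real k * y - y"
          using Suc by (simp_all add: algebra_simps)
        then show ?thesis by (simp only: cosh_add cosh_diff) simp
      qed
      have "((\<lambda>x. (1/2) * (of_real (cosh (1 - x) ^ m * cosh (real (Suc k) * (1 - x))) * W x) +
          (1/2) * (of_real (cosh (1 - x) ^ m * cosh (real k' * (1 - x))) * W x)) has_integral (1/2) * 0 + (1/2) * 0) {0..1}"
        by (intro has_integral_add has_integral_mult_right Suc.IH)
      also have "(\<lambda>x. (1/2) * (of_real (cosh (1 - x) ^ m * cosh (real (Suc k) * (1 - x))) * W x) +
          (1/2) * (of_real (cosh (1 - x) ^ m * cosh (real k' * (1 - x))) * W x)) =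
          (\<lambda>x. of_real (cosh (1 - x) ^ Suc m * cosh (real k * (1 - x))) * W x)"
      proof
        fix x
        have "(1/2) * (of_real (cosh (1 - x) ^ m * cosh (real (Suc k) * (1 - x))) * W x) +
          (1/2) * (of_real (cosh (1 - x) ^ m * cosh (real k' * (1 - x))) * W x) =
          of_real (cosh (1 - x) ^ m * ((cosh (real (Suc k) * (1 - x)) + cosh (real k' * (1 - x))) / 2)) * W x"
          by (simp add: algebra_simps add_divide_distrib)
        also have "\<dots> = of_real (cosh (1 - x) ^ Suc m * cosh (real k * (1 - x))) * W x"
          unfolding p[symmetric] by (simp only: power_Suc mult_ac)
        finally show "(1/2) * (of_real (cosh (1 - x) ^ m * cosh (real (Suc k) * (1 - x))) * W x) +
          (1/2) * (of_real (cosh (1 - x) ^ m * cosh (real k' * (1 - x))) * W x) =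
          of_real (cosh (1 - x) ^ Suc m * cosh (real k * (1 - x))) * W x" .
      qed
      finally show ?thesis by simp
    qed
  qed
  from this[of _ 0] show "integral {0..1} (\<lambda>x. of_real (cosh (1 - x)) ^ m * W x) = 0" for m
    by (simp add: integral_unique)
  show "inj_on (\<lambda>x. cosh (1 - x)) {0..1::real}"
    by (rule inj_onI) (auto simp: cosh_real_nonneg_le_iff intro!: antisym dest!: eq_refl)
qed (use assms in \<open>auto intro!: continuous_intros\<close>)

text \<open>The integrating factor \<open>exp (c * x)\<close> with c = X / Y makes its product with
  F constant, and F 0 = 0 makes the constant 0. For Y = 0 the equation itself says that F
  vanishes.\<close>

lemma zero_if_ode_zero:
  fixes F f :: "real \<Rightarrow> complex" and X Y :: real
  assumes F: "\<And>x. x \<in> {0..1} \<Longrightarrow> (F has_vector_derivative f x) (at x within {0..1})" "F 0 = 0"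
    and eq: "\<And>x. x \<in> {0..1} \<Longrightarrow> of_real X * F x + of_real Y * f x = 0"
    and XY: "X \<noteq> 0 \<or> Y \<noteq> 0" and x: "x \<in> {0..1}"
  shows "f x = 0"
proof -
  have "F y = 0" if y: "y \<in> {0..1}" for y
  proof (cases "Y = 0")
    case True
    then show ?thesis using eq[OF y] XY by simp
  next
    case False
    define c where "c = X / Y"
    have f: "f z = - (of_real c * F z)" if "z \<in> {0..1}" for z
      using eq[OF that] False by (simp add: c_def field_simps eq_neg_iff_add_eq_0)
    have e: "((\<lambda>z. exp (of_real c * of_real z) :: complex) has_vector_derivative of_real c * exp (of_real c * of_real z))
        (at z within {0..1})" for z :: real
      by (rule has_vector_derivative_real_field) (auto intro!: derivative_eq_intros)
    have "((\<lambda>z. exp (of_real c * of_real z) * F z) has_vector_derivative 0) (at z within {0..1})"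
      if z: "z \<in> {0..1}" for z
      using has_vector_derivative_mult[OF e[of z] F(1)[OF z]] by (simp add: f[OF z] algebra_simps)
    then have "((\<lambda>z. exp (of_real c * of_real z) * F z) has_derivative (\<lambda>h. 0)) (at z within {0..1})"
      if z: "z \<in> {0..1}" for z using z by (force simp: has_vector_derivative_def)
    then have "\<exists>k. \<forall>z\<in>{0..1}. exp (of_real c * of_real z) * F z = k"
      by (intro has_derivative_zero_constant convex_real_interval)
    then obtain k where k: "\<And>z. z \<in> {0..1} \<Longrightarrow> exp (of_real c * of_real z) * F z = k" by blast
    have "k = 0" using k[of 0] F(2) by simp
    then show ?thesis using k[OF y] by simp
  qed
  then have "(F has_vector_derivative 0) (at x within {0..1})"
    using x by (intro has_vector_derivative_transform[OF x, of F "\<lambda>_. 0"]) auto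
  from vector_derivative_within_closed_interval[OF _ x this]
    vector_derivative_within_closed_interval[OF _ x F(1)[OF x]]
  show ?thesis by simp
qed

text \<open>The relation says that \<open>(X * sinh (w * (1 - x)) + w * Y * cosh (w * (1 - x))) *
  \<phi> x\<close> has integral 0. Integrating the sinh part by parts against the primitive F leaves
  no boundary term, since sinh vanishes at x = 1 and F at x = 0. What remains is w times a cosh
  moment of \<open>X * F + Y * \<phi>\<close>. Hence this combination is 0, a first-order equation
  for F.\<close>

lemma zero_if_reflection_symmetric:
  fixes \<phi> :: "real \<Rightarrow> complex" and X Y :: real and m :: "real \<Rightarrow> bool"
  assumes \<phi>: "continuous_on {0..1} \<phi>" and XY: "X \<noteq> 0 \<or> Y \<noteq> 0" and fin: "finite {w. \<not> m w}"
    and E: "\<And>w::complex. E w = integral {0..1} (\<lambda>x. exp (w * of_real x) * \<phi> x)"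
    and eq: "\<And>w::real. m w \<Longrightarrow> E (of_real w) * of_real (exp (- w) * (X - w * Y)) =
      E (- of_real w) * of_real (exp w * (X + w * Y))"
    and x: "x \<in> {0..1}"
  shows "\<phi> x = 0"
proof -
  define F where "F x = integral {0..x} \<phi>" for x
  define W where "W x = of_real X * F x + of_real Y * \<phi> x" for x
  have F: "(F has_vector_derivative \<phi> x) (at x within {0..1})" if "x \<in> {0..1}" for x
    unfolding F_def using integral_has_vector_derivative[OF \<phi> that] .
  have F0: "F 0 = 0" by (simp add: F_def)
  have Fc: "continuous_on {0..1} F"
    using F continuous_on_vector_derivative by blast
  have Wc: "continuous_on {0..1} W" unfolding W_def by (intro continuous_intros Fc \<phi>)
  define Q where "Q w = integral {0..1} (\<lambda>x. of_real (cosh (w * (1 - x))) * W x)" for w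
  have Qm: "Q w = 0" if "m w" "w \<noteq> 0" for w
  proof -
    let ?s = "\<lambda>x. complex_of_real (sinh (w * (1 - x)))" and ?c = "\<lambda>x. complex_of_real (cosh (w * (1 - x)))"
    have sd: "(?s has_vector_derivative - of_real w * ?c x) (at x within {0..1})" for x
    proof -
      have "((\<lambda>x. sinh (w * (1 - x))) has_real_derivative - w * cosh (w * (1 - x))) (at x within {0..1})"
        by (auto intro!: derivative_eq_intros)
      from has_vector_derivative_of_real[OF this] show ?thesis by simp
    qed
    have "((\<lambda>x. ?s x * \<phi> x + - of_real w * ?c x * F x) has_integral ?s 1 * F 1 - ?s 0 * F 0) {0..1}"
      using has_vector_derivative_mult[OF sd F]
      by (intro fundamental_theorem_of_calculus) auto
    then have i1: "((\<lambda>x. ?s x * \<phi> x - of_real w * ?c x * F x) has_integral 0) {0..1}"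
      by (simp add: F0)
    have i2: "((\<lambda>x. exp (c * of_real x) * \<phi> x) has_integral E c) {0..1}" for c
      unfolding E by (intro integrable_integral integrable_continuous_real continuous_intros \<phi>)
    have i3: "((\<lambda>x. of_real (exp w * (X + w * Y)) * (exp (- of_real w * of_real x) * \<phi> x) -
        of_real (exp (- w) * (X - w * Y)) * (exp (of_real w * of_real x) * \<phi> x)) has_integral
        of_real (exp w * (X + w * Y)) * E (- of_real w) - of_real (exp (- w) * (X - w * Y)) * E (of_real w)) {0..1}"
      by (intro has_integral_diff has_integral_mult_right i2)
    have e: "of_real (exp w * (X + w * Y)) * (exp (- of_real w * of_real x) * \<phi> x) -
        of_real (exp (- w) * (X - w * Y)) * (exp (of_real w * of_real x) * \<phi> x) =
        2 * (of_real X * (?s x * \<phi> x) + of_real (w * Y) * (?c x * \<phi> x))" for x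
    proof -
      have 1: "complex_of_real (exp w) * exp (- of_real w * of_real x) = of_real (cosh (w * (1 - x)) + sinh (w * (1 - x)))"
        unfolding cosh_plus_sinh by (simp add: exp_of_real[symmetric] mult_exp_exp algebra_simps)
      have 2: "complex_of_real (exp (- w)) * exp (of_real w * of_real x) = of_real (cosh (w * (1 - x)) - sinh (w * (1 - x)))"
        unfolding cosh_minus_sinh by (simp add: exp_of_real[symmetric] mult_exp_exp algebra_simps)
      have "of_real (exp w * (X + w * Y)) * (exp (- of_real w * of_real x) * \<phi> x) -
        of_real (exp (- w) * (X - w * Y)) * (exp (of_real w * of_real x) * \<phi> x) =
        of_real (X + w * Y) * ((complex_of_real (exp w) * exp (- of_real w * of_real x)) * \<phi> x) -
        of_real (X - w * Y) * ((complex_of_real (exp (- w)) * exp (of_real w * of_real x)) * \<phi> x)"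
        by (simp only: of_real_mult mult_ac)
      then show ?thesis unfolding 1 2 by (simp add: algebra_simps)
    qed
    have half: "1 / 2 * (2 * u) = u" for u :: complex by simp
    have "of_real (exp (- w) * (X - w * Y)) * E (of_real w) = of_real (exp w * (X + w * Y)) * E (- of_real w)"
      using eq[OF that(1)] by (simp only: mult.commute)
    then have "((\<lambda>x. 2 * (of_real X * (?s x * \<phi> x) + of_real (w * Y) * (?c x * \<phi> x))) has_integral 0) {0..1}"
      using i3[unfolded e] by (simp only: diff_self)
    from has_integral_mult_right[OF this, of "1 / 2"]
    have "((\<lambda>x. of_real X * (?s x * \<phi> x) + of_real (w * Y) * (?c x * \<phi> x)) has_integral 0) {0..1}"
      by (simp only: half mult_zero_right)
    from has_integral_diff[OF this has_integral_mult_right[OF i1, of "of_real X"]]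
    have "((\<lambda>x. of_real w * (?c x * W x)) has_integral 0) {0..1}"
      by (simp add: W_def algebra_simps)
    from has_integral_mult_right[OF this, of "1 / of_real w"] that(2)
    show ?thesis unfolding Q_def by (simp add: integral_unique)
  qed
  have Qc: "continuous_on UNIV Q"
  proof -
    have "continuous_on (UNIV \<times> cbox 0 1) (\<lambda>(w, x). of_real (cosh (w * (1 - x))) * W x)"
      unfolding split_beta' by (intro continuous_intros continuous_on_compose2[OF Wc]) auto
    from integral_continuous_on_param[OF this] show ?thesis
      unfolding Q_def by simp
  qed
  \<comment> \<open>Q is continuous and vanishes with finitely many possible exceptions. Its
    nonvanishing set is open and finite, hence empty.\<close>
  have "Q w = 0" for w
  proof -
    have "open (Q -` (- {0}))" using Qc by (intro open_vimage) auto
    moreover have "Q -` (- {0}) \<subseteq> insert 0 {w. \<not> m w}" using Qm by auto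
    then have "finite (Q -` (- {0}))" using fin by (meson finite_insert finite_subset)
    ultimately have "Q -` (- {0}) = {}" using finite_imp_not_open by blast
    then show ?thesis by blast
  qed
  then have "W y = 0" if "y \<in> {0..1}" for y
    using that by (intro zero_if_cosh_orthogonal[OF Wc]) (auto simp: Q_def)
  then show ?thesis
    using zero_if_ode_zero[OF F F0 _ XY x] unfolding W_def by blast
qed

text \<open>For \<open>n = 2\<close> and \<open>a = 0\<close> all zeros of \<open>Delta\<close> may be real, and then no $F^-$ is
  in the system. The growth along the real axis in \<open>w\<close> of the relation between \<open>E w\<close> and \<open>E (- w)\<close> then has to
  replace it.\<close>

lemma zero_if_numer_plus_zero_2:
  assumes \<phi>: "\<phi> \<in> Cinf" and ne: "\<exists>z. Delta 2 bs \<beta>s z \<noteq> 0" and sev: "several_zeros 2 bs \<beta>s"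
    and num: "\<And>z. numer 2 bs \<beta>s bs z \<phi> = 0" and x: "x \<in> {0..1}"
  shows "\<phi> x = 0"
proof -
  have c: "continuous_on {0..1} \<phi>" using continuous_on_D[OF \<phi>, of 0] by (simp add: D_0)
  define E where "E w = integral {0..1} (\<lambda>x. exp (w * of_real x) * \<phi> x)" for w :: complex
  define m where "m j w = of_real (bs j 0) + w * of_real (bs j 1)" for j and w :: complex
  define mm where "mm j w = of_real (\<beta>s j 0) + w * of_real (\<beta>s j 1)" for j and w :: complex
  \<comment> \<open>In the variable w the vanishing of the numerator reads
    \<open>E w * P w + E (- w) * (exp w * Q w) = 0\<close>. Here q and Q mix adjoint coefficients at
    0 and at 1, while \<kappa> and \<kappa>' are the minors of the coefficients at a single end
    point: \<open>m 2 (- w) * m 1 w - m 1 (- w) * m 2 w = 2 * \<kappa> * w\<close>.\<close>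
  define q where "q w = mm 2 (- w) * m 1 w - mm 1 (- w) * m 2 w" for w
  define Q where "Q w = mm 1 w * m 2 w - mm 2 w * m 1 w" for w
  define \<kappa> where "\<kappa> = bs 2 0 * bs 1 1 - bs 1 0 * bs 2 1"
  define \<kappa>' where "\<kappa>' = \<beta>s 2 0 * \<beta>s 1 1 - \<beta>s 1 0 * \<beta>s 2 1"
  define P where "P w = 2 * of_real \<kappa> * w + exp (- w) * q w" for w
  have M1: "Mentry 2 bs \<beta>s (\<i> * w) (Suc 0) j = m j w + mm j w * exp w" for w j
    unfolding Mentry_def Mpart_2 m_def mm_def by simp
  have M2: "Mentry 2 bs \<beta>s (\<i> * w) 2 j = m j (- w) + mm j (- w) * exp (- w)" for w j
    unfolding Mentry_def Mpart_2' m_def mm_def by (simp add: alpha_2)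
  have H: "E w * P w + E (- w) * (exp w * Q w) = 0" for w
  proof -
    have I: "integral {0..1} (\<lambda>x. exp (- \<i> * (\<i> * w) * of_real x) * \<phi> x) = E w"
      "integral {0..1} (\<lambda>x. exp (- \<i> * - (\<i> * w) * of_real x) * \<phi> x) = E (- w)"
      by (simp_all add: E_def mult.assoc[symmetric])
    have "E w * (Mentry 2 bs \<beta>s (\<i> * w) 2 2 * m 1 w - Mentry 2 bs \<beta>s (\<i> * w) 2 1 * m 2 w) +
       E (- w) * (Mentry 2 bs \<beta>s (\<i> * w) 1 1 * m 2 w - Mentry 2 bs \<beta>s (\<i> * w) 1 2 * m 1 w) = 0"
      using numer_2[of "\<lambda>z. integral {0..1} (\<lambda>x. exp (- \<i> * z * of_real x) * \<phi> x)" \<phi> bs \<beta>s bs "\<i> * w"] num[of "\<i> * w"]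
      unfolding I by (simp add: Mpart_2 m_def)
    then show ?thesis
      unfolding One_nat_def M1 M2 P_def q_def Q_def \<kappa>_def m_def mm_def
      by (simp add: algebra_simps)
  qed
  have D: "Delta 2 bs \<beta>s (\<i> * w) = 2 * of_real (\<kappa> + \<kappa>') * w + exp (- w) * q w - exp w * q (- w)" for w
  proof -
    have e: "exp w * exp (- w) = 1" by (simp add: mult_exp_exp)
    have "Delta 2 bs \<beta>s (\<i> * w) = (m 1 w * m 2 (- w) - m 2 w * m 1 (- w)) +
        (mm 1 w * mm 2 (- w) - mm 2 w * mm 1 (- w)) * (exp w * exp (- w)) + exp (- w) * q w - exp w * q (- w)"
      unfolding Delta_2 One_nat_def M1 M2 q_def minus_minus by (simp only: ring_distribs mult_ac add_ac) (simp add: algebra_simps)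
    then show ?thesis unfolding e by (simp add: m_def mm_def \<kappa>_def \<kappa>'_def algebra_simps)
  qed
  have iw: "z = \<i> * (- \<i> * z)" for z by simp
  \<comment> \<open>Without q, \<open>Delta\<close> is a multiple of z, and a zero other than 0
    would make it vanish identically.\<close>
  have q_ne: "\<exists>w. q w \<noteq> 0"
  proof (rule ccontr)
    assume "\<nexists>w. q w \<noteq> 0"
    then have q0: "q w = 0" for w by blast
    obtain \<sigma> where \<sigma>: "Delta 2 bs \<beta>s \<sigma> = 0" "\<sigma> \<noteq> 0"
      using sev unfolding several_zeros_def by metis
    have "2 * of_real (\<kappa> + \<kappa>') * (- \<i> * \<sigma>) = 0"
      using D[of "- \<i> * \<sigma>"] \<sigma>(1) iw[of \<sigma>] by (simp only: q0) simp
    then have k: "complex_of_real (\<kappa> + \<kappa>') = 0" using \<sigma>(2) by (simp del: of_real_add)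
    have "Delta 2 bs \<beta>s z = 0" for z
      using D[of "- \<i> * z"] unfolding iw[of z, symmetric] q0 k by simp
    then show False using ne by blast
  qed
  show ?thesis
  proof (cases "\<forall>w. E w = 0")
    case True
    have "integral {0..1} (\<lambda>x. exp (- \<i> * z * of_real x) * \<phi> x) = 0" for z
      using True[rule_format, of "- \<i> * z"] by (simp only: E_def)
    then show ?thesis by (rule exp_transform_eq_zero[OF c _ x])
  next
    case False
    then obtain w0 where w0: "E w0 \<noteq> 0" by blast
    have hol: "E holomorphic_on UNIV"
      using holomorphic_integral_exp[OF c, of 1] unfolding E_def by simp
    have "open (E -` (- {0}))"
      using hol by (intro open_vimage holomorphic_on_imp_continuous_on) auto
    then have lim: "w0 islimpt (E -` (- {0}))"
      using w0 by (intro interior_limit_point) (auto simp: interior_open)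
    \<comment> \<open>The relations at w and at -w are a homogeneous linear system for
      \<open>E w\<close> and \<open>E (- w)\<close>. Its determinant is the factor that appears
      here.\<close>
    have prod: "E w * (P w * P (- w) - Q w * Q (- w)) = 0" for w
    proof -
      have e: "exp w * exp (- w) = 1" by (simp add: mult_exp_exp)
      have "E w * (P w * P (- w) - (exp w * exp (- w)) * (Q w * Q (- w))) =
          P (- w) * (E w * P w + E (- w) * (exp w * Q w)) - exp w * Q w * (E (- w) * P (- w) + E w * (exp (- w) * Q (- w)))"
        by (simp add: algebra_simps)
      then show ?thesis using H[of w] H[of "- w"] unfolding e by simp
    qed
    have PQ: "P w * P (- w) - Q w * Q (- w) = 0" for w
    proof (rule entire_eq_zero[OF _ lim, of "\<lambda>w. P w * P (- w) - Q w * Q (- w)"])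
      show "(\<lambda>w. P w * P (- w) - Q w * Q (- w)) holomorphic_on UNIV"
        unfolding P_def q_def Q_def m_def mm_def by (intro holomorphic_intros)
      show "P z * P (- z) - Q z * Q (- z) = 0" if "z \<in> E -` (- {0})" for z
        using prod[of z] that by auto
    qed
    \<comment> \<open>For large positive w the product \<open>P w * P (- w)\<close> contains
      \<open>2 * \<kappa> * w * exp w * q (- w)\<close>, while all other terms of \<open>PQ\<close>
      are polynomially bounded. A nonzero \<kappa> would therefore force q to vanish.\<close>
    have \<kappa>0: "\<kappa> = 0"
    proof (rule ccontr)
      assume \<kappa>: "\<kappa> \<noteq> 0"
      define c0 where "c0 = \<beta>s 2 0 * bs 1 0 - \<beta>s 1 0 * bs 2 0"
      define c1 where "c1 = \<beta>s 2 1 * bs 1 0 - \<beta>s 2 0 * bs 1 1 - \<beta>s 1 1 * bs 2 0 + \<beta>s 1 0 * bs 2 1"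
      define c2 where "c2 = \<beta>s 1 1 * bs 2 1 - \<beta>s 2 1 * bs 1 1"
      have qc: "q (- w) = of_real c0 + of_real c1 * w + of_real c2 * w ^ 2" for w
        unfolding q_def m_def mm_def c0_def c1_def c2_def by (simp add: algebra_simps power2_eq_square)
      define K where "K = (\<Sum>j\<in>{1,2}. \<Sum>k\<in>{0,1}. \<bar>bs j k\<bar> + \<bar>\<beta>s j k\<bar>)"
      have K0: "0 \<le> K" unfolding K_def by (intro sum_nonneg) auto
      have mK: "norm (m j (of_real w)) \<le> K * \<bar>w\<bar>" "norm (mm j (of_real w)) \<le> K * \<bar>w\<bar>"
        if j: "j = 1 \<or> j = 2" and w: "1 \<le> \<bar>w\<bar>" for j w
      proof -
        have gen: "norm (complex_of_real u + of_real w * of_real v) \<le> K * \<bar>w\<bar>" if "\<bar>u\<bar> + \<bar>v\<bar> \<le> K" for u v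
        proof -
          have "norm (complex_of_real u + of_real w * of_real v) \<le> \<bar>u\<bar> + \<bar>w\<bar> * \<bar>v\<bar>"
            by (rule order_trans[OF norm_triangle_ineq]) (simp add: norm_mult)
          also have "\<dots> \<le> \<bar>w\<bar> * \<bar>u\<bar> + \<bar>w\<bar> * \<bar>v\<bar>" using w by (intro add_right_mono) (simp add: mult_le_cancel_right1)
          also have "\<dots> \<le> \<bar>w\<bar> * K" unfolding distrib_left[symmetric] using that by (intro mult_left_mono) auto
          finally show ?thesis by (simp add: mult.commute)
        qed
        have "\<bar>bs j 0\<bar> + \<bar>bs j 1\<bar> \<le> K" "\<bar>\<beta>s j 0\<bar> + \<bar>\<beta>s j 1\<bar> \<le> K"
          using j by (auto simp: K_def)
        then show "norm (m j (of_real w)) \<le> K * \<bar>w\<bar>" "norm (mm j (of_real w)) \<le> K * \<bar>w\<bar>"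
          unfolding m_def mm_def by (auto intro: gen)
      qed
      have prodK: "norm (a1 * b1 - a2 * b2) \<le> 2 * K ^ 2 * w ^ 2"
        if "norm a1 \<le> K * w" "norm b1 \<le> K * w" "norm a2 \<le> K * w" "norm b2 \<le> K * w" "0 \<le> w" for a1 b1 a2 b2 :: complex and w :: real
      proof -
        have "norm (a1 * b1 - a2 * b2) \<le> norm a1 * norm b1 + norm a2 * norm b2"
          by (rule order_trans[OF norm_triangle_ineq4]) (simp add: norm_mult)
        also have "\<dots> \<le> (K * w) * (K * w) + (K * w) * (K * w)"
          using that K0 by (intro add_mono mult_mono) auto
        finally show ?thesis by (simp add: power2_eq_square mult_ac)
      qed
      \<comment> \<open>The summands are the bounds \<open>n1\<close>, \<open>n3\<close>,
        \<open>n4\<close>, \<open>n2\<close> below, in this order; the denominator removes the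
        factor \<open>2 * \<bar>\<kappa>\<bar>\<close> on the left.\<close>
      define C where "C = (4 * K ^ 4 + 4 * \<kappa> ^ 2 + 4 * \<bar>\<kappa>\<bar> * K ^ 2 + 4 * K ^ 4) / (2 * \<bar>\<kappa>\<bar>)"
      have bound: "\<bar>c0 + c1 * w + c2 * w ^ 2\<bar> * exp w \<le> C * w ^ 4" if w: "1 \<le> w" for w
      proof -
        let ?w = "complex_of_real w"
        have mw: "norm (m j ?w) \<le> K * w" "norm (mm j ?w) \<le> K * w" "norm (m j (- ?w)) \<le> K * w" "norm (mm j (- ?w)) \<le> K * w"
          if "j = 1 \<or> j = 2" for j
          using mK[OF that, of w] mK[OF that, of "- w"] w by auto
        have bq: "norm (q ?w) \<le> 2 * K ^ 2 * w ^ 2" "norm (q (- ?w)) \<le> 2 * K ^ 2 * w ^ 2"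
          "norm (Q ?w) \<le> 2 * K ^ 2 * w ^ 2" "norm (Q (- ?w)) \<le> 2 * K ^ 2 * w ^ 2"
          unfolding q_def Q_def minus_minus using w by (auto intro!: prodK mw)
        have e: "exp ?w * exp (- ?w) = 1" by (simp add: mult_exp_exp)
        have "P ?w * P (- ?w) = - 4 * of_real \<kappa> ^ 2 * ?w ^ 2 + 2 * of_real \<kappa> * ?w * (exp ?w * q (- ?w)) -
            2 * of_real \<kappa> * ?w * (exp (- ?w) * q ?w) + (exp ?w * exp (- ?w)) * (q ?w * q (- ?w))"
          unfolding P_def by (simp add: algebra_simps power2_eq_square)
        then have eq: "2 * of_real \<kappa> * ?w * (exp ?w * q (- ?w)) = Q ?w * Q (- ?w) + 4 * of_real \<kappa> ^ 2 * ?w ^ 2 +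
            2 * of_real \<kappa> * ?w * (exp (- ?w) * q ?w) - q ?w * q (- ?w)"
          using PQ[of ?w] unfolding e by (simp add: algebra_simps)
        have w24: "w ^ 2 \<le> w ^ 4" "w ^ 3 \<le> w ^ 4" using w by (auto intro: power_increasing)
        have n1: "norm (Q ?w * Q (- ?w)) \<le> 4 * K ^ 4 * w ^ 4"
        proof -
          have "norm (Q ?w * Q (- ?w)) \<le> (2 * K ^ 2 * w ^ 2) * (2 * K ^ 2 * w ^ 2)"
            unfolding norm_mult using bq by (intro mult_mono) auto
          then show ?thesis by (simp add: power2_eq_square power4_eq_xxxx mult_ac)
        qed
        have n2: "norm (q ?w * q (- ?w)) \<le> 4 * K ^ 4 * w ^ 4"
        proof -
          have "norm (q ?w * q (- ?w)) \<le> (2 * K ^ 2 * w ^ 2) * (2 * K ^ 2 * w ^ 2)"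
            unfolding norm_mult using bq by (intro mult_mono) auto
          then show ?thesis by (simp add: power2_eq_square power4_eq_xxxx mult_ac)
        qed
        have n3: "norm (4 * complex_of_real \<kappa> ^ 2 * ?w ^ 2) \<le> 4 * \<kappa> ^ 2 * w ^ 4"
          using w24(1) by (simp add: norm_mult norm_power mult_left_mono)
        have n4: "norm (2 * of_real \<kappa> * ?w * (exp (- ?w) * q ?w)) \<le> 4 * \<bar>\<kappa>\<bar> * K ^ 2 * w ^ 4"
        proof -
          have "norm (2 * of_real \<kappa> * ?w * (exp (- ?w) * q ?w)) = 2 * \<bar>\<kappa>\<bar> * w * (exp (- w) * norm (q ?w))"
            using w by (simp add: norm_mult)
          also have "\<dots> \<le> 2 * \<bar>\<kappa>\<bar> * w * (1 * (2 * K ^ 2 * w ^ 2))"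
            using w bq(1) by (intro mult_left_mono mult_mono) auto
          also have "\<dots> = 4 * \<bar>\<kappa>\<bar> * K ^ 2 * w ^ 3" by (simp add: power2_eq_square power3_eq_cube)
          also have "\<dots> \<le> 4 * \<bar>\<kappa>\<bar> * K ^ 2 * w ^ 4" using w24(2) by (intro mult_left_mono) auto
          finally show ?thesis .
        qed
        have "2 * \<bar>\<kappa>\<bar> * w * (exp w * norm (q (- ?w))) = norm (2 * of_real \<kappa> * ?w * (exp ?w * q (- ?w)))"
          using w by (simp add: norm_mult)
        also have "\<dots> \<le> 4 * K ^ 4 * w ^ 4 + 4 * \<kappa> ^ 2 * w ^ 4 + 4 * \<bar>\<kappa>\<bar> * K ^ 2 * w ^ 4 + 4 * K ^ 4 * w ^ 4"
          unfolding eq by (rule order_trans[OF norm_triangle_ineq4] add_mono order_trans[OF norm_triangle_ineq] n1 n2 n3 n4)+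
        also have "\<dots> = 2 * \<bar>\<kappa>\<bar> * (C * w ^ 4)" using \<kappa> unfolding C_def by (simp add: field_simps)
        finally have "2 * \<bar>\<kappa>\<bar> * (w * (exp w * norm (q (- ?w)))) \<le> 2 * \<bar>\<kappa>\<bar> * (C * w ^ 4)" by (simp add: mult_ac)
        then have "w * (exp w * norm (q (- ?w))) \<le> C * w ^ 4" using \<kappa> by (simp add: mult_le_cancel_left_pos)
        moreover have "1 * (exp w * norm (q (- ?w))) \<le> w * (exp w * norm (q (- ?w)))" using w by (intro mult_right_mono) auto
        moreover have "norm (q (- ?w)) = \<bar>c0 + c1 * w + c2 * w ^ 2\<bar>"
        proof -
          have "q (- ?w) = complex_of_real (c0 + c1 * w + c2 * w ^ 2)" unfolding qc by simp
          then show ?thesis by (simp only: norm_of_real)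
        qed
        ultimately have "\<bar>c0 + c1 * w + c2 * w ^ 2\<bar> = norm (q (- ?w))" "exp w * norm (q (- ?w)) \<le> C * w ^ 4"
          by linarith+
        then show ?thesis by (simp only: mult.commute)
      qed
      from quadratic_times_exp_bounded[OF this] have "q (- w) = 0" for w unfolding qc by simp
      then have "q w = 0" for w by (metis minus_minus)
      then show False using q_ne by blast
    qed
    \<comment> \<open>With \<kappa> = 0 the two coefficient rows at 0 are proportional, so q and Q
      share a linear factor. The cofactors of it are reflections of each other up to sign, which is
      the relation treated by \<open>zero_if_reflection_symmetric\<close>.\<close>
    have "\<exists>mx my X Y. \<forall>w. q w = (of_real mx + w * of_real my) * (of_real X - w * of_real Y) \<and>
        Q w = - ((of_real mx + w * of_real my) * (of_real X + w * of_real Y))"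
    proof (cases "bs 1 0 = 0 \<and> bs 1 1 = 0")
      case True
      then show ?thesis
        by (intro exI[of _ "bs 2 0"] exI[of _ "bs 2 1"] exI[of _ "- \<beta>s 1 0"] exI[of _ "- \<beta>s 1 1"])
          (simp add: q_def Q_def m_def mm_def algebra_simps)
    next
      case False
      have "\<exists>t. bs 2 0 = t * bs 1 0 \<and> bs 2 1 = t * bs 1 1"
      proof (cases "bs 1 0 = 0")
        case True
        with False \<kappa>0 show ?thesis by (intro exI[of _ "bs 2 1 / bs 1 1"]) (auto simp: \<kappa>_def)
      next
        case False
        with \<kappa>0 show ?thesis by (intro exI[of _ "bs 2 0 / bs 1 0"]) (auto simp: \<kappa>_def field_simps)
      qed
      then obtain t where t: "bs 2 0 = t * bs 1 0" "bs 2 1 = t * bs 1 1" by blast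
      then show ?thesis
        by (intro exI[of _ "bs 1 0"] exI[of _ "bs 1 1"] exI[of _ "\<beta>s 2 0 - t * \<beta>s 1 0"] exI[of _ "\<beta>s 2 1 - t * \<beta>s 1 1"])
          (simp add: q_def Q_def m_def mm_def algebra_simps)
    qed
    then obtain mx my X Y where mXY: "\<And>w. q w = (of_real mx + w * of_real my) * (of_real X - w * of_real Y)"
      "\<And>w. Q w = - ((of_real mx + w * of_real my) * (of_real X + w * of_real Y))" by blast
    have nz: "mx \<noteq> 0 \<or> my \<noteq> 0" "X \<noteq> 0 \<or> Y \<noteq> 0"
      using q_ne by (auto simp: mXY)
    show ?thesis
    proof (rule zero_if_reflection_symmetric[OF c nz(2) _ E_def _ x])
      \<comment> \<open>Division by the common factor is possible except at its single possible
        root.\<close>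
      have "{w. \<not> mx + w * my \<noteq> 0} \<subseteq> {- mx / my}"
      proof
        fix w assume "w \<in> {w. \<not> mx + w * my \<noteq> 0}"
        then have "w * my = - mx" by simp
        moreover from this have "my \<noteq> 0" using nz(1) by auto
        ultimately have "w = - mx / my" by (metis nonzero_mult_div_cancel_right)
        then show "w \<in> {- mx / my}" by simp
      qed
      then show "finite {w. \<not> mx + w * my \<noteq> 0}" by (rule finite_subset) simp
      fix w assume w: "mx + w * my \<noteq> 0"
      let ?w = "complex_of_real w"
      have "of_real (mx + w * my) * (E ?w * of_real (exp (- w) * (X - w * Y)) - E (- ?w) * of_real (exp w * (X + w * Y))) =
          E ?w * P ?w + E (- ?w) * (exp ?w * Q ?w)"
        unfolding P_def mXY \<kappa>0 by (simp add: exp_of_real[symmetric] algebra_simps)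
      also have "\<dots> = 0" by (rule H)
      finally show "E ?w * of_real (exp (- w) * (X - w * Y)) = E (- ?w) * of_real (exp w * (X + w * Y))"
        using w by (simp only: mult_eq_0_iff of_real_eq_0_iff) simp
    qed
  qed
qed

section \<open>Functionals from the lower half-plane\<close>

lemma arc_subset_frontier:
  assumes "separation n bs \<beta>s \<epsilon>" "2 \<le> n"
  shows "sphere 0 (2 * \<epsilon>) \<inter> {z. Im z < 0 \<and> 0 < Re (a * z ^ n)} \<subseteq>
    frontier ({z. Im z < 0 \<and> 0 < Re (a * z ^ n)} - (\<Union>\<sigma>\<in>{\<sigma>. Delta n bs \<beta>s \<sigma> = 0}. cball \<sigma> (2 * \<epsilon>)))"
proof
  let ?V = "{z. Im z < 0 \<and> 0 < Re (a * z ^ n)}" and ?B = "\<Union>\<sigma>\<in>{\<sigma>. Delta n bs \<beta>s \<sigma> = 0}. cball \<sigma> (2 * \<epsilon>)"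
  fix z assume z: "z \<in> sphere 0 (2 * \<epsilon>) \<inter> ?V"
  have \<epsilon>: "0 < \<epsilon>" using assms(1) by (simp add: separation_def)
  have D0: "Delta n bs \<beta>s 0 = 0" using Delta_0[OF assms(2)] .
  have nz: "norm z = 2 * \<epsilon>" using z by simp
  have "z \<in> ?B" using D0 nz by (intro UN_I[of 0]) auto
  then have "z \<notin> interior (?V - ?B)" using interior_subset by blast
  moreover have "z \<in> closure (?V - ?B)"
    unfolding closure_approachable
  proof (intro allI impI)
    fix e :: real assume e: "0 < e"
    \<comment> \<open>The sector is a cone, so z is approached from outside along its own ray. With
      \<delta> \<le> 1/4 the modulus is at most 5/2 \<epsilon>, so a zero of modulus at least 5
      \<epsilon> is at distance at least 5/2 \<epsilon> > 2 \<epsilon>. The other bound on \<delta>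
      keeps the point within e of z.\<close>
    define \<delta> where "\<delta> = min (1 / 4) (e / (4 * \<epsilon>))"
    have \<delta>: "0 < \<delta>" "\<delta> \<le> 1 / 4" "2 * \<epsilon> * \<delta> < e" using e \<epsilon> by (auto simp: \<delta>_def min_def field_simps)
    let ?z = "of_real (1 + \<delta>) * z"
    have nz': "norm ?z = (1 + \<delta>) * (2 * \<epsilon>)" using \<delta>(1) nz by (simp add: norm_mult del: of_real_add)
    have "a * ?z ^ n = of_real ((1 + \<delta>) ^ n) * (a * z ^ n)" by (simp add: power_mult_distrib)
    then have "Re (a * ?z ^ n) = (1 + \<delta>) ^ n * Re (a * z ^ n)" by (simp only: Re_of_real_times)
    moreover have "Im z < 0" "0 < Re (a * z ^ n)" using z by blast+
    ultimately have "0 < Re (a * ?z ^ n)" "Im ?z < 0"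
      using \<delta>(1) by (simp_all only: mult_pos_pos zero_less_power add_pos_pos zero_less_one) (simp add: mult_pos_neg)
    then have "?z \<in> ?V" by blast
    moreover have "?z \<notin> cball \<sigma> (2 * \<epsilon>)" if "Delta n bs \<beta>s \<sigma> = 0" for \<sigma>
    proof (cases "\<sigma> = 0")
      case True
      have "2 * \<epsilon> < norm ?z" unfolding nz' using \<delta>(1) \<epsilon> by simp
      then show ?thesis using True by simp
    next
      case False
      then have "5 * \<epsilon> \<le> norm \<sigma>" using separation_dist[OF assms(1) that D0] by simp
      moreover have "norm \<sigma> \<le> dist \<sigma> ?z + norm ?z" unfolding dist_norm using norm_triangle_ineq[of "\<sigma> - ?z" ?z] by simp
      moreover have "(1 + \<delta>) * (2 * \<epsilon>) \<le> (5 / 4) * (2 * \<epsilon>)" using \<delta>(2) \<epsilon> by (intro mult_right_mono) auto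
      ultimately have "2 * \<epsilon> < dist \<sigma> ?z" unfolding nz' using \<epsilon> by linarith
      then show ?thesis by simp
    qed
    moreover have "dist ?z z < e"
    proof -
      have "?z - z = of_real \<delta> * z" by (simp add: algebra_simps)
      then show ?thesis using \<delta> nz by (simp add: dist_norm norm_mult mult.commute)
    qed
    ultimately show "\<exists>y\<in>?V - ?B. dist y z < e" by blast
  qed
  ultimately show "z \<in> frontier (?V - ?B)" by (simp add: frontier_def)
qed

text \<open>An n-th root u of \<open>cnj a\<close> gives \<open>a * u ^ n = a * cnj a\<close>, which
  is positive, and so do its rotations by powers of alpha. One of these has nonpositive imaginary
  part, and a small shift downwards makes it negative without leaving an open condition.\<close>

lemma ex_lower_sector_point:
  assumes "a \<noteq> 0" "2 \<le> n"
  shows "\<exists>u. Im u < 0 \<and> 0 < Re (a * u ^ n)"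
proof -
  obtain u0 where u0: "cnj a = u0 ^ n"
    using exists_complex_root[of n "cnj a"] assms(2) by auto
  obtain k where k: "Im (alpha n ^ k * u0) \<le> 0" using ex_rotation_Im_le[OF assms(2)] by blast
  define v where "v = alpha n ^ k * u0"
  have "(alpha n ^ k) ^ n = 1" using alpha_power_n[of n] assms(2) by (metis gr0I mult.commute not_numeral_le_zero power_mult power_one)
  then have "a * v ^ n = a * cnj a" by (simp add: v_def power_mult_distrib u0[symmetric])
  then have "0 < Re (a * v ^ n)" using assms(1) by (simp add: complex_mult_cnj) (metis complex_eq_0 not_sum_power2_lt_zero linorder_neqE_linordered_idom)
  moreover have "open {u. 0 < Re (a * u ^ n)}" by (intro open_Collect_less continuous_intros)
  ultimately obtain e where e: "0 < e" "ball v e \<subseteq> {u. 0 < Re (a * u ^ n)}"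
    by (metis (no_types, lifting) mem_Collect_eq openE)
  have "v - \<i> * of_real (e / 2) \<in> ball v e" using e(1) by (simp add: dist_norm norm_mult)
  then have "0 < Re (a * (v - \<i> * of_real (e / 2)) ^ n)" using e(2) by blast
  moreover have "Im (v - \<i> * of_real (e / 2)) < 0" using k e(1) by (simp add: v_def)
  ultimately show ?thesis by blast
qed

lemma complete_system_F:
  assumes n: "2 \<le> n" and ne: "\<exists>z. Delta n bs \<beta>s z \<noteq> 0" and sep: "separation n bs \<beta>s \<epsilon>"
    and a: "a \<noteq> 0 \<or> several_zeros n bs \<beta>s"
  shows "complete_system (Phi n b \<beta>)
             (Fplus n bs \<beta>s ` contour_set (Gamma0_plus n bs \<beta>s \<epsilon>) \<union>
              Fminus n bs \<beta>s ` contour_set (Gamma0_minus n bs \<beta>s \<epsilon>) \<union>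
              Fplus n bs \<beta>s ` contour_set (Gammaa_plus n bs \<beta>s \<epsilon> a) \<union>
              Fminus n bs \<beta>s ` contour_set (Gammaa_minus n bs \<beta>s \<epsilon> a))"
  unfolding complete_system_def
proof (intro ballI impI)
  fix \<phi> x assume \<phi>: "\<phi> \<in> Phi n b \<beta>" and x: "x \<in> {0..1::real}"
    and zero: "\<forall>E\<in>Fplus n bs \<beta>s ` contour_set (Gamma0_plus n bs \<beta>s \<epsilon>) \<union>
              Fminus n bs \<beta>s ` contour_set (Gamma0_minus n bs \<beta>s \<epsilon>) \<union>
              Fplus n bs \<beta>s ` contour_set (Gammaa_plus n bs \<beta>s \<epsilon> a) \<union>
              Fminus n bs \<beta>s ` contour_set (Gammaa_minus n bs \<beta>s \<epsilon> a). E \<phi> = 0"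
  have \<epsilon>: "0 < \<epsilon>" using sep by (simp add: separation_def)
  have C: "\<phi> \<in> Cinf" using \<phi> by (simp add: Phi_def)
  have D0: "Delta n bs \<beta>s 0 = 0" using Delta_0[OF n] .
  have Fp: "Fplus n bs \<beta>s z \<phi> = 0" if "z \<in> sphere 0 \<epsilon>" for z
  proof -
    have "z \<in> contour_set (Gamma0_plus n bs \<beta>s \<epsilon>)"
      unfolding Gamma0_plus_def contour_set.simps using D0 that by (intro UN_I[of 0]) auto
    then show ?thesis using zero by blast
  qed
  have Fm: "Fminus n bs \<beta>s z \<phi> = 0"
    if "z \<in> contour_set (Gamma0_minus n bs \<beta>s \<epsilon>) \<or> z \<in> contour_set (Gammaa_minus n bs \<beta>s \<epsilon> a)" for z
    using zero that by blast
  have lim: "\<sigma> + of_real \<epsilon> islimpt sphere \<sigma> \<epsilon>" for \<sigma> :: complex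
    using sphere_islimpt[OF \<epsilon> open_UNIV, of "\<sigma> + of_real \<epsilon>" \<sigma>] \<epsilon> by (simp add: dist_norm)
  have Np: "numer n bs \<beta>s bs z \<phi> = 0" for z
    using Fp Delta_sphere_ne_0[OF sep D0 _ \<epsilon>] \<epsilon> by (intro numer_zero_if_Fplus_zero[OF C lim[of 0]]) auto
  show "\<phi> x = 0"
  proof (cases "n = 2 \<and> a = 0")
    \<comment> \<open>Here the rotation by alpha = -1 cannot move a real zero below the real axis,
      and \<open>Gammaa_minus\<close> is empty. Only F^+ is sure to be in the system.\<close>
    case True
    then show ?thesis
      using zero_if_numer_plus_zero_2[OF C _ _ _ x] ne a Np by blast
  next
    case False
    have "numer n bs \<beta>s \<beta>s z \<phi> = 0" for z
    proof (cases "a = 0")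
      case True
      with False n have n3: "3 \<le> n" by auto
      obtain \<sigma> where \<sigma>: "Delta n bs \<beta>s \<sigma> = 0" "\<sigma> \<noteq> 0"
        using a True unfolding several_zeros_def by metis
      obtain k where k: "Im (alpha n ^ k * \<sigma>) < 0" using ex_rotation_Im_less[OF n3 \<sigma>(2)] by blast
      define \<tau> where "\<tau> = alpha n ^ k * \<sigma>"
      have \<tau>: "Delta n bs \<beta>s \<tau> = 0" unfolding \<tau>_def by (rule Delta_rotate[OF n \<sigma>(1)])
      have "sphere \<tau> \<epsilon> \<subseteq> contour_set (Gamma0_minus n bs \<beta>s \<epsilon>)"
        unfolding Gamma0_minus_def contour_set.simps using \<tau> k
        by (intro UN_upper) (simp add: \<tau>_def del: times_complex.sel)
      then show ?thesis
        using Fm Delta_sphere_ne_0[OF sep \<tau> _ \<epsilon>] \<epsilon> by (intro numer_zero_if_Fminus_zero[OF C lim[of \<tau>]]) auto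
    next
      case False
      let ?V = "{z. Im z < 0 \<and> 0 < Re (a * z ^ n)}"
      obtain u where u: "Im u < 0" "0 < Re (a * u ^ n)" using ex_lower_sector_point[OF False n] by blast
      define r where "r = 2 * \<epsilon> / norm u"
      have "u \<noteq> 0" using u(1) by auto
      then have r: "0 < r" "r * norm u = 2 * \<epsilon>" using \<epsilon> by (auto simp: r_def)
      define v where "v = of_real r * u"
      have "a * v ^ n = of_real (r ^ n) * (a * u ^ n)" by (simp add: v_def power_mult_distrib)
      then have "Re (a * v ^ n) = r ^ n * Re (a * u ^ n)" by (simp only: Re_of_real_times)
      then have "0 < Re (a * v ^ n)" using u r by (simp only: mult_pos_pos zero_less_power)
      moreover have "Im v < 0" using u r by (simp add: v_def mult_pos_neg)
      ultimately have v: "v \<in> ?V" by blast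
      have vs: "v \<in> sphere 0 (2 * \<epsilon>)" using r by (simp add: v_def norm_mult)
      have "open ?V" by (intro open_Collect_conj open_Collect_less continuous_intros)
      from sphere_islimpt[OF _ this vs v] \<epsilon> have "v islimpt sphere 0 (2 * \<epsilon>) \<inter> ?V" by simp
      then show ?thesis
      proof (rule numer_zero_if_Fminus_zero[OF C])
        fix z assume z: "z \<in> sphere 0 (2 * \<epsilon>) \<inter> ?V"
        then have "z \<in> contour_set (Gammaa_minus n bs \<beta>s \<epsilon> a)"
          unfolding Gammaa_minus_def contour_set.simps using arc_subset_frontier[OF sep n] by blast
        then show "Delta n bs \<beta>s z \<noteq> 0 \<and> Fminus n bs \<beta>s z \<phi> = 0"
          using Fm Delta_sphere_ne_0[OF sep D0, of z "2 * \<epsilon>"] z \<epsilon> by auto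
      qed
    qed
    then show ?thesis using zero_if_both_numer_zero[OF _ C ne Np _ x] n by auto
  qed
qed

section \<open>Step functions\<close>

definition jump :: "(real \<Rightarrow> complex) \<Rightarrow> real \<Rightarrow> complex" where
  "jump f x = Lim (at_right x) f - Lim (at_left x) f"

lemma Lim_eventually_const:
  assumes "F \<noteq> bot" "\<forall>\<^sub>F y in F. f y = (c :: complex)"
  shows "Lim F f = c"
  using assms by (intro tendsto_Lim tendsto_eventually)

text \<open>Between x and the nearest point of T on either side, f is locally constant on a
  connected set, hence constant, and the one-sided limits are attained.\<close>

lemma eventually_const_sides:
  fixes f :: "real \<Rightarrow> complex"
  assumes "finite T" and loc: "\<And>x. x \<in> {lo<..<hi} - T \<Longrightarrow> \<forall>\<^sub>F y in at x. f y = f x"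
    and x: "x \<in> {lo<..<hi}"
  shows "\<forall>\<^sub>F y in at_right x. f y = Lim (at_right x) f"
    and "\<forall>\<^sub>F y in at_left x. f y = Lim (at_left x) f"
proof -
  have const: "f y = f z" if "{p<..<q} \<subseteq> {lo<..<hi} - T" "y \<in> {p<..<q}" "z \<in> {p<..<q}" for p q y z
  proof (rule connected_local_const[of "{p<..<q}"])
    show "\<forall>a\<in>{p<..<q}. \<forall>\<^sub>F b in at a within {p<..<q}. f a = f b"
    proof
      fix a assume "a \<in> {p<..<q}"
      with that loc have "\<forall>\<^sub>F b in at a. f b = f a" by blast
      then show "\<forall>\<^sub>F b in at a within {p<..<q}. f a = f b"
        by (intro eventually_at_filter[THEN iffD2]) (auto simp: eventually_at_filter elim: eventually_mono)
    qed
  qed (use that in auto)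
  have "\<forall>\<^sub>F y in at x. y \<notin> T"
    using assms(1) islimpt_finite islimpt_iff_eventually by blast
  then have ev: "\<forall>\<^sub>F y in at_right x. y \<notin> T" "\<forall>\<^sub>F y in at_left x. y \<notin> T"
    by (simp_all add: eventually_at_split)
  obtain q where q: "x < q" "\<And>y. x < y \<Longrightarrow> y < q \<Longrightarrow> y \<notin> T"
    using ev(1) by (auto simp: eventually_at_right_field)
  define q' where "q' = min q hi"
  have q': "x < q'" "{x<..<q'} \<subseteq> {lo<..<hi} - T" using q x by (auto simp: q'_def)
  have "\<forall>\<^sub>F y in at_right x. f y = f ((x + q') / 2)"
    unfolding eventually_at_right_field
    using q' by (intro exI[of _ q']) (auto intro!: const[OF q'(2)] simp: field_simps)
  then show "\<forall>\<^sub>F y in at_right x. f y = Lim (at_right x) f"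
    using Lim_eventually_const[of "at_right x" f] by simp
  obtain p where p: "p < x" "\<And>y. p < y \<Longrightarrow> y < x \<Longrightarrow> y \<notin> T"
    using ev(2) by (auto simp: eventually_at_left_field)
  define p' where "p' = max p lo"
  have p': "p' < x" "{p'<..<x} \<subseteq> {lo<..<hi} - T" using p x by (auto simp: p'_def)
  have "\<forall>\<^sub>F y in at_left x. f y = f ((x + p') / 2)"
    unfolding eventually_at_left_field
    using p' by (intro exI[of _ p']) (auto intro!: const[OF p'(2)] simp: field_simps)
  then show "\<forall>\<^sub>F y in at_left x. f y = Lim (at_left x) f"
    using Lim_eventually_const[of "at_left x" f] by simp
qed

text \<open>Subtracting the accumulated jumps leaves equal one-sided limits everywhere, hence a
  constant. It is evaluated at \<open>x0\<close>, which precedes all of T.\<close>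

lemma step_function_sum:
  fixes f :: "real \<Rightarrow> complex"
  assumes T: "finite T" and loc: "\<And>x. x \<in> {lo<..<hi} - T \<Longrightarrow> \<forall>\<^sub>F y in at x. f y = f x"
    and x: "x \<in> {lo<..<hi} - T" and x0: "x0 \<in> {lo<..<hi}" "\<And>\<tau>. \<tau> \<in> T \<Longrightarrow> x0 < \<tau>"
  shows "f x = f x0 + (\<Sum>\<tau> | \<tau> \<in> T \<and> \<tau> < x. jump f \<tau>)"
proof -
  define F where "F y = f y - (\<Sum>\<tau> | \<tau> \<in> T \<and> \<tau> < y. jump f \<tau>)" for y
  \<comment> \<open>At points of T the value of f itself carries no information. G records the value
    that F takes on both sides.\<close>
  define G where "G z = Lim (at_left z) f - (\<Sum>\<tau> | \<tau> \<in> T \<and> \<tau> < z. jump f \<tau>)" for z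
  have side: "Lim (at_right z) f = f z" "Lim (at_left z) f = f z" if "z \<in> {lo<..<hi} - T" for z
  proof -
    have "\<forall>\<^sub>F y in at z. f y = f z" using loc[OF that] .
    then have "\<forall>\<^sub>F y in at_left z. f y = f z" "\<forall>\<^sub>F y in at_right z. f y = f z"
      by (simp_all add: eventually_at_split)
    then show "Lim (at_right z) f = f z" "Lim (at_left z) f = f z"
      by (auto intro: Lim_eventually_const)
  qed
  have FG: "\<forall>\<^sub>F y in at z. F y = G z" if z: "z \<in> {lo<..<hi}" for z
  proof -
    have c: "\<forall>\<^sub>F y in at_right z. f y = Lim (at_right z) f" "\<forall>\<^sub>F y in at_left z. f y = Lim (at_left z) f"
      using eventually_const_sides[OF T _ z, of f] loc by blast+
    have "\<forall>\<^sub>F y in at_left z. \<forall>\<tau>\<in>T. \<tau> < y \<longleftrightarrow> \<tau> < z"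
    proof (intro eventually_ball_finite T ballI)
      fix \<tau> assume "\<tau> \<in> T"
      show "\<forall>\<^sub>F y in at_left z. \<tau> < y \<longleftrightarrow> \<tau> < z"
      proof (cases "\<tau> < z")
        case True
        then show ?thesis
          unfolding eventually_at_left_field by (intro exI[of _ \<tau>]) auto
      next
        case False
        then show ?thesis
          unfolding eventually_at_left_field by (intro exI[of _ "z - 1"]) auto
      qed
    qed
    then have left: "\<forall>\<^sub>F y in at_left z. F y = G z"
      using c(2)
      by eventually_elim (auto simp: F_def G_def intro!: sum.cong)
    have "\<forall>\<^sub>F y in at_right z. \<forall>\<tau>\<in>T. \<tau> < y \<longleftrightarrow> \<tau> \<le> z"
    proof (intro eventually_ball_finite T ballI)
      fix \<tau> assume "\<tau> \<in> T"
      show "\<forall>\<^sub>F y in at_right z. \<tau> < y \<longleftrightarrow> \<tau> \<le> z"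
      proof (cases "\<tau> \<le> z")
        case True
        then show ?thesis
          unfolding eventually_at_right_field by (intro exI[of _ "z + 1"]) auto
      next
        case False
        then show ?thesis
          unfolding eventually_at_right_field by (intro exI[of _ \<tau>]) auto
      qed
    qed
    then have "\<forall>\<^sub>F y in at_right z. F y = Lim (at_right z) f - (\<Sum>\<tau> | \<tau> \<in> T \<and> \<tau> \<le> z. jump f \<tau>)"
      using c(1)
      by eventually_elim (auto simp: F_def intro!: sum.cong)
    moreover have "Lim (at_right z) f - (\<Sum>\<tau> | \<tau> \<in> T \<and> \<tau> \<le> z. jump f \<tau>) = G z"
    proof (cases "z \<in> T")
      case True
      then have "{\<tau>. \<tau> \<in> T \<and> \<tau> \<le> z} = insert z {\<tau>. \<tau> \<in> T \<and> \<tau> < z}" by auto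
      then have "(\<Sum>\<tau> | \<tau> \<in> T \<and> \<tau> \<le> z. jump f \<tau>) = jump f z + (\<Sum>\<tau> | \<tau> \<in> T \<and> \<tau> < z. jump f \<tau>)"
        using T by simp
      then show ?thesis by (simp add: G_def jump_def)
    next
      case False
      then have "{\<tau>. \<tau> \<in> T \<and> \<tau> \<le> z} = {\<tau>. \<tau> \<in> T \<and> \<tau> < z}" by (auto simp: less_le)
      then show ?thesis using side[of z] False z by (simp add: G_def)
    qed
    ultimately have "\<forall>\<^sub>F y in at_right z. F y = G z" by simp
    with left show ?thesis by (simp add: eventually_at_split)
  qed
  have Gconst: "G x = G x0"
  proof (rule connected_local_const[of "{lo<..<hi}"])
    show "\<forall>a\<in>{lo<..<hi}. \<forall>\<^sub>F b in at a within {lo<..<hi}. G a = G b"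
    proof
      fix a assume a: "a \<in> {lo<..<hi}"
      then obtain S where S: "open S" "a \<in> S" "\<And>y. y \<in> S \<Longrightarrow> y \<noteq> a \<Longrightarrow> F y = G a"
        using FG[OF a] unfolding eventually_at_topological by blast
      have "G a = G b" if "b \<in> S" "b \<noteq> a" "b \<in> {lo<..<hi}" for b
      proof -
        have "\<forall>\<^sub>F y in at b. F y = G a"
          unfolding eventually_at_topological using S that
          by (intro exI[of _ "S - {a}"]) auto
        with FG[OF that(3)] have "\<forall>\<^sub>F y in at b. G a = G b" by eventually_elim simp
        then show ?thesis by simp
      qed
      then show "\<forall>\<^sub>F b in at a within {lo<..<hi}. G a = G b"
        unfolding eventually_at_topological using S by blast
    qed
  qed (use x x0 in auto)
  have x0T: "x0 \<notin> T" using x0(2) by blast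
  have e: "{\<tau>. \<tau> \<in> T \<and> \<tau> < x0} = {}" using x0(2) by (auto dest: less_asym)
  have "G x0 = f x0" using side[of x0] x0 x0T unfolding G_def e by simp
  moreover have "G x = f x - (\<Sum>\<tau> | \<tau> \<in> T \<and> \<tau> < x. jump f \<tau>)" using side[of x] x by (simp add: G_def)
  ultimately show ?thesis using Gconst by simp
qed

section \<open>Separated sets of points\<close>

definition cell :: "real \<Rightarrow> complex \<Rightarrow> int \<times> int" where
  "cell \<epsilon> z = (\<lfloor>Re z / \<epsilon>\<rfloor>, \<lfloor>Im z / \<epsilon>\<rfloor>)"

definition separated :: "complex set \<Rightarrow> real \<Rightarrow> bool" where
  "separated Z \<epsilon> \<longleftrightarrow> (\<forall>\<sigma>\<in>Z. \<forall>\<tau>\<in>Z. \<sigma> \<noteq> \<tau> \<longrightarrow> 5 * \<epsilon> \<le> dist \<sigma> \<tau>)"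

text \<open>Two points in one square of side \<epsilon> are at distance at most 2 \<epsilon>, less
  than 5 \<epsilon>. Counting and summing over Z thereby reduce to the integer lattice.\<close>

lemma inj_on_cell:
  assumes "separated Z \<epsilon>" "0 < \<epsilon>"
  shows "inj_on (cell \<epsilon>) Z"
proof (rule inj_onI, rule ccontr)
  fix \<sigma> \<tau> assume *: "\<sigma> \<in> Z" "\<tau> \<in> Z" "cell \<epsilon> \<sigma> = cell \<epsilon> \<tau>" "\<sigma> \<noteq> \<tau>"
  have close: "\<bar>a - b\<bar> \<le> \<epsilon>" if "\<lfloor>a / \<epsilon>\<rfloor> = \<lfloor>b / \<epsilon>\<rfloor>" for a b
  proof -
    have "\<bar>a / \<epsilon> - b / \<epsilon>\<bar> \<le> 1" using that by linarith
    then have "\<bar>(a - b) / \<epsilon>\<bar> \<le> 1" by (simp add: diff_divide_distrib)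
    then show ?thesis using assms(2) by (simp add: abs_divide)
  qed
  have "dist \<sigma> \<tau> \<le> \<bar>Re \<sigma> - Re \<tau>\<bar> + \<bar>Im \<sigma> - Im \<tau>\<bar>"
    unfolding dist_norm using cmod_le[of "\<sigma> - \<tau>"] by simp
  also have "\<dots> \<le> \<epsilon> + \<epsilon>"
    using *(3) by (intro add_mono close) (auto simp: cell_def)
  finally show False using * assms unfolding separated_def by force
qed

lemma finite_separated_bounded:
  assumes "separated Z \<epsilon>" "0 < \<epsilon>"
  shows "finite {\<sigma>\<in>Z. norm \<sigma> \<le> R}"
proof (rule inj_on_finite)
  show "inj_on (cell \<epsilon>) {\<sigma>\<in>Z. norm \<sigma> \<le> R}"
    by (rule inj_on_subset[OF inj_on_cell[OF assms]]) auto
  have fl: "\<lfloor>a / \<epsilon>\<rfloor> \<in> {\<lfloor>- R / \<epsilon>\<rfloor>..\<lfloor>R / \<epsilon>\<rfloor>}" if "\<bar>a\<bar> \<le> R" for a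
    using that assms(2)
    by (simp only: atLeastAtMost_iff) (intro conjI floor_mono divide_right_mono, auto)
  have "cell \<epsilon> \<sigma> \<in> {\<lfloor>- R / \<epsilon>\<rfloor>..\<lfloor>R / \<epsilon>\<rfloor>} \<times> {\<lfloor>- R / \<epsilon>\<rfloor>..\<lfloor>R / \<epsilon>\<rfloor>}" if "norm \<sigma> \<le> R" for \<sigma>
    using abs_Re_le_cmod[of \<sigma>] abs_Im_le_cmod[of \<sigma>] that unfolding cell_def by (intro SigmaI fl) auto
  then show "cell \<epsilon> ` {\<sigma>\<in>Z. norm \<sigma> \<le> R} \<subseteq> {\<lfloor>- R / \<epsilon>\<rfloor>..\<lfloor>R / \<epsilon>\<rfloor>} \<times> {\<lfloor>- R / \<epsilon>\<rfloor>..\<lfloor>R / \<epsilon>\<rfloor>}" by blast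
qed auto

text \<open>Telescoping bounds the sum over the natural numbers by 2, and two copies cover the
  integers.\<close>

lemma sum_inverse_squares_int:
  assumes "finite (J :: int set)"
  shows "(\<Sum>j\<in>J. 1 / (1 + \<bar>real_of_int j\<bar>) ^ 2) \<le> 4"
proof -
  have nat: "(\<Sum>k\<le>N. 1 / (1 + real k) ^ 2) \<le> 2 - 1 / (real N + 1)" for N
  proof (induction N)
    case 0
    then show ?case by simp
  next
    case (Suc N)
    have "1 / (1 + real (Suc N)) ^ 2 \<le> 1 / (real N + 1) - 1 / (real (Suc N) + 1)"
      by (simp add: divide_simps power2_eq_square)
    then show ?case using Suc by simp
  qed
  obtain N where N: "\<And>j. j \<in> J \<Longrightarrow> nat \<bar>j\<bar> \<le> N"
    using finite_nat_set_iff_bounded_le[of "(\<lambda>j. nat \<bar>j\<bar>) ` J"] assms by auto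
  let ?u = "\<lambda>j. 1 / (1 + \<bar>real_of_int j\<bar>) ^ 2"
  have "J \<subseteq> int ` {..N} \<union> (\<lambda>k. - int k) ` {..N}"
  proof
    fix j assume "j \<in> J"
    then have "nat \<bar>j\<bar> \<in> {..N}" using N by simp
    moreover have "j = int (nat \<bar>j\<bar>) \<or> j = - int (nat \<bar>j\<bar>)" by linarith
    ultimately show "j \<in> int ` {..N} \<union> (\<lambda>k. - int k) ` {..N}" by blast
  qed
  then have "(\<Sum>j\<in>J. ?u j) \<le> (\<Sum>j\<in>int ` {..N} \<union> (\<lambda>k. - int k) ` {..N}. ?u j)"
    by (intro sum_mono2) auto
  also have "\<dots> \<le> (\<Sum>j\<in>int ` {..N}. ?u j) + (\<Sum>j\<in>(\<lambda>k. - int k) ` {..N}. ?u j)"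
    by (subst sum_Un) (auto intro!: sum_nonneg)
  also have "\<dots> = (\<Sum>k\<le>N. 1 / (1 + real k) ^ 2) + (\<Sum>k\<le>N. 1 / (1 + real k) ^ 2)"
    by (subst (1 2) sum.reindex) (auto simp: inj_on_def)
  also have "\<dots> \<le> 4"
  proof -
    have "2 - 1 / (real N + 1) \<le> 2" by simp
    then show ?thesis using nat[of N] by linarith
  qed
  finally show ?thesis .
qed

text \<open>Cell coordinates satisfy
  \<open>1 + \<bar>j\<bar> \<le> 3 * norm \<sigma> / \<epsilon>\<close>, so four powers of the
  modulus are absorbed by the product of two inverse squares at the cost of
  \<open>81 / \<epsilon> ^ 4\<close>, and the other two powers give \<open>1 / R ^ 2\<close>. The
  lattice sum is at most 4 * 4, and 81 * 16 = 1296.\<close>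

lemma separated_tail_sum:
  assumes Z: "separated Z \<epsilon>" "0 < \<epsilon>" and F: "finite F" "F \<subseteq> Z"
    and R: "\<epsilon> \<le> R" "\<And>\<sigma>. \<sigma> \<in> F \<Longrightarrow> R \<le> norm \<sigma>"
  shows "(\<Sum>\<sigma>\<in>F. 1 / norm \<sigma> ^ 6) \<le> 1296 / \<epsilon> ^ 4 / R ^ 2"
proof -
  let ?u = "\<lambda>j. 1 / (1 + \<bar>real_of_int j\<bar>) ^ 2"
  let ?w = "\<lambda>(j, k). ?u j * ?u k"
  have "0 < R" using R(1) Z(2) by simp
  have le: "1 / norm \<sigma> ^ 6 \<le> 81 / \<epsilon> ^ 4 / R ^ 2 * ?w (cell \<epsilon> \<sigma>)" if "\<sigma> \<in> F" for \<sigma>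
  proof -
    have n: "R \<le> norm \<sigma>" "\<epsilon> \<le> norm \<sigma>" "0 < norm \<sigma>" using R R(2)[OF that] \<open>0 < R\<close> by auto
    have fl: "1 + \<bar>real_of_int \<lfloor>a / \<epsilon>\<rfloor>\<bar> \<le> 3 * norm \<sigma> / \<epsilon>" if "\<bar>a\<bar> \<le> norm \<sigma>" for a
    proof -
      have "\<bar>a / \<epsilon>\<bar> \<le> norm \<sigma> / \<epsilon>" using that Z(2) by (simp add: abs_divide divide_right_mono)
      moreover have "1 \<le> norm \<sigma> / \<epsilon>" using n Z(2) by simp
      moreover have "\<bar>real_of_int \<lfloor>a / \<epsilon>\<rfloor>\<bar> \<le> \<bar>a / \<epsilon>\<bar> + 1" by linarith
      ultimately show ?thesis by simp
    qed
    obtain j k where jk: "cell \<epsilon> \<sigma> = (j, k)" by fastforce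
    have j: "1 + \<bar>real_of_int j\<bar> \<le> 3 * norm \<sigma> / \<epsilon>" and k: "1 + \<bar>real_of_int k\<bar> \<le> 3 * norm \<sigma> / \<epsilon>"
      using jk fl[OF abs_Re_le_cmod] fl[OF abs_Im_le_cmod] by (auto simp: cell_def)
    have "(1 + \<bar>real_of_int j\<bar>) ^ 2 * (1 + \<bar>real_of_int k\<bar>) ^ 2 \<le> (3 * norm \<sigma> / \<epsilon>) ^ 2 * (3 * norm \<sigma> / \<epsilon>) ^ 2"
      using j k by (intro mult_mono power_mono) auto
    also have "\<dots> = 81 / \<epsilon> ^ 4 * norm \<sigma> ^ 4" by (simp add: power_divide power_mult_distrib)
    finally have le4: "(1 + \<bar>real_of_int j\<bar>) ^ 2 * (1 + \<bar>real_of_int k\<bar>) ^ 2 \<le> 81 / \<epsilon> ^ 4 * norm \<sigma> ^ 4" .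
    have R2: "R ^ 2 \<le> norm \<sigma> ^ 2" using n \<open>0 < R\<close> by (intro power_mono) auto
    have 1: "(1 + \<bar>real_of_int j\<bar>) ^ 2 * (1 + \<bar>real_of_int k\<bar>) ^ 2 * R ^ 2 \<le> 81 / \<epsilon> ^ 4 * norm \<sigma> ^ 4 * norm \<sigma> ^ 2"
      by (rule mult_mono[OF le4 R2]) (use Z(2) in auto)
    have pos: "0 < (1 + \<bar>real_of_int j\<bar>) ^ 2 * (1 + \<bar>real_of_int k\<bar>) ^ 2 * R ^ 2"
      using \<open>0 < R\<close> by (intro mult_pos_pos zero_less_power) (auto intro: add_pos_nonneg)
    have "1 / norm \<sigma> ^ 6 = 81 / \<epsilon> ^ 4 / (81 / \<epsilon> ^ 4 * norm \<sigma> ^ 4 * norm \<sigma> ^ 2)"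
      using n Z(2) by (simp add: power_add[symmetric])
    also have "\<dots> \<le> 81 / \<epsilon> ^ 4 / ((1 + \<bar>real_of_int j\<bar>) ^ 2 * (1 + \<bar>real_of_int k\<bar>) ^ 2 * R ^ 2)"
      using 1 pos Z(2) n by (intro divide_left_mono mult_pos_pos) auto
    also have "\<dots> = 81 / \<epsilon> ^ 4 / R ^ 2 * ?w (cell \<epsilon> \<sigma>)" by (simp add: jk)
    finally show ?thesis .
  qed
  have inj: "inj_on (cell \<epsilon>) F" using inj_on_cell[OF Z] F(2) inj_on_subset by blast
  let ?J = "fst ` cell \<epsilon> ` F" and ?K = "snd ` cell \<epsilon> ` F"
  have "(\<Sum>\<sigma>\<in>F. ?w (cell \<epsilon> \<sigma>)) = (\<Sum>p\<in>cell \<epsilon> ` F. ?w p)"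
    by (subst sum.reindex[OF inj]) simp
  also have "\<dots> \<le> (\<Sum>p\<in>?J \<times> ?K. ?w p)"
    using F(1) by (intro sum_mono2) (auto simp: image_iff intro: rev_bexI, (metis fst_conv snd_conv)+)
  also have "\<dots> = (\<Sum>j\<in>?J. ?u j) * (\<Sum>k\<in>?K. ?u k)"
    by (simp only: sum_product sum.cartesian_product)
  also have "\<dots> \<le> 4 * 4"
    using F(1) by (intro mult_mono sum_inverse_squares_int sum_nonneg) auto
  finally have 16: "(\<Sum>\<sigma>\<in>F. ?w (cell \<epsilon> \<sigma>)) \<le> 16" by simp
  have "(\<Sum>\<sigma>\<in>F. 1 / norm \<sigma> ^ 6) \<le> (\<Sum>\<sigma>\<in>F. 81 / \<epsilon> ^ 4 / R ^ 2 * ?w (cell \<epsilon> \<sigma>))"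
    by (intro sum_mono le)
  also have "\<dots> = 81 / \<epsilon> ^ 4 / R ^ 2 * (\<Sum>\<sigma>\<in>F. ?w (cell \<epsilon> \<sigma>))" by (simp only: sum_distrib_left)
  also have "\<dots> \<le> 81 / \<epsilon> ^ 4 / R ^ 2 * 16"
    using Z(2) 16 by (intro mult_left_mono) auto
  finally show ?thesis by simp
qed

lemma card_int_interval_le:
  assumes "a \<le> b"
  shows "real (card {\<lfloor>a\<rfloor>..\<lfloor>b\<rfloor>}) \<le> b - a + 2"
  using assms floor_mono[OF assms] by simp linarith

text \<open>Each point occupies a cell of its own, and the cells meeting the two symmetric
  rectangles are counted by side lengths.\<close>

lemma separated_count:
  assumes Z: "separated Z \<epsilon>" "0 < \<epsilon>" and F: "finite F" "F \<subseteq> Z"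
    and l: "0 \<le> l" and a: "a \<le> b"
    and box: "\<And>\<sigma>. \<sigma> \<in> F \<Longrightarrow> \<bar>Im \<sigma>\<bar> \<le> l \<and> a \<le> \<bar>Re \<sigma>\<bar> \<and> \<bar>Re \<sigma>\<bar> \<le> b"
  shows "real (card F) \<le> 2 * ((b - a) / \<epsilon> + 2) * (2 * l / \<epsilon> + 2)"
proof -
  let ?J1 = "{\<lfloor>a / \<epsilon>\<rfloor>..\<lfloor>b / \<epsilon>\<rfloor>}" and ?J2 = "{\<lfloor>- b / \<epsilon>\<rfloor>..\<lfloor>- a / \<epsilon>\<rfloor>}" and ?K = "{\<lfloor>- l / \<epsilon>\<rfloor>..\<lfloor>l / \<epsilon>\<rfloor>}"
  have "cell \<epsilon> \<sigma> \<in> (?J1 \<union> ?J2) \<times> ?K" if "\<sigma> \<in> F" for \<sigma>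
  proof -
    have "\<lfloor>Re \<sigma> / \<epsilon>\<rfloor> \<in> ?J1 \<union> ?J2"
    proof (cases "0 \<le> Re \<sigma>")
      case True
      then have "a \<le> Re \<sigma>" "Re \<sigma> \<le> b" using box[OF that] by auto
      then have "\<lfloor>Re \<sigma> / \<epsilon>\<rfloor> \<in> ?J1" using Z(2) by (simp add: floor_mono divide_right_mono)
      then show ?thesis by blast
    next
      case False
      then have "- b \<le> Re \<sigma>" "Re \<sigma> \<le> - a" using box[OF that] by auto
      then have "\<lfloor>Re \<sigma> / \<epsilon>\<rfloor> \<in> ?J2" using Z(2)
        by (simp only: atLeastAtMost_iff) (intro conjI floor_mono divide_right_mono, auto)
      then show ?thesis by blast
    qed
    moreover have "\<lfloor>Im \<sigma> / \<epsilon>\<rfloor> \<in> ?K"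
      using box[OF that] Z(2) by (simp only: atLeastAtMost_iff) (intro conjI floor_mono divide_right_mono, auto)
    ultimately show ?thesis by (simp add: cell_def)
  qed
  then have "cell \<epsilon> ` F \<subseteq> (?J1 \<union> ?J2) \<times> ?K" by blast
  moreover have "inj_on (cell \<epsilon>) F" using inj_on_cell[OF Z] F(2) inj_on_subset by blast
  ultimately have "card F \<le> card ((?J1 \<union> ?J2) \<times> ?K)"
    by (intro card_inj_on_le) auto
  also have "\<dots> \<le> (card ?J1 + card ?J2) * card ?K"
    unfolding card_cartesian_product by (intro mult_right_mono card_Un_le) auto
  finally have "real (card F) \<le> (real (card ?J1) + real (card ?J2)) * real (card ?K)"
    by (metis of_nat_add of_nat_le_iff of_nat_mult)
  also have "\<dots> \<le> (((b - a) / \<epsilon> + 2) + ((b - a) / \<epsilon> + 2)) * (2 * l / \<epsilon> + 2)"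
  proof -
    have ab: "a / \<epsilon> \<le> b / \<epsilon>" "- b / \<epsilon> \<le> - a / \<epsilon>" "- l / \<epsilon> \<le> l / \<epsilon>"
      using a l Z(2) by (auto simp: divide_right_mono)
    have "real (card ?J1) \<le> (b - a) / \<epsilon> + 2" "real (card ?J2) \<le> (b - a) / \<epsilon> + 2" "real (card ?K) \<le> 2 * l / \<epsilon> + 2"
      using card_int_interval_le[OF ab(1)] card_int_interval_le[OF ab(2)] card_int_interval_le[OF ab(3)]
      by (simp_all add: diff_divide_distrib)
    moreover have "0 \<le> (b - a) / \<epsilon>" using a Z(2) by simp
    ultimately show ?thesis
      by (intro mult_mono add_mono add_nonneg_nonneg) (assumption | simp)+
  qed
  also have "\<dots> = 2 * ((b - a) / \<epsilon> + 2) * (2 * l / \<epsilon> + 2)" by simp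
  finally show ?thesis .
qed

text \<open>These are the points whose discs a truncation can cut. Those with
  \<open>s * Im \<sigma> \<ge> sqrt (norm \<sigma>)\<close> have exponentially small weight and form
  a convergent tail. The lower ones near the circle of radius A have
  \<open>\<bar>Re \<sigma>\<bar>\<close> in an interval of fixed length about A, so there are O(sqrt
  A) of them, each of weight O(1/A). Points near the imaginary axis are of the first kind, since
  their height is comparable to their modulus.\<close>

lemma separated_boundary_sum:
  fixes s y \<epsilon> :: real
  assumes Z: "separated Z \<epsilon>" "0 < \<epsilon>" and s: "s = 1 \<or> s = -1" and y: "0 < y" and \<eta>: "0 < \<eta>"
  shows "\<exists>R0. \<forall>A\<ge>R0. \<forall>B\<ge>R0. \<forall>F. finite F \<longrightarrow>
    F \<subseteq> {\<sigma>\<in>Z. - 2 * \<epsilon> \<le> s * Im \<sigma> \<and> (\<bar>norm \<sigma> - A\<bar> \<le> 2 * \<epsilon> \<or> \<bar>norm \<sigma> - B\<bar> \<le> 2 * \<epsilon> \<or>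
      (\<bar>Re \<sigma>\<bar> \<le> 2 * \<epsilon> \<and> min A B - 2 * \<epsilon> \<le> norm \<sigma>))} \<longrightarrow>
    (\<Sum>\<sigma>\<in>F. exp (- y * (s * Im \<sigma>)) / norm \<sigma>) \<le> \<eta>"
proof -
  let ?w = "\<lambda>\<sigma>. exp (- y * (s * Im \<sigma>)) / norm \<sigma>"
  \<comment> \<open>Number of points times largest weight: a box of width
    \<open>4 * \<epsilon> + 1\<close> with heights up to \<open>sqrt (A + 2 * \<epsilon>)\<close>,
    and the factor \<open>exp (2 * \<epsilon> * y)\<close> because points may lie
    \<open>2 * \<epsilon>\<close> below the axis.\<close>
  define q where "q A = (2 * ((4 * \<epsilon> + 1) / \<epsilon> + 2) * (2 * sqrt (A + 2 * \<epsilon>) / \<epsilon> + 2)) * (exp (2 * \<epsilon> * y) / (A - 2 * \<epsilon>))" for A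
  have "\<forall>\<^sub>F r in at_top. r ^ 5 * exp (- y * sqrt r) \<le> 1"
    using y by real_asymp
  moreover have "\<forall>\<^sub>F r in at_top. sqrt r < r - 2 * \<epsilon>" by real_asymp
  moreover have "\<forall>\<^sub>F r in at_top. r \<ge> max 1 (max (3 * \<epsilon>) (4 * \<epsilon> ^ 2))" by (rule eventually_ge_at_top)
  ultimately have "\<forall>\<^sub>F r in at_top. r ^ 5 * exp (- y * sqrt r) \<le> 1 \<and> sqrt r < r - 2 * \<epsilon> \<and> r \<ge> max 1 (max (3 * \<epsilon>) (4 * \<epsilon> ^ 2))"
    by eventually_elim auto
  then obtain R1 where R1: "\<And>r. R1 \<le> r \<Longrightarrow> r ^ 5 * exp (- y * sqrt r) \<le> 1 \<and> sqrt r < r - 2 * \<epsilon> \<and> r \<ge> max 1 (max (3 * \<epsilon>) (4 * \<epsilon> ^ 2))"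
    unfolding eventually_at_top_linorder by blast
  have "((\<lambda>A. 1296 / \<epsilon> ^ 4 / (A - 2 * \<epsilon>) ^ 2) \<longlongrightarrow> 0) at_top" by real_asymp
  then have e1: "\<forall>\<^sub>F A in at_top. 1296 / \<epsilon> ^ 4 / (A - 2 * \<epsilon>) ^ 2 < \<eta> / 3"
    using \<eta> by (intro order_tendstoD(2)) auto
  have "(q \<longlongrightarrow> 0) at_top" unfolding q_def using Z(2) by real_asymp
  then have e2: "\<forall>\<^sub>F A in at_top. q A < \<eta> / 3"
    using \<eta> by (intro order_tendstoD(2)) auto
  have "\<forall>\<^sub>F A in at_top. 1296 / \<epsilon> ^ 4 / (A - 2 * \<epsilon>) ^ 2 < \<eta> / 3 \<and> q A < \<eta> / 3 \<and> A \<ge> max (R1 + 2 * \<epsilon>) (3 * \<epsilon>)"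
    using e1 e2 eventually_ge_at_top[of "max (R1 + 2 * \<epsilon>) (3 * \<epsilon>)"] by eventually_elim auto
  then obtain R0 where R0: "\<And>A. R0 \<le> A \<Longrightarrow> 1296 / \<epsilon> ^ 4 / (A - 2 * \<epsilon>) ^ 2 < \<eta> / 3 \<and> q A < \<eta> / 3 \<and> A \<ge> max (R1 + 2 * \<epsilon>) (3 * \<epsilon>)"
    unfolding eventually_at_top_linorder by blast
  show ?thesis
  proof (intro exI[of _ R0] allI impI)
    fix A B F assume A: "R0 \<le> A" and B: "R0 \<le> B" and F: "finite F"
      and sub: "F \<subseteq> {\<sigma>\<in>Z. - 2 * \<epsilon> \<le> s * Im \<sigma> \<and> (\<bar>norm \<sigma> - A\<bar> \<le> 2 * \<epsilon> \<or> \<bar>norm \<sigma> - B\<bar> \<le> 2 * \<epsilon> \<or>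
        (\<bar>Re \<sigma>\<bar> \<le> 2 * \<epsilon> \<and> min A B - 2 * \<epsilon> \<le> norm \<sigma>))}"
    define m where "m = min A B"
    have m: "R0 \<le> m" using A B by (simp add: m_def)
    have big: "m - 2 * \<epsilon> \<le> norm \<sigma>" if "\<sigma> \<in> F" for \<sigma>
      using sub that by (auto simp: m_def)
    have R1': "R1 \<le> norm \<sigma>" if "\<sigma> \<in> F" for \<sigma> using big[OF that] R0[OF m] by auto
    have absIm: "\<bar>s * Im \<sigma>\<bar> = \<bar>Im \<sigma>\<bar>" for \<sigma> using s by auto
    let ?P1 = "\<lambda>\<sigma>. sqrt (norm \<sigma>) \<le> s * Im \<sigma>"
    let ?PA = "\<lambda>A \<sigma>. s * Im \<sigma> < sqrt (norm \<sigma>) \<and> \<bar>norm \<sigma> - A\<bar> \<le> 2 * \<epsilon>"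
    have cases: "?P1 \<sigma> \<or> ?PA A \<sigma> \<or> ?PA B \<sigma>" if "\<sigma> \<in> F" for \<sigma>
    proof (rule ccontr)
      assume c: "\<not> (?P1 \<sigma> \<or> ?PA A \<sigma> \<or> ?PA B \<sigma>)"
      then have Re: "\<bar>Re \<sigma>\<bar> \<le> 2 * \<epsilon>" and im: "- 2 * \<epsilon> \<le> s * Im \<sigma>" using sub that by auto
      have r: "sqrt (norm \<sigma>) < norm \<sigma> - 2 * \<epsilon>" "norm \<sigma> \<ge> max 1 (max (3 * \<epsilon>) (4 * \<epsilon> ^ 2))"
        using R1[OF R1'[OF that]] by auto
      have "norm \<sigma> \<le> \<bar>Re \<sigma>\<bar> + \<bar>s * Im \<sigma>\<bar>" using cmod_le[of \<sigma>] absIm by simp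
      then have 1: "norm \<sigma> - 2 * \<epsilon> \<le> \<bar>s * Im \<sigma>\<bar>" using Re by simp
      have "2 * \<epsilon> \<le> sqrt (norm \<sigma>)" using r(2) by (intro real_le_rsqrt) (simp add: power_mult_distrib)
      then have "0 \<le> s * Im \<sigma>" using 1 r(1) im by auto
      then show False using c 1 r(1) by auto
    qed
    have w0: "0 \<le> ?w \<sigma>" for \<sigma> by simp
    have "(\<Sum>\<sigma>\<in>F. ?w \<sigma>) \<le> (\<Sum>\<sigma>\<in>F. (if ?P1 \<sigma> then ?w \<sigma> else 0) + (if ?PA A \<sigma> then ?w \<sigma> else 0) + (if ?PA B \<sigma> then ?w \<sigma> else 0))"
    proof (rule sum_mono)
      fix \<sigma> assume "\<sigma> \<in> F"
      then show "?w \<sigma> \<le> (if ?P1 \<sigma> then ?w \<sigma> else 0) + (if ?PA A \<sigma> then ?w \<sigma> else 0) + (if ?PA B \<sigma> then ?w \<sigma> else 0)"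
        using cases[of \<sigma>] w0[of \<sigma>] by (smt (verit))
    qed
    also have "\<dots> = (\<Sum>\<sigma>\<in>{\<sigma>\<in>F. ?P1 \<sigma>}. ?w \<sigma>) + (\<Sum>\<sigma>\<in>{\<sigma>\<in>F. ?PA A \<sigma>}. ?w \<sigma>) + (\<Sum>\<sigma>\<in>{\<sigma>\<in>F. ?PA B \<sigma>}. ?w \<sigma>)"
      using F by (simp only: sum.distrib sum.inter_filter)
    finally have le: "(\<Sum>\<sigma>\<in>F. ?w \<sigma>) \<le> (\<Sum>\<sigma>\<in>{\<sigma>\<in>F. ?P1 \<sigma>}. ?w \<sigma>) +
        (\<Sum>\<sigma>\<in>{\<sigma>\<in>F. ?PA A \<sigma>}. ?w \<sigma>) + (\<Sum>\<sigma>\<in>{\<sigma>\<in>F. ?PA B \<sigma>}. ?w \<sigma>)" .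
    have P1: "(\<Sum>\<sigma>\<in>{\<sigma>\<in>F. ?P1 \<sigma>}. ?w \<sigma>) \<le> \<eta> / 3"
    proof -
      have "(\<Sum>\<sigma>\<in>{\<sigma>\<in>F. ?P1 \<sigma>}. ?w \<sigma>) \<le> (\<Sum>\<sigma>\<in>{\<sigma>\<in>F. ?P1 \<sigma>}. 1 / norm \<sigma> ^ 6)"
      proof (rule sum_mono)
        fix \<sigma> assume \<sigma>: "\<sigma> \<in> {\<sigma>\<in>F. ?P1 \<sigma>}"
        let ?r = "norm \<sigma>"
        have r: "?r ^ 5 * exp (- y * sqrt ?r) \<le> 1" "1 \<le> ?r" using R1[OF R1'] \<sigma> by auto
        have "exp (- y * (s * Im \<sigma>)) \<le> exp (- y * sqrt ?r)" using \<sigma> y by simp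
        \<comment> \<open>The fifth power and the factor \<open>1 / norm \<sigma>\<close> combine to
          the sixth power in \<open>separated_tail_sum\<close>.\<close>
        also have "\<dots> \<le> 1 / ?r ^ 5"
          using r by (subst pos_le_divide_eq) (auto simp: mult.commute)
        finally have "?w \<sigma> \<le> 1 / ?r ^ 5 / ?r" using r by (intro divide_right_mono) auto
        also have "\<dots> = 1 / ?r ^ 6" by (simp add: power_Suc[symmetric] mult.commute del: power_Suc)
        finally show "?w \<sigma> \<le> 1 / ?r ^ 6" .
      qed
      also have "\<dots> \<le> 1296 / \<epsilon> ^ 4 / (m - 2 * \<epsilon>) ^ 2"
        using R0[OF m] F sub big Z by (intro separated_tail_sum[OF Z]) auto
      also have "\<dots> \<le> \<eta> / 3" using R0[OF m] by simp
      finally show ?thesis .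
    qed
    have PA: "(\<Sum>\<sigma>\<in>{\<sigma>\<in>F. ?PA A \<sigma>}. ?w \<sigma>) \<le> \<eta> / 3" if A: "R0 \<le> A" for A
    proof -
      let ?F = "{\<sigma>\<in>F. ?PA A \<sigma>}"
      have A3: "3 * \<epsilon> \<le> A" "A \<ge> R1 + 2 * \<epsilon>" using R0[OF A] by auto
      have "real (card ?F) \<le> 2 * ((A + 2 * \<epsilon> - (A - 2 * \<epsilon> - 1)) / \<epsilon> + 2) * (2 * sqrt (A + 2 * \<epsilon>) / \<epsilon> + 2)"
      proof (rule separated_count[OF Z])
        fix \<sigma> assume \<sigma>: "\<sigma> \<in> ?F"
        let ?r = "norm \<sigma>"
        have r: "1 \<le> ?r" "4 * \<epsilon> ^ 2 \<le> ?r" using R1[OF R1'[of \<sigma>]] \<sigma> by auto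
        have "2 * \<epsilon> \<le> sqrt ?r" using r(2) by (intro real_le_rsqrt) (simp add: power_mult_distrib)
        then have im: "\<bar>Im \<sigma>\<bar> \<le> sqrt ?r" using \<sigma> sub absIm[of \<sigma>] by auto
        \<comment> \<open>Here the square of Im is at most r, so modulus and
          \<open>\<bar>Re \<sigma>\<bar>\<close> differ by at most 1.\<close>
        have "(?r - 1) ^ 2 \<le> ?r ^ 2 - ?r" using r(1) by (simp add: power2_eq_square algebra_simps)
        also have "\<dots> \<le> ?r ^ 2 - (Im \<sigma>) ^ 2"
          using im r(1) abs_le_square_iff[of "Im \<sigma>" "sqrt ?r"] by simp
        also have "\<dots> = (Re \<sigma>) ^ 2" by (simp add: cmod_power2)
        finally have "?r - 1 \<le> \<bar>Re \<sigma>\<bar>" using r(1) abs_le_square_iff[of "?r - 1" "Re \<sigma>"] by simp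
        moreover have "A - 2 * \<epsilon> \<le> ?r" "?r \<le> A + 2 * \<epsilon>" using \<sigma> by auto
        moreover have "sqrt ?r \<le> sqrt (A + 2 * \<epsilon>)" using \<open>?r \<le> A + 2 * \<epsilon>\<close> by simp
        ultimately show "\<bar>Im \<sigma>\<bar> \<le> sqrt (A + 2 * \<epsilon>) \<and> A - 2 * \<epsilon> - 1 \<le> \<bar>Re \<sigma>\<bar> \<and> \<bar>Re \<sigma>\<bar> \<le> A + 2 * \<epsilon>"
          using im abs_Re_le_cmod[of \<sigma>] by linarith
      qed (use F sub A3 Z in auto)
      then have card: "real (card ?F) \<le> 2 * ((4 * \<epsilon> + 1) / \<epsilon> + 2) * (2 * sqrt (A + 2 * \<epsilon>) / \<epsilon> + 2)"
        by (simp add: algebra_simps)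
      have "(\<Sum>\<sigma>\<in>?F. ?w \<sigma>) \<le> real (card ?F) * (exp (2 * \<epsilon> * y) / (A - 2 * \<epsilon>))"
      proof (rule sum_bounded_above)
        fix \<sigma> assume \<sigma>: "\<sigma> \<in> ?F"
        have "- 2 * \<epsilon> \<le> s * Im \<sigma>" using \<sigma> sub by auto
        then have "y * (- 2 * \<epsilon>) \<le> y * (s * Im \<sigma>)" using y by (intro mult_left_mono) auto
        then have "- y * (s * Im \<sigma>) \<le> 2 * \<epsilon> * y" by (simp add: algebra_simps)
        then show "?w \<sigma> \<le> exp (2 * \<epsilon> * y) / (A - 2 * \<epsilon>)"
          using \<sigma> A3 Z(2) by (intro frac_le) auto
      qed
      also have "\<dots> \<le> q A"
        unfolding q_def using A3 Z(2) by (intro mult_right_mono card) auto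
      also have "\<dots> \<le> \<eta> / 3" using R0[OF A] by simp
      finally show ?thesis .
    qed
    show "(\<Sum>\<sigma>\<in>F. ?w \<sigma>) \<le> \<eta>"
      using le P1 PA[OF A] PA[OF B] by linarith
  qed
qed

section \<open>Integrals over pieces of curves\<close>

text \<open>The fundamental theorem on the parameter interval where the curve is in S. The primitive
  is needed on that stretch only, and the finite exceptional set settles end points and
  tangencies.\<close>

lemma has_contour_integral_piece:
  assumes c: "\<And>t. (c has_vector_derivative c' t) (at t)"
    and G: "\<And>t. t1 \<le> t \<Longrightarrow> t \<le> t2 \<Longrightarrow> (G has_field_derivative g (c t)) (at (c t))"
    and t: "0 \<le> t1" "t1 \<le> t2" "t2 \<le> 1"
    and E: "finite E" "\<And>t. t \<in> {0..1} - E \<Longrightarrow> c t \<in> S \<longleftrightarrow> t1 < t \<and> t < t2"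
  shows "((\<lambda>z. if z \<in> S then g z else 0) has_contour_integral (G (c t2) - G (c t1))) c"
proof -
  have vd: "vector_derivative c (at t) = c' t" for t
    using c by (rule vector_derivative_at)
  have "((\<lambda>t. g (c t) * c' t) has_integral (G \<circ> c) t2 - (G \<circ> c) t1) {t1..t2}"
  proof (rule fundamental_theorem_of_calculus[OF t(2)])
    fix t assume "t \<in> {t1..t2}"
    then have "((G \<circ> c) has_vector_derivative c' t * g (c t)) (at t)"
      using G by (intro field_vector_diff_chain_at c) auto
    then show "((G \<circ> c) has_vector_derivative g (c t) * c' t) (at t within {t1..t2})"
      by (simp add: mult.commute has_vector_derivative_at_within)
  qed
  then have "((\<lambda>t. if t \<in> {t1..t2} then g (c t) * c' t else 0) has_integral G (c t2) - G (c t1)) {0..1}"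
    using t by (subst has_integral_restrict) auto
  then have "((\<lambda>t. (if c t \<in> S then g (c t) else 0) * vector_derivative c (at t)) has_integral G (c t2) - G (c t1)) {0..1}"
  proof (rule has_integral_spike[of "E \<union> {t1, t2}", rotated 2])
    show "negligible (E \<union> {t1, t2})" using E(1) by (intro negligible_finite) auto
    fix t assume "t \<in> {0..1} - (E \<union> {t1, t2})"
    then show "(if c t \<in> S then g (c t) else 0) * vector_derivative c (at t) = (if t \<in> {t1..t2} then g (c t) * c' t else 0)"
      using E(2)[of t] by (auto simp: vd)
  qed
  then show ?thesis by (simp add: has_contour_integral)
qed

lemma has_contour_integral_off_finite:
  assumes "finite E" "\<And>t. t \<in> {0..1} - E \<Longrightarrow> c t \<notin> S"
  shows "((\<lambda>z. if z \<in> S then g z else 0) has_contour_integral 0) c"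
  unfolding has_contour_integral
proof (rule has_integral_spike[of E _ _ "\<lambda>_. 0"])
  show "negligible E" using assms(1) by (rule negligible_finite)
qed (use assms(2) in auto)

text \<open>A closed circle may start at any angle, so the seam can be put where it does not
  interrupt the arc under study.\<close>

lemma has_contour_integral_rotate_circle:
  assumes I: "(f has_contour_integral I) (part_circlepath \<sigma> r (\<phi> - pi) (\<phi> + pi))" and \<phi>: "- pi \<le> \<phi>" "\<phi> \<le> pi"
  shows "(f has_contour_integral I) (circlepath \<sigma> r)"
proof -
  \<comment> \<open>At this fraction of the full turn the path has reached angle 0.\<close>
  define a where "a = (pi - \<phi>) / (2 * pi)"
  have a: "a \<in> {0..1}" using \<phi> by (auto simp: a_def field_simps)
  let ?P = "part_circlepath \<sigma> r (\<phi> - pi) (\<phi> + pi)"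
  have P: "?P x = \<sigma> + of_real r * cis (\<phi> - pi + 2 * pi * x)" for x
  proof -
    have "linepath (\<phi> - pi) (\<phi> + pi) x = \<phi> - pi + 2 * pi * x"
      by (simp add: linepath_def algebra_simps)
    then show ?thesis by (simp only: part_circlepath_def cis_conv_exp)
  qed
  have C: "circlepath \<sigma> r x = \<sigma> + of_real r * cis (2 * pi * x)" for x
  proof -
    have "linepath 0 (2 * pi) x = 2 * pi * x" by (simp add: linepath_def algebra_simps)
    then show ?thesis by (simp only: circlepath_def part_circlepath_def cis_conv_exp)
  qed
  have "shiftpath a ?P = circlepath \<sigma> r"
  proof
    fix t
    have e: "\<phi> - pi + 2 * pi * (a + t) = 2 * pi * t" by (simp add: a_def field_simps)
    have e': "\<phi> - pi + 2 * pi * (a + t - 1) = 2 * pi * t - 2 * pi"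
      using e by (simp add: algebra_simps)
    have "cis (2 * pi * t - 2 * pi) = cis (2 * pi * t)" by (simp add: cis_divide[symmetric])
    then show "shiftpath a ?P t = circlepath \<sigma> r t"
      unfolding shiftpath_def P C e e' by simp
  qed
  with has_contour_integral_shiftpath[OF I valid_path_part_circlepath a] show ?thesis by simp
qed

lemma has_vector_derivative_ray:
  "(linepath 0 (of_real R * u) has_vector_derivative of_real R * u) (at t)" for u :: complex
  using has_vector_derivative_linepath_within[of 0 "of_real R * u" t UNIV] by simp

lemma has_contour_integral_ray:
  fixes u :: complex
  assumes R: "0 < R" and r: "0 \<le> r1" "r1 \<le> r2" "r2 \<le> R"
    and G: "\<And>\<rho>. r1 \<le> \<rho> \<Longrightarrow> \<rho> \<le> r2 \<Longrightarrow> (G has_field_derivative g (of_real \<rho> * u)) (at (of_real \<rho> * u))"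
    and E: "finite E" "\<And>\<rho>. \<rho> \<in> {0..R} - E \<Longrightarrow> of_real \<rho> * u \<in> S \<longleftrightarrow> r1 < \<rho> \<and> \<rho> < r2"
  shows "((\<lambda>z. if z \<in> S then g z else 0) has_contour_integral (G (of_real r2 * u) - G (of_real r1 * u))) (linepath 0 (of_real R * u))"
proof -
  let ?c = "linepath 0 (of_real R * u)"
  have c: "?c t = of_real (R * t) * u" for t by (simp add: linepath_def scaleR_conv_of_real mult_ac)
  have "((\<lambda>z. if z \<in> S then g z else 0) has_contour_integral (G (?c (r2 / R)) - G (?c (r1 / R)))) ?c"
  proof (rule has_contour_integral_piece[OF has_vector_derivative_ray, where E = "(\<lambda>\<rho>. \<rho> / R) ` E"])
    show "(G has_field_derivative g (?c t)) (at (?c t))" if "r1 / R \<le> t" "t \<le> r2 / R" for t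
      unfolding c using that R by (intro G) (auto simp: field_simps)
    fix t assume t: "t \<in> {0..1} - (\<lambda>\<rho>. \<rho> / R) ` E"
    have "R * t \<notin> E"
    proof
      assume "R * t \<in> E"
      then have "R * t / R \<in> (\<lambda>\<rho>. \<rho> / R) ` E" by blast
      then show False using t R by simp
    qed
    then have "R * t \<in> {0..R} - E" using t R by auto
    from E(2)[OF this] show "?c t \<in> S \<longleftrightarrow> r1 / R < t \<and> t < r2 / R"
      unfolding c using R by (simp add: field_simps)
  qed (use R r E in \<open>auto simp: field_simps\<close>)
  moreover have "?c (r2 / R) = of_real r2 * u" "?c (r1 / R) = of_real r1 * u"
    unfolding c using R by simp_all
  ultimately show ?thesis by (simp only:)
qed

text \<open>The chord runs from \<open>(p - h) * u\<close> to \<open>(p + h) * u\<close>, and the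
  arc to the left of the ray runs back, so the two integrals are opposite increments of G. Here p
  and q are the coordinates of \<sigma> relative to the direction u. The condition
  \<open>r ^ 2 < p ^ 2 + q ^ 2\<close> keeps 0 outside the disc, so together with p > 0 the chord
  lies on the ray itself. If the ray does not enter the open disc, both integrals are 0.\<close>

lemma half_plane_chord:
  fixes \<sigma> u :: complex
  assumes u: "norm u = 1" and \<sigma>: "\<sigma> = u * Complex p q" and p: "0 < p" and r: "0 < r" "r ^ 2 < p ^ 2 + q ^ 2"
    and R: "norm \<sigma> + r \<le> R"
    and G: "\<And>z. z \<in> cball \<sigma> r \<Longrightarrow> (G has_field_derivative g z) (at z)"
  shows "\<exists>I. ((\<lambda>z. if z \<in> cball \<sigma> r then g z else 0) has_contour_integral I) (linepath 0 (of_real R * u)) \<and>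
     ((\<lambda>z. if z \<in> {z. 0 < Im (z * cnj u)} then g z else 0) has_contour_integral (- I)) (circlepath \<sigma> r)"
proof -
  have R0: "0 < R" using R r norm_ge_zero[of \<sigma>] by linarith
  have uu: "u * cnj u = 1" using u by (simp add: complex_norm_square[symmetric])
  \<comment> \<open>The circle is started at \<open>\<sigma> - \<i> * r * u\<close>, its point
    farthest to the right of the ray, so that the arc on the left is a single parameter
    interval.\<close>
  define \<phi> where "\<phi> = Arg (\<i> * u)"
  have \<phi>: "- pi \<le> \<phi>" "\<phi> \<le> pi" using Arg_bounded[of "\<i> * u"] by (auto simp: \<phi>_def)
  have cis\<phi>: "cis \<phi> = \<i> * u"
    unfolding \<phi>_def using u by (subst cis_Arg) (auto simp: sgn_eq norm_mult)
  let ?P = "part_circlepath \<sigma> r (\<phi> - pi) (\<phi> + pi)"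
  have P: "?P t = \<sigma> + of_real r * (\<i> * u * cis (2 * pi * t - pi))" for t
  proof -
    have "linepath (\<phi> - pi) (\<phi> + pi) t = \<phi> + (2 * pi * t - pi)"
      by (simp add: linepath_def algebra_simps)
    then show ?thesis unfolding part_circlepath_def by (simp only: cis_conv_exp[symmetric] cis\<phi>[symmetric] cis_mult)
  qed
  have P': "?P t * cnj u = Complex (p - r * sin (2 * pi * t - pi)) (q + r * cos (2 * pi * t - pi))" for t
  proof -
    have "?P t * cnj u = (u * cnj u) * (Complex p q + of_real r * (\<i> * cis (2 * pi * t - pi)))"
      unfolding P unfolding \<sigma> by (simp only: distrib_left distrib_right mult_ac)
    then show ?thesis unfolding uu by (simp add: complex_eq_iff)
  qed
  have Pu: "?P t = u * Complex (p - r * sin (2 * pi * t - pi)) (q + r * cos (2 * pi * t - pi))" for t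
    using P'[of t] uu by (metis mult.assoc mult.commute mult_1)
  have ImP: "?P t \<in> {z. 0 < Im (z * cnj u)} \<longleftrightarrow> 0 < q + r * cos (2 * pi * t - pi)" for t
    by (simp only: mem_Collect_eq P' complex.sel)
  have Pball: "?P t \<in> cball \<sigma> r" for t
    unfolding P using r u by (simp add: dist_norm norm_mult)
  note dP = has_vector_derivative_part_circlepath[of \<sigma> r "\<phi> - pi" "\<phi> + pi" _ UNIV]
  have GP: "(G has_field_derivative g (?P t)) (at (?P t))" for t by (intro G Pball)
  have ray_ball: "of_real \<rho> * u \<in> cball \<sigma> r \<longleftrightarrow> (\<rho> - p) ^ 2 + q ^ 2 \<le> r ^ 2" for \<rho>
  proof -
    have "of_real \<rho> * u - \<sigma> = u * Complex (\<rho> - p) (- q)"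
      unfolding \<sigma> by (simp add: complex_eq_iff algebra_simps)
    then have n: "dist \<sigma> (of_real \<rho> * u) = norm (Complex (\<rho> - p) (- q))"
      by (metis dist_commute dist_norm mult_1 norm_mult u)
    have "dist \<sigma> (of_real \<rho> * u) \<le> r \<longleftrightarrow> norm (Complex (\<rho> - p) (- q)) ^ 2 \<le> r ^ 2"
      unfolding n using r by (simp add: power_mono_iff)
    then show ?thesis by (simp add: cmod_power2)
  qed
  consider "\<bar>q\<bar> < r" | "r \<le> q" | "q \<le> - r" by linarith
  then show ?thesis
  proof cases
    case 1
    define h where "h = sqrt (r ^ 2 - q ^ 2)"
    have q2: "q ^ 2 < r ^ 2" using power_strict_mono[of "\<bar>q\<bar>" r 2] 1 by simp 
    have h: "0 < h" "h ^ 2 = r ^ 2 - q ^ 2" using q2 by (auto simp: h_def)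
    have hp: "h < p" using h(2) r(2) p by (intro power2_less_imp_less[of h p]) auto
    have n\<sigma>: "norm \<sigma> = sqrt (p ^ 2 + q ^ 2)" unfolding \<sigma> norm_mult u by (simp add: cmod_def)
    have "p \<le> norm \<sigma>" unfolding n\<sigma> using p by (intro real_le_rsqrt) auto
    moreover have "h \<le> r" using h r by (intro power2_le_imp_le[of h r]) auto
    ultimately have hR: "p + h \<le> R" using R by linarith
    have iff: "(\<rho> - p) ^ 2 + q ^ 2 \<le> r ^ 2 \<longleftrightarrow> p - h \<le> \<rho> \<and> \<rho> \<le> p + h" for \<rho>
    proof -
      have "(\<rho> - p) ^ 2 + q ^ 2 \<le> r ^ 2 \<longleftrightarrow> (\<rho> - p) ^ 2 \<le> h ^ 2" using h(2) by linarith
      also have "\<dots> \<longleftrightarrow> \<bar>\<rho> - p\<bar> \<le> h" using h(1) by (metis abs_le_square_iff abs_of_pos)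
      finally show ?thesis by linarith
    qed
    have ray: "((\<lambda>z. if z \<in> cball \<sigma> r then g z else 0) has_contour_integral (G (of_real (p + h) * u) - G (of_real (p - h) * u)))
       (linepath 0 (of_real R * u))"
    proof (rule has_contour_integral_ray[OF R0, where E = "{p - h, p + h}"])
      show "(G has_field_derivative g (of_real \<rho> * u)) (at (of_real \<rho> * u))" if "p - h \<le> \<rho>" "\<rho> \<le> p + h" for \<rho>
        using that by (intro G) (simp only: ray_ball iff)
      show "of_real \<rho> * u \<in> cball \<sigma> r \<longleftrightarrow> p - h < \<rho> \<and> \<rho> < p + h" if "\<rho> \<in> {0..R} - {p - h, p + h}" for \<rho>
        using that unfolding ray_ball iff by auto
    qed (use h hp hR in auto)
    \<comment> \<open>Half the opening angle of the left arc, seen from the centre and measured from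
      the direction \<open>\<i> * u\<close>.\<close>
    define \<beta> where "\<beta> = arccos (- q / r)"
    have qr: "- 1 < - q / r" "- q / r < 1" using 1 r by (auto simp: field_simps abs_less_iff)
    have \<beta>: "0 < \<beta>" "\<beta> < pi" "cos \<beta> = - q / r"
      using qr arccos_lt_bounded[of "- q / r"] by (auto simp: \<beta>_def)
    have sin\<beta>: "r * sin \<beta> = h"
    proof -
      have "(r * sin \<beta>) ^ 2 = r ^ 2 * (1 - cos \<beta> ^ 2)" by (simp add: power_mult_distrib sin_squared_eq)
      also have "\<dots> = h ^ 2" unfolding h(2) \<beta>(3) using r by (simp add: power_divide field_simps)
      finally have "(r * sin \<beta>) ^ 2 = h ^ 2" .
      moreover have "0 \<le> r * sin \<beta>" using \<beta> r by (intro mult_nonneg_nonneg sin_ge_zero) auto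
      ultimately show ?thesis using h(1) by (simp add: power2_eq_iff_nonneg)
    qed
    define t1 where "t1 = (pi - \<beta>) / (2 * pi)"
    define t2 where "t2 = (pi + \<beta>) / (2 * pi)"
    have t: "2 * pi * t1 - pi = - \<beta>" "2 * pi * t2 - pi = \<beta>" by (simp_all add: t1_def t2_def)
    have "((\<lambda>z. if z \<in> {z. 0 < Im (z * cnj u)} then g z else 0) has_contour_integral (G (?P t2) - G (?P t1))) ?P"
    proof (rule has_contour_integral_piece[OF dP GP, where E = "{}"])
      fix t :: real assume t01: "t \<in> {0..1} - {}"
      define x where "x = 2 * pi * t - pi"
      have x: "\<bar>x\<bar> \<le> pi" using t01 by (auto simp: x_def abs_le_iff mult_left_le)
      have "0 < q + r * cos x \<longleftrightarrow> cos \<beta> < cos \<bar>x\<bar>" unfolding \<beta>(3) using r by (auto simp: field_simps)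
      also have "\<dots> \<longleftrightarrow> \<bar>x\<bar> < \<beta>" using x \<beta> by (intro cos_mono_less_eq) auto
      also have "\<dots> \<longleftrightarrow> t1 < t \<and> t < t2" by (auto simp: x_def t1_def t2_def field_simps abs_less_iff)
      finally show "?P t \<in> {z. 0 < Im (z * cnj u)} \<longleftrightarrow> t1 < t \<and> t < t2" unfolding ImP x_def .
    qed (use \<beta> in \<open>auto simp: t1_def t2_def field_simps\<close>)
    also have "?P t2 = of_real (p - h) * u"
      unfolding Pu t \<beta>(3) sin\<beta> using r by (simp add: complex_eq_iff)
    also have "?P t1 = of_real (p + h) * u"
      unfolding Pu t using \<beta>(3) sin\<beta> r by (simp add: complex_eq_iff)
    finally have "((\<lambda>z. if z \<in> {z. 0 < Im (z * cnj u)} then g z else 0) has_contour_integral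
        (- (G (of_real (p + h) * u) - G (of_real (p - h) * u)))) ?P" by simp
    with ray show ?thesis using has_contour_integral_rotate_circle[OF _ \<phi>] by blast
  next
    case 2
    have ray: "((\<lambda>z. if z \<in> cball \<sigma> r then g z else 0) has_contour_integral 0) (linepath 0 (of_real R * u))"
    \<comment> \<open>For q = r the ray touches the circle, at the parameter p / R only.\<close>
    proof (rule has_contour_integral_off_finite[where E = "{p / R}"])
      fix t assume t: "t \<in> {0..1} - {p / R}"
      then have "R * t \<noteq> p" using R0 by (auto simp: field_simps)
      then have "0 < (R * t - p) ^ 2" by simp
      moreover have "r ^ 2 \<le> q ^ 2" using 2 r by (intro power_mono) auto
      ultimately have "of_real (R * t) * u \<notin> cball \<sigma> r" unfolding ray_ball by linarith
      then show "linepath 0 (of_real R * u) t \<notin> cball \<sigma> r"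
        by (simp add: linepath_def scaleR_conv_of_real mult_ac)
    qed simp
    have "((\<lambda>z. if z \<in> {z. 0 < Im (z * cnj u)} then g z else 0) has_contour_integral (G (?P 1) - G (?P 0))) ?P"
    proof (rule has_contour_integral_piece[OF dP GP, where E = "{0, 1}"])
      fix t :: real assume t01: "t \<in> {0..1} - {0, 1}"
      define x where "x = 2 * pi * t - pi"
      have x: "\<bar>x\<bar> < pi" using t01 by (auto simp: x_def abs_less_iff)
      have "- 1 < cos \<bar>x\<bar>" using cos_monotone_0_pi[of "\<bar>x\<bar>" pi] x by simp
      then have "r * (- 1) < r * cos x" using r by (intro mult_strict_left_mono) auto
      then have "0 < q + r * cos x" using 2 by linarith
      then show "?P t \<in> {z. 0 < Im (z * cnj u)} \<longleftrightarrow> 0 < t \<and> t < 1" unfolding ImP using t01 by (auto simp: x_def)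
    qed auto
    moreover have "?P 1 = ?P 0" unfolding Pu by simp
    ultimately have "((\<lambda>z. if z \<in> {z. 0 < Im (z * cnj u)} then g z else 0) has_contour_integral - 0) ?P" by simp
    with ray show ?thesis using has_contour_integral_rotate_circle[OF _ \<phi>] by blast
  next
    case 3
    have ray: "((\<lambda>z. if z \<in> cball \<sigma> r then g z else 0) has_contour_integral 0) (linepath 0 (of_real R * u))"
    proof (rule has_contour_integral_off_finite[where E = "{p / R}"])
      fix t assume t: "t \<in> {0..1} - {p / R}"
      then have "R * t \<noteq> p" using R0 by (auto simp: field_simps)
      then have "0 < (R * t - p) ^ 2" by simp
      moreover have "r ^ 2 \<le> q ^ 2" using power_mono[of r "- q" 2] 3 r by simp
      ultimately have "of_real (R * t) * u \<notin> cball \<sigma> r" unfolding ray_ball by linarith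
      then show "linepath 0 (of_real R * u) t \<notin> cball \<sigma> r"
        by (simp add: linepath_def scaleR_conv_of_real mult_ac)
    qed simp
    have "((\<lambda>z. if z \<in> {z. 0 < Im (z * cnj u)} then g z else 0) has_contour_integral - 0) ?P"
      unfolding minus_zero
    proof (rule has_contour_integral_off_finite[where E = "{}"])
      fix t :: real
      have "r * cos (2 * pi * t - pi) \<le> r * 1" using r by (intro mult_left_mono) auto
      then show "?P t \<notin> {z. 0 < Im (z * cnj u)}" unfolding ImP using 3 by linarith
    qed simp
    with ray show ?thesis using has_contour_integral_rotate_circle[OF _ \<phi>] by blast
  qed
qed

text \<open>A bounded measurable function on a compact interval is integrable. S is a Borel set
  because the truncation regions need be neither open nor closed; the closed set F around it is
  where g is continuous.\<close>

lemma integrable_indicator_path: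
  fixes c c' :: "real \<Rightarrow> complex" and g :: "complex \<Rightarrow> complex"
  assumes c: "continuous_on {0..1} c" and c': "continuous_on {0..1} c'"
    and F: "closed F" "continuous_on (F \<inter> c ` {0..1}) g" and S: "S \<in> sets borel" "S \<subseteq> F"
  shows "(\<lambda>t. (if c t \<in> S then g (c t) else 0) * c' t) integrable_on {0..1}"
proof -
  define A where "A = {0..1} \<inter> c -` F"
  have A: "closed A" unfolding A_def using c F(1) by (intro continuous_closed_preimage) auto
  have Ac: "compact A" using A compact_Int_closed[of "{0..1::real}" A] by (simp add: A_def inf.assoc[symmetric])
  define \<phi> where "\<phi> t = g (c t) * c' t" for t
  have \<phi>c: "continuous_on A \<phi>"
  proof -
    have "continuous_on A c" "continuous_on A c'"
      by (rule continuous_on_subset[OF c], simp add: A_def, rule continuous_on_subset[OF c'], simp add: A_def)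
    moreover from this(1) have "continuous_on A (\<lambda>t. g (c t))"
      by (rule continuous_on_compose2[OF F(2)]) (auto simp: A_def)
    ultimately show ?thesis unfolding \<phi>_def by (intro continuous_on_mult)
  qed
  then obtain B where B: "\<And>t. t \<in> A \<Longrightarrow> norm (\<phi> t) \<le> B"
    using compact_continuous_image[OF \<phi>c Ac] compact_imp_bounded bounded_iff by (metis imageI)
  have m1: "(\<lambda>t. indicator A t *\<^sub>R \<phi> t) \<in> borel_measurable borel"
    using A \<phi>c by (intro borel_measurable_continuous_on_indicator) auto
  have cm: "(\<lambda>t. indicator {0..1} t *\<^sub>R c t) \<in> borel_measurable borel"
    using c by (intro borel_measurable_continuous_on_indicator) auto
  have "(\<lambda>t. indicator S (indicator {0..1} t *\<^sub>R c t) *\<^sub>R (indicator A t *\<^sub>R \<phi> t) :: complex) \<in> borel_measurable borel"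
    by (intro borel_measurable_scaleR m1 measurable_compose[OF cm] borel_measurable_indicator S(1))
  then have m: "(\<lambda>t. indicator S (indicator {0..1} t *\<^sub>R c t) *\<^sub>R (indicator A t *\<^sub>R \<phi> t) :: complex) \<in> borel_measurable lebesgue"
    using measurable_completion[of _ lborel borel] by simp
  have "(\<lambda>t. indicator S (indicator {0..1} t *\<^sub>R c t) *\<^sub>R (indicator A t *\<^sub>R \<phi> t)) integrable_on {0..1}"
  proof (rule measurable_bounded_by_integrable_imp_integrable[where g = "\<lambda>_. max B 0"])
    show "(\<lambda>t. indicator S (indicator {0..1} t *\<^sub>R c t) *\<^sub>R (indicator A t *\<^sub>R \<phi> t) :: complex) \<in> borel_measurable (lebesgue_on {0..1})"
      using m by (rule measurable_restrict_space1)
    fix t :: real assume "t \<in> {0..1}"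
    show "norm (indicator S (indicator {0..1} t *\<^sub>R c t) *\<^sub>R (indicator A t *\<^sub>R \<phi> t)) \<le> max B 0"
      using B[of t] by (auto simp: indicator_def)
  qed auto
  then show ?thesis
  proof (rule integrable_eq)
    fix t :: real assume "t \<in> {0..1}"
    then show "indicator S (indicator {0..1} t *\<^sub>R c t) *\<^sub>R (indicator A t *\<^sub>R \<phi> t) = (if c t \<in> S then g (c t) else 0) * c' t"
      using S(2) by (auto simp: indicator_def A_def \<phi>_def)
  qed
qed

text \<open>An arbitrary finite index set makes room for the disjoint union of rays and
  circles.\<close>

lemma has_bdry_integral_inI:
  fixes X :: "'i set" and c :: "'i \<Rightarrow> real \<Rightarrow> complex"
  assumes X: "finite X"
    and c: "\<And>i. i \<in> X \<Longrightarrow> simple_path (c i)" "\<And>i. i \<in> X \<Longrightarrow> c i C1_differentiable_on {0..1}"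
      "\<And>i t. i \<in> X \<Longrightarrow> t \<in> {0..1} \<Longrightarrow> vector_derivative (c i) (at t) \<noteq> 0"
    and fin: "\<And>i j. i \<in> X \<Longrightarrow> j \<in> X \<Longrightarrow> i \<noteq> j \<Longrightarrow> finite (path_image (c i) \<inter> path_image (c j))"
    and cover: "frontier \<Omega> \<inter> K \<subseteq> (\<Union>i\<in>X. path_image (c i))"
    and int: "\<And>i. i \<in> X \<Longrightarrow> ((\<lambda>t. bdry_sign \<Omega> (c i t) (vector_derivative (c i) (at t)) *
        g (c i t) * vector_derivative (c i) (at t)) has_integral I i) {t\<in>{0..1}. c i t \<in> K}"
  shows "has_bdry_integral_in \<Omega> K g (\<Sum>i\<in>X. I i)"
proof -
  obtain h where h: "bij_betw h {0..<card X} X" using ex_bij_betw_nat_finite[OF X] by blast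
  have hX: "h i \<in> X" if "i < card X" for i using h that by (auto simp: bij_betw_def)
  have hinj: "h i \<noteq> h j" if "i < card X" "j < card X" "i \<noteq> j" for i j
    using h that by (auto simp: bij_betw_def inj_on_def)
  have "(\<Sum>i\<in>X. I i) = (\<Sum>i<card X. I (h i))"
    using sum.reindex_bij_betw[OF h, of I] by (simp add: atLeast0LessThan)
  moreover have "(\<Union>i\<in>X. path_image (c i)) = (\<Union>i<card X. path_image (c (h i)))"
  proof -
    have "X = h ` {0..<card X}" using h by (simp add: bij_betw_def)
    then have "(\<Union>i\<in>X. path_image (c i)) = (\<Union>i\<in>h ` {0..<card X}. path_image (c i))" by (simp only:)
    then show ?thesis by (simp add: atLeast0LessThan)
  qed
  ultimately show ?thesis
    unfolding has_bdry_integral_in_def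
    by (intro exI[of _ "card X"] exI[of _ "\<lambda>i. c (h i)"] exI[of _ "\<lambda>i. I (h i)"] conjI allI impI ballI)
      (use c fin cover int hX hinj in auto)
qed

section \<open>A decaying primitive\<close>

lemma polar_half_plane:
  fixes z :: complex and s :: real
  assumes s: "s = 1 \<or> s = -1" and z: "0 \<le> s * Im z" "z \<noteq> 0"
  obtains \<theta> where "\<bar>\<theta>\<bar> \<le> pi / 2" "z = of_real (norm z) * (\<i> * of_real s * cis \<theta>)"
proof -
  define w where "w = - (\<i> * of_real s * z)"
  have w: "w \<noteq> 0" "0 \<le> Re w" "norm w = norm z" using s z by (auto simp: w_def norm_mult)
  have "\<bar>Arg w\<bar> \<le> pi / 2" using w Re_Ln_pos_le[of w] by (simp add: Arg_eq_Im_Ln)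
  moreover have "w = of_real (norm z) * cis (Arg w)"
    using w by (metis rcis_cmod_Arg rcis_def)
  moreover have "z = \<i> * of_real s * w" using s by (auto simp: w_def)
  ultimately show thesis using that[of "Arg w"] by (metis mult.left_commute)
qed

lemma differentiable_bound_real:
  fixes f :: "real \<Rightarrow> complex"
  assumes "a \<le> b" and f: "\<And>x. x \<in> {a..b} \<Longrightarrow> (f has_vector_derivative f' x) (at x)"
    and p: "\<And>x. x \<in> {a..b} \<Longrightarrow> (p has_vector_derivative p' x) (at x)"
    and le: "\<And>x. x \<in> {a..b} \<Longrightarrow> norm (f' x) \<le> p' x"
  shows "norm (f b - f a) \<le> p b - p a"
proof (cases "a = b")
  case False
  show ?thesis
  proof (rule differentiable_bound_general[of a b f p f' p'])
    show "continuous_on {a..b} f" "continuous_on {a..b} p"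
      using f p has_vector_derivative_continuous by (blast intro: continuous_at_imp_continuous_on)+
  qed (use assms False in auto)
qed simp

text \<open>Away from 0 the lowest power dominates. The shift k serves the sum itself (k = 0) and
  its derivative (k = 1).\<close>

lemma norm_sum_powers_bound:
  fixes c :: "nat \<Rightarrow> complex"
  assumes "0 < r"
  shows "\<exists>C\<ge>0. \<forall>z. r \<le> norm z \<longrightarrow> norm (\<Sum>m=1..n. c m / z ^ (m + k)) \<le> C / norm z ^ (k + 1)"
proof (intro exI conjI allI impI)
  let ?C = "\<Sum>m=1..n. norm (c m) / r ^ (m - 1)"
  show "0 \<le> ?C" using assms by (intro sum_nonneg) auto
  fix z :: complex assume z: "r \<le> norm z"
  have z0: "0 < norm z" using z assms by linarith
  have "norm (\<Sum>m=1..n. c m / z ^ (m + k)) \<le> (\<Sum>m=1..n. norm (c m) / r ^ (m - 1) / norm z ^ (k + 1))"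
  proof (rule sum_norm_le)
    fix m assume m: "m \<in> {1..n}"
    have "m + k = (m - 1) + (k + 1)" using m by auto
    then have "norm (c m / z ^ (m + k)) = norm (c m) / (norm z ^ (m - 1) * norm z ^ (k + 1))"
      by (simp only: norm_divide norm_mult norm_power power_add)
    also have "\<dots> \<le> norm (c m) / (r ^ (m - 1) * norm z ^ (k + 1))"
      using z z0 assms by (intro divide_left_mono mult_right_mono power_mono mult_pos_pos) auto
    finally show "norm (c m / z ^ (m + k)) \<le> norm (c m) / r ^ (m - 1) / norm z ^ (k + 1)" by simp
  qed
  also have "\<dots> = ?C / norm z ^ (k + 1)" by (rule sum_divide_distrib[symmetric])
  finally show "norm (\<Sum>m=1..n. c m / z ^ (m + k)) \<le> ?C / norm z ^ (k + 1)" .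
qed

lemma norm_exp_half_plane: "norm (exp (\<i> * of_real s * of_real y * z)) = exp (- y * (s * Im z))"
  by simp

text \<open>A term 1/z excludes a primitive on the punctured plane. The cut runs along
  \<open>- \<i> * s\<close>, opposite to the half-plane; multiplication by \<open>- \<i> * s\<close>
  turns it into the standard slit plane, which is starlike.\<close>

lemma ex_primitive_slit_plane:
  fixes g :: "complex \<Rightarrow> complex" and s :: real
  assumes g: "g holomorphic_on - {0}" and s: "s = 1 \<or> s = -1"
  shows "\<exists>G. \<forall>z. - (\<i> * of_real s * z) \<notin> \<real>\<^sub>\<le>\<^sub>0 \<longrightarrow> (G has_field_derivative g z) (at z)"
proof -
  define k where "k = \<i> * complex_of_real s"
  have k: "k * k = - 1" "k \<noteq> 0" using s by (auto simp: k_def)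
  define g0 where "g0 w = g (k * w) * k" for w
  have slit: "(- \<real>\<^sub>\<le>\<^sub>0 :: complex set) = - (complex_of_real ` {..0})"
    by (auto simp: nonpos_Reals_def)
  have op: "open (- \<real>\<^sub>\<le>\<^sub>0 :: complex set)" by auto
  have ne: "k * w \<in> - {0}" if "w \<in> - \<real>\<^sub>\<le>\<^sub>0" for w using that k by auto
  have hol: "g0 holomorphic_on - \<real>\<^sub>\<le>\<^sub>0"
    unfolding g0_def using ne
    by (intro holomorphic_intros holomorphic_on_compose_gen[OF _ g, unfolded o_def]) auto
  have "\<exists>H. \<forall>w\<in>- \<real>\<^sub>\<le>\<^sub>0. (H has_field_derivative g0 w) (at w)"
  proof (rule holomorphic_starlike_primitive[where k = "{}"])
    show "starlike (- \<real>\<^sub>\<le>\<^sub>0 :: complex set)" unfolding slit by (rule starlike_slotted_complex_plane_left)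
    show "g0 field_differentiable at x" if "x \<in> - \<real>\<^sub>\<le>\<^sub>0 - {}" for x
      using hol op that holomorphic_on_imp_differentiable_at by auto
  qed (use hol op holomorphic_on_imp_continuous_on in auto)
  then obtain H where H: "\<And>w. w \<notin> \<real>\<^sub>\<le>\<^sub>0 \<Longrightarrow> (H has_field_derivative g0 w) (at w)" by auto
  have "((\<lambda>z. H (- k * z)) has_field_derivative g z) (at z)" if "- (k * z) \<notin> \<real>\<^sub>\<le>\<^sub>0" for z
  proof -
    have "((\<lambda>z. H (- k * z)) has_field_derivative g0 (- k * z) * (- k)) (at z)"
      using that by (intro DERIV_chain'[where g = H] H) (auto intro!: derivative_eq_intros)
    moreover have "g0 (- k * z) * (- k) = g (- (k * k) * z) * (- (k * k))" by (simp add: g0_def mult_ac)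
    ultimately show ?thesis by (simp add: k)
  qed
  then show ?thesis unfolding k_def by blast
qed

text \<open>Since g is only O(1 / norm z) on the real axis, the length of an arc times the maximum
  of g does not tend to 0. One integration by parts splits off \<open>G1\<close>, itself O(1 / norm
  z), and leaves \<open>G2\<close> with derivative O(1 / norm z ^ 2). The latter is integrable along
  radii and contributes O(1 / R) along an arc of radius R.\<close>

lemma ex_decaying_primitive:
  fixes c :: "nat \<Rightarrow> complex" and s y :: real and n :: nat
  assumes s: "s = 1 \<or> s = -1" and y: "0 < y"
  defines "g \<equiv> \<lambda>z. exp (\<i> * of_real s * of_real y * z) * (\<Sum>m=1..n. c m / z ^ m)"
  shows "\<exists>G. (\<forall>z. - (\<i> * of_real s * z) \<notin> \<real>\<^sub>\<le>\<^sub>0 \<longrightarrow> (G has_field_derivative g z) (at z)) \<and>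
    (\<forall>\<eta>>0. \<exists>R0>0. \<forall>z w. R0 \<le> norm z \<and> R0 \<le> norm w \<and> 0 \<le> s * Im z \<and> 0 \<le> s * Im w \<longrightarrow> norm (G z - G w) \<le> \<eta>)"
proof -
  define h where "h z = (\<Sum>m=1..n. c m / z ^ m)" for z
  define h' where "h' z = (\<Sum>m=1..n. (- of_nat m * c m) / z ^ (m + 1))" for z
  define k where "k = \<i> * of_real s * complex_of_real y"
  have k: "k \<noteq> 0" using s y by (auto simp: k_def)
  have nk: "norm k = y" using s y by (auto simp: k_def norm_mult)
  define E where "E z = exp (k * z)" for z
  have gE: "g z = E z * h z" for z by (simp add: g_def E_def h_def k_def)
  have nE: "norm (E z) \<le> 1" if "0 \<le> s * Im z" for z
  proof -
    have "norm (E z) = exp (- y * (s * Im z))" unfolding E_def k_def by (rule norm_exp_half_plane)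
    also have "\<dots> \<le> exp 0" using that y by (subst exp_le_cancel_iff) simp
    finally show ?thesis by simp
  qed
  have "g holomorphic_on - {0}" unfolding g_def by (intro holomorphic_intros) auto
  from ex_primitive_slit_plane[OF this s] obtain G where
    G: "\<And>z. - (\<i> * of_real s * z) \<notin> \<real>\<^sub>\<le>\<^sub>0 \<Longrightarrow> (G has_field_derivative g z) (at z)" by blast
  define G1 where "G1 z = E z * h z / k" for z
  define G2 where "G2 z = G z - G1 z" for z
  have dh: "(h has_field_derivative h' z) (at z)" if "z \<noteq> 0" for z
    unfolding h_def h'_def
  proof (rule DERIV_sum)
    fix m assume "m \<in> {1..n}"
    then obtain m' where m: "m = Suc m'" by (cases m) auto
    have "((\<lambda>z. z ^ m) has_field_derivative of_nat m * z ^ (m - Suc 0)) (at z)"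
      by (auto intro!: derivative_eq_intros)
    then have "((\<lambda>z. z ^ m) has_field_derivative of_nat m * z ^ m') (at z)"
      by (simp add: m)
    from DERIV_divide[OF DERIV_const[of "c m"] this]
    have "((\<lambda>z. c m / z ^ m) has_field_derivative - (c m * (of_nat m * z ^ m')) / (z ^ m * z ^ m)) (at z)"
      using that by simp
    also have "- (c m * (of_nat m * z ^ m')) / (z ^ m * z ^ m) = (- of_nat m * c m) / z ^ (m + 1)"
      using that by (simp add: m field_simps)
    finally show "((\<lambda>z. c m / z ^ m) has_field_derivative (- of_nat m * c m) / z ^ (m + 1)) (at z)" .
  qed
  have dG1: "(G1 has_field_derivative g z + E z * h' z / k) (at z)" if "z \<noteq> 0" for z
    unfolding G1_def[abs_def] E_def[abs_def] gE
    by (rule derivative_eq_intros dh that refl k | simp add: k E_def field_simps)+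
  have dG2: "(G2 has_field_derivative - (E z * h' z / k)) (at z)" if "- (\<i> * of_real s * z) \<notin> \<real>\<^sub>\<le>\<^sub>0" for z
  proof -
    have "z \<noteq> 0" using that by auto
    from DERIV_diff[OF G[OF that] dG1[OF this]] show ?thesis unfolding G2_def by simp
  qed
  obtain C1 where C1: "0 \<le> C1" "\<And>z. 1 \<le> norm z \<Longrightarrow> norm (h z) \<le> C1 / norm z"
    using norm_sum_powers_bound[where r = 1 and n = n and c = c and k = 0] unfolding h_def by auto
  obtain C2 where C2: "0 \<le> C2" "\<And>z. 1 \<le> norm z \<Longrightarrow> norm (h' z) \<le> C2 / norm z ^ 2"
    using norm_sum_powers_bound[where r = 1 and n = n and c = "\<lambda>m. - of_nat m * c m" and k = 1] unfolding h'_def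
    by (auto simp: numeral_2_eq_2)
  define C where "C = C2 / y"
  have C0: "0 \<le> C" using C2(1) y by (simp add: C_def)
  have bG2: "norm (- (E z * h' z / k)) \<le> C / norm z ^ 2" if "1 \<le> norm z" "0 \<le> s * Im z" for z
  proof -
    have "norm (- (E z * h' z / k)) = norm (E z) * norm (h' z) / y" by (simp add: norm_mult norm_divide nk)
    also have "\<dots> \<le> 1 * (C2 / norm z ^ 2) / y"
      using that y by (intro divide_right_mono mult_mono nE C2) auto
    finally show ?thesis by (simp add: C_def mult.commute)
  qed
  define e where "e \<theta> = \<i> * of_real s * cis \<theta>" for \<theta>
  have ne: "norm (of_real \<rho> * e \<theta>) = \<rho>" if "0 \<le> \<rho>" for \<rho> \<theta> using s that by (auto simp: e_def norm_mult)
  have Ime: "s * Im (of_real \<rho> * e \<theta>) = \<rho> * cos \<theta>" for \<rho> \<theta> using s by (auto simp: e_def)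
  have slit: "- (\<i> * of_real s * (of_real \<rho> * e \<theta>)) \<notin> \<real>\<^sub>\<le>\<^sub>0" if "0 < \<rho>" "\<bar>\<theta>\<bar> \<le> pi / 2" for \<rho> \<theta>
  proof -
    have eq: "- (\<i> * of_real s * (of_real \<rho> * e \<theta>)) = of_real \<rho> * cis \<theta>" using s by (auto simp: e_def algebra_simps)
    have "0 \<le> cos \<theta>" using that by (intro cos_ge_zero) auto
    moreover have "sin \<theta> \<noteq> 0 \<or> 0 < cos \<theta>" using \<open>0 \<le> cos \<theta>\<close> sin_cos_squared_add[of \<theta>] by (cases "cos \<theta> = 0") auto
    ultimately show ?thesis unfolding eq using that(1) by (auto simp: complex_nonpos_Reals_iff mult_le_0_iff)
  qed
  have arc: "norm (G2 (of_real \<rho> * e \<theta>) - G2 (of_real \<rho> * e 0)) \<le> C * pi / \<rho>" if "1 \<le> \<rho>" "\<bar>\<theta>\<bar> \<le> pi / 2" for \<rho> \<theta>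
  proof -
    have d: "((\<lambda>x. G2 (of_real \<rho> * e x)) has_vector_derivative (of_real \<rho> * (\<i> * e x)) * - (E (of_real \<rho> * e x) * h' (of_real \<rho> * e x) / k)) (at x)"
      if "\<bar>x\<bar> \<le> pi / 2" for x
    proof -
      have "((\<lambda>x. of_real \<rho> * e x) has_vector_derivative of_real \<rho> * (\<i> * e x)) (at x)"
        unfolding e_def cis_conv_exp
        by (rule has_vector_derivative_real_field) (auto intro!: derivative_eq_intros simp: mult_ac)
      from field_vector_diff_chain_at[OF this dG2[OF slit]] show ?thesis
        using that \<open>1 \<le> \<rho>\<close> by (simp add: o_def)
    qed
    have b: "norm ((of_real \<rho> * (\<i> * e x)) * - (E (of_real \<rho> * e x) * h' (of_real \<rho> * e x) / k)) \<le> C / \<rho>" if "\<bar>x\<bar> \<le> pi / 2" for x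
    proof -
      have "0 \<le> cos x" using that by (intro cos_ge_zero) auto
      then have "norm (- (E (of_real \<rho> * e x) * h' (of_real \<rho> * e x) / k)) \<le> C / \<rho> ^ 2"
        using bG2[of "of_real \<rho> * e x"] \<open>1 \<le> \<rho>\<close> unfolding Ime by (simp add: ne)
      then have "norm (of_real \<rho> * (\<i> * e x)) * norm (- (E (of_real \<rho> * e x) * h' (of_real \<rho> * e x) / k)) \<le> \<rho> * (C / \<rho> ^ 2)"
        using \<open>1 \<le> \<rho>\<close> s by (intro mult_mono) (auto simp: e_def norm_mult)
      moreover have "\<rho> * (C / \<rho> ^ 2) = C / \<rho>" using \<open>1 \<le> \<rho>\<close> by (simp add: power2_eq_square)
      ultimately show ?thesis by (simp only: norm_mult[of "of_real \<rho> * (\<i> * e x)"])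
    qed
    have pd: "((\<lambda>x. x * (C / \<rho>)) has_vector_derivative C / \<rho>) (at x)" for x
      by (auto intro!: derivative_eq_intros)
    have "\<bar>\<theta>\<bar> * (C / \<rho>) \<le> pi * (C / \<rho>)" using that C0 by (intro mult_right_mono) auto
    moreover have "norm (G2 (of_real \<rho> * e \<theta>) - G2 (of_real \<rho> * e 0)) \<le> \<bar>\<theta>\<bar> * (C / \<rho>)"
    proof (cases "0 \<le> \<theta>")
      case True
      have "norm (G2 (of_real \<rho> * e \<theta>) - G2 (of_real \<rho> * e 0)) \<le> \<theta> * (C / \<rho>) - 0 * (C / \<rho>)"
        using that True by (intro differentiable_bound_real[OF _ d pd b]) auto
      then show ?thesis using True by simp
    next
      case False
      have "norm (G2 (of_real \<rho> * e 0) - G2 (of_real \<rho> * e \<theta>)) \<le> 0 * (C / \<rho>) - \<theta> * (C / \<rho>)"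
        using that False by (intro differentiable_bound_real[OF _ d pd b]) auto
      then show ?thesis using False by (simp add: norm_minus_commute)
    qed
    ultimately show ?thesis by (simp add: mult.commute)
  qed
  have rad: "norm (G2 (of_real \<rho>2 * e 0) - G2 (of_real \<rho>1 * e 0)) \<le> C / \<rho>1" if "1 \<le> \<rho>1" "\<rho>1 \<le> \<rho>2" for \<rho>1 \<rho>2
  proof -
    have d: "((\<lambda>\<rho>. G2 (of_real \<rho> * e 0)) has_vector_derivative e 0 * - (E (of_real \<rho> * e 0) * h' (of_real \<rho> * e 0) / k)) (at \<rho>)"
      if "1 \<le> \<rho>" for \<rho>
    proof -
      have "((\<lambda>\<rho>. of_real \<rho> * e 0) has_vector_derivative e 0) (at \<rho>)"
        by (rule has_vector_derivative_real_field) (auto intro!: derivative_eq_intros)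
      from field_vector_diff_chain_at[OF this dG2[OF slit]] show ?thesis
        using that by (simp add: o_def)
    qed
    have b: "norm (e 0 * - (E (of_real \<rho> * e 0) * h' (of_real \<rho> * e 0) / k)) \<le> C / \<rho> ^ 2" if "1 \<le> \<rho>" for \<rho>
    proof -
      have "norm (- (E (of_real \<rho> * e 0) * h' (of_real \<rho> * e 0) / k)) \<le> C / \<rho> ^ 2"
        using bG2[of "of_real \<rho> * e 0"] that unfolding Ime by (simp add: ne)
      moreover have "norm (e 0) = 1" using ne[of 1 0] by simp
      ultimately show ?thesis by (simp only: norm_mult[of "e 0"] mult_1)
    qed
    have pd: "((\<lambda>x. - C / x) has_vector_derivative C / x ^ 2) (at x)" if "1 \<le> x" for x :: real
      using that unfolding has_real_derivative_iff_has_vector_derivative[symmetric]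
      by (auto intro!: derivative_eq_intros simp: power2_eq_square)
    have "norm (G2 (of_real \<rho>2 * e 0) - G2 (of_real \<rho>1 * e 0)) \<le> - C / \<rho>2 - - C / \<rho>1"
      using that by (intro differentiable_bound_real[OF _ d pd b]) auto
    also have "\<dots> \<le> C / \<rho>1" using C0 that by simp
    finally show ?thesis .
  qed
  \<comment> \<open>Every far point is joined by an arc and a radial segment to the reference point
    \<open>of_real R * e 0\<close> on the axis of the half-plane. The three summands come from the
    two values of \<open>G1\<close>, the arc and the radius.\<close>
  have dist: "norm (G z - G (of_real R * e 0)) \<le> (2 * C1 / y + C * pi + C) / R"
    if R: "1 \<le> R" and z: "R \<le> norm z" "0 \<le> s * Im z" for R z
  proof -
    have z0: "z \<noteq> 0" using R z by auto
    obtain \<theta> where \<theta>: "\<bar>\<theta>\<bar> \<le> pi / 2" "z = of_real (norm z) * e \<theta>"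
      using polar_half_plane[OF s z(2) z0] unfolding e_def by blast
    have g1: "norm (G1 w) \<le> C1 / y / R" if "R \<le> norm w" "0 \<le> s * Im w" for w
    proof -
      have "norm (G1 w) = norm (E w) * norm (h w) / y" by (simp add: G1_def norm_mult norm_divide nk)
      also have "\<dots> \<le> 1 * (C1 / norm w) / y"
        using that y R by (intro divide_right_mono mult_mono nE C1) auto
      also have "\<dots> \<le> 1 * (C1 / R) / y"
        using that y R C1(1) by (intro divide_right_mono mult_left_mono divide_left_mono mult_pos_pos) auto
      finally show ?thesis by (simp add: mult.commute)
    qed
    have "R \<le> norm (of_real R * e 0)" "0 \<le> s * Im (of_real R * e 0)"
      unfolding Ime using R ne[of R 0] by simp_all
    then have "norm (G1 (of_real R * e 0)) \<le> C1 / y / R" by (rule g1)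
    moreover have "norm (G1 z) \<le> C1 / y / R" using z by (intro g1)
    moreover have "norm (G2 z - G2 (of_real (norm z) * e 0)) \<le> C * pi / R"
    proof -
      have "norm (G2 z - G2 (of_real (norm z) * e 0)) \<le> C * pi / norm z"
        using arc[of "norm z" \<theta>] \<theta> R z by simp
      also have "\<dots> \<le> C * pi / R" using C0 R z by (intro divide_left_mono mult_pos_pos) auto
      finally show ?thesis .
    qed
    moreover have "norm (G2 (of_real (norm z) * e 0) - G2 (of_real R * e 0)) \<le> C / R"
      using R z by (intro rad)
    moreover have "G z - G (of_real R * e 0) = (G1 z - G1 (of_real R * e 0)) +
        ((G2 z - G2 (of_real (norm z) * e 0)) + (G2 (of_real (norm z) * e 0) - G2 (of_real R * e 0)))"
      by (simp add: G2_def)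
    moreover have "norm (G1 z - G1 (of_real R * e 0)) \<le> norm (G1 z) + norm (G1 (of_real R * e 0))"
      by (rule norm_triangle_ineq4)
    ultimately have "norm (G z - G (of_real R * e 0)) \<le> (C1 / y / R + C1 / y / R) + (C * pi / R + C / R)"
      by (smt (verit) norm_triangle_ineq)
    also have "\<dots> = (2 * C1 / y + C * pi + C) / R" by (simp add: add_divide_distrib)
    finally show ?thesis .
  qed
  have decay: "\<exists>R0>0. \<forall>z w. R0 \<le> norm z \<and> R0 \<le> norm w \<and> 0 \<le> s * Im z \<and> 0 \<le> s * Im w \<longrightarrow> norm (G z - G w) \<le> \<eta>"
    if \<eta>: "0 < \<eta>" for \<eta>
  proof -
    define M where "M = 2 * C1 / y + C * pi + C"
    have M: "0 \<le> M" using C0 C1(1) y by (simp add: M_def)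
    define R where "R = max 1 (2 * M / \<eta>)"
    have R: "1 \<le> R" "M / R \<le> \<eta> / 2" using \<eta> M by (auto simp: R_def field_simps max_def)
    have "norm (G z - G w) \<le> \<eta>" if "R \<le> norm z" "R \<le> norm w" "0 \<le> s * Im z" "0 \<le> s * Im w" for z w
    proof -
      have "norm (G z - G w) \<le> norm (G z - G (of_real R * e 0)) + norm (G w - G (of_real R * e 0))"
        using norm_triangle_ineq4[of "G z - G (of_real R * e 0)" "G w - G (of_real R * e 0)"] by simp
      then show ?thesis using dist[OF R(1) that(1,3)] dist[OF R(1) that(2,4)] R(2) unfolding M_def[symmetric] by linarith
    qed
    then show ?thesis using R(1) by (intro exI[of _ R]) auto
  qed
  show ?thesis using G decay by blast
qed

section \<open>Integrals along the boundary of a perforated sector\<close>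

text \<open>The squared distance to \<sigma> is a monic quadratic polynomial in t.\<close>

lemma finite_ray_sphere:
  fixes u \<sigma> :: complex
  assumes "norm u = 1"
  shows "finite {t::real. norm (of_real t * u - \<sigma>) = r}"
proof -
  define q where "q = [:(norm \<sigma>)\<^sup>2 - r\<^sup>2, - 2 * Re (\<sigma> * cnj u), 1:]"
  have "norm (of_real t * u - \<sigma>) ^ 2 = t\<^sup>2 - 2 * t * Re (\<sigma> * cnj u) + (norm \<sigma>)\<^sup>2" for t
  proof -
    have u: "(Re u)\<^sup>2 + (Im u)\<^sup>2 = 1" using assms by (metis cmod_power2 power_one)
    have "norm (of_real t * u - \<sigma>) ^ 2 = t\<^sup>2 * ((Re u)\<^sup>2 + (Im u)\<^sup>2) - 2 * t * Re (\<sigma> * cnj u) + ((Re \<sigma>)\<^sup>2 + (Im \<sigma>)\<^sup>2)"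
      unfolding cmod_power2 by (simp add: power2_eq_square algebra_simps)
    then show ?thesis unfolding u cmod_power2 by simp
  qed
  then have "{t::real. norm (of_real t * u - \<sigma>) = r} \<subseteq> {t. poly q t = 0}"
    by (auto simp: q_def power2_eq_square algebra_simps)
  moreover have "finite {t. poly q t = 0}" by (rule poly_roots_finite) (simp add: q_def)
  ultimately show ?thesis by (rule finite_subset)
qed

lemma finite_simple_path_preimage:
  assumes "simple_path c" "finite S"
  shows "finite {t\<in>{0..1}. c t \<in> S}"
proof -
  have "inj_on c {0..<1}"
    using assms(1) unfolding simple_path_def loop_free_def inj_on_def by fastforce
  then have "finite (c -` S \<inter> {0..<1})" using assms(2) by (intro finite_vimage_IntI)
  moreover have "{t\<in>{0..1}. c t \<in> S} \<subseteq> insert 1 (c -` S \<inter> {0..<1})" by auto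
  ultimately show ?thesis by (meson finite_insert finite_subset)
qed

text \<open>Near a given point only finitely many of the discs matter, so their union is
  closed.\<close>

lemma open_Compl_cballs:
  assumes "separated Z \<epsilon>" "0 < \<epsilon>"
  shows "open (- (\<Union>\<sigma>\<in>Z. cball \<sigma> (2 * \<epsilon>)))"
proof (rule openI)
  let ?B = "\<Union>\<sigma>\<in>Z. cball \<sigma> (2 * \<epsilon>)"
  fix x assume x: "x \<in> - ?B"
  have fin: "finite {\<sigma>\<in>Z. norm \<sigma> \<le> norm x + 1 + 2 * \<epsilon>}" by (rule finite_separated_bounded[OF assms])
  let ?O = "ball x 1 \<inter> (\<Inter>\<sigma>\<in>{\<sigma>\<in>Z. norm \<sigma> \<le> norm x + 1 + 2 * \<epsilon>}. - cball \<sigma> (2 * \<epsilon>))"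
  have "open ?O" using fin by (intro open_Int open_INT) auto
  moreover have "x \<in> ?O" using x by auto
  moreover have "?O \<subseteq> - ?B"
  proof
    fix w assume w: "w \<in> ?O"
    have "w \<notin> cball \<sigma> (2 * \<epsilon>)" if "\<sigma> \<in> Z" for \<sigma>
    proof
      assume c: "w \<in> cball \<sigma> (2 * \<epsilon>)"
      have "norm \<sigma> \<le> norm x + dist x w + dist w \<sigma>"
        unfolding dist_norm using norm_triangle_ineq[of "x + (w - x)" "\<sigma> - w"] norm_triangle_ineq[of x "w - x"]
        by (simp add: norm_minus_commute)
      then have "norm \<sigma> \<le> norm x + 1 + 2 * \<epsilon>" using w c by (simp add: dist_commute)
      then show False using w c that by auto
    qed
    then show "w \<in> - ?B" by auto
  qed
  ultimately show "\<exists>e>0. ball x e \<subseteq> - ?B" by (meson open_contains_ball subset_trans)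
qed

lemma cos_nonneg_imp:
  assumes "0 \<le> cos x" "\<bar>x\<bar> < pi"
  shows "\<bar>x\<bar> \<le> pi / 2"
proof (rule ccontr)
  assume "\<not> \<bar>x\<bar> \<le> pi / 2"
  then have "cos \<bar>x\<bar> < cos (pi / 2)" using assms(2) by (intro cos_monotone_0_pi) auto
  then show False using assms(1) by simp
qed

text \<open>The sign \<open>s\<close> selects the upper or the lower half-plane. Angles are measured from the ray \<open>s\<i>\<close>, so
  that the cut of the primitive \<open>G\<close> lies outside of the half-plane. The boundary of \<open>U\<close> consists of the rays
  with angles in \<open>T\<close>, and the jump \<open>j \<theta>\<close> of the indicator of \<open>U\<close> across a ray is its
  orientation, or \<open>0\<close> for a ray that is not part of the boundary.\<close>

locale perforated_sector =
  fixes s y \<epsilon> :: real and Z :: "complex set" and n :: nat and a :: complex and g G :: "complex \<Rightarrow> complex"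
  assumes s: "s = 1 \<or> s = -1" and y: "0 < y" and \<epsilon>: "0 < \<epsilon>"
    and Z: "separated Z \<epsilon>" and Z0: "0 \<in> Z" and n: "1 \<le> n" and a: "a \<noteq> 0"
    and g_hol: "g holomorphic_on - {0}"
    and g_bound: "\<exists>C\<ge>0. \<forall>z. \<epsilon> \<le> norm z \<and> 0 \<le> s * Im z \<longrightarrow> norm (g z) \<le> C * exp (- y * (s * Im z)) / norm z"
    and G: "\<And>z. - (\<i> * of_real s * z) \<notin> \<real>\<^sub>\<le>\<^sub>0 \<Longrightarrow> (G has_field_derivative g z) (at z)"
    and decay: "\<And>\<eta>. 0 < \<eta> \<Longrightarrow> \<exists>R0>0. \<forall>z w. R0 \<le> norm z \<and> R0 \<le> norm w \<and> 0 \<le> s * Im z \<and> 0 \<le> s * Im w \<longrightarrow> norm (G z - G w) \<le> \<eta>"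
begin

definition e :: "real \<Rightarrow> complex" where "e \<theta> = \<i> * of_real s * cis \<theta>"
definition ang :: "complex \<Rightarrow> real" where "ang z = Arg (- (\<i> * of_real s * z))"
definition slit :: "complex \<Rightarrow> bool" where "slit z \<longleftrightarrow> - (\<i> * of_real s * z) \<notin> \<real>\<^sub>\<le>\<^sub>0"
definition U :: "complex set" where "U = {z. 0 < s * Im z \<and> 0 < Re (a * z ^ n)}"
definition B :: "complex set" where "B = (\<Union>\<sigma>\<in>Z. cball \<sigma> (2 * \<epsilon>))"
text \<open>A closed set on which g is continuous. It contains the circles of radius 2 \<epsilon>
  about points of Z and the exterior of the one about 0, and so serves as the safe region for
  integrability.\<close>

definition far :: "complex set" where "far = {z. \<epsilon> \<le> norm z}"
definition f :: "real \<Rightarrow> complex" where "f \<theta> = of_bool (e \<theta> \<in> U)"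
definition T :: "real set" where "T = {\<theta>. \<bar>\<theta>\<bar> \<le> pi / 2 \<and> (cos \<theta> = 0 \<or> Re (a * e \<theta> ^ n) = 0)}"
definition j :: "real \<Rightarrow> complex" where "j \<theta> = jump f \<theta>"

section \<open>Polar coordinates and the jumps across the rays\<close>

lemma norm_e [simp]: "norm (e \<theta>) = 1"
  using s by (auto simp: e_def norm_mult)

lemma s_Im_e: "s * Im (of_real r * e \<theta>) = r * cos \<theta>"
  using s by (auto simp: e_def)

lemma Im_s_e: "s * Im (e \<theta>) = cos \<theta>"
  using s by (auto simp: e_def)

lemma e_cnj: "e \<alpha> * cnj (e \<theta>) = cis (\<alpha> - \<theta>)"
proof -
  have "e \<alpha> * cnj (e \<theta>) = (of_real s * of_real s) * (cis \<alpha> * cis (- \<theta>))"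
    by (simp add: e_def cis_cnj mult_ac)
  moreover have "complex_of_real s * of_real s = 1" using s by (elim disjE) simp_all
  ultimately show ?thesis by (simp add: cis_mult)
qed

lemma unrotate: "- (\<i> * of_real s * (of_real r * e \<theta>)) = of_real r * cis \<theta>"
  using s by (auto simp: e_def mult_ac)

lemma polar: "z = of_real (norm z) * e (ang z)"
proof -
  let ?w = "- (\<i> * of_real s * z)"
  have "?w = of_real (norm ?w) * cis (Arg ?w)" by (metis rcis_cmod_Arg rcis_def)
  moreover have "norm ?w = norm z" using s by (auto simp: norm_mult)
  ultimately have w: "?w = of_real (norm z) * cis (ang z)" by (simp add: ang_def)
  have "z = \<i> * of_real s * ?w" using s by auto
  then show ?thesis unfolding w e_def by (simp add: mult_ac)
qed

lemma ang_bounds: "- pi < ang z" "ang z \<le> pi"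
  using Arg_bounded[of "- (\<i> * of_real s * z)"] by (auto simp: ang_def)

lemma ang_e:
  assumes "0 < r" "- pi < \<theta>" "\<theta> \<le> pi"
  shows "ang (of_real r * e \<theta>) = \<theta>"
  unfolding ang_def unrotate using assms by (simp add: Arg_times_of_real Arg_cis)

lemma slit_e:
  assumes "0 < r" "\<bar>\<theta>\<bar> < pi"
  shows "slit (of_real r * e \<theta>)"
proof (rule ccontr)
  assume "\<not> slit (of_real r * e \<theta>)"
  then have "of_real r * cis \<theta> \<in> \<real>\<^sub>\<le>\<^sub>0" by (simp only: slit_def unrotate not_not)
  then have "r * cos \<theta> \<le> 0" "r * sin \<theta> = 0" by (simp_all add: complex_nonpos_Reals_iff)
  then have "sin \<theta> = 0" "cos \<theta> \<le> 0" using assms(1) by (auto simp: mult_le_0_iff)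
  moreover from this(1) have "\<theta> = 0" using assms(2) by (simp add: sin_eq_0_pi abs_less_iff)
  ultimately show False by simp
qed

lemma slit_ang:
  assumes "slit z"
  shows "\<bar>ang z\<bar> < pi" "z \<noteq> 0"
proof -
  show "z \<noteq> 0" using assms by (auto simp: slit_def)
  have "ang z \<noteq> pi"
  proof
    assume p: "ang z = pi"
    have "z = of_real (norm z) * e pi" using polar[of z] unfolding p .
    then have "- (\<i> * of_real s * z) = of_real (norm z) * cis pi" by (metis unrotate)
    then have "- (\<i> * of_real s * z) \<in> \<real>\<^sub>\<le>\<^sub>0" by (simp add: complex_nonpos_Reals_iff)
    then show False using assms by (simp add: slit_def)
  qed
  then show "\<bar>ang z\<bar> < pi" using ang_bounds[of z] by linarith
qed

lemma U_scale:
  assumes "0 < r"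
  shows "of_real r * z \<in> U \<longleftrightarrow> z \<in> U"
proof -
  have "a * (of_real r * z) ^ n = of_real (r ^ n) * (a * z ^ n)" by (simp add: power_mult_distrib)
  then have "Re (a * (of_real r * z) ^ n) = r ^ n * Re (a * z ^ n)" by (simp only: Re_of_real_times)
  moreover have "s * Im (of_real r * z) = r * (s * Im z)" by simp
  ultimately show ?thesis
    unfolding U_def mem_Collect_eq using assms by (simp only:) (simp add: zero_less_mult_iff del: times_complex.sel)
qed

lemma U_iff_ang: "z \<noteq> 0 \<Longrightarrow> z \<in> U \<longleftrightarrow> e (ang z) \<in> U"
  using polar[of z] U_scale[of "norm z" "e (ang z)"] by simp

lemma open_U: "open U"
  unfolding U_def by (intro open_Collect_conj open_Collect_less continuous_intros)

lemma inj_on_e: "inj_on e {- pi / 2..pi / 2}"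
proof (rule inj_onI)
  fix \<theta> \<theta>' assume *: "\<theta> \<in> {- pi / 2..pi / 2}" "\<theta>' \<in> {- pi / 2..pi / 2}" "e \<theta> = e \<theta>'"
  then have "ang (of_real 1 * e \<theta>) = ang (of_real 1 * e \<theta>')" by simp
  moreover have "- pi < \<theta>" "\<theta> \<le> pi" "- pi < \<theta>'" "\<theta>' \<le> pi"
    using *(1,2) pi_gt_zero unfolding atLeastAtMost_iff by linarith+
  ultimately show "\<theta> = \<theta>'" using ang_e[of 1 \<theta>] ang_e[of 1 \<theta>'] by simp
qed

text \<open>On the unit circle \<open>Re (a * e \<theta> ^ n) = 0\<close>, multiplied by
  \<open>e \<theta> ^ n\<close>, becomes the equation \<open>a * X ^ (2 * n) + cnj a = 0\<close>,
  which is nontrivial because a is nonzero. The condition \<open>cos \<theta> = 0\<close> adds the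
  two halves of the real axis.\<close>

lemma finite_T: "finite T"
proof -
  define P where "P = monom a (2 * n) + [:cnj a:]"
  have "coeff P (2 * n) = a" using n by (simp add: P_def coeff_pCons split: nat.split)
  then have "P \<noteq> 0" using a by auto
  then have fin: "finite {z. poly P z = 0}" by (rule poly_roots_finite)
  have "e ` {\<theta>\<in>T. Re (a * e \<theta> ^ n) = 0} \<subseteq> {z. poly P z = 0}"
  proof safe
    fix \<theta> assume "Re (a * e \<theta> ^ n) = 0"
    then have "a * e \<theta> ^ n + cnj (a * e \<theta> ^ n) = 0" by (simp only: complex_add_cnj mult_zero_right of_real_0)
    then have "a * e \<theta> ^ n + cnj a * cnj (e \<theta>) ^ n = 0" by (simp only: complex_cnj_mult complex_cnj_power)
    then have "(a * e \<theta> ^ n + cnj a * cnj (e \<theta>) ^ n) * e \<theta> ^ n = 0" by simp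
    moreover have "cnj (e \<theta>) ^ n * e \<theta> ^ n = 1"
      using e_cnj[of \<theta> \<theta>] by (simp add: power_mult_distrib[symmetric] mult.commute)
    moreover have "(a * e \<theta> ^ n + cnj a * cnj (e \<theta>) ^ n) * e \<theta> ^ n = a * (e \<theta> ^ n * e \<theta> ^ n) + cnj a * (cnj (e \<theta>) ^ n * e \<theta> ^ n)"
      by (simp add: algebra_simps)
    ultimately show "poly P (e \<theta>) = 0" by (simp add: P_def poly_monom mult_2 power_add)
  qed
  then have "finite (e ` {\<theta>\<in>T. Re (a * e \<theta> ^ n) = 0})" using fin finite_subset by blast
  moreover have "inj_on e {\<theta>\<in>T. Re (a * e \<theta> ^ n) = 0}"
    by (rule inj_on_subset[OF inj_on_e]) (auto simp: T_def abs_le_iff)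
  ultimately have 1: "finite {\<theta>\<in>T. Re (a * e \<theta> ^ n) = 0}" by (rule finite_imageD)
  have "T \<subseteq> {\<theta>\<in>T. Re (a * e \<theta> ^ n) = 0} \<union> {- pi / 2, pi / 2}"
  proof
    fix \<theta> assume \<theta>: "\<theta> \<in> T"
    show "\<theta> \<in> {\<theta>\<in>T. Re (a * e \<theta> ^ n) = 0} \<union> {- pi / 2, pi / 2}"
    proof (cases "cos \<theta> = 0")
      case True
      have "\<bar>\<theta>\<bar> = pi / 2"
      proof (rule ccontr)
        assume "\<bar>\<theta>\<bar> \<noteq> pi / 2"
        then have "0 < cos \<theta>" using \<theta> by (intro cos_gt_zero_pi) (auto simp: T_def)
        then show False using True by simp
      qed
      then show ?thesis by auto
    qed (use \<theta> in \<open>auto simp: T_def\<close>)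
  qed
  then show ?thesis by (rule finite_subset) (use 1 in simp)
qed

lemma T_bounds:
  assumes "\<theta> \<in> T"
  shows "\<bar>\<theta>\<bar> \<le> pi / 2" "\<bar>\<theta>\<bar> < pi" "0 \<le> cos \<theta>"
proof -
  show 1: "\<bar>\<theta>\<bar> \<le> pi / 2" using assms by (simp add: T_def)
  then show "\<bar>\<theta>\<bar> < pi" using pi_gt_zero by linarith
  show "0 \<le> cos \<theta>" using 1 unfolding abs_le_iff by (intro cos_ge_zero) linarith+
qed

lemma continuous_e: "isCont e \<theta>"
proof -
  have "continuous_on UNIV e" unfolding e_def[abs_def] by (intro continuous_intros)
  then show ?thesis by (simp add: continuous_on_eq_continuous_at)
qed

lemma f_locally_const:
  assumes "\<theta> \<in> {- pi<..<pi} - T"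
  shows "\<forall>\<^sub>F x in at \<theta>. f x = f \<theta>"
proof -
  have cos: "(cos \<longlongrightarrow> cos \<theta>) (at \<theta>)" using isCont_cos isContD by blast
  have Re: "((\<lambda>x. Re (a * e x ^ n)) \<longlongrightarrow> Re (a * e \<theta> ^ n)) (at \<theta>)"
    using continuous_e[of \<theta>] unfolding isCont_def by (intro tendsto_intros)
  have fx: "f x = of_bool (0 < cos x \<and> 0 < Re (a * e x ^ n))" for x by (simp add: f_def U_def Im_s_e)
  consider "cos \<theta> < 0" | "0 < cos \<theta>" | "cos \<theta> = 0" by linarith
  then show ?thesis
  proof cases
    case 1
    from order_tendstoD(2)[OF cos this] show ?thesis by eventually_elim (use 1 in \<open>simp add: fx\<close>)
  next
    case 2
    then have "\<bar>\<theta>\<bar> \<le> pi / 2" using assms by (intro cos_nonneg_imp) auto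
    then have "Re (a * e \<theta> ^ n) \<noteq> 0" using assms by (auto simp: T_def)
    then consider "0 < Re (a * e \<theta> ^ n)" | "Re (a * e \<theta> ^ n) < 0" by linarith
    then show ?thesis
    proof cases
      case 1
      from order_tendstoD(1)[OF cos 2] order_tendstoD(1)[OF Re 1] show ?thesis
        by eventually_elim (use 1 2 in \<open>simp add: fx\<close>)
    next
      case neg: 2
      from order_tendstoD(2)[OF Re neg] show ?thesis by eventually_elim (use neg in \<open>simp add: fx\<close>)
    qed
  next
    case 3
    then have "\<bar>\<theta>\<bar> \<le> pi / 2" using assms by (intro cos_nonneg_imp) auto
    then show ?thesis using assms 3 by (simp add: T_def)
  qed
qed

lemma f_outside:
  assumes "pi / 2 < \<bar>\<theta>\<bar>" "\<bar>\<theta>\<bar> < pi"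
  shows "f \<theta> = 0"
proof -
  have "\<not> 0 < cos \<theta>" using cos_nonneg_imp[of \<theta>] assms by auto
  then show ?thesis by (simp add: f_def U_def Im_s_e)
qed

lemma f_eq_sum:
  assumes "\<theta> \<in> {- pi<..<pi} - T"
  shows "f \<theta> = (\<Sum>\<tau>\<in>T. j \<tau> * of_bool (\<tau> < \<theta>))"
proof -
  \<comment> \<open>The base angle lies between the cut at -pi and all rays, where f
    vanishes.\<close>
  have "f \<theta> = f (- 3 * pi / 4) + (\<Sum>\<tau> | \<tau> \<in> T \<and> \<tau> < \<theta>. jump f \<tau>)"
  proof (rule step_function_sum[OF finite_T f_locally_const assms])
    show "- 3 * pi / 4 < \<tau>" if "\<tau> \<in> T" for \<tau> using T_bounds(1)[OF that] pi_gt_zero unfolding abs_le_iff by linarith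
  qed (auto, use pi_gt_zero in linarith)
  also have "f (- 3 * pi / 4) = 0" using pi_gt_zero by (intro f_outside) auto
  also have "(\<Sum>\<tau> | \<tau> \<in> T \<and> \<tau> < \<theta>. jump f \<tau>) = (\<Sum>\<tau>\<in>T. if \<tau> < \<theta> then j \<tau> else 0)"
    unfolding j_def using finite_T by (simp add: sum.inter_filter)
  also have "\<dots> = (\<Sum>\<tau>\<in>T. j \<tau> * of_bool (\<tau> < \<theta>))" by (intro sum.cong) auto
  finally show ?thesis by simp
qed

text \<open>The indicator is 0 on both sides of the half-plane, so its jumps balance. Through this
  identity every contribution common to all rays drops out.\<close>

lemma sum_j: "(\<Sum>\<tau>\<in>T. j \<tau>) = 0"
proof -
  have lt: "\<tau> < 3 * pi / 4" if "\<tau> \<in> T" for \<tau> using T_bounds(1)[OF that] pi_gt_zero unfolding abs_le_iff by linarith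
  have "0 = f (3 * pi / 4)" using pi_gt_zero by (subst f_outside) auto
  also have "\<dots> = (\<Sum>\<tau>\<in>T. j \<tau> * of_bool (\<tau> < 3 * pi / 4))"
    using lt pi_gt_zero by (intro f_eq_sum) force
  also have "\<dots> = (\<Sum>\<tau>\<in>T. j \<tau>)" using lt by (intro sum.cong) auto
  finally show ?thesis by simp
qed

section \<open>Orientation of the boundary pieces\<close>

lemma open_Compl_B: "open (- B)"
  unfolding B_def by (rule open_Compl_cballs[OF Z \<epsilon>])

lemma eventually_line:
  fixes S :: "complex set"
  assumes "open S" "z \<in> S"
  shows "\<forall>\<^sub>F t in at_right 0. z + of_real t * v \<in> S"
proof -
  have "((\<lambda>t::real. z + of_real t * v) \<longlongrightarrow> z + of_real 0 * v) (at_right 0)"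
    by (intro tendsto_add tendsto_mult tendsto_of_real tendsto_const tendsto_ident_at)
  then show ?thesis using topological_tendstoD[OF _ assms(1)] assms(2) by simp
qed

text \<open>A step perpendicular to the ray changes the angle by an arctangent. The two tests in
  \<open>bdry_sign\<close> thereby become one-sided limits of f.\<close>

lemma tangent_e:
  assumes "0 < \<rho>"
  shows "of_real \<rho> * e \<theta> + of_real t * \<i> * (of_real R * e \<theta>) = of_real (sqrt (\<rho>\<^sup>2 + (t * R)\<^sup>2)) * e (\<theta> + arctan (t * R / \<rho>))"
proof -
  let ?x = "t * R / \<rho>"
  have sq: "sqrt (\<rho>\<^sup>2 + (t * R)\<^sup>2) = \<rho> * sqrt (1 + ?x\<^sup>2)"
  proof -
    have "\<rho>\<^sup>2 + (t * R)\<^sup>2 = \<rho>\<^sup>2 * (1 + ?x\<^sup>2)" using assms by (simp add: power_divide field_simps)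
    then show ?thesis using assms by (simp add: real_sqrt_mult)
  qed
  have "1 + ?x\<^sup>2 \<noteq> 0" using zero_le_power2[of ?x] by linarith
  then have "of_real (sqrt (1 + ?x\<^sup>2)) * cis (arctan ?x) = 1 + \<i> * of_real ?x"
    by (simp add: complex_eq_iff cos_arctan sin_arctan)
  then have "of_real \<rho> * (of_real (sqrt (1 + ?x\<^sup>2)) * cis (arctan ?x)) = of_real \<rho> + \<i> * of_real (t * R)"
    using assms by (simp add: algebra_simps)
  then have "(of_real \<rho> * (of_real (sqrt (1 + ?x\<^sup>2)) * cis (arctan ?x))) * e \<theta> = (of_real \<rho> + \<i> * of_real (t * R)) * e \<theta>"
    by simp
  moreover have "e (\<theta> + arctan ?x) = cis (arctan ?x) * e \<theta>" by (simp add: e_def cis_mult[symmetric] mult_ac)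
  ultimately show ?thesis unfolding sq by (simp add: algebra_simps)
qed

text \<open>To the left of an outward ray the angle is larger, so the left test returns the
  right-hand limit of f and the right test the left-hand limit. Off B membership of nearby points in
  the region depends on the angle alone.\<close>

lemma bdry_sign_ray:
  assumes \<theta>: "\<theta> \<in> T" and \<rho>: "0 < \<rho>" and R: "0 < R" and nB: "of_real \<rho> * e \<theta> \<notin> B"
  shows "bdry_sign (U - B) (of_real \<rho> * e \<theta>) (of_real R * e \<theta>) = j \<theta>"
proof -
  let ?z = "of_real \<rho> * e \<theta>" and ?v = "of_real R * e \<theta>"
  have \<theta>': "\<theta> \<in> {- pi<..<pi}" using T_bounds(2)[OF \<theta>] by (simp add: abs_less_iff)
  have side: "of_bool (\<forall>\<^sub>F t in at_right 0. ?z + of_real (\<delta> * t) * \<i> * ?v \<in> U - B) = L"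
    if \<delta>: "\<delta> = 1 \<or> \<delta> = -1" and Fl: "filterlim (\<lambda>t. \<theta> + arctan (\<delta> * t * R / \<rho>)) F (at_right 0)" and L: "\<forall>\<^sub>F x in F. f x = L" for \<delta> F L
  proof -
    have fe: "?z + of_real (\<delta> * t) * \<i> * ?v \<in> U \<longleftrightarrow> f (\<theta> + arctan (\<delta> * t * R / \<rho>)) = 1" for t
    proof -
      have "0 < sqrt (\<rho>\<^sup>2 + (\<delta> * t * R)\<^sup>2)" using \<rho> by (simp add: add_pos_nonneg)
      then show ?thesis unfolding tangent_e[OF \<rho>] by (simp add: U_scale f_def)
    qed
    have nb: "\<forall>\<^sub>F t in at_right 0. ?z + of_real (\<delta> * t) * \<i> * ?v \<notin> B"
      using eventually_line[OF open_Compl_B, of ?z "of_real \<delta> * \<i> * ?v"] nB by (simp add: mult_ac)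
    have ev: "\<forall>\<^sub>F t in at_right 0. f (\<theta> + arctan (\<delta> * t * R / \<rho>)) = L"
      using Fl L unfolding filterlim_iff by blast
    with nb have "\<forall>\<^sub>F t in at_right 0. (?z + of_real (\<delta> * t) * \<i> * ?v \<in> U - B \<longleftrightarrow> L = 1)"
      by eventually_elim (use fe in auto)
    then have "(\<forall>\<^sub>F t in at_right 0. ?z + of_real (\<delta> * t) * \<i> * ?v \<in> U - B) \<longleftrightarrow> (\<forall>\<^sub>F t in at_right (0::real). L = 1)"
      by (rule eventually_subst) 
    then have iff: "(\<forall>\<^sub>F t in at_right 0. ?z + of_real (\<delta> * t) * \<i> * ?v \<in> U - B) \<longleftrightarrow> L = 1" by simp
    obtain t where "f (\<theta> + arctan (\<delta> * t * R / \<rho>)) = L"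
      using eventually_happens[OF ev] by auto
    then have "L = 0 \<or> L = 1" by (auto simp: f_def)
    then show ?thesis unfolding iff by auto
  qed
  have "filterlim (\<lambda>t. \<theta> + arctan (1 * t * R / \<rho>)) (at_right \<theta>) (at_right 0)"
    unfolding filterlim_at
  proof
    have "((\<lambda>t. \<theta> + arctan (1 * t * R / \<rho>)) \<longlongrightarrow> \<theta> + arctan (1 * 0 * R / \<rho>)) (at_right 0)"
      using \<rho> by (intro tendsto_intros) auto
    then show "((\<lambda>t. \<theta> + arctan (1 * t * R / \<rho>)) \<longlongrightarrow> \<theta>) (at_right 0)" by simp
    show "\<forall>\<^sub>F t in at_right 0. \<theta> + arctan (1 * t * R / \<rho>) \<in> {\<theta><..} \<and> \<theta> + arctan (1 * t * R / \<rho>) \<noteq> \<theta>"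
      using eventually_at_right_less by eventually_elim (use \<rho> R in simp)
  qed
  from side[OF _ this eventually_const_sides(1)[OF finite_T f_locally_const \<theta>']]
  have r: "of_bool (\<forall>\<^sub>F t in at_right 0. ?z + of_real t * \<i> * ?v \<in> U - B) = Lim (at_right \<theta>) f" by simp
  have "filterlim (\<lambda>t. \<theta> + arctan (- 1 * t * R / \<rho>)) (at_left \<theta>) (at_right 0)"
    unfolding filterlim_at
  proof
    have "((\<lambda>t. \<theta> + arctan (- 1 * t * R / \<rho>)) \<longlongrightarrow> \<theta> + arctan (- 1 * 0 * R / \<rho>)) (at_right 0)"
      using \<rho> by (intro tendsto_intros) auto
    then show "((\<lambda>t. \<theta> + arctan (- 1 * t * R / \<rho>)) \<longlongrightarrow> \<theta>) (at_right 0)" by simp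
    show "\<forall>\<^sub>F t in at_right 0. \<theta> + arctan (- 1 * t * R / \<rho>) \<in> {..<\<theta>} \<and> \<theta> + arctan (- 1 * t * R / \<rho>) \<noteq> \<theta>"
      using eventually_at_right_less by eventually_elim (use \<rho> R in \<open>simp add: arctan_minus\<close>)
  qed
  from side[OF _ this eventually_const_sides(2)[OF finite_T f_locally_const \<theta>']]
  have l: "of_bool (\<forall>\<^sub>F t in at_right 0. ?z - of_real t * \<i> * ?v \<in> U - B) = Lim (at_left \<theta>) f" by simp
  show ?thesis unfolding bdry_sign_def r l j_def jump_def ..
qed

text \<open>This permits a ray to run straight through a removed disc: both of its sides lie in B,
  so the sign cancels that stretch.\<close>

lemma bdry_sign_ball:
  assumes "\<sigma> \<in> Z" "z \<in> ball \<sigma> (2 * \<epsilon>)"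
  shows "bdry_sign (U - B) z v = 0"
proof -
  have sub: "ball \<sigma> (2 * \<epsilon>) \<subseteq> B" using assms(1) by (force simp: B_def)
  have no: "\<not> (\<forall>\<^sub>F t in at_right 0. z + of_real t * w \<in> U - B)" for w
  proof
    assume "\<forall>\<^sub>F t in at_right 0. z + of_real t * w \<in> U - B"
    with eventually_line[OF open_ball assms(2), of w] have "\<forall>\<^sub>F t in at_right (0::real). False"
      by eventually_elim (use sub in blast)
    then show False by simp
  qed
  from no[of "\<i> * v"] no[of "- \<i> * v"] show ?thesis
    unfolding bdry_sign_def by (simp add: mult.assoc)
qed

lemma Z_dist: "\<sigma> \<in> Z \<Longrightarrow> \<tau> \<in> Z \<Longrightarrow> \<sigma> \<noteq> \<tau> \<Longrightarrow> 5 * \<epsilon> \<le> dist \<sigma> \<tau>"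
  using Z by (auto simp: separated_def)

lemma Z_norm: "\<sigma> \<in> Z \<Longrightarrow> \<sigma> \<noteq> 0 \<Longrightarrow> 5 * \<epsilon> \<le> norm \<sigma>"
  using Z_dist[OF _ Z0, of \<sigma>] by simp

lemma sphere_other:
  assumes "\<sigma> \<in> Z" "\<tau> \<in> Z" "\<sigma> \<noteq> \<tau>" "z \<in> cball \<sigma> (2 * \<epsilon>)"
  shows "z \<notin> cball \<tau> (2 * \<epsilon>)"
proof
  assume "z \<in> cball \<tau> (2 * \<epsilon>)"
  then have "dist \<sigma> \<tau> \<le> 2 * \<epsilon> + 2 * \<epsilon>" using assms(4) dist_triangle[of \<sigma> \<tau> z] by (simp add: dist_commute)
  then show False using Z_dist[OF assms(1-3)] \<epsilon> by simp
qed

text \<open>Off U and off the rays one of the two inequalities fails strictly, since otherwise the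
  angle of z would belong to T.\<close>

lemma not_on_ray_cases:
  assumes "\<And>\<theta> \<rho>. \<theta> \<in> T \<Longrightarrow> 0 \<le> \<rho> \<Longrightarrow> z \<noteq> of_real \<rho> * e \<theta>" "z \<notin> U" "z \<noteq> 0"
  shows "\<exists>S. open S \<and> z \<in> S \<and> S \<inter> U = {}"
proof (cases "s * Im z < 0 \<or> Re (a * z ^ n) < 0")
  case True
  then show ?thesis
  proof
    assume "s * Im z < 0"
    then show ?thesis
      by (intro exI[of _ "{z. s * Im z < 0}"] conjI open_Collect_less continuous_intros) (auto simp: U_def)
  next
    assume "Re (a * z ^ n) < 0"
    then show ?thesis
      by (intro exI[of _ "{z. Re (a * z ^ n) < 0}"] conjI open_Collect_less continuous_intros) (auto simp: U_def)
  qed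
next
  case False
  have p: "s * Im z = norm z * cos (ang z)" by (subst polar) (rule s_Im_e)
  have Rez: "Re (a * z ^ n) = norm z ^ n * Re (a * e (ang z) ^ n)"
  proof -
    have "a * (of_real (norm z) * e (ang z)) ^ n = of_real (norm z ^ n) * (a * e (ang z) ^ n)"
      by (simp add: power_mult_distrib)
    then have "a * z ^ n = of_real (norm z ^ n) * (a * e (ang z) ^ n)" using polar[of z] by simp
    then show ?thesis by (simp only: Re_of_real_times)
  qed
  have c: "0 \<le> cos (ang z)" using False p assms(3) by (simp add: zero_le_mult_iff not_less)
  have "ang z \<noteq> pi" using c by auto
  then have "\<bar>ang z\<bar> < pi" using ang_bounds[of z] by linarith
  with c have "\<bar>ang z\<bar> \<le> pi / 2" by (rule cos_nonneg_imp)
  moreover have "cos (ang z) = 0 \<or> Re (a * e (ang z) ^ n) = 0"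
    using False assms(2,3) p Rez by (auto simp: U_def not_less)
  ultimately have "ang z \<in> T" by (simp add: T_def)
  then show ?thesis using assms(1)[of "ang z" "norm z"] polar[of z] by simp
qed

text \<open>On the left of a positively oriented circle is the removed disc. On the right is the
  region exactly if z is in U, since z lies on no ray and in no other disc. Hence the boundary runs
  clockwise around the holes.\<close>

lemma bdry_sign_circle:
  assumes \<sigma>: "\<sigma> \<in> Z" and z: "z \<in> sphere \<sigma> (2 * \<epsilon>)" and k: "0 < k"
    and ray: "\<And>\<theta> \<rho>. \<theta> \<in> T \<Longrightarrow> 0 \<le> \<rho> \<Longrightarrow> z \<noteq> of_real \<rho> * e \<theta>"
    and z0: "z \<noteq> 0"
  shows "bdry_sign (U - B) z (\<i> * of_real k * (z - \<sigma>)) = - of_bool (z \<in> U)"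
proof -
  let ?v = "\<i> * of_real k * (z - \<sigma>)"
  have nz: "norm (z - \<sigma>) = 2 * \<epsilon>" using z by (simp add: dist_norm norm_minus_commute)
  have small: "\<forall>\<^sub>F t in at_right (0::real). t < 1 / k" using k by (intro eventually_at_right_real[THEN eventually_mono, of 0 "1 / k"]) auto
  have inn: "\<not> (\<forall>\<^sub>F t in at_right 0. z + of_real t * \<i> * ?v \<in> U - B)"
  proof
    assume "\<forall>\<^sub>F t in at_right 0. z + of_real t * \<i> * ?v \<in> U - B"
    with small eventually_at_right_less[of 0] have "\<forall>\<^sub>F t in at_right (0::real). False"
    proof eventually_elim
      case (elim t)
      have "z + of_real t * \<i> * ?v = \<sigma> + of_real (1 - t * k) * (z - \<sigma>)" by (simp add: algebra_simps)
      then have "dist \<sigma> (z + of_real t * \<i> * ?v) = \<bar>1 - t * k\<bar> * (2 * \<epsilon>)"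
        by (simp add: dist_norm norm_mult nz del: of_real_diff)
      also have "\<dots> \<le> 1 * (2 * \<epsilon>)" using elim k \<epsilon> by (intro mult_right_mono) (auto simp: field_simps)
      finally have "z + of_real t * \<i> * ?v \<in> B" using \<sigma> by (auto simp: B_def)
      then show ?case using elim by blast
    qed
    then show False by simp
  qed
  have out: "(\<forall>\<^sub>F t in at_right 0. z - of_real t * \<i> * ?v \<in> U - B) \<longleftrightarrow> z \<in> U"
  proof
    assume zU: "z \<in> U"
    have "separated (Z - {\<sigma>}) \<epsilon>" using Z by (simp add: separated_def)
    from open_Compl_cballs[OF this \<epsilon>] have op: "open (- (\<Union>\<tau>\<in>Z - {\<sigma>}. cball \<tau> (2 * \<epsilon>)))" .
    have "z \<in> cball \<sigma> (2 * \<epsilon>)" using z by simp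
    then have zo: "z \<in> - (\<Union>\<tau>\<in>Z - {\<sigma>}. cball \<tau> (2 * \<epsilon>))" using sphere_other[OF \<sigma>] by blast
    show "\<forall>\<^sub>F t in at_right 0. z - of_real t * \<i> * ?v \<in> U - B"
      using eventually_line[OF open_U zU, of "- \<i> * ?v"] eventually_line[OF op zo, of "- \<i> * ?v"] eventually_at_right_less[of 0]
    proof eventually_elim
      case (elim t)
      have eq: "z + of_real t * (- \<i> * ?v) = z - of_real t * \<i> * ?v" by (simp add: algebra_simps)
      have "z - of_real t * \<i> * ?v = \<sigma> + of_real (1 + t * k) * (z - \<sigma>)" by (simp add: algebra_simps)
      then have "dist \<sigma> (z - of_real t * \<i> * ?v) = \<bar>1 + t * k\<bar> * (2 * \<epsilon>)"
        by (simp add: dist_norm norm_mult nz del: of_real_add)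
      also have "1 * (2 * \<epsilon>) < \<bar>1 + t * k\<bar> * (2 * \<epsilon>)"
        using elim(3) k \<epsilon> by (intro mult_strict_right_mono) auto
      finally have "z - of_real t * \<i> * ?v \<notin> cball \<sigma> (2 * \<epsilon>)" by simp
      then show ?case using elim(1,2) unfolding eq B_def by blast
    qed
  next
    assume ev: "\<forall>\<^sub>F t in at_right 0. z - of_real t * \<i> * ?v \<in> U - B"
    show "z \<in> U"
    proof (rule ccontr)
      assume "z \<notin> U"
      from not_on_ray_cases[OF ray this z0] obtain S where S: "open S" "z \<in> S" "S \<inter> U = {}" by blast
      from eventually_line[OF S(1,2), of "- \<i> * ?v"] ev have "\<forall>\<^sub>F t in at_right (0::real). False"
        by eventually_elim (use S(3) in \<open>auto simp: mult_ac\<close>)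
      then show False by simp
    qed
  qed
  show ?thesis unfolding bdry_sign_def using inn out by simp
qed

end

section \<open>Truncated boundary integrals\<close>

lemma half_discs_borel: "half_discs A B \<in> sets borel"
proof -
  have "half_discs A B = ({z. 0 \<le> Re z} \<inter> {z. norm z \<le> A}) \<union> ({z. Re z < 0} \<inter> {z. norm z \<le> B})"
    by (auto simp: half_discs_def)
  moreover have "closed {z. 0 \<le> Re z}" "closed {z::complex. norm z \<le> A}" "closed {z::complex. norm z \<le> B}" "open {z. Re z < 0}"
    by (intro closed_Collect_le open_Collect_less continuous_intros)+
  ultimately show ?thesis by (auto intro!: sets.Un sets.Int)
qed

lemma has_vector_derivative_circle:
  "(circlepath \<sigma> r has_vector_derivative 2 * of_real pi * \<i> * (circlepath \<sigma> r t - \<sigma>)) (at t)"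
proof -
  have "(circlepath \<sigma> r has_vector_derivative 2 * of_real pi * \<i> * of_real r * exp (2 * of_real pi * \<i> * of_real t)) (at t)"
    using has_vector_derivative_circlepath[of \<sigma> r t UNIV] by simp
  then show ?thesis by (simp add: circlepath mult_ac)
qed

context perforated_sector
begin

definition K :: "real \<Rightarrow> real \<Rightarrow> complex set" where "K = half_discs"

definition ray :: "real \<Rightarrow> real \<Rightarrow> real \<Rightarrow> complex" where
  "ray R \<theta> = linepath 0 (of_real R * e \<theta>)"

definition circ :: "complex \<Rightarrow> real \<Rightarrow> complex" where
  "circ \<sigma> = circlepath \<sigma> (2 * \<epsilon>)"

text \<open>The curve is cut by an indicator in the integrand and not by subpaths, so these
  integrals are additive in S whatever its shape.\<close>

definition ri :: "real \<Rightarrow> complex set \<Rightarrow> real \<Rightarrow> complex" where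
  "ri R S \<theta> = contour_integral (ray R \<theta>) (\<lambda>z. if z \<in> S then g z else 0)"

definition ci :: "complex set \<Rightarrow> complex \<Rightarrow> complex" where
  "ci S \<sigma> = contour_integral (circ \<sigma>) (\<lambda>z. if z \<in> S then g z else 0)"

lemma ray_eq: "ray R \<theta> t = of_real (R * t) * e \<theta>"
  by (simp add: ray_def linepath_def scaleR_conv_of_real mult_ac)

lemma vd_ray: "vector_derivative (ray R \<theta>) (at t) = of_real R * e \<theta>"
  unfolding ray_def by (rule vector_derivative_at[OF has_vector_derivative_ray])

lemma vd_circ: "vector_derivative (circ \<sigma>) (at t) = 2 * of_real pi * \<i> * (circ \<sigma> t - \<sigma>)"
  unfolding circ_def by (rule vector_derivative_at[OF has_vector_derivative_circle])

lemma circ_sphere: "t \<in> {0..1} \<Longrightarrow> circ \<sigma> t \<in> sphere \<sigma> (2 * \<epsilon>)"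
  using path_image_circlepath[of \<sigma> "2 * \<epsilon>"] \<epsilon> unfolding circ_def path_image_def by auto

lemma path_image_circ: "path_image (circ \<sigma>) = sphere \<sigma> (2 * \<epsilon>)"
  using \<epsilon> by (simp add: circ_def)

lemma sphere_far: "\<sigma> \<in> Z \<Longrightarrow> z \<in> cball \<sigma> (2 * \<epsilon>) \<Longrightarrow> \<sigma> \<noteq> 0 \<Longrightarrow> 3 * \<epsilon> \<le> norm z"
  using Z_norm[of \<sigma>] norm_triangle_sub[of \<sigma> z] by (simp add: dist_norm)

lemma circ_far:
  assumes "\<sigma> \<in> Z" "z \<in> sphere \<sigma> (2 * \<epsilon>)"
  shows "z \<in> far"
proof (cases "\<sigma> = 0")
  case True
  then show ?thesis using assms \<epsilon> by (simp add: far_def)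
next
  case False
  then show ?thesis using sphere_far[OF assms(1) _ False, of z] assms(2) \<epsilon> by (simp add: far_def)
qed

lemma closed_far: "closed far"
  unfolding far_def by (intro closed_Collect_le continuous_intros)

lemma continuous_on_g_far: "continuous_on (far \<inter> S) g"
  by (rule continuous_on_subset[OF holomorphic_on_imp_continuous_on[OF g_hol]]) (use \<epsilon> in \<open>auto simp: far_def\<close>)

lemma ray_integrable:
  assumes "S \<in> sets borel" "S \<subseteq> far"
  shows "(\<lambda>z. if z \<in> S then g z else 0) contour_integrable_on ray R \<theta>"
  unfolding contour_integrable_on vd_ray
  by (rule integrable_indicator_path[OF _ _ closed_far continuous_on_g_far assms])
    (auto simp: ray_eq[abs_def] intro!: continuous_intros)

lemma circ_integrable:
  assumes "S \<in> sets borel" "S \<subseteq> far"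
  shows "(\<lambda>z. if z \<in> S then g z else 0) contour_integrable_on circ \<sigma>"
proof -
  have c: "continuous_on {0..1} (circ \<sigma>)"
    unfolding circ_def using path_circlepath by (simp add: path_def)
  show ?thesis
    unfolding contour_integrable_on vd_circ
    by (rule integrable_indicator_path[OF c _ closed_far continuous_on_g_far assms])
      (intro continuous_intros c)
qed

lemma ri_has: "S \<in> sets borel \<Longrightarrow> S \<subseteq> far \<Longrightarrow> ((\<lambda>z. if z \<in> S then g z else 0) has_contour_integral ri R S \<theta>) (ray R \<theta>)"
  unfolding ri_def by (intro has_contour_integral_integral ray_integrable)

lemma ci_has: "S \<in> sets borel \<Longrightarrow> S \<subseteq> far \<Longrightarrow> ((\<lambda>z. if z \<in> S then g z else 0) has_contour_integral ci S \<sigma>) (circ \<sigma>)"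
  unfolding ci_def by (intro has_contour_integral_integral circ_integrable)

lemma B_borel: "B \<in> sets borel"
  using open_Compl_B by (metis borel_open sets.compl_sets space_borel Compl_eq_Diff_UNIV double_complement)

lemma K_borel: "K A B' \<in> sets borel"
  by (simp add: K_def half_discs_borel)

lemma U_borel: "U \<in> sets borel"
  using open_U by simp

lemma far_borel: "far \<in> sets borel"
  using closed_far by simp

lemma K_norm: "z \<in> K A B' \<Longrightarrow> norm z \<le> max A B'"
  by (auto simp: K_def half_discs_def)

lemma nearby_far: "- B \<subseteq> far" "- cball 0 (2 * \<epsilon>) \<subseteq> far"
proof -
  have "cball 0 (2 * \<epsilon>) \<subseteq> B" using Z0 by (auto simp: B_def)
  moreover show "- cball 0 (2 * \<epsilon>) \<subseteq> far" using \<epsilon> by (auto simp: far_def)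
  ultimately show "- B \<subseteq> far" by blast
qed

text \<open>The points of Z whose discs can meet the disc of radius R about 0; the separation makes
  them finite in number.\<close>

definition Zf :: "real \<Rightarrow> complex set" where "Zf R = {\<sigma>\<in>Z. norm \<sigma> \<le> R + 2 * \<epsilon>}"

lemma finite_Zf: "finite (Zf R)"
  unfolding Zf_def by (rule finite_separated_bounded[OF Z \<epsilon>])

lemma near_Zf:
  assumes "\<sigma> \<in> Z" "z \<in> cball \<sigma> (2 * \<epsilon>)" "norm z \<le> R"
  shows "\<sigma> \<in> Zf R"
  using assms norm_triangle_sub[of \<sigma> z] by (simp add: Zf_def dist_norm)

lemma frontier_cover:
  assumes R: "0 < R" and z: "z \<in> frontier (U - B)" "norm z \<le> R"
  shows "(\<exists>\<theta>\<in>T. z \<in> path_image (ray R \<theta>)) \<or> (\<exists>\<sigma>\<in>Zf R. z \<in> path_image (circ \<sigma>))"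
proof -
  have op: "open (U - B)" using open_U open_Compl_B by (simp add: Diff_eq open_Int)
  have cl: "z \<in> closure (U - B)" and nin: "z \<notin> U - B"
    using z(1) op by (auto simp: frontier_def interior_open)
  show ?thesis
  proof (cases "z \<in> B")
    case True
    then obtain \<sigma> where \<sigma>: "\<sigma> \<in> Z" "z \<in> cball \<sigma> (2 * \<epsilon>)" by (auto simp: B_def)
    have "z \<notin> ball \<sigma> (2 * \<epsilon>)"
    proof
      assume "z \<in> ball \<sigma> (2 * \<epsilon>)"
      then have "ball \<sigma> (2 * \<epsilon>) \<inter> (U - B) \<noteq> {}"
        using cl by (metis open_ball open_Int_closure_eq_empty disjoint_iff)
      moreover have "ball \<sigma> (2 * \<epsilon>) \<subseteq> B" using \<sigma>(1) by (force simp: B_def)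
      ultimately show False by blast
    qed
    then have "z \<in> sphere \<sigma> (2 * \<epsilon>)" using \<sigma>(2) by auto
    then show ?thesis using near_Zf[OF \<sigma> z(2)] unfolding path_image_circ by blast
  next
    case False
    then have zU: "z \<notin> U" using nin by blast
    have z0: "z \<noteq> 0" using False Z0 \<epsilon> by (auto simp: B_def)
    have "\<exists>\<theta> \<rho>. \<theta> \<in> T \<and> 0 \<le> \<rho> \<and> z = of_real \<rho> * e \<theta>"
    proof (rule ccontr)
      assume "\<not> ?thesis"
      then obtain S where S: "open S" "z \<in> S" "S \<inter> U = {}" using not_on_ray_cases[OF _ zU z0] by blast
      then have "S \<inter> (U - B) \<noteq> {}" using cl by (metis open_Int_closure_eq_empty disjoint_iff)
      then show False using S(3) by blast
    qed
    then obtain \<theta> \<rho> where \<theta>: "\<theta> \<in> T" "0 \<le> \<rho>" "z = of_real \<rho> * e \<theta>" by blast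
    have "\<rho> \<le> R" using \<theta> z(2) by (simp add: norm_mult)
    then have "z = ray R \<theta> (\<rho> / R)" "\<rho> / R \<in> {0..1}" unfolding ray_eq using \<theta> R by auto
    then show ?thesis using \<theta>(1) unfolding path_image_def by blast
  qed
qed

lemma finite_circ_rays: "finite (sphere \<sigma> (2 * \<epsilon>) \<inter> (\<Union>\<theta>\<in>T. {of_real \<rho> * e \<theta> | \<rho>. True}))"
proof -
  have "sphere \<sigma> (2 * \<epsilon>) \<inter> {of_real \<rho> * e \<theta> | \<rho>. True} \<subseteq> (\<lambda>\<rho>. of_real \<rho> * e \<theta>) ` {\<rho>::real. norm (of_real \<rho> * e \<theta> - \<sigma>) = 2 * \<epsilon>}" for \<theta>
    by (auto simp: dist_norm norm_minus_commute)
  then have "finite (sphere \<sigma> (2 * \<epsilon>) \<inter> {of_real \<rho> * e \<theta> | \<rho>. True})" for \<theta>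
    using finite_ray_sphere[OF norm_e, of \<theta> \<sigma> "2 * \<epsilon>"] by (meson finite_imageI finite_subset)
  then show ?thesis using finite_T by (simp only: Int_UN_distrib) (intro finite_UN_I, auto)
qed

lemma simple_circ: "simple_path (circ \<sigma>)"
  using \<epsilon> by (simp add: circ_def simple_path_circlepath)

lemma finite_circ_times: "finite {t\<in>{0..1}. circ \<sigma> t \<in> (\<Union>\<theta>\<in>T. {of_real \<rho> * e \<theta> | \<rho>. True})}"
proof -
  have "{t\<in>{0..1}. circ \<sigma> t \<in> (\<Union>\<theta>\<in>T. {of_real \<rho> * e \<theta> | \<rho>. True})} \<subseteq>
      {t\<in>{0..1}. circ \<sigma> t \<in> sphere \<sigma> (2 * \<epsilon>) \<inter> (\<Union>\<theta>\<in>T. {of_real \<rho> * e \<theta> | \<rho>. True})}"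
    using circ_sphere by blast
  then show ?thesis
    using finite_simple_path_preimage[OF simple_circ finite_circ_rays] by (rule finite_subset)
qed

lemma finite_ray_times:
  assumes "0 < R"
  shows "finite {t\<in>{0..1}. \<exists>\<sigma>\<in>Zf R. ray R \<theta> t \<in> sphere \<sigma> (2 * \<epsilon>)}"
proof -
  have "finite {t::real. norm (of_real (R * t) * e \<theta> - \<sigma>) = 2 * \<epsilon>}" for \<sigma>
  proof -
    have "{t::real. norm (of_real (R * t) * e \<theta> - \<sigma>) = 2 * \<epsilon>} \<subseteq> (\<lambda>\<rho>. \<rho> / R) ` {\<rho>::real. norm (of_real \<rho> * e \<theta> - \<sigma>) = 2 * \<epsilon>}"
      using assms by (auto intro!: image_eqI[where x = "R * _"])
    then show ?thesis using finite_ray_sphere[OF norm_e, of \<theta> \<sigma> "2 * \<epsilon>"] by (meson finite_imageI finite_subset)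
  qed
  then have "finite (\<Union>\<sigma>\<in>Zf R. {t::real. norm (of_real (R * t) * e \<theta> - \<sigma>) = 2 * \<epsilon>})"
    using finite_Zf by blast
  moreover have "{t\<in>{0..1}. \<exists>\<sigma>\<in>Zf R. ray R \<theta> t \<in> sphere \<sigma> (2 * \<epsilon>)} \<subseteq> (\<Union>\<sigma>\<in>Zf R. {t::real. norm (of_real (R * t) * e \<theta> - \<sigma>) = 2 * \<epsilon>})"
    unfolding ray_eq by (auto simp: dist_norm norm_minus_commute)
  ultimately show ?thesis by (rule finite_subset[rotated])
qed

text \<open>The sign is \<open>j \<theta>\<close> off B and 0 inside the discs. The finitely many
  points where the ray meets a circle are left open, as they do not affect the integral.\<close>

lemma has_integral_ray:
  assumes \<theta>: "\<theta> \<in> T" and R: "0 < R"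
  shows "((\<lambda>t. bdry_sign (U - B) (ray R \<theta> t) (vector_derivative (ray R \<theta>) (at t)) * g (ray R \<theta> t) *
      vector_derivative (ray R \<theta>) (at t)) has_integral (j \<theta> * ri R (K A B' - B) \<theta>)) {t\<in>{0..1}. ray R \<theta> t \<in> K A B'}"
proof -
  let ?c = "ray R \<theta>" and ?S = "K A B' - B"
  let ?E = "{t\<in>{0..1}. \<exists>\<sigma>\<in>Zf R. ?c t \<in> sphere \<sigma> (2 * \<epsilon>)}"
  have "((\<lambda>z. if z \<in> ?S then g z else 0) has_contour_integral ri R ?S \<theta>) ?c"
    using nearby_far(1) K_borel B_borel by (intro ri_has sets.Diff) auto
  then have "((\<lambda>t. (if ?c t \<in> ?S then g (?c t) else 0) * (of_real R * e \<theta>)) has_integral ri R ?S \<theta>) {0..1}"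
    unfolding has_contour_integral vd_ray .
  from has_integral_mult_right[OF this, of "j \<theta>"]
  have "((\<lambda>t. j \<theta> * ((if ?c t \<in> ?S then g (?c t) else 0) * (of_real R * e \<theta>))) has_integral (j \<theta> * ri R ?S \<theta>)) {0..1}" .
  then have "((\<lambda>t. if t \<in> {t\<in>{0..1}. ?c t \<in> K A B'} then bdry_sign (U - B) (?c t) (of_real R * e \<theta>) * g (?c t) * (of_real R * e \<theta>) else 0)
      has_integral (j \<theta> * ri R ?S \<theta>)) {0..1}"
  proof (rule has_integral_spike[rotated 2])
    show "negligible ?E" using finite_ray_times[OF R] by (rule negligible_finite)
    fix t assume t: "t \<in> {0..1} - ?E"
    show "(if t \<in> {t\<in>{0..1}. ?c t \<in> K A B'} then bdry_sign (U - B) (?c t) (of_real R * e \<theta>) * g (?c t) * (of_real R * e \<theta>) else 0) =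
        j \<theta> * ((if ?c t \<in> ?S then g (?c t) else 0) * (of_real R * e \<theta>))"
    proof (cases "?c t \<in> K A B'")
      case False
      then show ?thesis by simp
    next
      case K: True
      show ?thesis
      proof (cases "?c t \<in> B")
        case True
        then obtain \<sigma> where \<sigma>: "\<sigma> \<in> Z" "?c t \<in> cball \<sigma> (2 * \<epsilon>)" by (auto simp: B_def)
        have "norm (?c t) \<le> R" using t R by (simp add: ray_eq norm_mult mult_left_le)
        with \<sigma> have "\<sigma> \<in> Zf R" by (intro near_Zf)
        then have "?c t \<notin> sphere \<sigma> (2 * \<epsilon>)" using t by blast
        then have "?c t \<in> ball \<sigma> (2 * \<epsilon>)" using \<sigma>(2) by auto
        then show ?thesis using bdry_sign_ball[OF \<sigma>(1)] True t by simp
      next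
        case False
        have "t \<noteq> 0"
        proof
          assume "t = 0"
          then have "?c t = 0" by (simp add: ray_eq)
          then show False using False Z0 \<epsilon> by (auto simp: B_def)
        qed
        then have "0 < R * t" using t R by simp
        from bdry_sign_ray[OF \<theta> this R] False have "bdry_sign (U - B) (?c t) (of_real R * e \<theta>) = j \<theta>"
          unfolding ray_eq by blast
        then show ?thesis using False K t by simp
      qed
    qed
  qed
  then show ?thesis unfolding vd_ray by (subst (asm) has_integral_restrict) auto
qed

lemma has_integral_circ:
  assumes \<sigma>: "\<sigma> \<in> Z"
  shows "((\<lambda>t. bdry_sign (U - B) (circ \<sigma> t) (vector_derivative (circ \<sigma>) (at t)) * g (circ \<sigma> t) *
      vector_derivative (circ \<sigma>) (at t)) has_integral (- ci (U \<inter> K A B' \<inter> far) \<sigma>)) {t\<in>{0..1}. circ \<sigma> t \<in> K A B'}"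
proof -
  let ?c = "circ \<sigma>" and ?S = "U \<inter> K A B' \<inter> far"
  let ?E = "{t\<in>{0..1}. ?c t \<in> (\<Union>\<theta>\<in>T. {of_real \<rho> * e \<theta> | \<rho>. True})}"
  have "((\<lambda>z. if z \<in> ?S then g z else 0) has_contour_integral ci ?S \<sigma>) ?c"
    using K_borel U_borel far_borel by (intro ci_has sets.Int) auto
  then have "((\<lambda>t. (if ?c t \<in> ?S then g (?c t) else 0) * vector_derivative ?c (at t)) has_integral ci ?S \<sigma>) {0..1}"
    unfolding has_contour_integral .
  from has_integral_neg[OF this]
  have "((\<lambda>t. if t \<in> {t\<in>{0..1}. ?c t \<in> K A B'} then bdry_sign (U - B) (?c t) (vector_derivative ?c (at t)) * g (?c t) * vector_derivative ?c (at t) else 0)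
      has_integral (- ci ?S \<sigma>)) {0..1}"
  proof (rule has_integral_spike[rotated 2])
    show "negligible ?E" using finite_circ_times by (rule negligible_finite)
    fix t assume t: "t \<in> {0..1} - ?E"
    have sp: "?c t \<in> sphere \<sigma> (2 * \<epsilon>)" using t circ_sphere by blast
    then have far: "?c t \<in> far" by (rule circ_far[OF \<sigma>])
    then have z0: "?c t \<noteq> 0" using \<epsilon> by (auto simp: far_def)
    have "vector_derivative ?c (at t) = \<i> * of_real (2 * pi) * (?c t - \<sigma>)" by (simp add: vd_circ mult_ac)
    moreover have "bdry_sign (U - B) (?c t) (\<i> * of_real (2 * pi) * (?c t - \<sigma>)) = - of_bool (?c t \<in> U)"
      using t by (intro bdry_sign_circle[OF \<sigma> sp _ _ z0]) auto
    ultimately have "bdry_sign (U - B) (?c t) (vector_derivative ?c (at t)) = - of_bool (?c t \<in> U)" by simp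
    then show "(if t \<in> {t\<in>{0..1}. ?c t \<in> K A B'} then bdry_sign (U - B) (?c t) (vector_derivative ?c (at t)) * g (?c t) * vector_derivative ?c (at t) else 0) =
        - ((if ?c t \<in> ?S then g (?c t) else 0) * vector_derivative ?c (at t))"
      using t far by simp
  qed
  then show ?thesis by (subst (asm) has_integral_restrict) auto
qed

lemma bdry_integral_in:
  assumes A: "0 < A" "0 < B'"
  defines "R \<equiv> max A B'"
  shows "has_bdry_integral_in (U - B) (half_discs A B') g
    ((\<Sum>\<theta>\<in>T. j \<theta> * ri R (K A B' - B) \<theta>) - (\<Sum>\<sigma>\<in>Zf R. ci (U \<inter> K A B' \<inter> far) \<sigma>))"
proof -
  have R: "0 < R" using A by (simp add: R_def)
  \<comment> \<open>\<open>Inl\<close> indexes the rays and \<open>Inr\<close> the circles. All rays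
    have length \<open>max A B'\<close>, so they reach whichever truncation radius applies to
    them.\<close>
  define X where "X = Inl ` T \<union> Inr ` Zf R"
  define c where "c = case_sum (ray R) circ"
  define I where "I = case_sum (\<lambda>\<theta>. j \<theta> * ri R (K A B' - B) \<theta>) (\<lambda>\<sigma>. - ci (U \<inter> K A B' \<inter> far) \<sigma>)"
  have Xcases: "(\<exists>\<theta>\<in>T. i = Inl \<theta>) \<or> (\<exists>\<sigma>\<in>Zf R. i = Inr \<sigma>)" if "i \<in> X" for i using that by (auto simp: X_def)
  have ZfZ: "\<sigma> \<in> Z" if "\<sigma> \<in> Zf R" for \<sigma> using that by (simp add: Zf_def)
  have rr: "finite (path_image (ray R \<theta>) \<inter> path_image (ray R \<theta>'))" if "\<theta> \<in> T" "\<theta>' \<in> T" "\<theta> \<noteq> \<theta>'" for \<theta> \<theta>'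
  proof -
    have "path_image (ray R \<theta>) \<inter> path_image (ray R \<theta>') \<subseteq> {0}"
    proof
      fix z assume "z \<in> path_image (ray R \<theta>) \<inter> path_image (ray R \<theta>')"
      then obtain t t' where t: "0 \<le> t" "0 \<le> t'" "z = of_real (R * t) * e \<theta>" "z = of_real (R * t') * e \<theta>'"
        unfolding path_image_def ray_eq by auto
      show "z \<in> {0}"
      proof (rule ccontr)
        assume "z \<notin> {0}"
        then have pos: "0 < R * t" "0 < R * t'" using t R by (auto simp: zero_less_mult_iff less_le)
        have "\<theta> = ang z" using t(3) T_bounds(2)[OF that(1)] ang_e[OF pos(1), of \<theta>] by (simp add: abs_less_iff)
        moreover have "\<theta>' = ang z" using t(4) T_bounds(2)[OF that(2)] ang_e[OF pos(2), of \<theta>'] by (simp add: abs_less_iff)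
        ultimately show False using that(3) by simp
      qed
    qed
    then show ?thesis by (rule finite_subset) simp
  qed
  have rc: "finite (path_image (ray R \<theta>) \<inter> path_image (circ \<sigma>))" if "\<theta> \<in> T" for \<theta> \<sigma>
  proof (rule finite_subset[OF _ finite_circ_rays[of \<sigma>]])
    have "\<exists>\<rho>. z = of_real \<rho> * e \<theta>" if "z \<in> path_image (ray R \<theta>)" for z
      using that unfolding path_image_def ray_eq by blast
    then show "path_image (ray R \<theta>) \<inter> path_image (circ \<sigma>) \<subseteq> sphere \<sigma> (2 * \<epsilon>) \<inter> (\<Union>\<theta>\<in>T. {of_real \<rho> * e \<theta> | \<rho>. True})"
      using that unfolding path_image_circ by blast
  qed
  have cc: "finite (path_image (circ \<sigma>) \<inter> path_image (circ \<tau>))" if "\<sigma> \<in> Zf R" "\<tau> \<in> Zf R" "\<sigma> \<noteq> \<tau>" for \<sigma> \<tau>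
  proof -
    have "path_image (circ \<sigma>) \<inter> path_image (circ \<tau>) = {}"
      unfolding path_image_circ using sphere_other[OF ZfZ[OF that(1)] ZfZ[OF that(2)] that(3)] sphere_cball by blast
    then show ?thesis by simp
  qed
  have "has_bdry_integral_in (U - B) (K A B') g (\<Sum>i\<in>X. I i)"
  proof (rule has_bdry_integral_inI[where c = c])
    show "finite X" using finite_T finite_Zf by (simp add: X_def)
    fix i assume i: "i \<in> X"
    show "simple_path (c i)"
    proof -
      have "simple_path (ray R \<theta>)" for \<theta>
        unfolding ray_def using R norm_e[of \<theta>] by (intro simple_path_linepath) (metis mult_eq_0_iff norm_zero of_real_eq_0_iff order_less_irrefl zero_neq_one)
      then show ?thesis using Xcases[OF i] simple_circ by (auto simp: c_def)
    qed
    show "c i C1_differentiable_on {0..1}"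
      using Xcases[OF i]
    proof (elim disjE bexE)
      fix \<theta> assume "i = Inl \<theta>"
      then show ?thesis
        unfolding C1_differentiable_on_def c_def
        by (intro exI[of _ "\<lambda>_. of_real R * e \<theta>"]) (auto simp: ray_def intro: has_vector_derivative_ray)
    next
      fix \<sigma> assume "i = Inr \<sigma>"
      moreover have "continuous_on {0..1} (circ \<sigma>)"
        unfolding circ_def using path_circlepath by (simp add: path_def)
      ultimately show ?thesis
        unfolding C1_differentiable_on_def c_def
        by (intro exI[of _ "\<lambda>t. 2 * of_real pi * \<i> * (circ \<sigma> t - \<sigma>)"])
          (auto simp: circ_def intro!: has_vector_derivative_circle continuous_intros)
    qed
    show "vector_derivative (c i) (at t) \<noteq> 0" if "t \<in> {0..1}" for t
      using Xcases[OF i]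
    proof (elim disjE bexE)
      fix \<theta> assume "i = Inl \<theta>"
      moreover have "e \<theta> \<noteq> 0" by (metis norm_e norm_zero zero_neq_one)
      ultimately show ?thesis using R by (simp add: c_def vd_ray)
    next
      fix \<sigma> assume "i = Inr \<sigma>"
      then show ?thesis using circ_sphere[OF that, of \<sigma>] \<epsilon> by (auto simp: c_def vd_circ)
    qed
    show "((\<lambda>t. bdry_sign (U - B) (c i t) (vector_derivative (c i) (at t)) * g (c i t) * vector_derivative (c i) (at t))
        has_integral I i) {t\<in>{0..1}. c i t \<in> K A B'}"
      using Xcases[OF i] has_integral_ray[OF _ R] has_integral_circ ZfZ by (auto simp: c_def I_def)
  next
    fix i i' assume i: "i \<in> X" "i' \<in> X" "i \<noteq> i'"
    have cr: "finite (path_image (circ \<sigma>) \<inter> path_image (ray R \<theta>))" if "\<theta> \<in> T" for \<theta> \<sigma>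
      using rc[OF that] by (simp only: Int_commute)
    have cR: "c (Inl \<theta>) = ray R \<theta>" and cC: "c (Inr \<sigma>) = circ \<sigma>" for \<theta> \<sigma> by (simp_all add: c_def)
    show "finite (path_image (c i) \<inter> path_image (c i'))"
      using Xcases[OF i(1)] Xcases[OF i(2)]
    proof (elim disjE bexE)
      fix \<theta> \<theta>' assume *: "\<theta> \<in> T" "\<theta>' \<in> T" "i = Inl \<theta>" "i' = Inl \<theta>'"
      show ?thesis unfolding *(3,4) cR using i(3) * by (intro rr) auto
    next
      fix \<sigma> \<tau> assume *: "\<sigma> \<in> Zf R" "\<tau> \<in> Zf R" "i = Inr \<sigma>" "i' = Inr \<tau>"
      show ?thesis unfolding *(3,4) cC using i(3) * by (intro cc) auto
    next
      fix \<theta> \<sigma> assume *: "\<theta> \<in> T" "i = Inl \<theta>" "i' = Inr \<sigma>"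
      show ?thesis unfolding *(2,3) cR cC using *(1) by (rule rc)
    next
      fix \<theta> \<sigma> assume *: "\<theta> \<in> T" "i = Inr \<sigma>" "i' = Inl \<theta>"
      show ?thesis unfolding *(2,3) cR cC using *(1) by (rule cr)
    qed
  next
    show "frontier (U - B) \<inter> K A B' \<subseteq> (\<Union>i\<in>X. path_image (c i))"
    proof
      fix z assume z: "z \<in> frontier (U - B) \<inter> K A B'"
      then have "norm z \<le> R" using K_norm unfolding R_def by blast
      with frontier_cover[OF R] z show "z \<in> (\<Union>i\<in>X. path_image (c i))"
        by (force simp: X_def c_def)
    qed
  qed
  moreover have "(\<Sum>i\<in>X. I i) = (\<Sum>\<theta>\<in>T. j \<theta> * ri R (K A B' - B) \<theta>) - (\<Sum>\<sigma>\<in>Zf R. ci (U \<inter> K A B' \<inter> far) \<sigma>)"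
  proof -
    have "(\<Sum>i\<in>X. I i) = (\<Sum>i\<in>Inl ` T. I i) + (\<Sum>i\<in>Inr ` Zf R. I i)"
      unfolding X_def using finite_T finite_Zf by (intro sum.union_disjoint) auto
    then show ?thesis by (simp add: sum.reindex I_def sum_negf)
  qed
  ultimately show ?thesis unfolding K_def by simp
qed

text \<open>The discs are pairwise disjoint, so removing them is a plain subtraction of sums. The
  disc about 0 is kept apart because g is singular there.\<close>

lemma ray_perforated:
  assumes R: "0 < R" "\<And>z. z \<in> K A B' \<Longrightarrow> norm z \<le> R"
  shows "ri R (K A B' - B) \<theta> = ri R (K A B' - cball 0 (2 * \<epsilon>)) \<theta> - (\<Sum>\<sigma>\<in>Zf R - {0}. ri R (K A B' \<inter> cball \<sigma> (2 * \<epsilon>)) \<theta>)"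
proof -
  have sub: "K A B' \<inter> cball \<sigma> (2 * \<epsilon>) \<subseteq> far" if "\<sigma> \<in> Zf R - {0}" for \<sigma>
    using sphere_far[of \<sigma>] that \<epsilon> by (force simp: Zf_def far_def)
  have "((\<lambda>z. (if z \<in> K A B' - cball 0 (2 * \<epsilon>) then g z else 0) - (\<Sum>\<sigma>\<in>Zf R - {0}. if z \<in> K A B' \<inter> cball \<sigma> (2 * \<epsilon>) then g z else 0))
      has_contour_integral (ri R (K A B' - cball 0 (2 * \<epsilon>)) \<theta> - (\<Sum>\<sigma>\<in>Zf R - {0}. ri R (K A B' \<inter> cball \<sigma> (2 * \<epsilon>)) \<theta>))) (ray R \<theta>)"
    using K_borel nearby_far(2) finite_Zf sub
    by (intro has_contour_integral_diff has_contour_integral_sum ri_has) auto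
  moreover have "(if z \<in> K A B' - cball 0 (2 * \<epsilon>) then g z else 0) - (\<Sum>\<sigma>\<in>Zf R - {0}. if z \<in> K A B' \<inter> cball \<sigma> (2 * \<epsilon>) then g z else 0) =
      (if z \<in> K A B' - B then g z else 0)" for z
  proof (cases "z \<in> K A B' \<and> z \<in> B")
    case False
    then have "z \<notin> K A B' \<inter> cball \<sigma> (2 * \<epsilon>)" if "\<sigma> \<in> Zf R" for \<sigma> using that by (auto simp: B_def Zf_def)
    then have "(\<Sum>\<sigma>\<in>Zf R - {0}. if z \<in> K A B' \<inter> cball \<sigma> (2 * \<epsilon>) then g z else 0) = 0"
      by (intro sum.neutral) auto
    moreover have "z \<in> K A B' - cball 0 (2 * \<epsilon>) \<longleftrightarrow> z \<in> K A B' - B" using False Z0 by (auto simp: B_def)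
    ultimately show ?thesis by simp
  next
    case True
    then obtain \<sigma> where \<sigma>: "\<sigma> \<in> Z" "z \<in> cball \<sigma> (2 * \<epsilon>)" "z \<in> K A B'" by (auto simp: B_def)
    have \<sigma>f: "\<sigma> \<in> Zf R" using near_Zf[OF \<sigma>(1,2)] R(2)[OF \<sigma>(3)] by blast
    have other: "z \<notin> cball \<tau> (2 * \<epsilon>)" if "\<tau> \<in> Z" "\<tau> \<noteq> \<sigma>" for \<tau>
      using sphere_other[OF \<sigma>(1) that(1) _ \<sigma>(2)] that(2) by blast
    have "(\<Sum>\<tau>\<in>Zf R - {0}. if z \<in> K A B' \<inter> cball \<tau> (2 * \<epsilon>) then g z else 0) = (\<Sum>\<tau>\<in>Zf R - {0}. if \<tau> = \<sigma> then g z else 0)"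
      using \<sigma> other by (intro sum.cong) (auto simp: Zf_def)
    also have "\<dots> = (if \<sigma> = 0 then 0 else g z)"
      using finite_Zf \<sigma>f by simp
    finally show ?thesis using \<sigma> True other[OF Z0] by auto
  qed
  ultimately have "((\<lambda>z. if z \<in> K A B' - B then g z else 0) has_contour_integral
      (ri R (K A B' - cball 0 (2 * \<epsilon>)) \<theta> - (\<Sum>\<sigma>\<in>Zf R - {0}. ri R (K A B' \<inter> cball \<sigma> (2 * \<epsilon>)) \<theta>))) (ray R \<theta>)" by simp
  then show ?thesis unfolding ri_def[of R "K A B' - B"] by (rule contour_integral_unique)
qed

section \<open>Cauchy's theorem on a removed disc\<close>

definition H :: "real \<Rightarrow> complex set" where "H \<theta> = {z. slit z \<and> \<theta> < ang z}"

text \<open>The step function f is the sum of its jumps, each switched on beyond its ray. Read in z,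
  this resolves the indicator of U into regions bounded by a single ray each, to which
  \<open>half_plane_chord\<close> can be applied.\<close>

lemma indicator_U:
  assumes "slit z" "\<And>\<theta> \<rho>. \<theta> \<in> T \<Longrightarrow> z \<noteq> of_real \<rho> * e \<theta>"
  shows "(if z \<in> U then g z else 0) = (\<Sum>\<theta>\<in>T. j \<theta> * (if z \<in> H \<theta> then g z else 0))"
proof -
  have a: "\<bar>ang z\<bar> < pi" "z \<noteq> 0" using slit_ang[OF assms(1)] by auto
  have "ang z \<notin> T" using assms(2)[of "ang z" "norm z"] polar[of z] by blast
  then have "f (ang z) = (\<Sum>\<tau>\<in>T. j \<tau> * of_bool (\<tau> < ang z))" using a by (intro f_eq_sum) (auto simp: abs_less_iff)
  moreover have "f (ang z) = of_bool (z \<in> U)" by (simp add: f_def U_iff_ang[OF a(2)])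
  ultimately have "(if z \<in> U then g z else 0) = (\<Sum>\<tau>\<in>T. j \<tau> * of_bool (\<tau> < ang z)) * g z"
    by (auto simp: of_bool_def split: if_splits)
  also have "\<dots> = (\<Sum>\<theta>\<in>T. j \<theta> * (if z \<in> H \<theta> then g z else 0))"
    unfolding sum_distrib_right using assms(1) by (intro sum.cong) (auto simp: H_def)
  finally show ?thesis .
qed

text \<open>If the disc met the cut, both coordinates of \<sigma> would be at most 2 \<epsilon> in
  absolute value, hence \<open>norm \<sigma> \<le> 4 * \<epsilon>\<close>, whereas nonzero points of
  Z have modulus at least 5 \<epsilon>.\<close>

lemma slit_ball:
  assumes "\<sigma> \<in> Z" "\<sigma> \<noteq> 0" "- 2 * \<epsilon> \<le> s * Im \<sigma>" "z \<in> cball \<sigma> (2 * \<epsilon>)"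
  shows "slit z"
proof (rule ccontr)
  assume "\<not> slit z"
  then have z: "s * Im z \<le> 0" "Re z = 0"
    using s by (auto simp: slit_def complex_nonpos_Reals_iff)
  have d: "norm (\<sigma> - z) \<le> 2 * \<epsilon>" using assms(4) by (simp add: dist_norm)
  have "\<bar>Re \<sigma>\<bar> \<le> 2 * \<epsilon>" using abs_Re_le_cmod[of "\<sigma> - z"] d z(2) by simp
  moreover have "\<bar>Im \<sigma>\<bar> \<le> 2 * \<epsilon>" using abs_Im_le_cmod[of "\<sigma> - z"] d z(1) assms(3) s by auto
  ultimately have "norm \<sigma> \<le> 4 * \<epsilon>" using cmod_le[of \<sigma>] by linarith
  then show False using Z_norm[OF assms(1,2)] \<epsilon> by simp
qed

lemma G_slit: "slit z \<Longrightarrow> (G has_field_derivative g z) (at z)"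
  using G by (simp add: slit_def)

lemma continuous_ang: "slit z \<Longrightarrow> isCont ang z"
  unfolding ang_def[abs_def] slit_def
  by (intro continuous_intros isCont_o2[of _ "\<lambda>z. - (\<i> * of_real s * z)" Arg] continuous_at_Arg) auto

text \<open>If the ray meets the disc, the whole disc is within a right angle of the ray, so
  \<open>H \<theta>\<close> agrees there with the half-plane to its left and
  \<open>half_plane_chord\<close> applies. If not, the angle stays on one side of \<theta> on the
  connected disc; the ray contributes nothing, and the circle counts either entirely, giving 0 by
  closedness, or not at all.\<close>

lemma chord_cancels:
  assumes \<sigma>: "\<sigma> \<in> Z" "\<sigma> \<noteq> 0" "- 2 * \<epsilon> \<le> s * Im \<sigma>" and \<theta>: "\<theta> \<in> T" and R: "norm \<sigma> + 2 * \<epsilon> \<le> R"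
  shows "\<exists>I. ((\<lambda>z. if z \<in> cball \<sigma> (2 * \<epsilon>) then g z else 0) has_contour_integral I) (ray R \<theta>) \<and>
    ((\<lambda>z. if z \<in> H \<theta> then g z else 0) has_contour_integral (- I)) (circ \<sigma>)"
proof -
  have n\<sigma>: "5 * \<epsilon> \<le> norm \<sigma>" using Z_norm[OF \<sigma>(1,2)] .
  have slitb: "slit z" if "z \<in> cball \<sigma> (2 * \<epsilon>)" for z using slit_ball[OF \<sigma> that] .
  have R0: "0 < R" using R \<epsilon> n\<sigma> by linarith
  show ?thesis
  proof (cases "\<exists>\<rho>\<ge>0. of_real \<rho> * e \<theta> \<in> cball \<sigma> (2 * \<epsilon>)")
    case True
    then obtain \<rho> where \<rho>: "0 \<le> \<rho>" "of_real \<rho> * e \<theta> \<in> cball \<sigma> (2 * \<epsilon>)" by blast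
    let ?w = "of_real \<rho> * e \<theta>"
    \<comment> \<open>With \<open>norm \<sigma> \<ge> 5 * \<epsilon>\<close> the square of the
      modulus exceeds the error \<open>4 * \<epsilon> * norm \<sigma> + 4 * \<epsilon> ^ 2\<close>,
      because 25 - 20 - 4 > 0.\<close>
    have pos: "0 < Re (z * cnj ?w)" if "z \<in> cball \<sigma> (2 * \<epsilon>)" for z
    proof -
      define p where "p = z - \<sigma>"
      define q where "q = ?w - \<sigma>"
      have pq: "norm p \<le> 2 * \<epsilon>" "norm q \<le> 2 * \<epsilon>" using that \<rho> by (auto simp: p_def q_def dist_norm norm_minus_commute)
      have "z * cnj ?w = \<sigma> * cnj \<sigma> + (\<sigma> * cnj q + p * cnj \<sigma> + p * cnj q)"
        by (simp add: p_def q_def algebra_simps)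
      then have "Re (z * cnj ?w) = (norm \<sigma>)\<^sup>2 + Re (\<sigma> * cnj q + p * cnj \<sigma> + p * cnj q)"
        by (simp add: complex_mult_cnj cmod_power2)
      moreover have "\<bar>Re (\<sigma> * cnj q + p * cnj \<sigma> + p * cnj q)\<bar> \<le> norm \<sigma> * (2 * \<epsilon>) + (2 * \<epsilon>) * norm \<sigma> + (2 * \<epsilon>) * (2 * \<epsilon>)"
      proof -
        have "norm (\<sigma> * cnj q + p * cnj \<sigma> + p * cnj q) \<le> norm \<sigma> * norm q + norm p * norm \<sigma> + norm p * norm q"
          by (rule order_trans[OF norm_triangle_ineq] add_mono order_trans[OF norm_triangle_ineq] | simp add: norm_mult)+
        also have "\<dots> \<le> norm \<sigma> * (2 * \<epsilon>) + (2 * \<epsilon>) * norm \<sigma> + (2 * \<epsilon>) * (2 * \<epsilon>)"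
          using pq \<epsilon> by (intro add_mono mult_mono) auto
        finally show ?thesis using abs_Re_le_cmod order_trans by blast
      qed
      moreover have "norm \<sigma> * (2 * \<epsilon>) + (2 * \<epsilon>) * norm \<sigma> + (2 * \<epsilon>) * (2 * \<epsilon>) < (norm \<sigma>)\<^sup>2"
      proof -
        have "(5 * \<epsilon>) * \<epsilon> \<le> norm \<sigma> * (norm \<sigma> - 4 * \<epsilon>)" using n\<sigma> \<epsilon> by (intro mult_mono) auto
        moreover have "0 < \<epsilon> * \<epsilon>" using \<epsilon> by simp
        ultimately show ?thesis by (simp add: power2_eq_square algebra_simps)
      qed
      ultimately show ?thesis by linarith
    qed
    have iff: "0 < Im (z * cnj (e \<theta>)) \<longleftrightarrow> z \<in> H \<theta>" if z: "z \<in> cball \<sigma> (2 * \<epsilon>)" for z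
    proof -
      define d where "d = ang z - \<theta>"
      have zc: "z * cnj (e \<theta>) = of_real (norm z) * cis d"
        using polar[of z] e_cnj[of "ang z" \<theta>] unfolding d_def by (metis mult.assoc)
      have nz: "0 < norm z" using slit_ang(2)[OF slitb[OF z]] by simp
      have "Re (z * cnj ?w) = \<rho> * (norm z * cos d)"
      proof -
        have "z * cnj ?w = of_real \<rho> * (z * cnj (e \<theta>))" by (simp add: mult_ac)
        then show ?thesis unfolding zc by (simp only: Re_of_real_times cis.sel)
      qed
      then have cosd: "0 < cos d" using pos[OF z] \<rho>(1) nz by (auto simp: zero_less_mult_iff)
      \<comment> \<open>A positive cosine determines d only modulo 2 * pi; this bound excludes the
        other intervals.\<close>
      have dr: "\<bar>d\<bar> < 3 * pi / 2"
        using slit_ang(1)[OF slitb[OF z]] T_bounds(1)[OF \<theta>] unfolding d_def by linarith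
      have "\<bar>d\<bar> < pi / 2"
      proof (rule ccontr)
        assume "\<not> \<bar>d\<bar> < pi / 2"
        then have "0 \<le> sin (\<bar>d\<bar> - pi / 2)" using dr by (intro sin_ge_zero) auto
        then show False using cosd by (simp add: sin_diff)
      qed
      then have "0 < sin d \<longleftrightarrow> 0 < d"
        using sin_gt_zero[of d] sin_ge_zero[of "- d"] by (cases "0 < d") auto
      moreover have "Im (z * cnj (e \<theta>)) = norm z * sin d" unfolding zc by simp
      ultimately show ?thesis using nz slitb[OF z] by (simp add: H_def d_def zero_less_mult_iff)
    qed
    define p where "p = Re (\<sigma> * cnj (e \<theta>))"
    define q where "q = Im (\<sigma> * cnj (e \<theta>))"
    have \<sigma>eq: "\<sigma> = e \<theta> * Complex p q"
    proof -
      have "e \<theta> * (\<sigma> * cnj (e \<theta>)) = (e \<theta> * cnj (e \<theta>)) * \<sigma>" by (simp only: mult_ac)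
      also have "\<sigma> * cnj (e \<theta>) = Complex p q" by (simp only: p_def q_def complex_surj)
      finally show ?thesis unfolding e_cnj by simp
    qed
    have "\<sigma> \<in> cball \<sigma> (2 * \<epsilon>)" using \<epsilon> by simp
    from pos[OF this] have "0 < \<rho> * p" by (simp add: p_def algebra_simps)
    then have p: "0 < p" using \<rho>(1) by (simp add: zero_less_mult_iff)
    have "norm \<sigma> = norm (Complex p q)" by (subst \<sigma>eq) (simp add: norm_mult)
    then have "(norm \<sigma>)\<^sup>2 = p\<^sup>2 + q\<^sup>2" by (simp add: cmod_power2)
    moreover have "(5 * \<epsilon>)\<^sup>2 \<le> (norm \<sigma>)\<^sup>2" using n\<sigma> \<epsilon> by (intro power_mono) auto
    moreover have "(2 * \<epsilon>)\<^sup>2 < (5 * \<epsilon>)\<^sup>2" using \<epsilon> by (intro power_strict_mono) auto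
    ultimately have pq: "(2 * \<epsilon>)\<^sup>2 < p\<^sup>2 + q\<^sup>2" by linarith
    obtain I where I: "((\<lambda>z. if z \<in> cball \<sigma> (2 * \<epsilon>) then g z else 0) has_contour_integral I) (linepath 0 (of_real R * e \<theta>))"
      "((\<lambda>z. if z \<in> {z. 0 < Im (z * cnj (e \<theta>))} then g z else 0) has_contour_integral (- I)) (circlepath \<sigma> (2 * \<epsilon>))"
      using half_plane_chord[OF norm_e \<sigma>eq p _ pq R, of G g] G_slit slitb \<epsilon> by auto
    have "((\<lambda>z. if z \<in> H \<theta> then g z else 0) has_contour_integral (- I)) (circ \<sigma>)"
      unfolding circ_def
    proof (rule has_contour_integral_eq[OF I(2)])
      fix z assume "z \<in> path_image (circlepath \<sigma> (2 * \<epsilon>))"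
      then have "z \<in> cball \<sigma> (2 * \<epsilon>)" using path_image_circ[of \<sigma>] sphere_cball unfolding circ_def by blast
      then show "(if z \<in> {z. 0 < Im (z * cnj (e \<theta>))} then g z else 0) = (if z \<in> H \<theta> then g z else 0)"
        using iff by simp
    qed
    then show ?thesis using I(1) unfolding ray_def by blast
  next
    case False
    have r0: "((\<lambda>z. if z \<in> cball \<sigma> (2 * \<epsilon>) then g z else 0) has_contour_integral 0) (ray R \<theta>)"
    proof (rule has_contour_integral_off_finite[of "{}"])
      fix t :: real assume "t \<in> {0..1} - {}"
      then have "0 \<le> R * t" using R0 by simp
      then show "ray R \<theta> t \<notin> cball \<sigma> (2 * \<epsilon>)" using False unfolding ray_eq by blast
    qed simp
    have ne: "ang z \<noteq> \<theta>" if "z \<in> cball \<sigma> (2 * \<epsilon>)" for z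
    proof
      assume "ang z = \<theta>"
      then have "of_real (norm z) * e \<theta> \<in> cball \<sigma> (2 * \<epsilon>)" using polar[of z] that by simp
      then show False using False norm_ge_zero by blast
    qed
    have conn: "connected (ang ` cball \<sigma> (2 * \<epsilon>))"
    proof (rule connected_continuous_image)
      show "continuous_on (cball \<sigma> (2 * \<epsilon>)) ang"
        using continuous_ang slitb by (intro continuous_at_imp_continuous_on) auto
    qed (rule convex_connected[OF convex_cball])
    have "(\<forall>z\<in>cball \<sigma> (2 * \<epsilon>). \<theta> < ang z) \<or> (\<forall>z\<in>cball \<sigma> (2 * \<epsilon>). ang z < \<theta>)"
    proof (rule ccontr)
      assume "\<not> ?thesis"
      then obtain z w where zw: "z \<in> cball \<sigma> (2 * \<epsilon>)" "w \<in> cball \<sigma> (2 * \<epsilon>)" "ang z \<le> \<theta>" "\<theta> \<le> ang w"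
        by (auto simp: not_less)
      have "\<theta> \<in> ang ` cball \<sigma> (2 * \<epsilon>)"
        by (rule connectedD_interval[OF conn imageI[OF zw(1)] imageI[OF zw(2)] zw(3,4)])
      then show False using ne by blast
    qed
    then have "((\<lambda>z. if z \<in> H \<theta> then g z else 0) has_contour_integral - 0) (circ \<sigma>)"
    proof
      assume all: "\<forall>z\<in>cball \<sigma> (2 * \<epsilon>). \<theta> < ang z"
      have cb: "circ \<sigma> t \<in> cball \<sigma> (2 * \<epsilon>)" if "t \<in> {0..1}" for t using circ_sphere[OF that, of \<sigma>] by simp
      have "((\<lambda>z. if z \<in> H \<theta> then g z else 0) has_contour_integral (G (circ \<sigma> 1) - G (circ \<sigma> 0))) (circ \<sigma>)"
      proof (rule has_contour_integral_piece[where E = "{0, 1}"])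
        show "(circ \<sigma> has_vector_derivative 2 * of_real pi * \<i> * (circ \<sigma> t - \<sigma>)) (at t)" for t
          unfolding circ_def by (rule has_vector_derivative_circle)
        show "(G has_field_derivative g (circ \<sigma> t)) (at (circ \<sigma> t))" if "0 \<le> t" "t \<le> 1" for t
          using cb[of t] that by (intro G_slit slitb) auto
        show "circ \<sigma> t \<in> H \<theta> \<longleftrightarrow> 0 < t \<and> t < 1" if "t \<in> {0..1} - {0, 1}" for t
          using cb[of t] all slitb that by (auto simp: H_def)
      qed auto
      moreover have "circ \<sigma> 1 = circ \<sigma> 0"
        unfolding circ_def using pathfinish_circlepath pathstart_circlepath by (metis pathfinish_def pathstart_def)
      ultimately show ?thesis by simp
    next
      assume all: "\<forall>z\<in>cball \<sigma> (2 * \<epsilon>). ang z < \<theta>"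
      have "circ \<sigma> t \<notin> H \<theta>" if "t \<in> {0..1}" for t
      proof -
        have "circ \<sigma> t \<in> cball \<sigma> (2 * \<epsilon>)" using circ_sphere[OF that, of \<sigma>] by simp
        with all have "ang (circ \<sigma> t) < \<theta>" by blast
        then show ?thesis by (simp add: H_def)
      qed
      then show ?thesis unfolding minus_zero by (intro has_contour_integral_off_finite[of "{}"]) auto
    qed
    with r0 show ?thesis by blast
  qed
qed

text \<open>The error of integrating straight through a removed disc instead of around it. By Cauchy's theorem
  it vanishes for every disc that the truncation does not cut.\<close>

definition defect :: "real \<Rightarrow> real \<Rightarrow> real \<Rightarrow> complex \<Rightarrow> complex" where
  "defect R A B' \<sigma> = (\<Sum>\<theta>\<in>T. j \<theta> * ri R (K A B' \<inter> cball \<sigma> (2 * \<epsilon>)) \<theta>) + ci (U \<inter> K A B' \<inter> far) \<sigma>"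

lemma ri_off: "(\<And>t. t \<in> {0..1} \<Longrightarrow> ray R \<theta> t \<notin> S) \<Longrightarrow> ri R S \<theta> = 0"
  unfolding ri_def by (rule contour_integral_unique, rule has_contour_integral_off_finite[of "{}"]) auto

lemma ci_off: "(\<And>t. t \<in> {0..1} \<Longrightarrow> circ \<sigma> t \<notin> S) \<Longrightarrow> ci S \<sigma> = 0"
  unfolding ci_def by (rule contour_integral_unique, rule has_contour_integral_off_finite[of "{}"]) auto

lemma ray_upper:
  assumes "\<theta> \<in> T" "0 < R" "t \<in> {0..1}"
  shows "0 \<le> s * Im (ray R \<theta> t)"
  unfolding ray_eq s_Im_e using T_bounds(3)[OF assms(1)] assms(2,3) by simp

text \<open>Rays and U stay in the closed half-plane, which this disc does not meet.\<close>

lemma defect_lower: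
  assumes "s * Im \<sigma> < - 2 * \<epsilon>" "0 < R"
  shows "defect R A B' \<sigma> = 0"
proof -
  have low: "s * Im z < 0" if "z \<in> cball \<sigma> (2 * \<epsilon>)" for z
  proof -
    have "\<bar>Im z - Im \<sigma>\<bar> \<le> 2 * \<epsilon>" using abs_Im_le_cmod[of "z - \<sigma>"] that by (simp add: dist_norm norm_minus_commute)
    then show ?thesis using assms(1) s by auto
  qed
  have "ri R (K A B' \<inter> cball \<sigma> (2 * \<epsilon>)) \<theta> = 0" if "\<theta> \<in> T" for \<theta>
    using ray_upper[OF that assms(2)] low by (intro ri_off) force
  moreover have "ci (U \<inter> K A B' \<inter> far) \<sigma> = 0"
  proof (rule ci_off)
    fix t :: real assume "t \<in> {0..1}"
    then have "circ \<sigma> t \<in> cball \<sigma> (2 * \<epsilon>)" using circ_sphere[of t \<sigma>] by simp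
    from low[OF this] show "circ \<sigma> t \<notin> U \<inter> K A B' \<inter> far" by (simp add: U_def)
  qed
  ultimately show ?thesis by (simp add: defect_def)
qed

lemma defect_outside:
  assumes "cball \<sigma> (2 * \<epsilon>) \<inter> K A B' = {}"
  shows "defect R A B' \<sigma> = 0"
proof -
  have "ri R (K A B' \<inter> cball \<sigma> (2 * \<epsilon>)) \<theta> = 0" for \<theta> using assms by (intro ri_off) auto
  moreover have "ci (U \<inter> K A B' \<inter> far) \<sigma> = 0"
  proof (rule ci_off)
    fix t :: real assume "t \<in> {0..1}"
    then have "circ \<sigma> t \<in> cball \<sigma> (2 * \<epsilon>)" using circ_sphere[of t \<sigma>] by simp
    then show "circ \<sigma> t \<notin> U \<inter> K A B' \<inter> far" using assms by blast
  qed
  ultimately show ?thesis by (simp add: defect_def)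
qed

text \<open>The circle integral over U splits into the regions \<open>H \<theta>\<close>, weighted
  by the jumps, and \<open>chord_cancels\<close> matches each of them with the chord of its
  ray.\<close>

lemma defect_inside:
  assumes \<sigma>: "\<sigma> \<in> Z" "\<sigma> \<noteq> 0" and sub: "cball \<sigma> (2 * \<epsilon>) \<subseteq> K A B'" and R: "R = max A B'" "0 < R"
  shows "defect R A B' \<sigma> = 0"
proof (cases "s * Im \<sigma> < - 2 * \<epsilon>")
  case True
  then show ?thesis by (rule defect_lower[OF _ R(2)])
next
  case False
  then have low: "- 2 * \<epsilon> \<le> s * Im \<sigma>" by simp
  have n\<sigma>: "5 * \<epsilon> \<le> norm \<sigma>" using Z_norm[OF \<sigma>] .
  then have n0: "0 < norm \<sigma>" using \<epsilon> by linarith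
  \<comment> \<open>The point of the disc farthest from 0. As it lies in \<open>K A B'\<close>, the
    rays are long enough for the whole chord.\<close>
  define z where "z = of_real (1 + 2 * \<epsilon> / norm \<sigma>) * \<sigma>"
  have "z - \<sigma> = of_real (2 * \<epsilon> / norm \<sigma>) * \<sigma>" by (simp add: z_def algebra_simps)
  then have "norm (z - \<sigma>) = 2 * \<epsilon>" using n0 \<epsilon> by (simp add: norm_mult del: of_real_divide of_real_mult)
  then have "z \<in> cball \<sigma> (2 * \<epsilon>)" by (simp add: dist_norm norm_minus_commute)
  then have "norm z \<le> R" using sub K_norm unfolding R(1) by blast
  moreover have "norm z = norm \<sigma> + 2 * \<epsilon>"
  proof -
    have "norm z = \<bar>1 + 2 * \<epsilon> / norm \<sigma>\<bar> * norm \<sigma>" unfolding z_def norm_mult norm_of_real ..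
    also have "\<bar>1 + 2 * \<epsilon> / norm \<sigma>\<bar> = 1 + 2 * \<epsilon> / norm \<sigma>" using n0 \<epsilon> by simp
    also have "\<dots> * norm \<sigma> = norm \<sigma> + 2 * \<epsilon>" using n0 by (simp add: field_simps)
    finally show ?thesis .
  qed
  ultimately have nR: "norm \<sigma> + 2 * \<epsilon> \<le> R" by simp
  have "\<forall>\<theta>\<in>T. \<exists>I. ((\<lambda>z. if z \<in> cball \<sigma> (2 * \<epsilon>) then g z else 0) has_contour_integral I) (ray R \<theta>) \<and>
      ((\<lambda>z. if z \<in> H \<theta> then g z else 0) has_contour_integral (- I)) (circ \<sigma>)"
    using chord_cancels[OF \<sigma> low _ nR] by blast
  then obtain I where I: "\<And>\<theta>. \<theta> \<in> T \<Longrightarrow> ((\<lambda>z. if z \<in> cball \<sigma> (2 * \<epsilon>) then g z else 0) has_contour_integral I \<theta>) (ray R \<theta>)"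
    "\<And>\<theta>. \<theta> \<in> T \<Longrightarrow> ((\<lambda>z. if z \<in> H \<theta> then g z else 0) has_contour_integral (- I \<theta>)) (circ \<sigma>)"
    unfolding bchoice_iff by blast
  have "K A B' \<inter> cball \<sigma> (2 * \<epsilon>) = cball \<sigma> (2 * \<epsilon>)" using sub by blast
  then have ri: "ri R (K A B' \<inter> cball \<sigma> (2 * \<epsilon>)) \<theta> = I \<theta>" if "\<theta> \<in> T" for \<theta>
    using I(1)[OF that] unfolding ri_def by (simp add: contour_integral_unique)
  have "((\<lambda>z. \<Sum>\<theta>\<in>T. j \<theta> * (if z \<in> H \<theta> then g z else 0)) has_contour_integral (\<Sum>\<theta>\<in>T. j \<theta> * (- I \<theta>))) (circ \<sigma>)"
    by (intro has_contour_integral_sum finite_T has_contour_integral_lmul I(2))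
  then have "((\<lambda>t. (\<Sum>\<theta>\<in>T. j \<theta> * (if circ \<sigma> t \<in> H \<theta> then g (circ \<sigma> t) else 0)) * vector_derivative (circ \<sigma>) (at t)) has_integral (\<Sum>\<theta>\<in>T. j \<theta> * (- I \<theta>))) {0..1}"
    unfolding has_contour_integral .
  then have "((\<lambda>t. (if circ \<sigma> t \<in> U \<inter> K A B' \<inter> far then g (circ \<sigma> t) else 0) * vector_derivative (circ \<sigma>) (at t)) has_integral (\<Sum>\<theta>\<in>T. j \<theta> * (- I \<theta>))) {0..1}"
  proof (rule has_integral_spike[rotated 2])
    let ?E = "{t\<in>{0..1}. circ \<sigma> t \<in> (\<Union>\<theta>\<in>T. {of_real \<rho> * e \<theta> | \<rho>. True})}"
    show "negligible ?E" using finite_circ_times by (rule negligible_finite)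
    fix t assume t: "t \<in> {0..1} - ?E"
    then have sp: "circ \<sigma> t \<in> sphere \<sigma> (2 * \<epsilon>)" using circ_sphere by blast
    then have cb: "circ \<sigma> t \<in> cball \<sigma> (2 * \<epsilon>)" by simp
    then have "circ \<sigma> t \<in> K A B'" "circ \<sigma> t \<in> far" using sub circ_far[OF \<sigma>(1) sp] by auto
    moreover have "(if circ \<sigma> t \<in> U then g (circ \<sigma> t) else 0) = (\<Sum>\<theta>\<in>T. j \<theta> * (if circ \<sigma> t \<in> H \<theta> then g (circ \<sigma> t) else 0))"
      using t by (intro indicator_U slit_ball[OF \<sigma> low cb]) auto
    ultimately show "(if circ \<sigma> t \<in> U \<inter> K A B' \<inter> far then g (circ \<sigma> t) else 0) * vector_derivative (circ \<sigma>) (at t) =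
        (\<Sum>\<theta>\<in>T. j \<theta> * (if circ \<sigma> t \<in> H \<theta> then g (circ \<sigma> t) else 0)) * vector_derivative (circ \<sigma>) (at t)"
      by simp
  qed
  then have "ci (U \<inter> K A B' \<inter> far) \<sigma> = (\<Sum>\<theta>\<in>T. j \<theta> * (- I \<theta>))"
    unfolding ci_def by (intro contour_integral_unique) (simp add: has_contour_integral)
  then show ?thesis using ri by (simp add: defect_def sum_negf)
qed

text \<open>Length times maximum of g: a ray meets the disc only at moduli within 2 \<epsilon> of
  \<open>norm \<sigma>\<close>, so its chord has length at most 4 \<epsilon>. The constant does not
  depend on the truncation.\<close>

lemma defect_bound:
  "\<exists>C\<ge>0. \<forall>\<sigma> R A B'. \<sigma> \<in> Z \<longrightarrow> \<sigma> \<noteq> 0 \<longrightarrow> 0 < R \<longrightarrow> norm (defect R A B' \<sigma>) \<le> C * (exp (- y * (s * Im \<sigma>)) / norm \<sigma>)"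
proof -
  obtain C where C: "0 \<le> C" "\<And>z. \<epsilon> \<le> norm z \<Longrightarrow> 0 \<le> s * Im z \<Longrightarrow> norm (g z) \<le> C * exp (- y * (s * Im z)) / norm z"
    using g_bound by blast
  \<comment> \<open>On the disc the height drops by at most 2 \<epsilon>, whence the exponential.
    The factor 5/3 comes from \<open>norm z \<ge> (3 / 5) * norm \<sigma>\<close>, as
    \<open>2 * \<epsilon> \<le> (2 / 5) * norm \<sigma>\<close>.\<close>
  define C' where "C' = C * exp (2 * \<epsilon> * y) * (5 / 3)"
  have C'0: "0 \<le> C'" using C(1) by (simp add: C'_def)
  define D where "D = (\<Sum>\<theta>\<in>T. norm (j \<theta>) * (4 * \<epsilon>)) + 2 * pi * (2 * \<epsilon>)"
  have D0: "0 \<le> D" unfolding D_def using \<epsilon> by (intro add_nonneg_nonneg sum_nonneg) auto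
  have "norm (defect R A B' \<sigma>) \<le> (D * C') * (exp (- y * (s * Im \<sigma>)) / norm \<sigma>)"
    if \<sigma>: "\<sigma> \<in> Z" "\<sigma> \<noteq> 0" and R: "0 < R" for \<sigma> R A B'
  proof -
    let ?w = "exp (- y * (s * Im \<sigma>)) / norm \<sigma>"
    define M where "M = C' * ?w"
    have n\<sigma>: "5 * \<epsilon> \<le> norm \<sigma>" using Z_norm[OF \<sigma>] .
    have n0: "0 < norm \<sigma>" using n\<sigma> \<epsilon> by linarith
    have M0: "0 \<le> M" unfolding M_def using C'0 n0 by simp
    have gM: "norm (g z) \<le> M" if z: "z \<in> cball \<sigma> (2 * \<epsilon>)" "0 \<le> s * Im z" for z
    proof -
      have nz: "norm \<sigma> * (3 / 5) \<le> norm z" "\<epsilon> \<le> norm z"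
        using z(1) norm_triangle_sub[of \<sigma> z] n\<sigma> \<epsilon> by (auto simp: dist_norm)
      have "\<bar>Im z - Im \<sigma>\<bar> \<le> 2 * \<epsilon>" using abs_Im_le_cmod[of "z - \<sigma>"] z(1) by (simp add: dist_norm norm_minus_commute)
      then have "s * Im \<sigma> - 2 * \<epsilon> \<le> s * Im z" using s by auto
      then have "y * (s * Im \<sigma> - 2 * \<epsilon>) \<le> y * (s * Im z)" using y by (intro mult_left_mono) auto
      then have ex: "exp (- y * (s * Im z)) \<le> exp (2 * \<epsilon> * y) * exp (- y * (s * Im \<sigma>))"
        unfolding exp_add[symmetric] by (simp add: algebra_simps)
      have "norm (g z) \<le> C * exp (- y * (s * Im z)) / norm z" using C(2) nz(2) z(2) .
      also have "\<dots> \<le> C * (exp (2 * \<epsilon> * y) * exp (- y * (s * Im \<sigma>))) / (norm \<sigma> * (3 / 5))"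
        using nz(1) n0 C(1) ex by (intro frac_le mult_left_mono mult_nonneg_nonneg) auto
      also have "\<dots> = M" by (simp add: M_def C'_def)
      finally show ?thesis .
    qed
    have ci: "norm (ci (U \<inter> K A B' \<inter> far) \<sigma>) \<le> M * (2 * pi * (2 * \<epsilon>))"
    proof (rule has_contour_integral_bound_circlepath)
      show "((\<lambda>z. if z \<in> U \<inter> K A B' \<inter> far then g z else 0) has_contour_integral ci (U \<inter> K A B' \<inter> far) \<sigma>) (circlepath \<sigma> (2 * \<epsilon>))"
        using ci_has[of "U \<inter> K A B' \<inter> far" \<sigma>] K_borel U_borel far_borel unfolding circ_def by auto
      fix z assume "norm (z - \<sigma>) = 2 * \<epsilon>"
      then have "z \<in> cball \<sigma> (2 * \<epsilon>)" by (simp add: dist_norm norm_minus_commute)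
      then show "norm (if z \<in> U \<inter> K A B' \<inter> far then g z else 0) \<le> M"
        using gM[of z] M0 by (auto simp: U_def)
    qed (use M0 \<epsilon> in auto)
    have ri: "norm (ri R (K A B' \<inter> cball \<sigma> (2 * \<epsilon>)) \<theta>) \<le> M * (4 * \<epsilon>)" if \<theta>: "\<theta> \<in> T" for \<theta>
    proof -
      let ?S = "K A B' \<inter> cball \<sigma> (2 * \<epsilon>)"
      let ?h = "\<lambda>t. (if ray R \<theta> t \<in> ?S then g (ray R \<theta> t) else 0) * (of_real R * e \<theta>)"
      define t1 where "t1 = (norm \<sigma> - 2 * \<epsilon>) / R"
      define t2 where "t2 = (norm \<sigma> + 2 * \<epsilon>) / R"
      have "?S \<subseteq> far" using sphere_far[OF \<sigma>(1) _ \<sigma>(2)] \<epsilon> by (force simp: far_def)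
      then have "((\<lambda>z. if z \<in> ?S then g z else 0) has_contour_integral ri R ?S \<theta>) (ray R \<theta>)"
        using K_borel by (intro ri_has) auto
      then have "(?h has_integral ri R ?S \<theta>) {0..1}" unfolding has_contour_integral vd_ray .
      then have h: "((\<lambda>t. if t \<in> {0..1} then ?h t else 0) has_integral ri R ?S \<theta>) UNIV"
        by (subst has_integral_restrict_UNIV)
      have "((\<lambda>t. M * R) has_integral (t2 - t1) * (M * R)) {t1..t2}"
        using has_integral_const_real[of "M * R" t1 t2] R \<epsilon> by (simp add: t1_def t2_def divide_right_mono content_real)
      then have b: "((\<lambda>t. if t \<in> {t1..t2} then M * R else 0) has_integral (t2 - t1) * (M * R)) UNIV"
        by (subst has_integral_restrict_UNIV)
      have "norm (integral UNIV (\<lambda>t. if t \<in> {0..1} then ?h t else 0)) \<le> integral UNIV (\<lambda>t. if t \<in> {t1..t2} then M * R else 0)"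
      proof (rule integral_norm_bound_integral)
        fix t :: real
        show "norm (if t \<in> {0..1} then ?h t else 0) \<le> (if t \<in> {t1..t2} then M * R else 0)"
        proof (cases "t \<in> {0..1} \<and> ray R \<theta> t \<in> ?S")
          case True
          then have t: "t \<in> {0..1}" and cb: "ray R \<theta> t \<in> cball \<sigma> (2 * \<epsilon>)" by auto
          have nt: "norm (ray R \<theta> t) = R * t" using t R by (simp add: ray_eq norm_mult)
          have "\<bar>norm \<sigma> - norm (ray R \<theta> t)\<bar> \<le> 2 * \<epsilon>"
            using cb norm_triangle_ineq3[of \<sigma> "ray R \<theta> t"] by (simp add: dist_norm)
          then have "t \<in> {t1..t2}" unfolding nt t1_def t2_def using R by (auto simp: field_simps abs_le_iff)
          moreover have "norm (g (ray R \<theta> t)) * R \<le> M * R"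
            using gM[OF cb ray_upper[OF \<theta> R t]] R by (intro mult_right_mono) auto
          ultimately show ?thesis using True R by (simp add: norm_mult)
        next
          case False
          then show ?thesis using M0 R by auto
        qed
      qed (use h b in auto)
      also have "\<dots> = (t2 - t1) * (M * R)" using b by (rule integral_unique)
      also have "\<dots> = M * (4 * \<epsilon>)" using R by (simp add: t1_def t2_def field_simps)
      finally show ?thesis using integral_unique[OF h] by simp
    qed
    have "norm (defect R A B' \<sigma>) \<le> (\<Sum>\<theta>\<in>T. norm (j \<theta>) * (M * (4 * \<epsilon>))) + M * (2 * pi * (2 * \<epsilon>))"
      unfolding defect_def
    proof (rule order_trans[OF norm_triangle_ineq add_mono[OF _ ci]])
      show "norm (\<Sum>\<theta>\<in>T. j \<theta> * ri R (K A B' \<inter> cball \<sigma> (2 * \<epsilon>)) \<theta>) \<le> (\<Sum>\<theta>\<in>T. norm (j \<theta>) * (M * (4 * \<epsilon>)))"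
      proof (rule sum_norm_le)
        fix \<theta> assume "\<theta> \<in> T"
        then show "norm (j \<theta> * ri R (K A B' \<inter> cball \<sigma> (2 * \<epsilon>)) \<theta>) \<le> norm (j \<theta>) * (M * (4 * \<epsilon>))"
          unfolding norm_mult by (intro mult_left_mono ri) auto
      qed
    qed
    also have "\<dots> = D * M" by (simp add: D_def sum_distrib_left sum_distrib_right algebra_simps)
    finally show ?thesis by (simp add: M_def mult.assoc)
  qed
  then show ?thesis using D0 C'0 by (intro exI[of _ "D * C'"]) auto
qed

text \<open>A ray contributes the increment of G from radius 2 \<epsilon> to its truncation radius,
  and the circle about 0 contributes increments from the rays to one common end point. The values at
  radius 2 \<epsilon> cancel ray by ray, and the common value drops out by
  \<open>sum_j\<close>.\<close>

lemma main_term: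
  assumes A: "2 * \<epsilon> < A" "2 * \<epsilon> < B'" and R: "R = max A B'"
  shows "(\<Sum>\<theta>\<in>T. j \<theta> * ri R (K A B' - cball 0 (2 * \<epsilon>)) \<theta>) - ci (U \<inter> K A B' \<inter> far) 0 =
    (\<Sum>\<theta>\<in>T. j \<theta> * G (of_real (if 0 \<le> Re (e \<theta>) then A else B') * e \<theta>))"
proof -
  define \<rho> where "\<rho> \<theta> = (if 0 \<le> Re (e \<theta>) then A else B')" for \<theta>
  have R0: "0 < R" using A \<epsilon> by (simp add: R)
  have \<rho>: "2 * \<epsilon> < \<rho> \<theta>" "\<rho> \<theta> \<le> R" for \<theta> using A by (auto simp: \<rho>_def R)
  have ri: "ri R (K A B' - cball 0 (2 * \<epsilon>)) \<theta> = G (of_real (\<rho> \<theta>) * e \<theta>) - G (of_real (2 * \<epsilon>) * e \<theta>)" if \<theta>: "\<theta> \<in> T" for \<theta>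
    unfolding ri_def ray_def
  proof (rule contour_integral_unique, rule has_contour_integral_ray[OF R0, where E = "{2 * \<epsilon>, \<rho> \<theta>}"])
    fix x assume x: "2 * \<epsilon> \<le> x" "x \<le> \<rho> \<theta>"
    then show "(G has_field_derivative g (of_real x * e \<theta>)) (at (of_real x * e \<theta>))"
      using \<epsilon> T_bounds(2)[OF \<theta>] by (intro G_slit slit_e) auto
  next
    fix x assume x: "x \<in> {0..R} - {2 * \<epsilon>, \<rho> \<theta>}"
    have "of_real x * e \<theta> \<in> K A B' \<longleftrightarrow> x \<le> \<rho> \<theta>" if "0 < x"
      using that by (auto simp: K_def half_discs_def \<rho>_def norm_mult zero_le_mult_iff mult_less_0_iff)
    then show "of_real x * e \<theta> \<in> K A B' - cball 0 (2 * \<epsilon>) \<longleftrightarrow> 2 * \<epsilon> < x \<and> x < \<rho> \<theta>"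
      using x \<epsilon> by (auto simp: norm_mult)
  qed (use \<epsilon> \<rho>[of \<theta>] in auto)
  \<comment> \<open>The angle 3 * pi / 4 is beyond every ray and before the cut at pi, so the arcs
    \<open>H' \<theta>\<close> end within the domain of G, and U has no points between there and the
    cut.\<close>
  define E where "E = G (of_real (2 * \<epsilon>) * e (3 * pi / 4))"
  define \<phi> where "\<phi> = s * pi / 2"
  have \<phi>: "- pi \<le> \<phi>" "\<phi> \<le> pi" using s pi_gt_zero by (auto simp: \<phi>_def)
  have cis\<phi>: "cis \<phi> = \<i> * of_real s" using s by (auto simp: \<phi>_def complex_eq_iff)
  let ?P = "part_circlepath 0 (2 * \<epsilon>) (\<phi> - pi) (\<phi> + pi)"
  have P: "?P t = of_real (2 * \<epsilon>) * e (2 * pi * t - pi)" for t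
  proof -
    have "linepath (\<phi> - pi) (\<phi> + pi) t = \<phi> + (2 * pi * t - pi)"
      by (simp add: linepath_def algebra_simps)
    then show ?thesis unfolding part_circlepath_def e_def
      by (simp only: cis_conv_exp[symmetric] cis\<phi>[symmetric] cis_mult add_0)
  qed
  have lt: "\<bar>\<theta>\<bar> < 3 * pi / 4" if "\<theta> \<in> T" for \<theta> using T_bounds(1)[OF that] pi_gt_zero by linarith
  define H' where "H' \<theta> = {z. slit z \<and> \<theta> < ang z \<and> ang z < 3 * pi / 4}" for \<theta>
  have arc: "((\<lambda>z. if z \<in> H' \<theta> then g z else 0) has_contour_integral (E - G (of_real (2 * \<epsilon>) * e \<theta>))) (circ 0)" if \<theta>: "\<theta> \<in> T" for \<theta>
  proof -
    define t1 where "t1 = (\<theta> + pi) / (2 * pi)"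
    define t2 where "t2 = (3 * pi / 4 + pi) / (2 * pi)"
    have t: "2 * pi * t1 - pi = \<theta>" "2 * pi * t2 - pi = 3 * pi / 4" by (simp_all add: t1_def t2_def)
    have ang_t: "slit (?P t)" "ang (?P t) = 2 * pi * t - pi" if "0 < t" "t < 1" for t
    proof -
      have "0 < pi * t" "pi * t < pi" using that by simp_all
      then have "\<bar>2 * pi * t - pi\<bar> < pi" "- pi < 2 * pi * t - pi" "2 * pi * t - pi \<le> pi"
        unfolding abs_less_iff by linarith+
      moreover have "0 < 2 * \<epsilon>" using \<epsilon> by simp
      ultimately show "slit (?P t)" "ang (?P t) = 2 * pi * t - pi"
        unfolding P by (simp_all only: slit_e ang_e)
    qed
    have t01: "0 < t1" "t1 \<le> t2" "t2 < 1" using lt[OF \<theta>] pi_gt_zero by (auto simp: t1_def t2_def field_simps abs_less_iff)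
    have "((\<lambda>z. if z \<in> H' \<theta> then g z else 0) has_contour_integral (G (?P t2) - G (?P t1))) ?P"
    proof (rule has_contour_integral_piece[OF has_vector_derivative_part_circlepath[of 0 "2 * \<epsilon>" "\<phi> - pi" "\<phi> + pi" _ UNIV], where E = "{0, 1}"])
      show "(G has_field_derivative g (?P t)) (at (?P t))" if "t1 \<le> t" "t \<le> t2" for t
        using that t01 by (intro G_slit ang_t) auto
      fix t :: real assume tt: "t \<in> {0..1} - {0, 1}"
      then have "?P t \<in> H' \<theta> \<longleftrightarrow> \<theta> < 2 * pi * t - pi \<and> 2 * pi * t - pi < 3 * pi / 4"
        using ang_t[of t] by (simp add: H'_def)
      also have "\<dots> \<longleftrightarrow> t1 < t \<and> t < t2" by (auto simp: t1_def t2_def field_simps)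
      finally show "?P t \<in> H' \<theta> \<longleftrightarrow> t1 < t \<and> t < t2" .
    qed (use t01 in auto)
    then have "((\<lambda>z. if z \<in> H' \<theta> then g z else 0) has_contour_integral (E - G (of_real (2 * \<epsilon>) * e \<theta>))) ?P"
      unfolding P t E_def .
    then show ?thesis unfolding circ_def by (rule has_contour_integral_rotate_circle[OF _ \<phi>])
  qed
  have K0: "z \<in> K A B'" if "norm z = 2 * \<epsilon>" for z using that A by (auto simp: K_def half_discs_def)
  have ind: "(if z \<in> U \<inter> K A B' \<inter> far then g z else 0) = (\<Sum>\<theta>\<in>T. j \<theta> * (if z \<in> H' \<theta> then g z else 0))"
    if z: "norm z = 2 * \<epsilon>" "slit z" and nr: "\<And>\<theta> \<rho>. \<theta> \<in> T \<Longrightarrow> z \<noteq> of_real \<rho> * e \<theta>" for z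
  proof (cases "ang z < 3 * pi / 4")
    case True
    then have "z \<in> H' \<theta> \<longleftrightarrow> z \<in> H \<theta>" for \<theta> by (simp add: H'_def H_def)
    then show ?thesis using indicator_U[OF z(2) nr] K0[OF z(1)] z(1) \<epsilon> by (simp add: far_def)
  next
    case False
    then have "f (ang z) = 0" using slit_ang[OF z(2)] pi_gt_zero by (intro f_outside) linarith+
    then have "z \<notin> U" using U_iff_ang[of z] slit_ang[OF z(2)] by (simp add: f_def)
    then show ?thesis using False by (simp add: H'_def)
  qed
  have "((\<lambda>z. \<Sum>\<theta>\<in>T. j \<theta> * (if z \<in> H' \<theta> then g z else 0)) has_contour_integral (\<Sum>\<theta>\<in>T. j \<theta> * (E - G (of_real (2 * \<epsilon>) * e \<theta>)))) (circ 0)"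
    by (intro has_contour_integral_sum finite_T has_contour_integral_lmul arc)
  then have "((\<lambda>t. (\<Sum>\<theta>\<in>T. j \<theta> * (if circ 0 t \<in> H' \<theta> then g (circ 0 t) else 0)) * vector_derivative (circ 0) (at t)) has_integral (\<Sum>\<theta>\<in>T. j \<theta> * (E - G (of_real (2 * \<epsilon>) * e \<theta>)))) {0..1}"
    unfolding has_contour_integral .
  then have "((\<lambda>t. (if circ 0 t \<in> U \<inter> K A B' \<inter> far then g (circ 0 t) else 0) * vector_derivative (circ 0) (at t)) has_integral (\<Sum>\<theta>\<in>T. j \<theta> * (E - G (of_real (2 * \<epsilon>) * e \<theta>)))) {0..1}"
  proof (rule has_integral_spike[rotated 2])
    let ?E = "{t\<in>{0..1}. circ 0 t \<in> (\<Union>\<theta>\<in>T. {of_real \<rho> * e \<theta> | \<rho>. True})} \<union> {t\<in>{0..1}. circ 0 t \<in> {of_real (2 * \<epsilon>) * e pi}}"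
    show "negligible ?E"
      using finite_circ_times finite_simple_path_preimage[OF simple_circ[of 0], of "{of_real (2 * \<epsilon>) * e pi}"]
      by (intro negligible_finite finite_UnI) auto
    fix t assume t: "t \<in> {0..1} - ?E"
    then have sp: "norm (circ 0 t) = 2 * \<epsilon>" using circ_sphere[of t 0] by simp
    have pol: "circ 0 t = of_real (2 * \<epsilon>) * e (ang (circ 0 t))" using polar[of "circ 0 t"] sp by simp
    then have "ang (circ 0 t) \<noteq> pi" using t by auto
    then have "\<bar>ang (circ 0 t)\<bar> < pi" using ang_bounds[of "circ 0 t"] by linarith
    then have "slit (circ 0 t)" using slit_e[of "2 * \<epsilon>" "ang (circ 0 t)"] \<epsilon> pol by simp
    then show "(if circ 0 t \<in> U \<inter> K A B' \<inter> far then g (circ 0 t) else 0) * vector_derivative (circ 0) (at t) =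
        (\<Sum>\<theta>\<in>T. j \<theta> * (if circ 0 t \<in> H' \<theta> then g (circ 0 t) else 0)) * vector_derivative (circ 0) (at t)"
      using t by (subst ind[OF sp]) auto
  qed
  then have ci: "ci (U \<inter> K A B' \<inter> far) 0 = (\<Sum>\<theta>\<in>T. j \<theta> * (E - G (of_real (2 * \<epsilon>) * e \<theta>)))"
    unfolding ci_def by (intro contour_integral_unique) (simp add: has_contour_integral)
  have "(\<Sum>\<theta>\<in>T. j \<theta> * ri R (K A B' - cball 0 (2 * \<epsilon>)) \<theta>) - ci (U \<inter> K A B' \<inter> far) 0 =
      (\<Sum>\<theta>\<in>T. j \<theta> * (G (of_real (\<rho> \<theta>) * e \<theta>) - G (of_real (2 * \<epsilon>) * e \<theta>)) - j \<theta> * (E - G (of_real (2 * \<epsilon>) * e \<theta>)))"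
    unfolding ci sum_subtractf by (simp add: ri)
  also have "\<dots> = (\<Sum>\<theta>\<in>T. j \<theta> * G (of_real (\<rho> \<theta>) * e \<theta>) - j \<theta> * E)"
    by (intro sum.cong refl) (simp add: algebra_simps)
  also have "\<dots> = (\<Sum>\<theta>\<in>T. j \<theta> * G (of_real (\<rho> \<theta>) * e \<theta>)) - (\<Sum>\<theta>\<in>T. j \<theta>) * E"
    by (simp add: sum_subtractf sum_distrib_right)
  finally show ?thesis unfolding sum_j \<rho>_def by simp
qed

text \<open>A disc that crosses the imaginary axis may straddle the mismatch of the two radii.
  Otherwise it lies on one side and crosses the arc there.\<close>

lemma crossing_ball:
  assumes p: "p \<in> cball \<sigma> (2 * \<epsilon>)" "p \<in> K A B'" and q: "q \<in> cball \<sigma> (2 * \<epsilon>)" "q \<notin> K A B'"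
  shows "\<bar>norm \<sigma> - A\<bar> \<le> 2 * \<epsilon> \<or> \<bar>norm \<sigma> - B'\<bar> \<le> 2 * \<epsilon> \<or> (\<bar>Re \<sigma>\<bar> \<le> 2 * \<epsilon> \<and> min A B' - 2 * \<epsilon> \<le> norm \<sigma>)"
proof -
  have n: "\<bar>norm \<sigma> - norm z\<bar> \<le> 2 * \<epsilon>" "\<bar>Re \<sigma> - Re z\<bar> \<le> 2 * \<epsilon>" if "z \<in> cball \<sigma> (2 * \<epsilon>)" for z
    using that norm_triangle_ineq3[of \<sigma> z] abs_Re_le_cmod[of "\<sigma> - z"] by (auto simp: dist_norm)
  show ?thesis
  proof (cases "0 \<le> Re p \<longleftrightarrow> 0 \<le> Re q")
    case True
    then show ?thesis
      using p(2) q(2) n(1)[OF p(1)] n(1)[OF q(1)] by (auto simp: K_def half_discs_def not_le)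
  next
    case False
    then have "\<bar>Re \<sigma>\<bar> \<le> 2 * \<epsilon>" using n(2)[OF p(1)] n(2)[OF q(1)] by linarith
    moreover have "min A B' - 2 * \<epsilon> \<le> norm \<sigma>"
      using q(2) n(1)[OF q(1)] by (cases "0 \<le> Re q") (auto simp: K_def half_discs_def)
    ultimately show ?thesis by blast
  qed
qed

lemma bdry_integral_zero: "has_bdry_integral (U - B) g 0"
proof -
  define J where "J A B' = (\<Sum>\<theta>\<in>T. j \<theta> * ri (max A B') (K A B' - B) \<theta>) - (\<Sum>\<sigma>\<in>Zf (max A B'). ci (U \<inter> K A B' \<inter> far) \<sigma>)" for A B'
  have split: "J A B' = (\<Sum>\<theta>\<in>T. j \<theta> * G (of_real (if 0 \<le> Re (e \<theta>) then A else B') * e \<theta>)) -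
      (\<Sum>\<sigma>\<in>Zf (max A B') - {0}. defect (max A B') A B' \<sigma>)"
    if A: "2 * \<epsilon> < A" "2 * \<epsilon> < B'" for A B'
  proof -
    let ?R = "max A B'" and ?Z = "Zf (max A B') - {0}"
    have R: "0 < ?R" using A \<epsilon> by simp
    have 0: "0 \<in> Zf ?R" using Z0 R \<epsilon> by (simp add: Zf_def)
    have "J A B' = (\<Sum>\<theta>\<in>T. j \<theta> * (ri ?R (K A B' - cball 0 (2 * \<epsilon>)) \<theta> - (\<Sum>\<sigma>\<in>?Z. ri ?R (K A B' \<inter> cball \<sigma> (2 * \<epsilon>)) \<theta>))) -
        (ci (U \<inter> K A B' \<inter> far) 0 + (\<Sum>\<sigma>\<in>?Z. ci (U \<inter> K A B' \<inter> far) \<sigma>))"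
      unfolding J_def using sum.remove[OF finite_Zf 0, of "ci (U \<inter> K A B' \<inter> far)"]
      by (simp add: ray_perforated[OF R K_norm])
    also have "\<dots> = ((\<Sum>\<theta>\<in>T. j \<theta> * ri ?R (K A B' - cball 0 (2 * \<epsilon>)) \<theta>) - ci (U \<inter> K A B' \<inter> far) 0) -
        ((\<Sum>\<theta>\<in>T. \<Sum>\<sigma>\<in>?Z. j \<theta> * ri ?R (K A B' \<inter> cball \<sigma> (2 * \<epsilon>)) \<theta>) + (\<Sum>\<sigma>\<in>?Z. ci (U \<inter> K A B' \<inter> far) \<sigma>))"
      by (simp add: right_diff_distrib sum_subtractf sum_distrib_left)
    also have "(\<Sum>\<theta>\<in>T. \<Sum>\<sigma>\<in>?Z. j \<theta> * ri ?R (K A B' \<inter> cball \<sigma> (2 * \<epsilon>)) \<theta>) = (\<Sum>\<sigma>\<in>?Z. \<Sum>\<theta>\<in>T. j \<theta> * ri ?R (K A B' \<inter> cball \<sigma> (2 * \<epsilon>)) \<theta>)"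
      by (rule sum.swap)
    finally show ?thesis
      unfolding main_term[OF A refl] defect_def sum.distrib .
  qed
  obtain C where C: "0 \<le> C" "\<And>\<sigma> R A B'. \<sigma> \<in> Z \<Longrightarrow> \<sigma> \<noteq> 0 \<Longrightarrow> 0 < R \<Longrightarrow> norm (defect R A B' \<sigma>) \<le> C * (exp (- y * (s * Im \<sigma>)) / norm \<sigma>)"
    using defect_bound by blast
  have small: "\<exists>R0. \<forall>A\<ge>R0. \<forall>B'\<ge>R0. norm (J A B') < \<eta>" if \<eta>: "0 < \<eta>" for \<eta>
  proof -
    define N where "N = (\<Sum>\<theta>\<in>T. norm (j \<theta>))"
    have N0: "0 \<le> N" unfolding N_def by (intro sum_nonneg) auto
    obtain R1 where R1: "0 < R1" "\<And>z w. R1 \<le> norm z \<Longrightarrow> R1 \<le> norm w \<Longrightarrow> 0 \<le> s * Im z \<Longrightarrow> 0 \<le> s * Im w \<Longrightarrow> norm (G z - G w) \<le> \<eta> / (4 * (N + 1))"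
      using decay[of "\<eta> / (4 * (N + 1))"] \<eta> N0 by auto
    \<comment> \<open>The summand 1, here and in \<open>N + 1\<close>, covers vanishing
      constants.\<close>
    have "0 < \<eta> / (4 * (C + 1))" using \<eta> C(1) by simp
    from separated_boundary_sum[OF Z \<epsilon> s y this]
    obtain R2 where R2': "\<forall>A\<ge>R2. \<forall>B'\<ge>R2. \<forall>F. finite F \<longrightarrow>
        F \<subseteq> {\<sigma>\<in>Z. - 2 * \<epsilon> \<le> s * Im \<sigma> \<and> (\<bar>norm \<sigma> - A\<bar> \<le> 2 * \<epsilon> \<or> \<bar>norm \<sigma> - B'\<bar> \<le> 2 * \<epsilon> \<or>
          (\<bar>Re \<sigma>\<bar> \<le> 2 * \<epsilon> \<and> min A B' - 2 * \<epsilon> \<le> norm \<sigma>))} \<longrightarrow>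
        (\<Sum>\<sigma>\<in>F. exp (- y * (s * Im \<sigma>)) / norm \<sigma>) \<le> \<eta> / (4 * (C + 1))"
      by (rule exE)
    note R2 = R2'[rule_format]
    define R0 where "R0 = max (max R1 R2) (3 * \<epsilon>)"
    have "norm (J A B') < \<eta>" if A: "R0 \<le> A" and B': "R0 \<le> B'" for A B'
    proof -
      have big: "2 * \<epsilon> < A" "2 * \<epsilon> < B'" "R1 \<le> A" "R1 \<le> B'" "R2 \<le> A" "R2 \<le> B'"
        using A B' \<epsilon> by (auto simp: R0_def)
      let ?R = "max A B'" and ?Z = "Zf (max A B') - {0}"
      have R: "0 < ?R" using big \<epsilon> by simp
      define \<rho> where "\<rho> \<theta> = (if 0 \<le> Re (e \<theta>) then A else B')" for \<theta>
      have \<rho>: "R1 \<le> \<rho> \<theta>" "0 < \<rho> \<theta>" for \<theta> using big \<epsilon> by (auto simp: \<rho>_def)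
      \<comment> \<open>As the jumps add up to 0, G may be replaced by its difference from a
        reference value. Only the oscillation of G is known to be small, not G itself.\<close>
      let ?w = "of_real A * e 0"
      have w: "R1 \<le> norm ?w" "0 \<le> s * Im ?w" unfolding s_Im_e using big \<epsilon> by (auto simp: norm_mult)
      have "(\<Sum>\<theta>\<in>T. j \<theta> * G (of_real (\<rho> \<theta>) * e \<theta>)) = (\<Sum>\<theta>\<in>T. j \<theta> * (G (of_real (\<rho> \<theta>) * e \<theta>) - G ?w))"
        using sum_j by (simp add: right_diff_distrib sum_subtractf sum_distrib_right[symmetric])
      also have "norm \<dots> \<le> (\<Sum>\<theta>\<in>T. norm (j \<theta>) * (\<eta> / (4 * (N + 1))))"
      proof (rule sum_norm_le)
        fix \<theta> assume \<theta>: "\<theta> \<in> T"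
        have "R1 \<le> norm (of_real (\<rho> \<theta>) * e \<theta>)" "0 \<le> s * Im (of_real (\<rho> \<theta>) * e \<theta>)"
          unfolding s_Im_e using \<rho>[of \<theta>] T_bounds(3)[OF \<theta>] by (simp_all add: norm_mult)
        then have "norm (G (of_real (\<rho> \<theta>) * e \<theta>) - G ?w) \<le> \<eta> / (4 * (N + 1))"
          using w by (intro R1)
        then show "norm (j \<theta> * (G (of_real (\<rho> \<theta>) * e \<theta>) - G ?w)) \<le> norm (j \<theta>) * (\<eta> / (4 * (N + 1)))"
          unfolding norm_mult by (rule mult_left_mono) simp
      qed
      also have "\<dots> = N * (\<eta> / (4 * (N + 1)))" by (simp only: N_def sum_distrib_right)
      also have "\<dots> \<le> (N + 1) * (\<eta> / (4 * (N + 1)))" using \<eta> N0 by (intro mult_right_mono) auto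
      also have "\<dots> = \<eta> / 4" using N0 by (simp add: divide_simps)
      finally have 1: "norm (\<Sum>\<theta>\<in>T. j \<theta> * G (of_real (\<rho> \<theta>) * e \<theta>)) \<le> \<eta> / 4" .
      \<comment> \<open>The discs that the truncation really cuts; all others have defect 0.\<close>
      define F where "F = {\<sigma>\<in>?Z. - 2 * \<epsilon> \<le> s * Im \<sigma> \<and> (\<exists>p\<in>cball \<sigma> (2 * \<epsilon>). p \<in> K A B') \<and> (\<exists>q\<in>cball \<sigma> (2 * \<epsilon>). q \<notin> K A B')}"
      have finF: "finite F" using finite_Zf by (simp add: F_def)
      have ZfZ: "\<sigma> \<in> Z" if "\<sigma> \<in> Zf ?R" for \<sigma> using that by (simp add: Zf_def)
      have zero: "defect ?R A B' \<sigma> = 0" if \<sigma>: "\<sigma> \<in> ?Z - F" for \<sigma>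
      proof -
        have \<sigma>Z: "\<sigma> \<in> Z" "\<sigma> \<noteq> 0" using \<sigma> ZfZ by auto
        consider "s * Im \<sigma> < - 2 * \<epsilon>" | "cball \<sigma> (2 * \<epsilon>) \<inter> K A B' = {}" | "cball \<sigma> (2 * \<epsilon>) \<subseteq> K A B'"
          using \<sigma> by (fastforce simp: F_def not_less)
        then show ?thesis
          using defect_lower[OF _ R] defect_outside defect_inside[OF \<sigma>Z _ refl R] by cases auto
      qed
      have "(\<Sum>\<sigma>\<in>?Z. defect ?R A B' \<sigma>) = (\<Sum>\<sigma>\<in>F. defect ?R A B' \<sigma>)"
        using zero finite_Zf by (intro sum.mono_neutral_right) (auto simp: F_def)
      also have "norm \<dots> \<le> (\<Sum>\<sigma>\<in>F. C * (exp (- y * (s * Im \<sigma>)) / norm \<sigma>))"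
        using ZfZ R by (intro sum_norm_le C(2)) (auto simp: F_def)
      also have "\<dots> = C * (\<Sum>\<sigma>\<in>F. exp (- y * (s * Im \<sigma>)) / norm \<sigma>)" by (simp only: sum_distrib_left)
      also have "\<dots> \<le> C * (\<eta> / (4 * (C + 1)))"
      proof (rule mult_left_mono[OF R2[OF big(5,6) finF] C(1)])
        show "F \<subseteq> {\<sigma>\<in>Z. - 2 * \<epsilon> \<le> s * Im \<sigma> \<and> (\<bar>norm \<sigma> - A\<bar> \<le> 2 * \<epsilon> \<or> \<bar>norm \<sigma> - B'\<bar> \<le> 2 * \<epsilon> \<or>
          (\<bar>Re \<sigma>\<bar> \<le> 2 * \<epsilon> \<and> min A B' - 2 * \<epsilon> \<le> norm \<sigma>))}"
        proof
          fix \<sigma> assume \<sigma>: "\<sigma> \<in> F"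
          then obtain p q where "p \<in> cball \<sigma> (2 * \<epsilon>)" "p \<in> K A B'" "q \<in> cball \<sigma> (2 * \<epsilon>)" "q \<notin> K A B'"
            unfolding F_def by blast
          from crossing_ball[OF this] \<sigma> ZfZ show "\<sigma> \<in> {\<sigma>\<in>Z. - 2 * \<epsilon> \<le> s * Im \<sigma> \<and> (\<bar>norm \<sigma> - A\<bar> \<le> 2 * \<epsilon> \<or> \<bar>norm \<sigma> - B'\<bar> \<le> 2 * \<epsilon> \<or>
            (\<bar>Re \<sigma>\<bar> \<le> 2 * \<epsilon> \<and> min A B' - 2 * \<epsilon> \<le> norm \<sigma>))}" by (simp add: F_def)
        qed
      qed
      also have "\<dots> \<le> (C + 1) * (\<eta> / (4 * (C + 1)))" using \<eta> C(1) by (intro mult_right_mono) auto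
      also have "\<dots> = \<eta> / 4" using C(1) by (simp add: divide_simps)
      finally have 2: "norm (\<Sum>\<sigma>\<in>?Z. defect ?R A B' \<sigma>) \<le> \<eta> / 4" .
      have "norm (J A B') \<le> \<eta> / 4 + \<eta> / 4"
        unfolding split[OF big(1,2)] using 1 2 unfolding \<rho>_def by (rule order_trans[OF norm_triangle_ineq4 add_mono])
      then show ?thesis using \<eta> by linarith
    qed
    then show ?thesis by blast
  qed
  have "((\<lambda>(A, B'). J A B') \<longlongrightarrow> 0) (at_top \<times>\<^sub>F at_top)"
  proof (rule tendstoI)
    fix \<eta> :: real assume "0 < \<eta>"
    then obtain R0 where R0: "\<And>A B'. R0 \<le> A \<Longrightarrow> R0 \<le> B' \<Longrightarrow> norm (J A B') < \<eta>" using small by blast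
    have "\<forall>\<^sub>F p in at_top \<times>\<^sub>F at_top. R0 \<le> fst p \<and> R0 \<le> snd p"
      by (intro eventually_prodI eventually_ge_at_top)
    then show "\<forall>\<^sub>F p in at_top \<times>\<^sub>F at_top. dist (case p of (A, B') \<Rightarrow> J A B') 0 < \<eta>"
      by eventually_elim (auto simp: R0 split: prod.splits)
  qed
  moreover have "has_bdry_integral_in (U - B) (half_discs A B') g (J A B')" if "0 < A" "0 < B'" for A B'
    unfolding J_def by (rule bdry_integral_in[OF that])
  ultimately show ?thesis unfolding has_bdry_integral_def by blast
qed

end

section \<open>The augmented eigenfunctions\<close>

text \<open>One statement for both contours: F^+ takes s = 1 and y = x, F^- takes s = -1 and y = 1 -
  x. For a = 0 the region is empty.\<close>

lemma sector_boundary_integral: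
  fixes c :: "nat \<Rightarrow> complex" and s y \<epsilon> :: real
  assumes s: "s = 1 \<or> s = -1" and y: "0 < y" and \<epsilon>: "0 < \<epsilon>" and Z: "separated Z \<epsilon>" "0 \<in> Z" and n: "1 \<le> n"
  shows "has_bdry_integral ({z. 0 < s * Im z \<and> 0 < Re (a * z ^ n)} - (\<Union>\<sigma>\<in>Z. cball \<sigma> (2 * \<epsilon>)))
    (\<lambda>z. exp (\<i> * of_real s * of_real y * z) * (\<Sum>m=1..n. c m / z ^ m)) 0"
proof (cases "a = 0")
  case True
  have "has_bdry_integral_in {} K g 0" for K g
    using has_bdry_integral_inI[of "{}" "\<lambda>_. linepath 0 1" "{}" K g "\<lambda>_. 0"] by simp
  then show ?thesis
    using True unfolding has_bdry_integral_def by (intro exI[of _ "\<lambda>_ _. 0"]) (auto simp: case_prod_unfold)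
next
  case False
  let ?g = "\<lambda>z. exp (\<i> * of_real s * of_real y * z) * (\<Sum>m=1..n. c m / z ^ m)"
  obtain G where G: "\<And>z. - (\<i> * of_real s * z) \<notin> \<real>\<^sub>\<le>\<^sub>0 \<Longrightarrow> (G has_field_derivative ?g z) (at z)"
    "\<And>\<eta>. 0 < \<eta> \<Longrightarrow> \<exists>R0>0. \<forall>z w. R0 \<le> norm z \<and> R0 \<le> norm w \<and> 0 \<le> s * Im z \<and> 0 \<le> s * Im w \<longrightarrow> norm (G z - G w) \<le> \<eta>"
    using ex_decaying_primitive[OF s y, of c n] by blast
  obtain C where C: "0 \<le> C" "\<And>z. \<epsilon> \<le> norm z \<Longrightarrow> norm (\<Sum>m=1..n. c m / z ^ m) \<le> C / norm z"
    using norm_sum_powers_bound[OF \<epsilon>, where n = n and c = c and k = 0] by auto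
  have bound: "norm (?g z) \<le> C * exp (- y * (s * Im z)) / norm z" if "\<epsilon> \<le> norm z" for z
  proof -
    have "norm (?g z) = exp (- y * (s * Im z)) * norm (\<Sum>m=1..n. c m / z ^ m)"
      unfolding norm_mult[of "exp _"] norm_exp_half_plane ..
    also have "\<dots> \<le> exp (- y * (s * Im z)) * (C / norm z)" using C(2)[OF that] by (rule mult_left_mono) simp
    finally show ?thesis by (simp add: mult.commute)
  qed
  interpret perforated_sector s y \<epsilon> Z n a ?g G
  proof
    show "?g holomorphic_on - {0}" by (intro holomorphic_intros) auto
    show "\<exists>C\<ge>0. \<forall>z. \<epsilon> \<le> norm z \<and> 0 \<le> s * Im z \<longrightarrow> norm (?g z) \<le> C * exp (- y * (s * Im z)) / norm z"
      using bound C(1) by blast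
  qed (use s y \<epsilon> Z n False G in blast)+
  show ?thesis using bdry_integral_zero unfolding U_def B_def .
qed

text \<open>The functional that is left once \<open>Delta\<close> has cancelled, so it makes sense
  at the zeros of \<open>Delta\<close> as well. The factor k is 1 for F^+ and
  \<open>- exp (- \<i> * z)\<close> for F^-.\<close>

definition remainder ::
    "nat \<Rightarrow> (nat \<Rightarrow> nat \<Rightarrow> real) \<Rightarrow> (nat \<Rightarrow> real \<Rightarrow> complex) \<Rightarrow> (complex \<Rightarrow> complex) \<Rightarrow> complex \<Rightarrow> functional" where
  "remainder n d v k z \<phi> = (\<Sum>j=1..n. (k z / (2 * of_real pi) * Mpart n d z 1 j) * bracket_diff n \<phi> (v j))"

lemma remainders_numer:
  assumes "0 < n"
    and v: "\<And>\<phi> \<psi>. \<phi> \<in> Phi n b \<beta> \<Longrightarrow> \<psi> \<in> Cinf \<Longrightarrow>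
      bracket_diff n \<phi> \<psi> = (\<Sum>j=1..n. cnj (bform n bs \<beta>s j \<psi>) * bracket_diff n \<phi> (v j))"
    and \<gamma>: "\<And>z. z \<in> contour_set \<gamma> \<Longrightarrow> Delta n bs \<beta>s z \<noteq> 0"
    and E: "\<And>z f. E z f = k z / (2 * of_real pi * Delta n bs \<beta>s z) * numer n bs \<beta>s d z f"
  shows "remainders n (Phi n b \<beta>) (Sop n) \<gamma> E (remainder n d v k)"
  unfolding remainders_def
proof (intro ballI conjI)
  fix z assume z: "z \<in> contour_set \<gamma>"
  have "E z = (\<lambda>f. k z / (2 * of_real pi * Delta n bs \<beta>s z) * numer n bs \<beta>s d z f)" using E by blast
  then show "E z \<in> dual Cinf" by (simp only: numer_dual)
  have "remainder n d v k z = (\<lambda>\<phi>. \<Sum>j=1..n. (k z / (2 * of_real pi) * Mpart n d z 1 j) * bracket_diff n \<phi> (v j))"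
    unfolding remainder_def by blast
  then show "remainder n d v k z \<in> dual (Phi n b \<beta>)" by (simp only: bracket_diff_dual)
  fix \<phi> assume \<phi>: "\<phi> \<in> Phi n b \<beta>"
  then have C: "\<phi> \<in> Cinf" by (simp add: Phi_def)
  define W where "W = (\<Sum>j=1..n. Mpart n d z 1 j * bracket_diff n \<phi> (v j))"
  have N: "numer n bs \<beta>s d z (Sop n \<phi>) = z ^ n * numer n bs \<beta>s d z \<phi> + Delta n bs \<beta>s z * W"
    unfolding W_def by (rule numer_Sop[OF assms(1) C v[OF \<phi>]])
  have R: "remainder n d v k z \<phi> = k z / (2 * of_real pi) * W"
    unfolding remainder_def W_def sum_distrib_left by (simp only: mult.assoc)
  show "E z (Sop n \<phi>) = z ^ n * E z \<phi> + remainder n d v k z \<phi>"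
    unfolding E N R using \<gamma>[OF z] by (simp add: field_simps)
qed

lemma holomorphic_remainder:
  assumes "k holomorphic_on S"
  shows "(\<lambda>z. remainder n d v k z \<phi>) holomorphic_on S"
  unfolding remainder_def Mpart_def by (intro holomorphic_intros assms) auto

lemma has_int_over_circles_entire:
  assumes "f holomorphic_on UNIV"
  shows "has_int_over (Circles Z r) f 0"
proof -
  have "(f has_contour_integral 0) (circlepath \<sigma> r)" for \<sigma>
    by (rule Cauchy_theorem_convex_simple[OF assms]) auto
  then have "f contour_integrable_on circlepath \<sigma> r" "contour_integral (circlepath \<sigma> r) f = 0" for \<sigma>
    by (auto simp: contour_integrable_on_def contour_integral_unique)
  then show ?thesis by (auto intro!: has_sum_0)
qed

text \<open>Degrees r < n become negative powers m = n - r with m \<ge> 1. The absence of a constant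
  term is the source of the decay O(1 / norm z).\<close>

lemma remainder_over_power:
  assumes n: "1 \<le> n"
  shows "remainder n d v k z \<phi> / z ^ n =
    k z * (\<Sum>m=1..n. (\<Sum>j=1..n. (- \<i>) ^ (n - m) * of_real (d j (n - m)) * bracket_diff n \<phi> (v j) / (2 * of_real pi)) / z ^ m)"
proof (cases "z = 0")
  \<comment> \<open>Both sides are 0 here because division by 0 yields 0.\<close>
  case True
  then show ?thesis using n by (simp add: power_0_left)
next
  case False
  have M: "Mpart n d z 1 j / z ^ n = (\<Sum>m=1..n. (- \<i>) ^ (n - m) * of_real (d j (n - m)) / z ^ m)" for j
  proof -
    have "Mpart n d z 1 j / z ^ n = (\<Sum>r<n. (- \<i> * z) ^ r * of_real (d j r) / z ^ n)"
      unfolding Mpart_def by (simp add: sum_divide_distrib)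
    also have "\<dots> = (\<Sum>m=1..n. (- \<i>) ^ (n - m) * of_real (d j (n - m)) / z ^ m)"
    proof (rule sum.reindex_bij_witness[of _ "\<lambda>m. n - m" "\<lambda>r. n - r"])
      fix r assume "r \<in> {..<n}"
      then have r: "n - (n - r) = r" "z ^ n = z ^ r * z ^ (n - r)" by (auto simp: power_add[symmetric])
      show "(- \<i>) ^ (n - (n - r)) * of_real (d j (n - (n - r))) / z ^ (n - r) = (- \<i> * z) ^ r * of_real (d j r) / z ^ n"
        unfolding r(1) r(2) power_mult_distrib using False by simp
    qed auto
    finally show ?thesis .
  qed
  have "remainder n d v k z \<phi> / z ^ n = (\<Sum>j=1..n. k z * (bracket_diff n \<phi> (v j) / (2 * of_real pi)) * (Mpart n d z 1 j / z ^ n))"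
    unfolding remainder_def sum_divide_distrib by (intro sum.cong refl) simp
  also have "\<dots> = k z * (\<Sum>j=1..n. \<Sum>m=1..n. (- \<i>) ^ (n - m) * of_real (d j (n - m)) * bracket_diff n \<phi> (v j) / (2 * of_real pi) / z ^ m)"
    unfolding M sum_distrib_left by (intro sum.cong refl) simp
  also have "\<dots> = k z * (\<Sum>m=1..n. (\<Sum>j=1..n. (- \<i>) ^ (n - m) * of_real (d j (n - m)) * bracket_diff n \<phi> (v j) / (2 * of_real pi)) / z ^ m)"
    unfolding sum_divide_distrib by (subst sum.swap) (rule refl)
  finally show ?thesis .
qed

text \<open>A zero is the centre of a removed disc, so an open ball about it misses the region and
  its closure.\<close>

lemma frontier_Delta_ne_0:
  assumes "0 < \<epsilon>" "z \<in> frontier (V - (\<Union>\<sigma>\<in>{\<sigma>. Delta n bs \<beta>s \<sigma> = 0}. cball \<sigma> (2 * \<epsilon>)))"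
  shows "Delta n bs \<beta>s z \<noteq> 0"
proof
  let ?W = "V - (\<Union>\<sigma>\<in>{\<sigma>. Delta n bs \<beta>s \<sigma> = 0}. cball \<sigma> (2 * \<epsilon>))"
  assume "Delta n bs \<beta>s z = 0"
  then have "ball z (2 * \<epsilon>) \<inter> ?W = {}" by force
  then have "ball z (2 * \<epsilon>) \<inter> closure ?W = {}" by (simp add: open_Int_closure_eq_empty)
  moreover have "z \<in> closure ?W" using assms(2) by (simp add: frontier_def)
  moreover have "z \<in> ball z (2 * \<epsilon>)" using assms(1) by simp
  ultimately show False by blast
qed

theorem proposition4p3:
  fixes n :: nat and b \<beta> bs \<beta>s :: "nat \<Rightarrow> nat \<Rightarrow> real" and a :: complex and T \<epsilon> :: real
  assumes "2 \<le> n"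
    and "indep_forms n b \<beta>"
    and "adjoint_forms n b \<beta> bs \<beta>s"
    and "\<exists>z. Delta n bs \<beta>s z \<noteq> 0"
    and "separation n bs \<beta>s \<epsilon>"
    and "0 < T"
  shows "augmented_type_I n (Phi n b \<beta>) (Sop n)
           (Gamma0_plus n bs \<beta>s \<epsilon>) (Fplus n bs \<beta>s)
           (Gamma0_minus n bs \<beta>s \<epsilon>) (Fminus n bs \<beta>s) \<and>
         augmented_type_II n (Phi n b \<beta>) (Sop n)
           (Gammaa_plus n bs \<beta>s \<epsilon> a) (Fplus n bs \<beta>s)
           (Gammaa_minus n bs \<beta>s \<epsilon> a) (Fminus n bs \<beta>s) \<and>
         (well_posed n b \<beta> a T \<and> (a \<noteq> 0 \<or> several_zeros n bs \<beta>s) \<longrightarrow>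
           complete_system (Phi n b \<beta>)
             (Fplus n bs \<beta>s ` contour_set (Gamma0_plus n bs \<beta>s \<epsilon>) \<union>
              Fminus n bs \<beta>s ` contour_set (Gamma0_minus n bs \<beta>s \<epsilon>) \<union>
              Fplus n bs \<beta>s ` contour_set (Gammaa_plus n bs \<beta>s \<epsilon> a) \<union>
              Fminus n bs \<beta>s ` contour_set (Gammaa_minus n bs \<beta>s \<epsilon> a)))"
proof (intro conjI impI)
  have \<epsilon>: "0 < \<epsilon>" using assms(5) by (simp add: separation_def)
  have n: "0 < n" "1 \<le> n" using assms(1) by auto
  obtain v where v': "\<forall>\<phi>\<in>Phi n b \<beta>. \<forall>\<psi>\<in>Cinf.
      bracket_diff n \<phi> \<psi> = (\<Sum>j=1..n. cnj (bform n bs \<beta>s j \<psi>) * bracket_diff n \<phi> (v j))"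
    using adjoint_representation[OF assms(3)] by (rule exE)
  note v = v'[rule_format]
  define kp where "kp = (\<lambda>z::complex. 1 :: complex)"
  define km where "km = (\<lambda>z::complex. - exp (- \<i> * z))"
  have hol: "kp holomorphic_on S" "km holomorphic_on S" for S
    unfolding kp_def km_def by (intro holomorphic_intros)+
  have Rp: "remainders n (Phi n b \<beta>) (Sop n) \<gamma> (Fplus n bs \<beta>s) (remainder n bs v kp)"
    if "\<And>z. z \<in> contour_set \<gamma> \<Longrightarrow> Delta n bs \<beta>s z \<noteq> 0" for \<gamma>
    by (rule remainders_numer[OF n(1) v that]) (simp_all add: Fplus_numer kp_def)
  have Rm: "remainders n (Phi n b \<beta>) (Sop n) \<gamma> (Fminus n bs \<beta>s) (remainder n \<beta>s v km)"
    if "\<And>z. z \<in> contour_set \<gamma> \<Longrightarrow> Delta n bs \<beta>s z \<noteq> 0" for \<gamma>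
    by (rule remainders_numer[OF n(1) v that]) (simp_all add: Fminus_numer km_def)
  have circ: "Delta n bs \<beta>s z \<noteq> 0" if "z \<in> contour_set (Gamma0_plus n bs \<beta>s \<epsilon>) \<or> z \<in> contour_set (Gamma0_minus n bs \<beta>s \<epsilon>)" for z
    using that Delta_sphere_ne_0[OF assms(5) _ _ \<epsilon>] \<epsilon> by (auto simp: Gamma0_plus_def Gamma0_minus_def)
  have fr: "Delta n bs \<beta>s z \<noteq> 0" if "z \<in> contour_set (Gammaa_plus n bs \<beta>s \<epsilon> a) \<or> z \<in> contour_set (Gammaa_minus n bs \<beta>s \<epsilon> a)" for z
    using that frontier_Delta_ne_0[OF \<epsilon>] unfolding Gammaa_plus_def Gammaa_minus_def contour_set.simps by blast
  show "augmented_type_I n (Phi n b \<beta>) (Sop n) (Gamma0_plus n bs \<beta>s \<epsilon>) (Fplus n bs \<beta>s)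
      (Gamma0_minus n bs \<beta>s \<epsilon>) (Fminus n bs \<beta>s)"
    unfolding augmented_type_I_def
  proof (intro exI conjI ballI)
    show "remainders n (Phi n b \<beta>) (Sop n) (Gamma0_plus n bs \<beta>s \<epsilon>) (Fplus n bs \<beta>s) (remainder n bs v kp)"
      using circ by (intro Rp) blast
    show "remainders n (Phi n b \<beta>) (Sop n) (Gamma0_minus n bs \<beta>s \<epsilon>) (Fminus n bs \<beta>s) (remainder n \<beta>s v km)"
      using circ by (intro Rm) blast
    fix \<phi> x
    show "has_int_over (Gamma0_plus n bs \<beta>s \<epsilon>) (\<lambda>z. exp (\<i> * z * of_real x) * remainder n bs v kp z \<phi>) 0"
      unfolding Gamma0_plus_def by (intro has_int_over_circles_entire holomorphic_intros holomorphic_remainder hol)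
    show "has_int_over (Gamma0_minus n bs \<beta>s \<epsilon>) (\<lambda>z. exp (\<i> * z * of_real x) * remainder n \<beta>s v km z \<phi>) 0"
      unfolding Gamma0_minus_def by (intro has_int_over_circles_entire holomorphic_intros holomorphic_remainder hol)
  qed simp
  let ?Z = "{\<sigma>. Delta n bs \<beta>s \<sigma> = 0}"
  have Z: "separated ?Z \<epsilon>" "0 \<in> ?Z"
    using separation_dist[OF assms(5)] Delta_0[OF assms(1)] by (auto simp: separated_def)
  show "augmented_type_II n (Phi n b \<beta>) (Sop n) (Gammaa_plus n bs \<beta>s \<epsilon> a) (Fplus n bs \<beta>s)
      (Gammaa_minus n bs \<beta>s \<epsilon> a) (Fminus n bs \<beta>s)"
    unfolding augmented_type_II_def
  proof (intro exI conjI ballI)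
    show "remainders n (Phi n b \<beta>) (Sop n) (Gammaa_plus n bs \<beta>s \<epsilon> a) (Fplus n bs \<beta>s) (remainder n bs v kp)"
      using fr by (intro Rp) blast
    show "remainders n (Phi n b \<beta>) (Sop n) (Gammaa_minus n bs \<beta>s \<epsilon> a) (Fminus n bs \<beta>s) (remainder n \<beta>s v km)"
      using fr by (intro Rm) blast
    fix \<phi> and x :: real assume x: "x \<in> {0<..<1}"
    let ?c = "\<lambda>d m. \<Sum>j=1..n. (- \<i>) ^ (n - m) * of_real (d j (n - m)) * bracket_diff n \<phi> (v j) / (2 * of_real pi)"
    have "exp (\<i> * z * of_real x) / z ^ n * remainder n bs v kp z \<phi> =
        exp (\<i> * of_real 1 * of_real x * z) * (\<Sum>m=1..n. ?c bs m / z ^ m)" for z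
    proof -
      have "exp (\<i> * z * of_real x) / z ^ n * remainder n bs v kp z \<phi> = exp (\<i> * z * of_real x) * (remainder n bs v kp z \<phi> / z ^ n)" by simp
      also have "\<dots> = exp (\<i> * of_real 1 * of_real x * z) * (remainder n bs v kp z \<phi> / z ^ n)" by (simp add: mult_ac)
      finally show ?thesis unfolding remainder_over_power[OF n(2)] kp_def mult_1 .
    qed
    then show "has_int_over (Gammaa_plus n bs \<beta>s \<epsilon> a) (\<lambda>z. exp (\<i> * z * of_real x) / z ^ n * remainder n bs v kp z \<phi>) 0"
      using sector_boundary_integral[OF _ _ \<epsilon> Z n(2), of 1 x a "?c bs"] x
      unfolding Gammaa_plus_def by simp
    \<comment> \<open>The factor \<open>exp (- \<i> * z)\<close> in F^- turns
      \<open>exp (\<i> * z * x)\<close> into \<open>exp (- \<i> * (1 - x) * z)\<close>, which decays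
      in the lower half-plane because x < 1.\<close>
    have "exp (\<i> * z * of_real x) / z ^ n * remainder n \<beta>s v km z \<phi> =
        exp (\<i> * of_real (- 1) * of_real (1 - x) * z) * (\<Sum>m=1..n. - ?c \<beta>s m / z ^ m)" for z
    proof -
      have "exp (\<i> * z * of_real x) / z ^ n * remainder n \<beta>s v km z \<phi> = exp (\<i> * z * of_real x) * (remainder n \<beta>s v km z \<phi> / z ^ n)" by simp
      also have "\<dots> = (exp (\<i> * z * of_real x) * exp (- \<i> * z)) * - (\<Sum>m=1..n. ?c \<beta>s m / z ^ m)"
        unfolding remainder_over_power[OF n(2)] km_def by simp
      also have "exp (\<i> * z * of_real x) * exp (- \<i> * z) = exp (\<i> * of_real (- 1) * of_real (1 - x) * z)"
        unfolding exp_add[symmetric] by (simp add: algebra_simps)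
      also have "- (\<Sum>m=1..n. ?c \<beta>s m / z ^ m) = (\<Sum>m=1..n. - ?c \<beta>s m / z ^ m)"
        unfolding sum_negf[symmetric] minus_divide_left ..
      finally show ?thesis .
    qed
    then show "has_int_over (Gammaa_minus n bs \<beta>s \<epsilon> a) (\<lambda>z. exp (\<i> * z * of_real x) / z ^ n * remainder n \<beta>s v km z \<phi>) 0"
      using sector_boundary_integral[OF _ _ \<epsilon> Z n(2), of "- 1" "1 - x" a "\<lambda>m. - ?c \<beta>s m"] x
      unfolding Gammaa_minus_def by simp
  qed simp
  assume "well_posed n b \<beta> a T \<and> (a \<noteq> 0 \<or> several_zeros n bs \<beta>s)"
  then show "complete_system (Phi n b \<beta>)
             (Fplus n bs \<beta>s ` contour_set (Gamma0_plus n bs \<beta>s \<epsilon>) \<union>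
              Fminus n bs \<beta>s ` contour_set (Gamma0_minus n bs \<beta>s \<epsilon>) \<union>
              Fplus n bs \<beta>s ` contour_set (Gammaa_plus n bs \<beta>s \<epsilon> a) \<union>
              Fminus n bs \<beta>s ` contour_set (Gammaa_minus n bs \<beta>s \<epsilon> a))"
    using complete_system_F[OF assms(1,4,5)] by blast
qed

end
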